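(* Let $a,g\geq 1$. Let $G$ be a graph and $A\subseteq V(G)$ with $|A|=a$ such that $H=G\setminus A$ is a graph of genus $g$. Let $z:E(G)\to\mathbb{R}_{\geq 0}$ be $\beta$-thick for some $\beta>0$. Then there exists a polynomial time algorithm which, given $G$, $A$, an embedding of $H$ on a surface of genus $g$, and $z$, outputs a spanning forest of $G$ that is $O((a g)/\beta)$-thin with respect to $z$ and has at most $O(a+g)$ connected components.
   Context: For $U\subseteq V(G)$, $\delta(U)$ is the set of edges with exactly one endpoint in $U$. $z$ is $\beta$-thick if $z(\delta(U))\geq\beta$ for every nonempty $U\subsetneq V(G)$. A subgraph $T$ is $\gamma$-thin w.r.t. $z$ if $|E(T)\cap\delta(U)|\leq\gamma\, z(\delta(U))$ for every $U\subseteq V(G)$. *)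

theory Defs
  imports
    Complex_Main
    "HOL-Combinatorics.Orbits"
    "HOL-Computational_Algebra.Polynomial"
begin

section \<open>Graphs, cuts, thickness and thinness\<close>

record 'v ugraph =
  vertices :: "'v set"
  edges :: "'v set set"

definition finite_simple_graph :: "'v ugraph \<Rightarrow> bool" where
  "finite_simple_graph G \<longleftrightarrow>
     finite (vertices G) \<and> (\<forall>e\<in>edges G. e \<subseteq> vertices G \<and> card e = 2)"

definition delete_vertices :: "'v ugraph \<Rightarrow> 'v set \<Rightarrow> 'v ugraph" where
  "delete_vertices G A =
     \<lparr> vertices = vertices G - A, edges = {e \<in> edges G. e \<inter> A = {}} \<rparr>"

definition neighbours :: "'v ugraph \<Rightarrow> 'v \<Rightarrow> 'v set" where
  "neighbours G v = {w. {v, w} \<in> edges G}"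

definition cut :: "'v ugraph \<Rightarrow> 'v set \<Rightarrow> 'v set set" where
  "cut G U = {e \<in> edges G. card (e \<inter> U) = 1}"

definition thick :: "'v ugraph \<Rightarrow> ('v set \<Rightarrow> real) \<Rightarrow> real \<Rightarrow> bool" where
  "thick G z \<beta> \<longleftrightarrow>
     (\<forall>U. U \<noteq> {} \<and> U \<subset> vertices G \<longrightarrow> (\<Sum>e\<in>cut G U. z e) \<ge> \<beta>)"

definition subgraph :: "'v ugraph \<Rightarrow> 'v ugraph \<Rightarrow> bool" where
  "subgraph T G \<longleftrightarrow> vertices T \<subseteq> vertices G \<and> edges T \<subseteq> edges G \<and> \<Union> (edges T) \<subseteq> vertices T"

definition thin :: "'v ugraph \<Rightarrow> ('v set \<Rightarrow> real) \<Rightarrow> 'v ugraph \<Rightarrow> real \<Rightarrow> bool" where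
  "thin G z T \<gamma> \<longleftrightarrow>
     (\<forall>U. U \<subseteq> vertices G \<longrightarrow>
        real (card (edges T \<inter> cut G U)) \<le> \<gamma> * (\<Sum>e\<in>cut G U. z e))"

definition components :: "'v ugraph \<Rightarrow> 'v set set" where
  "components G = vertices G //
     {(u, v). u \<in> vertices G \<and> v \<in> vertices G \<and> (u, v) \<in> {(x, y). {x, y} \<in> edges G}\<^sup>*}"

definition is_cycle :: "'v ugraph \<Rightarrow> 'v list \<Rightarrow> bool" where
  "is_cycle G xs \<longleftrightarrow> length xs \<ge> 3 \<and> distinct xs \<and>
     (\<forall>i<length xs. {xs ! i, xs ! ((i + 1) mod length xs)} \<in> edges G)"

definition spanning_forest :: "'v ugraph \<Rightarrow> 'v ugraph \<Rightarrow> bool" where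
  "spanning_forest G T \<longleftrightarrow>
     subgraph T G \<and> vertices T = vertices G \<and> (\<nexists>xs. is_cycle T xs)"

section \<open>Embeddings on surfaces\<close>

text \<open>
  An embedding is represented combinatorially by a signed rotation system:
  \<open>rot v\<close> is the cyclic order of the neighbours around \<open>v\<close>, and \<open>twisted e\<close> says that the
  local orientations at the two ends of \<open>e\<close> disagree along \<open>e\<close>.
\<close>

definition rotation_system :: "'v ugraph \<Rightarrow> ('v \<Rightarrow> 'v \<Rightarrow> 'v) \<Rightarrow> bool" where
  "rotation_system G rot \<longleftrightarrow>
     (\<forall>v\<in>vertices G. neighbours G v \<noteq> {} \<longrightarrow> cyclic_on (rot v) (neighbours G v))"

text \<open>
  The state \<open>(u, v, b)\<close> of a face traversal means that the edge \<open>uv\<close> is being traversed from \<open>u\<close>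
  to \<open>v\<close>; the next edge at a vertex is chosen clockwise or anticlockwise depending on the flag,
  which flips along twisted edges.
\<close>

definition face_step ::
  "'v ugraph \<Rightarrow> ('v \<Rightarrow> 'v \<Rightarrow> 'v) \<Rightarrow> ('v set \<Rightarrow> bool) \<Rightarrow> 'v \<times> 'v \<times> bool \<Rightarrow> 'v \<times> 'v \<times> bool" where
  "face_step G rot twisted = (\<lambda>(u, v, b).
     let b' = (b \<noteq> twisted {u, v})
     in (v, if b' then rot v u else inv_into (neighbours G v) (rot v) u, b'))"

text \<open>
  Every facial walk gives exactly two orbits of \<^const>\<open>face_step\<close>, one per direction.  An isolated
  vertex has one face, which no orbit accounts for.
\<close>

definition num_faces :: "'v ugraph \<Rightarrow> ('v \<Rightarrow> 'v \<Rightarrow> 'v) \<Rightarrow> ('v set \<Rightarrow> bool) \<Rightarrow> nat" where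
  "num_faces G rot twisted =
     card (orbit (face_step G rot twisted) ` {(u, v, b). {u, v} \<in> edges G}) div 2
     + card {v \<in> vertices G. neighbours G v = {}}"

text \<open>
  The sum over the components of \<open>2 - (|V| - |E| + |F|)\<close>, i.e. the Euler genus of the connected sum
  of the closed surfaces in which the components are cellularly embedded.
\<close>

definition euler_genus :: "'v ugraph \<Rightarrow> ('v \<Rightarrow> 'v \<Rightarrow> 'v) \<Rightarrow> ('v set \<Rightarrow> bool) \<Rightarrow> int" where
  "euler_genus G rot twisted =
     2 * int (card (components G)) - int (card (vertices G)) + int (card (edges G))
     - int (num_faces G rot twisted)"

text \<open>The local orientations can be reversed at some vertices so that no edge is twisted.\<close>

definition orientable_system :: "'v ugraph \<Rightarrow> ('v set \<Rightarrow> bool) \<Rightarrow> bool" where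
  "orientable_system G twisted \<longleftrightarrow>
     (\<exists>s :: 'v \<Rightarrow> bool. \<forall>u v. {u, v} \<in> edges G \<longrightarrow> (twisted {u, v} \<longleftrightarrow> s u \<noteq> s v))"

datatype orientability = Orientable | Nonorientable

text \<open>
  The surface of genus \<open>g\<close> is the sphere with \<open>g\<close> handles (Euler genus \<open>2 g\<close>) or the sphere with
  \<open>g \<ge> 1\<close> crosscaps (Euler genus \<open>g\<close>).  Embeddings need not be cellular (in particular, \<open>G\<close> may be
  disconnected): a signed rotation system comes from an embedding on a surface iff that surface is
  obtained from the cellular one by adding handles or crosscaps inside faces.  If the system is
  orientable and the surface is not, at least one crosscap has to be added.
\<close>

definition embedding_on ::
  "orientability \<Rightarrow> nat \<Rightarrow> 'v ugraph \<Rightarrow> ('v \<Rightarrow> 'v \<Rightarrow> 'v) \<Rightarrow> ('v set \<Rightarrow> bool) \<Rightarrow> bool" where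
  "embedding_on k g G rot twisted \<longleftrightarrow>
     rotation_system G rot \<and>
     (case k of
        Orientable \<Rightarrow> orientable_system G twisted \<and> euler_genus G rot twisted \<le> 2 * int g
      | Nonorientable \<Rightarrow>
          (if orientable_system G twisted then euler_genus G rot twisted < int g
           else euler_genus G rot twisted \<le> int g))"

definition graph_genus :: "orientability \<Rightarrow> 'v ugraph \<Rightarrow> nat" where
  "graph_genus k G = (LEAST g. \<exists>rot twisted. embedding_on k g G rot twisted)"

section \<open>A random access machine with real registers\<close>

text \<open>
  Unit-cost RAM with a memory of natural numbers and a memory of real numbers, both indirectly
  addressed.  The arithmetic operations are addition, (truncated) subtraction and comparison only.
  As there is no unit-cost multiplication, bit lengths grow by at most a constant per step, so that
  polynomially many steps on rational weights can be simulated by a Turing machine in polynomial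
  time.  Real numbers other than 0 and 1 are not available as program constants.
\<close>

type_synonym state = "(nat \<Rightarrow> nat) \<times> (nat \<Rightarrow> real)"

datatype nexp = NConst nat | NMem nexp | NAdd nexp nexp | NSub nexp nexp

datatype rexp = RZero | ROne | RMem nexp | RAdd rexp rexp | RSub rexp rexp

datatype bexp = NLess nexp nexp | RLess rexp rexp | BNot bexp | BAnd bexp bexp

datatype com =
    Skip
  | NStore nexp nexp
  | RStore nexp rexp
  | Seq com com
  | Cond bexp com com
  | While bexp com

primrec nval :: "nexp \<Rightarrow> state \<Rightarrow> nat" where
  "nval (NConst k) s = k"
| "nval (NMem e) s = fst s (nval e s)"
| "nval (NAdd e f) s = nval e s + nval f s"
| "nval (NSub e f) s = nval e s - nval f s"

primrec rval :: "rexp \<Rightarrow> state \<Rightarrow> real" where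
  "rval RZero s = 0"
| "rval ROne s = 1"
| "rval (RMem e) s = snd s (nval e s)"
| "rval (RAdd e f) s = rval e s + rval f s"
| "rval (RSub e f) s = rval e s - rval f s"

primrec bval :: "bexp \<Rightarrow> state \<Rightarrow> bool" where
  "bval (NLess e f) s \<longleftrightarrow> nval e s < nval f s"
| "bval (RLess e f) s \<longleftrightarrow> rval e s < rval f s"
| "bval (BNot b) s \<longleftrightarrow> \<not> bval b s"
| "bval (BAnd b c) s \<longleftrightarrow> bval b s \<and> bval c s"

text \<open>\<open>exec c s t s'\<close>: started in \<open>s\<close>, the program \<open>c\<close> halts after \<open>t\<close> steps in \<open>s'\<close>.\<close>

inductive exec :: "com \<Rightarrow> state \<Rightarrow> nat \<Rightarrow> state \<Rightarrow> bool" where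
  exec_Skip: "exec Skip s 1 s"
| exec_NStore: "exec (NStore e f) s 1 ((fst s)(nval e s := nval f s), snd s)"
| exec_RStore: "exec (RStore e f) s 1 (fst s, (snd s)(nval e s := rval f s))"
| exec_Seq: "exec c s t s' \<Longrightarrow> exec d s' t' s'' \<Longrightarrow> exec (Seq c d) s (t + t') s''"
| exec_CondTrue: "bval b s \<Longrightarrow> exec c s t s' \<Longrightarrow> exec (Cond b c d) s (1 + t) s'"
| exec_CondFalse: "\<not> bval b s \<Longrightarrow> exec d s t s' \<Longrightarrow> exec (Cond b c d) s (1 + t) s'"
| exec_WhileFalse: "\<not> bval b s \<Longrightarrow> exec (While b c) s 1 s"
| exec_WhileTrue: "bval b s \<Longrightarrow> exec c s t s' \<Longrightarrow> exec (While b c) s' t' s'' \<Longrightarrow>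
    exec (While b c) s (1 + t + t') s''"

lemma exec_deterministic: "exec c s t s' \<Longrightarrow> exec c s u s'' \<Longrightarrow> u = t \<and> s'' = s'"
proof (induction arbitrary: u s'' rule: exec.induct)
  case (exec_Skip s)
  then show ?case by (cases rule: exec.cases) simp_all
next
  case (exec_NStore e f s)
  then show ?case by (cases rule: exec.cases) simp_all
next
  case (exec_RStore e f s)
  then show ?case by (cases rule: exec.cases) simp_all
next
  case (exec_Seq c s t s' d t' r)
  from exec_Seq.prems show ?case
    by (cases rule: exec.cases) (use exec_Seq.IH in blast)
next
  case (exec_CondTrue b s c t s' d)
  from exec_CondTrue.prems show ?case
    by (cases rule: exec.cases) (use exec_CondTrue.IH exec_CondTrue.hyps(1) in blast)+
next
  case (exec_CondFalse b s d t s' c)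
  from exec_CondFalse.prems show ?case
    by (cases rule: exec.cases) (use exec_CondFalse.IH exec_CondFalse.hyps(1) in blast)+
next
  case (exec_WhileFalse b s c)
  from exec_WhileFalse.prems show ?case
    by (cases rule: exec.cases) (use exec_WhileFalse.hyps(1) in simp_all)
next
  case (exec_WhileTrue b s c t s' t' r)
  from exec_WhileTrue.prems show ?case
    by (cases rule: exec.cases) (use exec_WhileTrue.IH exec_WhileTrue.hyps(1) in blast)+
qed

section \<open>Encoding of inputs and outputs\<close>

text \<open>
  A graph with vertex set \<open>{..<n}\<close> is stored by its adjacency matrix.  The memory of natural numbers
  holds, in this order: \<open>n\<close>; the surface (orientability and genus); the characteristic vector of
  \<open>A\<close>; and three \<open>n \<times> n\<close> matrices for the edges of \<open>G\<close>, the rotations and the twisted edges of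
  \<open>H = G - A\<close>.  The memory of real numbers holds the weight matrix.  All other cells are 0.
\<close>

definition entry :: "nat \<Rightarrow> (nat \<Rightarrow> nat \<Rightarrow> 'a) \<Rightarrow> nat \<Rightarrow> 'a" where
  "entry n f i = f (i div n) (i mod n)"

definition input_state ::
  "nat \<Rightarrow> nat ugraph \<Rightarrow> nat set \<Rightarrow> orientability \<Rightarrow> nat \<Rightarrow> (nat \<Rightarrow> nat \<Rightarrow> nat) \<Rightarrow>
     (nat set \<Rightarrow> bool) \<Rightarrow> (nat set \<Rightarrow> real) \<Rightarrow> state" where
  "input_state n G A k g rot twisted z =
     (let H = delete_vertices G A
      in
      (\<lambda>i. if i = 0 then n
           else if i = 1 then (if k = Orientable then 0 else 1)
           else if i = 2 then g
           else if i < 3 + n then of_bool (i - 3 \<in> A)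
           else if i < 3 + n + n * n then
             entry n (\<lambda>u v. of_bool ({u, v} \<in> edges G)) (i - (3 + n))
           else if i < 3 + n + 2 * (n * n) then
             entry n (\<lambda>u v. if {u, v} \<in> edges H then rot u v else 0) (i - (3 + n + n * n))
           else if i < 3 + n + 3 * (n * n) then
             entry n (\<lambda>u v. of_bool ({u, v} \<in> edges H \<and> twisted {u, v})) (i - (3 + n + 2 * (n * n)))
           else 0,
       \<lambda>i. if i < n * n then entry n (\<lambda>u v. if {u, v} \<in> edges G then z {u, v} else 0) i else 0))"

definition output_graph :: "nat \<Rightarrow> state \<Rightarrow> nat ugraph" where
  "output_graph n s =
     \<lparr> vertices = {..<n}, edges = {{u, v} | u v. u < v \<and> v < n \<and> fst s (u * n + v) = 1} \<rparr>"

end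

theory Submission
  imports Defs
begin

text \<open>
  Vertices of \<open>H\<close> are contracted into clusters.  The edges between unmarked clusters are called alive;
  each has two sides, and sides are grouped into classes, initially the faces of the embedding.  Two
  alive edges are consecutive if they share a class with exactly two alive sides (a digon), and the
  maximal chains of such edges are the threads.  Euler's formula, in the form that the even sets of
  alive edges fall into at most \<open>2 ^ (2 * g)\<close> classes modulo cuts, bounds the number of threads
  linearly.  Hence, as long as more than \<open>2 * g\<close> unmarked clusters remain, some cluster \<open>x\<close> meets at
  most 12 threads, and if \<open>B\<close> is the weight of the heaviest walk along a thread (at least half the
  thread), the alive edges at \<open>x\<close> weigh at most \<open>24 * B\<close>.  By \<open>\<beta>\<close>-thickness either
  \<open>B \<ge> \<beta> / (72 * a)\<close>, and two clusters are merged along the median edge of that walk, or most of the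
  weight leaving \<open>x\<close> goes to the apices and the clusters attached to them, and \<open>x\<close> is marked: it is
  attached by one edge to the heaviest of these \<open>a\<close> groups.  The components that remain are those of
  the \<open>a\<close> apices and of at most \<open>2 * g\<close> unmarked clusters.

  Thinness follows from two charging arguments.  For a cut \<open>\<delta>(U)\<close> the number of classes containing an
  odd number of its alive sides is initially zero.  If the median edge of a walk is in the cut,
  then each half of the walk either lies entirely in the cut or contains an odd class, which
  disappears together with the walk; so this number plus twice the number of tree edges in the cut
  is bounded by a multiple of the removed weight in the cut, divided by \<open>\<beta> / a\<close>.  The
  marking edges in the cut are bounded by the number of marked clusters that \<open>U\<close> separates from
  their apex, and each of these contributes weight \<open>\<Omega>(\<beta> / a)\<close> to the cut.
\<close>

subsection \<open>A calculus of polynomial-time array programs\<close>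

text \<open>No embedding of the contracted graph is maintained through mergers and deletions. What
  survives of it is the partition of sides into classes together with linear algebra over the field
  with two elements, in which dimensions appear as exponents of cardinalities \<open>2 ^ d\<close>.
  Deleting an edge identifies the classes of its sides, which is contraction in the dual graph.

  A marked cluster hangs on its apex by a single edge, so cuts through the cluster itself are the
  danger. Hence the weight of the lightest walk used for merging is remembered. Marking requires it,
  once it exists, to exceed \<open>B\<close>, so that a cut splitting the cluster costs more than
  \<open>B\<close>, to which the alive edges at the cluster are tied by the factor 24. If it does
  not exceed \<open>B\<close>, the current walk is as heavy as an earlier one, and merging is
  justified without any marking argument.

  Constants: 24 is two walks for each of 12 threads; the heaviest group must weigh at least twice
  that, 48; and 24 + 48 = 72. A newly separated cluster answers for 12 neighbours and its own edge,
  13 in all, and for \<open>24 * B + kap\<close>, at most 25 times the weight of a merging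
  walk.\<close>

definition bnd :: "state \<Rightarrow> nat" where
  "bnd I = 3 + fst I 0 + 3 * (fst I 0 * fst I 0)"

definition base :: "state \<Rightarrow> nat" where
  "base I = bnd I + fst I 2"

type_synonym arrays = "nat \<Rightarrow> nat \<Rightarrow> nat"
type_synonym env = "nat \<Rightarrow> nat"

text \<open>
  The cells beyond the input are split modulo 3 into the variables \<open>vad\<close>, an evaluation stack \<open>sad\<close>
  and 16 interleaved arrays \<open>aad\<close>.  The base is \<open>bnd I + g\<close>, so that the genus can still be
  recovered after cells 1 and 2 have been overwritten by \<open>bnd I\<close> and \<open>base I\<close>.
\<close>

definition vad :: "state \<Rightarrow> nat \<Rightarrow> nat" where "vad I k = base I + 3 * k"
definition sad :: "state \<Rightarrow> nat \<Rightarrow> nat" where "sad I d = base I + (3 * d + 1)"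
definition aad :: "state \<Rightarrow> nat \<Rightarrow> nat \<Rightarrow> nat" where "aad I j i = base I + (48 * i + (3 * j + 2))"

lemma base_ge: "bnd I \<le> base I" "3 \<le> base I" "3 \<le> bnd I" by (auto simp: base_def bnd_def)

lemma addr_eq[simp]:
  "vad I k = vad I k' \<longleftrightarrow> k = k'" "sad I k = sad I k' \<longleftrightarrow> k = k'"
  "sad I d \<noteq> vad I k" "vad I k \<noteq> sad I d" "sad I d \<noteq> aad I j i" "aad I j i \<noteq> sad I d" "aad I j i \<noteq> vad I k" "vad I k \<noteq> aad I j i"
  "\<not> sad I d < bnd I" "\<not> vad I d < bnd I" "\<not> aad I j i < bnd I"
  "sad I d \<noteq> 0" "vad I d \<noteq> 0" "aad I j i \<noteq> 0"
  "sad I d \<noteq> Suc 0" "vad I d \<noteq> Suc 0" "aad I j i \<noteq> Suc 0"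
  "sad I d \<noteq> 2" "vad I d \<noteq> 2" "aad I j i \<noteq> 2"
  using base_ge[of I] unfolding vad_def sad_def aad_def by presburger+

lemma aad_eq: "j < 16 \<Longrightarrow> j' < 16 \<Longrightarrow> aad I j i = aad I j' i' \<longleftrightarrow> i = i' \<and> j = j'"
proof (rule iffI)
  assume j: "j < 16" "j' < 16" and "aad I j i = aad I j' i'"
  then have e: "16 * i + j = 16 * i' + j'" by (simp add: aad_def)
  have "(16 * i + j) div 16 = i" "(16 * i' + j') div 16 = i'" using j by auto
  with e show "i = i' \<and> j = j'" by simp
qed simp

text \<open>Only the first \<open>v\<close> variables are tracked; later variables, the evaluation
  stacks and array 15 are unconstrained and serve as scratch space. Cells 1 and 2 are the program's
  own copies of the loop bound and of the base address.\<close>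

definition rep :: "nat \<Rightarrow> state \<Rightarrow> arrays \<Rightarrow> env \<Rightarrow> state \<Rightarrow> bool" where
  "rep v I a \<rho> s \<longleftrightarrow> fst s 0 = fst I 0 \<and> fst s 1 = bnd I \<and> fst s 2 = base I \<and>
     (\<forall>i. 3 \<le> i \<and> i < bnd I \<longrightarrow> fst s i = fst I i) \<and> (\<forall>i<bnd I. snd s i = snd I i) \<and>
     (\<forall>k<v. fst s (vad I k) = \<rho> k) \<and>
     (\<forall>j<15. \<forall>i. fst s (aad I j i) = a j i)"

text \<open>Frame condition: the levels below \<open>d\<close> hold intermediate results of
  enclosing computations, on the stack of natural numbers and on that of reals.\<close>

definition sameP :: "state \<Rightarrow> nat \<Rightarrow> state \<Rightarrow> state \<Rightarrow> bool" where
  "sameP I d s s' \<longleftrightarrow> (\<forall>k<d. fst s' (sad I k) = fst s (sad I k)) \<and> (\<forall>k<d. snd s' (base I + k) = snd s (base I + k))"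

text \<open>Array 15 is the target of parallel array assignments; no expression may read or write it.\<close>

definition same :: "state \<Rightarrow> nat \<Rightarrow> state \<Rightarrow> state \<Rightarrow> bool" where
  "same I d s s' \<longleftrightarrow> sameP I d s s' \<and> (\<forall>i. fst s' (aad I 15 i) = fst s (aad I 15 i))"

lemmas same_defs = same_def sameP_def

lemma same_refl[simp]: "same I d s s" by (simp add: same_defs)
lemma same_trans: "same I d s s' \<Longrightarrow> same I d s' s'' \<Longrightarrow> same I d s s''" by (simp add: same_defs)
lemma same_mono: "same I e s s' \<Longrightarrow> d \<le> e \<Longrightarrow> same I d s s'" by (auto simp add: same_defs)
lemma sameP_trans: "sameP I d s s' \<Longrightarrow> sameP I d s' s'' \<Longrightarrow> sameP I d s s''" by (simp add: same_defs)
lemma sameP_mono: "sameP I e s s' \<Longrightarrow> d \<le> e \<Longrightarrow> sameP I d s s'" by (auto simp add: same_defs)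
lemma same_sameP: "same I d s s' \<Longrightarrow> sameP I d s s'" by (simp add: same_def)

text \<open>The machine cannot multiply, so an address such as \<open>48 * i\<close> becomes a
  nested sum of fixed size.\<close>

fun ntm :: "nat \<Rightarrow> nexp \<Rightarrow> nexp" where
  "ntm 0 e = NConst 0"
| "ntm (Suc k) e = NAdd e (ntm k e)"

lemma nval_ntm[simp]: "nval (ntm k e) s = k * nval e s" by (induction k) auto

definition varA :: "nat \<Rightarrow> nexp" where "varA v = NAdd (NMem (NConst 2)) (NConst (3 * v))"
definition stkA :: "nat \<Rightarrow> nexp" where "stkA d = NAdd (NMem (NConst 2)) (NConst (3 * d + 1))"
definition arrA :: "nat \<Rightarrow> nexp \<Rightarrow> nexp" where
  "arrA j e = NAdd (NMem (NConst 2)) (NAdd (ntm 48 e) (NConst (3 * j + 2)))"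
definition rstA :: "nat \<Rightarrow> nexp" where "rstA d = NAdd (NMem (NConst 2)) (NConst d)"

definition setn :: "nat \<Rightarrow> nat \<Rightarrow> state \<Rightarrow> state" where "setn i x s = ((fst s)(i := x), snd s)"
definition setr :: "nat \<Rightarrow> real \<Rightarrow> state \<Rightarrow> state" where "setr i x s = (fst s, (snd s)(i := x))"

lemma setn_simps[simp]: "fst (setn i x s) j = (if j = i then x else fst s j)" "snd (setn i x s) = snd s"
  by (auto simp: setn_def)
lemma setr_simps[simp]: "snd (setr i x s) j = (if j = i then x else snd s j)" "fst (setr i x s) = fst s"
  by (auto simp: setr_def)

lemma exec_setn: "nval e s = i \<Longrightarrow> nval f s = x \<Longrightarrow> exec (NStore e f) s 1 (setn i x s)"
  using exec_NStore[of e f s] by (simp add: setn_def)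
lemma exec_setr: "nval e s = i \<Longrightarrow> rval f s = x \<Longrightarrow> exec (RStore e f) s 1 (setr i x s)"
  using exec_RStore[of e f s] by (simp add: setr_def)

lemma rep_addr:
  assumes "rep v I a \<rho> s"
  shows "nval (varA k) s = vad I k" "nval (stkA d) s = sad I d"
    "nval (arrA j e) s = aad I j (nval e s)" "nval (rstA d) s = base I + d"
  using assms by (auto simp: rep_def varA_def stkA_def arrA_def rstA_def vad_def sad_def aad_def)

lemma rep_read:
  assumes "rep v I a \<rho> s"
  shows "k < v \<Longrightarrow> nval (NMem (varA k)) s = \<rho> k" "nval (NMem (stkA d)) s = fst s (sad I d)"
    "j < 15 \<Longrightarrow> nval (NMem (arrA j e)) s = a j (nval e s)"
    "rval (RMem (rstA d)) s = snd s (base I + d)"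
    "nval (NMem (NConst 0)) s = fst I 0" "nval (NMem (NConst (Suc 0))) s = bnd I"
    "nval (NMem (NConst 2)) s = base I"
  using assms by (simp_all add: rep_addr[OF assms] rep_def)

lemma rep_setn_stk: "rep v I a \<rho> s \<Longrightarrow> rep v I a \<rho> (setn (sad I d) x s)"
  unfolding rep_def by (auto simp: eq_commute[of _ "sad I d"])

lemma rep_setr_stk: "rep v I a \<rho> s \<Longrightarrow> rep v I a \<rho> (setr (base I + d) x s)"
  using base_ge[of I] unfolding rep_def by auto

lemma rep_setn_var': "rep v I a \<rho> s \<Longrightarrow> k < v \<Longrightarrow> rep v I a (\<rho>(k := x)) (setn (vad I k) x s)"
  unfolding rep_def by (auto simp: eq_commute[of _ "vad I k"])

lemma rep_setn_var:
  assumes r: "rep v I a \<rho> s" shows "rep (Suc v) I a (\<rho>(v := x)) (setn (vad I v) x s)"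
proof -
  have "rep (Suc v) I a (\<rho>(v := fst s (vad I v))) s"
    using r by (auto simp: rep_def less_Suc_eq)
  from rep_setn_var'[OF this, of v x] show ?thesis by simp
qed

lemma rep_drop: "rep (Suc v) I a (\<rho>(v := x)) s \<Longrightarrow> rep v I a \<rho> s"
  unfolding rep_def by auto

lemma rep_setn_arr:
  assumes "rep v I a \<rho> s" "j < 15"
  shows "rep v I (a(j := (a j)(i := x))) \<rho> (setn (aad I j i) x s)"
  using assms unfolding rep_def by (auto simp: aad_eq eq_commute[of _ "aad I j i"])

lemma same_setn_stk: "d \<le> e \<Longrightarrow> same I d s (setn (sad I e) x s)"
  unfolding same_defs by auto
lemma same_setr_stk: "d \<le> e \<Longrightarrow> same I d s (setr (base I + e) x s)"
  unfolding same_defs by auto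
lemma same_setn_var: "same I d s (setn (vad I v) x s)"
  unfolding same_defs by auto
lemma sameP_setn_arr: "sameP I d s (setn (aad I j i) x s)"
  unfolding same_defs by auto

text \<open>Time is measured in \<open>fst I 0\<close>, the number of vertices of the original input
  \<open>I\<close>, whereas \<open>s\<close> is the current state; bounds of successive fragments
  therefore simply add.\<close>

definition does :: "com \<Rightarrow> nat poly \<Rightarrow> state \<Rightarrow> state \<Rightarrow> (state \<Rightarrow> bool) \<Rightarrow> bool" where
  "does c q I s Q \<longleftrightarrow> (\<exists>t s'. exec c s t s' \<and> t \<le> poly q (fst I 0) \<and> Q s')"

lemma does_Seq:
  assumes "does c q I s Q" "\<And>s'. Q s' \<Longrightarrow> does d r I s' R"
  shows "does (Seq c d) (q + r) I s R"
  using assms unfolding does_def by (metis add_mono exec_Seq poly_add)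

lemma does_mono: "does c q I s Q \<Longrightarrow> (\<And>s'. Q s' \<Longrightarrow> R s') \<Longrightarrow> does c q I s R"
  unfolding does_def by blast

lemma does_setn: "nval e s = i \<Longrightarrow> nval f s = x \<Longrightarrow> Q (setn i x s) \<Longrightarrow> does (NStore e f) 1 I s Q"
  unfolding does_def by (metis exec_setn order_refl poly_1)
lemma does_setr: "nval e s = i \<Longrightarrow> rval f s = x \<Longrightarrow> Q (setr i x s) \<Longrightarrow> does (RStore e f) 1 I s Q"
  unfolding does_def by (metis exec_setr order_refl poly_1)

lemma does_Cond:
  assumes "bval b s \<Longrightarrow> does c q I s Q" "\<not> bval b s \<Longrightarrow> does d r I s Q"
  shows "does (Cond b c d) (1 + q + r) I s Q"
proof (cases "bval b s")
  case True
  then obtain t s' where "exec c s t s'" "t \<le> poly q (fst I 0)" "Q s'" using assms(1) by (auto simp: does_def)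
  then show ?thesis using exec_CondTrue[OF True, of c t s' d] unfolding does_def
    by (intro exI[of _ "1+t"] exI[of _ s']) auto
next
  case False
  then obtain t s' where "exec d s t s'" "t \<le> poly r (fst I 0)" "Q s'" using assms(2) by (auto simp: does_def)
  then show ?thesis using exec_CondFalse[OF False, of d t s' c] unfolding does_def
    by (intro exI[of _ "1+t"] exI[of _ s']) auto
qed

lemma poly_bnd: "poly [:3, 1, 3:] (fst I 0) = bnd I" by (simp add: bnd_def algebra_simps)

text \<open>The invariant is indexed by the number of completed rounds and decides the loop
  condition, so the number of rounds is known beforehand and the bound for one round multiplies to
  one for the loop.\<close>

lemma does_While_iter:
  assumes step: "\<And>i s. i < N \<Longrightarrow> Q i s \<Longrightarrow> does c q I s (Q (Suc i))"
    and cond: "\<And>i s. i \<le> N \<Longrightarrow> Q i s \<Longrightarrow> bval b s \<longleftrightarrow> i < N" and Q: "Q 0 s" and N: "poly r (fst I 0) = N"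
  shows "does (While b c) (1 + r * (1 + q)) I s (Q N)"
proof -
  have "\<exists>t s'. exec (While b c) s t s' \<and> t \<le> 1 + k * (1 + poly q (fst I 0)) \<and> Q N s'"
    if "Q i s" "i + k = N" for i k s
    using that
  proof (induction k arbitrary: i s)
    case 0
    then have "\<not> bval b s" using cond[of i s] by simp
    from exec_WhileFalse[OF this, of c] 0 show ?case by (intro exI[of _ 1] exI[of _ s]) auto
  next
    case (Suc k)
    then obtain t s' where 1: "exec c s t s'" "t \<le> poly q (fst I 0)" "Q (Suc i) s'"
      using step[of i s] by (auto simp: does_def)
    then obtain t' s'' where 2: "exec (While b c) s' t' s''" "t' \<le> 1 + k * (1 + poly q (fst I 0))" "Q N s''"
      using Suc.IH[of "Suc i" s'] Suc.prems by auto
    have "exec (While b c) s (1 + t + t') s''"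
      by (rule exec_WhileTrue[OF _ 1(1) 2(1)]) (use cond[of i s] Suc.prems in auto)
    then show ?case using 1 2 by (intro exI[of _ "1+t+t'"] exI[of _ s'']) auto
  qed
  from this[of 0 s N] Q show ?thesis
    unfolding does_def by (simp only: poly_add poly_mult poly_1 N)
qed

text \<open>One universal loop length: \<open>bnd I\<close> exceeds the number of vertices, of edge
  numbers and of sides of edges, so it can bound every quantifier, sum and iteration of the
  algorithm.\<close>

lemma does_While:
  assumes "\<And>i s. i < bnd I \<Longrightarrow> Q i s \<Longrightarrow> does c q I s (Q (Suc i))"
    and "\<And>i s. Q i s \<Longrightarrow> bval b s \<longleftrightarrow> i < bnd I" and "Q 0 s"
  shows "does (While b c) (1 + [:3, 1, 3:] * (1 + q)) I s (Q (bnd I))"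
  by (rule does_While_iter) (use assms poly_bnd in auto)

text \<open>
  The code may use the stack from level \<open>d\<close> upwards and leaves its result at level \<open>d\<close>; quantifying
  over \<open>d\<close> is what makes the predicates compositional.
\<close>

definition implN :: "nat \<Rightarrow> (state \<Rightarrow> arrays \<Rightarrow> env \<Rightarrow> nat) \<Rightarrow> bool" where
  "implN v F \<longleftrightarrow> (\<forall>d. \<exists>c q. \<forall>I a \<rho> s. rep v I a \<rho> s \<longrightarrow>
     does c q I s (\<lambda>s'. rep v I a \<rho> s' \<and> same I d s s' \<and> fst s' (sad I d) = F I a \<rho>))"

definition implR :: "nat \<Rightarrow> (state \<Rightarrow> arrays \<Rightarrow> env \<Rightarrow> real) \<Rightarrow> bool" where
  "implR v F \<longleftrightarrow> (\<forall>d. \<exists>c q. \<forall>I a \<rho> s. rep v I a \<rho> s \<longrightarrow>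
     does c q I s (\<lambda>s'. rep v I a \<rho> s' \<and> same I d s s' \<and> snd s' (base I + d) = F I a \<rho>))"

definition implB :: "nat \<Rightarrow> (state \<Rightarrow> arrays \<Rightarrow> env \<Rightarrow> bool) \<Rightarrow> bool" where
  "implB v P \<longleftrightarrow> implN v (\<lambda>I a \<rho>. of_bool (P I a \<rho>))"

text \<open>Array programs begin without tracked variables, and they promise only
  \<open>sameP\<close> because assignments use array 15 as a buffer.\<close>

definition implP :: "(state \<Rightarrow> arrays \<Rightarrow> arrays) \<Rightarrow> bool" where
  "implP f \<longleftrightarrow> (\<forall>d. \<exists>c q. \<forall>I a \<rho> s. rep 0 I a \<rho> s \<longrightarrow>
     does c q I s (\<lambda>s'. rep 0 I (f I a) \<rho> s' \<and> sameP I d s s'))"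

lemma implNE:
  assumes "implN v F"
  obtains c q where "\<And>I a \<rho> s. rep v I a \<rho> s \<Longrightarrow>
     does c q I s (\<lambda>s'. rep v I a \<rho> s' \<and> same I d s s' \<and> fst s' (sad I d) = F I a \<rho>)"
  using assms unfolding implN_def by blast

lemma implRE:
  assumes "implR v F"
  obtains c q where "\<And>I a \<rho> s. rep v I a \<rho> s \<Longrightarrow>
     does c q I s (\<lambda>s'. rep v I a \<rho> s' \<and> same I d s s' \<and> snd s' (base I + d) = F I a \<rho>)"
  using assms unfolding implR_def by blast

lemma implPE:
  assumes "implP f"
  obtains c q where "\<And>I a \<rho> s. rep 0 I a \<rho> s \<Longrightarrow>
     does c q I s (\<lambda>s'. rep 0 I (f I a) \<rho> s' \<and> sameP I d s s')"
  using assms unfolding implP_def by blast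

section \<open>Compilation of natural number and Boolean expressions\<close>

lemma implN_expr:
  assumes "\<And>I a \<rho> s. rep v I a \<rho> s \<Longrightarrow> nval e s = F I a \<rho>"
  shows "implN v F"
  unfolding implN_def
proof (intro allI exI impI)
  fix d I a \<rho> s assume r: "rep v I a \<rho> s"
  show "does (NStore (stkA d) e) 1 I s (\<lambda>s'. rep v I a \<rho> s' \<and> same I d s s' \<and> fst s' (sad I d) = F I a \<rho>)"
    by (rule does_setn[OF rep_addr(2)[OF r] assms[OF r]]) (simp add: rep_setn_stk[OF r] same_setn_stk)
qed

lemma implN_const: "implN v (\<lambda>I a \<rho>. k)" by (rule implN_expr[of _ "NConst k"]) simp
lemma implN_var: "k < v \<Longrightarrow> implN v (\<lambda>I a \<rho>. \<rho> k)" by (rule implN_expr[of _ "NMem (varA k)"]) (simp add: rep_read del: nval.simps)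
lemma implN_n: "implN v (\<lambda>I a \<rho>. fst I 0)" by (rule implN_expr[of _ "NMem (NConst 0)"]) (simp add: rep_read del: nval.simps)
lemma implN_bnd: "implN v (\<lambda>I a \<rho>. bnd I)" by (rule implN_expr[of _ "NMem (NConst 1)"]) (simp add: rep_read del: nval.simps)
lemma implN_g: "implN v (\<lambda>I a \<rho>. fst I 2)"
  by (rule implN_expr[of _ "NSub (NMem (NConst 2)) (NMem (NConst 1))"]) (simp add: rep_def base_def)

lemma implN_unary:
  assumes F: "implN v F"
    and fin: "\<And>d. \<exists>c q. \<forall>I a \<rho> s. rep v I a \<rho> s \<longrightarrow> does c q I s (\<lambda>s'. s' = setn (sad I d) (h I a (fst s (sad I d))) s)"
  shows "implN v (\<lambda>I a \<rho>. h I a (F I a \<rho>))"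
  unfolding implN_def
proof
  fix d
  obtain c q where c: "\<And>I a \<rho> s. rep v I a \<rho> s \<Longrightarrow>
     does c q I s (\<lambda>s'. rep v I a \<rho> s' \<and> same I d s s' \<and> fst s' (sad I d) = F I a \<rho>)"
    by (rule implNE[OF F, where d="d"], rule that)
  obtain c2 q2 where c2: "\<And>I a \<rho> s. rep v I a \<rho> s \<Longrightarrow> does c2 q2 I s (\<lambda>s'. s' = setn (sad I d) (h I a (fst s (sad I d))) s)"
    using fin by blast
  have "does (Seq c c2) (q + q2) I s (\<lambda>s'. rep v I a \<rho> s' \<and> same I d s s' \<and> fst s' (sad I d) = h I a (F I a \<rho>))"
    if r: "rep v I a \<rho> s" for I a \<rho> s
    apply (rule does_Seq[OF c[OF r]])
    apply (rule does_mono[OF c2], blast)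
    by (metis order_refl rep_setn_stk same_setn_stk same_trans setn_simps(1))
  then show "\<exists>c q. \<forall>I a \<rho> s. rep v I a \<rho> s \<longrightarrow>
     does c q I s (\<lambda>s'. rep v I a \<rho> s' \<and> same I d s s' \<and> fst s' (sad I d) = h I a (F I a \<rho>))" by blast
qed

text \<open>The second operand is evaluated one level higher, where its code cannot touch the first;
  \<open>fin\<close> then combines the two levels.\<close>

lemma implN_binary:
  assumes F: "implN v F" and G: "implN v G"
    and fin: "\<And>d. \<exists>c q. \<forall>I a \<rho> s. rep v I a \<rho> s \<longrightarrow> does c q I s (\<lambda>s'. s' = setn (sad I d) (h (fst s (sad I d)) (fst s (sad I (Suc d)))) s)"
  shows "implN v (\<lambda>I a \<rho>. h (F I a \<rho>) (G I a \<rho>))"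
  unfolding implN_def
proof
  fix d
  obtain c q where c: "\<And>I a \<rho> s. rep v I a \<rho> s \<Longrightarrow>
     does c q I s (\<lambda>s'. rep v I a \<rho> s' \<and> same I d s s' \<and> fst s' (sad I d) = F I a \<rho>)"
    by (rule implNE[OF F, where d="d"], rule that)
  obtain c1 q1 where c1: "\<And>I a \<rho> s. rep v I a \<rho> s \<Longrightarrow>
     does c1 q1 I s (\<lambda>s'. rep v I a \<rho> s' \<and> same I (Suc d) s s' \<and> fst s' (sad I (Suc d)) = G I a \<rho>)"
    by (rule implNE[OF G, where d="Suc d"], rule that)
  obtain c2 q2 where c2: "\<And>I a \<rho> s. rep v I a \<rho> s \<Longrightarrow> does c2 q2 I s (\<lambda>s'. s' = setn (sad I d) (h (fst s (sad I d)) (fst s (sad I (Suc d)))) s)"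
    using fin by blast
  have "does (Seq c (Seq c1 c2)) (q + (q1 + q2)) I s (\<lambda>s'. rep v I a \<rho> s' \<and> same I d s s' \<and> fst s' (sad I d) = h (F I a \<rho>) (G I a \<rho>))"
    if r: "rep v I a \<rho> s" for I a \<rho> s
  proof (rule does_Seq[OF c[OF r]], rule does_Seq[OF c1], blast, rule does_mono[OF c2], blast)
    fix s1 s2 s3
    assume 1: "rep v I a \<rho> s1 \<and> same I d s s1 \<and> fst s1 (sad I d) = F I a \<rho>"
      and 2: "rep v I a \<rho> s2 \<and> same I (Suc d) s1 s2 \<and> fst s2 (sad I (Suc d)) = G I a \<rho>"
      and 3: "s3 = setn (sad I d) (h (fst s2 (sad I d)) (fst s2 (sad I (Suc d)))) s2"
    have "fst s2 (sad I d) = F I a \<rho>" using 1 2 by (auto simp: same_defs)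
    moreover have "same I d s s3" unfolding 3 using 1 2 same_mono[of I "Suc d" s1 s2 d] same_trans same_setn_stk[of d d]
      by (meson le_SucI order_refl)
    ultimately show "rep v I a \<rho> s3 \<and> same I d s s3 \<and> fst s3 (sad I d) = h (F I a \<rho>) (G I a \<rho>)"
      using 2 rep_setn_stk[of v I a \<rho> s2] by (simp add: 3)
  qed
  then show "\<exists>c q. \<forall>I a \<rho> s. rep v I a \<rho> s \<longrightarrow>
     does c q I s (\<lambda>s'. rep v I a \<rho> s' \<and> same I d s s' \<and> fst s' (sad I d) = h (F I a \<rho>) (G I a \<rho>))" by blast
qed

lemma implN_arr:
  assumes "j < 15" "implN v F" shows "implN v (\<lambda>I a \<rho>. a j (F I a \<rho>))"
proof (rule implN_unary[OF assms(2), where h="\<lambda>I a x. a j x"], intro exI allI impI)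
  fix d I a \<rho> s assume r: "rep v I a \<rho> s"
  show "does (NStore (stkA d) (NMem (arrA j (NMem (stkA d))))) 1 I s (\<lambda>s'. s' = setn (sad I d) (a j (fst s (sad I d))) s)"
    by (rule does_setn[OF rep_addr(2)[OF r] rep_read(3)[OF r assms(1)]]) (simp only: rep_read(2)[OF r])
qed

text \<open>Cells 0 to 2 have been overwritten and the cells from \<open>bnd I\<close> on are
  working memory; cutting off such reads makes the value a function of the input \<open>I\<close>
  alone.\<close>

definition rdn :: "state \<Rightarrow> nat \<Rightarrow> nat" where "rdn I i = (if 3 \<le> i \<and> i < bnd I then fst I i else 0)"
definition rdr :: "state \<Rightarrow> nat \<Rightarrow> real" where "rdr I i = (if i < bnd I then snd I i else 0)"

lemma implN_rdn:
  assumes "implN v F" shows "implN v (\<lambda>I a \<rho>. rdn I (F I a \<rho>))"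
proof (rule implN_unary[OF assms, where h="\<lambda>I a x. rdn I x"], intro exI allI impI)
  fix d I a \<rho> s assume r: "rep v I a \<rho> s"
  let ?e = "NMem (stkA d)"
  show "does (Cond (BAnd (NLess (NConst 2) ?e) (NLess ?e (NMem (NConst (Suc 0))))) (NStore (stkA d) (NMem ?e)) (NStore (stkA d) (NConst 0)))
    (1 + 1 + 1) I s (\<lambda>s'. s' = setn (sad I d) (rdn I (fst s (sad I d))) s)"
    by (intro does_Cond does_setn rep_addr(2)[OF r] refl)
      (use r in \<open>auto simp: rep_read[OF r] rep_addr[OF r] rdn_def rep_def\<close>)
qed

lemma implN_add: "implN v F \<Longrightarrow> implN v G \<Longrightarrow> implN v (\<lambda>I a \<rho>. F I a \<rho> + G I a \<rho>)"
proof (rule implN_binary, assumption, assumption, intro exI allI impI)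
  fix d I a \<rho> s assume r: "rep v I a \<rho> s"
  show "does (NStore (stkA d) (NAdd (NMem (stkA d)) (NMem (stkA (Suc d))))) 1 I s (\<lambda>s'. s' = setn (sad I d) (fst s (sad I d) + fst s (sad I (Suc d))) s)"
    by (rule does_setn[OF rep_addr(2)[OF r] refl]) (simp add: rep_addr[OF r])
qed

lemma implN_sub: "implN v F \<Longrightarrow> implN v G \<Longrightarrow> implN v (\<lambda>I a \<rho>. F I a \<rho> - G I a \<rho>)"
proof (rule implN_binary, assumption, assumption, intro exI allI impI)
  fix d I a \<rho> s assume r: "rep v I a \<rho> s"
  show "does (NStore (stkA d) (NSub (NMem (stkA d)) (NMem (stkA (Suc d))))) 1 I s (\<lambda>s'. s' = setn (sad I d) (fst s (sad I d) - fst s (sad I (Suc d))) s)"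
    by (rule does_setn[OF rep_addr(2)[OF r] refl]) (simp add: rep_addr[OF r])
qed

lemma implB_less: "implN v F \<Longrightarrow> implN v G \<Longrightarrow> implB v (\<lambda>I a \<rho>. F I a \<rho> < G I a \<rho>)"
  unfolding implB_def
proof (rule implN_binary[where h="\<lambda>x y. of_bool (x < y)"], assumption, assumption, intro exI allI impI)
  fix d I a \<rho> s assume r: "rep v I a \<rho> s"
  show "does (Cond (NLess (NMem (stkA d)) (NMem (stkA (Suc d)))) (NStore (stkA d) (NConst 1)) (NStore (stkA d) (NConst 0))) (1+1+1) I s (\<lambda>s'. s' = setn (sad I d) (of_bool (fst s (sad I d) < fst s (sad I (Suc d)))) s)"
    by (intro does_Cond does_setn rep_addr(2)[OF r] refl) (auto simp: rep_addr[OF r])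
qed

lemma implB_cong: "implB v P \<Longrightarrow> (\<And>I a \<rho>. P I a \<rho> = P' I a \<rho>) \<Longrightarrow> implB v P'"
  by (simp add: implB_def)
lemma implN_cong: "implN v P \<Longrightarrow> (\<And>I a \<rho>. P I a \<rho> = P' I a \<rho>) \<Longrightarrow> implN v P'"
  by (subgoal_tac "P = P'") (auto simp del: split_paired_All split_paired_all intro!: ext)

lemma implB_pos: "implN v F \<Longrightarrow> implB v (\<lambda>I a \<rho>. F I a \<rho> \<noteq> 0)"
  by (rule implB_cong[OF implB_less[OF implN_const[of v 0]]]) auto

lemma implB_not: "implB v P \<Longrightarrow> implB v (\<lambda>I a \<rho>. \<not> P I a \<rho>)"
  by (rule implB_cong[OF implB_less[OF _ implN_const[of v 1]], of "\<lambda>I a \<rho>. of_bool (P I a \<rho>)"]) (auto simp: implB_def)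
lemma implB_disj: "implB v P \<Longrightarrow> implB v Q \<Longrightarrow> implB v (\<lambda>I a \<rho>. P I a \<rho> \<or> Q I a \<rho>)"
  by (rule implB_cong[OF implB_pos[OF implN_add], of v "\<lambda>I a \<rho>. of_bool (P I a \<rho>)" "\<lambda>I a \<rho>. of_bool (Q I a \<rho>)"]) (auto simp: implB_def)
lemma implB_conj: "implB v P \<Longrightarrow> implB v Q \<Longrightarrow> implB v (\<lambda>I a \<rho>. P I a \<rho> \<and> Q I a \<rho>)"
  by (rule implB_cong[OF implB_not[OF implB_disj[OF implB_not implB_not]], of v P Q]) auto
lemma implB_imp: "implB v P \<Longrightarrow> implB v Q \<Longrightarrow> implB v (\<lambda>I a \<rho>. P I a \<rho> \<longrightarrow> Q I a \<rho>)"
  by (rule implB_cong[OF implB_disj[OF implB_not], of v P Q]) auto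
lemma implB_le: "implN v F \<Longrightarrow> implN v G \<Longrightarrow> implB v (\<lambda>I a \<rho>. F I a \<rho> \<le> G I a \<rho>)"
  by (rule implB_cong[OF implB_not[OF implB_less], of v G F]) auto
lemma implB_eq: "implN v F \<Longrightarrow> implN v G \<Longrightarrow> implB v (\<lambda>I a \<rho>. F I a \<rho> = G I a \<rho>)"
  by (rule implB_cong[OF implB_conj[OF implB_le implB_le], of v F G G F]) auto

lemma implN_If:
  assumes P: "implB v P" and F: "implN v F" and G: "implN v G"
  shows "implN v (\<lambda>I a \<rho>. if P I a \<rho> then F I a \<rho> else G I a \<rho>)"
  unfolding implN_def
proof
  fix d
  obtain c q where c: "\<And>I a \<rho> s. rep v I a \<rho> s \<Longrightarrow>
     does c q I s (\<lambda>s'. rep v I a \<rho> s' \<and> same I d s s' \<and> fst s' (sad I d) = of_bool (P I a \<rho>))"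
    by (rule implNE[OF P[unfolded implB_def], where d="d"], rule that)
  obtain c1 q1 where c1: "\<And>I a \<rho> s. rep v I a \<rho> s \<Longrightarrow>
     does c1 q1 I s (\<lambda>s'. rep v I a \<rho> s' \<and> same I d s s' \<and> fst s' (sad I d) = F I a \<rho>)"
    by (rule implNE[OF F, where d="d"], rule that)
  obtain c2 q2 where c2: "\<And>I a \<rho> s. rep v I a \<rho> s \<Longrightarrow>
     does c2 q2 I s (\<lambda>s'. rep v I a \<rho> s' \<and> same I d s s' \<and> fst s' (sad I d) = G I a \<rho>)"
    by (rule implNE[OF G, where d="d"], rule that)
  have "does (Seq c (Cond (NLess (NConst 0) (NMem (stkA d))) c1 c2)) (q + (1 + q1 + q2)) I s (\<lambda>s'. rep v I a \<rho> s' \<and> same I d s s' \<and> fst s' (sad I d) = (if P I a \<rho> then F I a \<rho> else G I a \<rho>))"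
    if r: "rep v I a \<rho> s" for I a \<rho> s
    by (rule does_Seq[OF c[OF r]], rule does_Cond; rule does_mono; (rule c1 c2)?)
      (auto simp: rep_addr intro: same_trans split: if_splits)
  then show "\<exists>c q. \<forall>I a \<rho> s. rep v I a \<rho> s \<longrightarrow>
     does c q I s (\<lambda>s'. rep v I a \<rho> s' \<and> same I d s s' \<and> fst s' (sad I d) = (if P I a \<rho> then F I a \<rho> else G I a \<rho>))" by blast
qed

text \<open>The value moves from the stack into the fresh variable \<open>v\<close>. The body runs
  in an environment changed at \<open>v\<close>, so \<open>ind\<close> requires that
  \<open>g\<close> depends on \<open>v\<close> only through its last argument.\<close>

lemma implN_let:
  assumes F: "implN v F" and G: "implN (Suc v) (\<lambda>I a \<rho>. g I a \<rho> (\<rho> v))"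
    and ind: "\<And>I a \<rho> i. g I a (\<rho>(v := i)) i = g I a \<rho> i"
  shows "implN v (\<lambda>I a \<rho>. g I a \<rho> (F I a \<rho>))"
  unfolding implN_def
proof
  fix d
  obtain c q where c: "\<And>I a \<rho> s. rep v I a \<rho> s \<Longrightarrow>
     does c q I s (\<lambda>s'. rep v I a \<rho> s' \<and> same I d s s' \<and> fst s' (sad I d) = F I a \<rho>)"
    by (rule implNE[OF F, where d="d"], rule that)
  obtain c1 q1 where c1: "\<And>I a \<rho> s. rep (Suc v) I a \<rho> s \<Longrightarrow>
     does c1 q1 I s (\<lambda>s'. rep (Suc v) I a \<rho> s' \<and> same I d s s' \<and> fst s' (sad I d) = g I a \<rho> (\<rho> v))"
    by (rule implNE[OF G, where d="d"], rule that)
  have "does (Seq c (Seq (NStore (varA v) (NMem (stkA d))) c1)) (q + (1 + q1)) I s (\<lambda>s'. rep v I a \<rho> s' \<and> same I d s s' \<and> fst s' (sad I d) = g I a \<rho> (F I a \<rho>))"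
    if r: "rep v I a \<rho> s" for I a \<rho> s
  proof (rule does_Seq[OF c[OF r]], rule does_Seq)
    fix s1 assume 1: "rep v I a \<rho> s1 \<and> same I d s s1 \<and> fst s1 (sad I d) = F I a \<rho>"
    then have r1: "rep v I a \<rho> s1" by blast
    show "does (NStore (varA v) (NMem (stkA d))) 1 I s1 (\<lambda>s'. rep (Suc v) I a (\<rho>(v := F I a \<rho>)) s' \<and> same I d s s')"
      by (rule does_setn[OF rep_addr(1)[OF r1] rep_read(2)[OF r1]])
         (use 1 rep_setn_var[OF r1] same_setn_var same_trans in metis)
  next
    fix s2 assume "rep (Suc v) I a (\<rho>(v := F I a \<rho>)) s2 \<and> same I d s s2"
    then show "does c1 q1 I s2 (\<lambda>s'. rep v I a \<rho> s' \<and> same I d s s' \<and> fst s' (sad I d) = g I a \<rho> (F I a \<rho>))"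
      by - (rule does_mono[OF c1], auto simp: ind intro: rep_drop same_trans)
  qed
  then show "\<exists>c q. \<forall>I a \<rho> s. rep v I a \<rho> s \<longrightarrow>
     does c q I s (\<lambda>s'. rep v I a \<rho> s' \<and> same I d s s' \<and> fst s' (sad I d) = g I a \<rho> (F I a \<rho>))" by blast
qed

text \<open>Variable \<open>v\<close> is the running index, level \<open>d\<close> the accumulator,
  and each summand is computed at level \<open>Suc d\<close>. Quantifiers, counting and minimisation
  all reduce to this loop.\<close>

lemma implN_sum:
  assumes G: "implN (Suc v) (\<lambda>I a \<rho>. g I a \<rho> (\<rho> v))"
    and ind: "\<And>I a \<rho> i. g I a (\<rho>(v := i)) i = g I a \<rho> i"
  shows "implN v (\<lambda>I a \<rho>. \<Sum>i<bnd I. g I a \<rho> i)"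
  unfolding implN_def
proof
  fix d
  obtain c q where c: "\<And>I a \<rho> s. rep (Suc v) I a \<rho> s \<Longrightarrow>
     does c q I s (\<lambda>s'. rep (Suc v) I a \<rho> s' \<and> same I (Suc d) s s' \<and> fst s' (sad I (Suc d)) = g I a \<rho> (\<rho> v))"
    by (rule implNE[OF G, where d="Suc d"], rule that)
  let ?body = "Seq c (Seq (NStore (stkA d) (NAdd (NMem (stkA d)) (NMem (stkA (Suc d))))) (NStore (varA v) (NAdd (NMem (varA v)) (NConst 1))))"
  let ?code = "Seq (NStore (stkA d) (NConst 0)) (Seq (NStore (varA v) (NConst 0)) (While (NLess (NMem (varA v)) (NMem (NConst (Suc 0)))) ?body))"
  have "does ?code (1 + (1 + (1 + [:3, 1, 3:] * (1 + (q + (1 + 1)))))) I s (\<lambda>s'. rep v I a \<rho> s' \<and> same I d s s' \<and> fst s' (sad I d) = (\<Sum>i<bnd I. g I a \<rho> i))"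
    if r: "rep v I a \<rho> s" for I a \<rho> s
  proof -
    define Q where "Q i s' \<longleftrightarrow> rep (Suc v) I a (\<rho>(v := i)) s' \<and> same I d s s' \<and> fst s' (sad I d) = (\<Sum>i<i. g I a \<rho> i)" for i s'
    have W: "does (While (NLess (NMem (varA v)) (NMem (NConst (Suc 0)))) ?body) (1 + [:3, 1, 3:] * (1 + (q + (1 + 1)))) I s' (Q (bnd I))"
      if Q0: "Q 0 s'" for s'
    proof (rule does_While[where Q=Q, OF _ _ Q0])
      fix i s1 assume "Q i s1"
      then have "rep (Suc v) I a (\<rho>(v := i)) s1" by (simp add: Q_def)
      then show "bval (NLess (NMem (varA v)) (NMem (NConst (Suc 0)))) s1 = (i < bnd I)"
        by (simp add: rep_read del: nval.simps)
    next
      fix i s1 assume i: "i < bnd I" and Q1: "Q i s1"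
      then have r1: "rep (Suc v) I a (\<rho>(v := i)) s1" by (simp add: Q_def)
      show "does ?body (q + (1 + 1)) I s1 (Q (Suc i))"
      proof (rule does_Seq[OF c[OF r1]], rule does_Seq)
        fix s2 assume 2: "rep (Suc v) I a (\<rho>(v := i)) s2 \<and> same I (Suc d) s1 s2 \<and> fst s2 (sad I (Suc d)) = g I a (\<rho>(v := i)) ((\<rho>(v := i)) v)"
        then have r2: "rep (Suc v) I a (\<rho>(v := i)) s2" by blast
        have f: "fst s2 (sad I d) = (\<Sum>i<i. g I a \<rho> i)"
          using Q1 2 by (auto simp: Q_def same_defs)
        have sm: "same I d s s2" using Q1 2 same_mono[of I "Suc d" s1 s2 d] same_trans[of I d s s1 s2] by (auto simp: Q_def)
        show "does (NStore (stkA d) (NAdd (NMem (stkA d)) (NMem (stkA (Suc d))))) 1 I s2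
          (\<lambda>s'. rep (Suc v) I a (\<rho>(v := i)) s' \<and> same I d s s' \<and> fst s' (sad I d) = (\<Sum>i<Suc i. g I a \<rho> i))"
          apply (rule does_setn[OF rep_addr(2)[OF r2] refl])
          using 2 f sm rep_setn_stk[OF r2] same_trans[OF sm same_setn_stk[of d d]]
          by (simp add: rep_read(2)[OF r2] rep_addr[OF r2] ind)
      next
        fix s2 assume 2: "rep (Suc v) I a (\<rho>(v := i)) s2 \<and> same I d s s2 \<and> fst s2 (sad I d) = (\<Sum>i<Suc i. g I a \<rho> i)"
        then have r2: "rep (Suc v) I a (\<rho>(v := i)) s2" by blast
        have nv: "nval (NAdd (NMem (varA v)) (NConst 1)) s2 = Suc i" using rep_read(1)[OF r2, of v] by simp
        have ne: "sad I d \<noteq> vad I v" by simp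
        show "does (NStore (varA v) (NAdd (NMem (varA v)) (NConst 1))) 1 I s2 (Q (Suc i))"
          apply (rule does_setn[OF rep_addr(1)[OF r2] nv])
          using 2 ne rep_setn_var'[OF r2, of v "Suc i"] same_trans[OF _ same_setn_var, of I d s s2 v "Suc i"]
          unfolding Q_def by simp
      qed
    qed
    show ?thesis
    proof (rule does_Seq[where Q="\<lambda>s'. rep v I a \<rho> s' \<and> same I d s s' \<and> fst s' (sad I d) = 0"])
      show "does (NStore (stkA d) (NConst 0)) 1 I s (\<lambda>s'. rep v I a \<rho> s' \<and> same I d s s' \<and> fst s' (sad I d) = 0)"
        by (rule does_setn[OF rep_addr(2)[OF r] refl]) (simp add: rep_setn_stk[OF r] same_setn_stk)
    next
      fix s1 assume 1: "rep v I a \<rho> s1 \<and> same I d s s1 \<and> fst s1 (sad I d) = 0"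
      then have r1: "rep v I a \<rho> s1" by blast
      have ne: "sad I d \<noteq> vad I v" by simp
      show "does (Seq (NStore (varA v) (NConst 0)) (While (NLess (NMem (varA v)) (NMem (NConst (Suc 0)))) ?body)) (1 + (1 + [:3, 1, 3:] * (1 + (q + (1 + 1))))) I s1
         (\<lambda>s'. rep v I a \<rho> s' \<and> same I d s s' \<and> fst s' (sad I d) = (\<Sum>i<bnd I. g I a \<rho> i))"
      proof (rule does_Seq[where Q="Q 0"])
        show "does (NStore (varA v) (NConst 0)) 1 I s1 (Q 0)"
          apply (rule does_setn[OF rep_addr(1)[OF r1] refl])
          using 1 ne rep_setn_var[OF r1, of "0"] same_trans[OF _ same_setn_var, of I d s s1 v 0]
          unfolding Q_def by simp
        fix s' assume "Q 0 s'"
        from W[OF this] show "does (While (NLess (NMem (varA v)) (NMem (NConst (Suc 0)))) ?body) (1 + [:3, 1, 3:] * (1 + (q + (1 + 1)))) I s'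
         (\<lambda>s'. rep v I a \<rho> s' \<and> same I d s s' \<and> fst s' (sad I d) = (\<Sum>i<bnd I. g I a \<rho> i))"
          by (rule does_mono) (auto simp: Q_def intro: rep_drop)
      qed
    qed
  qed
  then show "\<exists>c q. \<forall>I a \<rho> s. rep v I a \<rho> s \<longrightarrow>
     does c q I s (\<lambda>s'. rep v I a \<rho> s' \<and> same I d s s' \<and> fst s' (sad I d) = (\<Sum>i<bnd I. g I a \<rho> i))" by blast
qed

section \<open>Compilation of real expressions\<close>

lemma implR_expr:
  assumes "\<And>I a \<rho> s. rep v I a \<rho> s \<Longrightarrow> rval e s = F I a \<rho>"
  shows "implR v F"
  unfolding implR_def
proof (intro allI exI impI)
  fix d I a \<rho> s assume r: "rep v I a \<rho> s"
  show "does (RStore (rstA d) e) 1 I s (\<lambda>s'. rep v I a \<rho> s' \<and> same I d s s' \<and> snd s' (base I + d) = F I a \<rho>)"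
    by (rule does_setr[OF rep_addr(4)[OF r] assms[OF r]]) (simp add: rep_setr_stk[OF r] same_setr_stk)
qed

lemma implR_0: "implR v (\<lambda>I a \<rho>. 0)" by (rule implR_expr[of _ RZero]) simp

lemma implR_rdr:
  assumes F: "implN v F" shows "implR v (\<lambda>I a \<rho>. rdr I (F I a \<rho>))"
  unfolding implR_def
proof
  fix d
  obtain c q where c: "\<And>I a \<rho> s. rep v I a \<rho> s \<Longrightarrow>
     does c q I s (\<lambda>s'. rep v I a \<rho> s' \<and> same I d s s' \<and> fst s' (sad I d) = F I a \<rho>)"
    by (rule implNE[OF F, where d="d"], rule that)
  let ?e = "NMem (stkA d)"
  have "does (Seq c (Cond (NLess ?e (NMem (NConst (Suc 0)))) (RStore (rstA d) (RMem ?e)) (RStore (rstA d) RZero))) (q + (1 + 1 + 1)) I s (\<lambda>s'. rep v I a \<rho> s' \<and> same I d s s' \<and> snd s' (base I + d) = rdr I (F I a \<rho>))"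
    if r: "rep v I a \<rho> s" for I a \<rho> s
  proof (rule does_Seq[OF c[OF r]])
    fix s1 assume 1: "rep v I a \<rho> s1 \<and> same I d s s1 \<and> fst s1 (sad I d) = F I a \<rho>"
    then have r1: "rep v I a \<rho> s1" by blast
    show "does (Cond (NLess ?e (NMem (NConst (Suc 0)))) (RStore (rstA d) (RMem ?e)) (RStore (rstA d) RZero)) (1 + 1 + 1) I s1 (\<lambda>s'. rep v I a \<rho> s' \<and> same I d s s' \<and> snd s' (base I + d) = rdr I (F I a \<rho>))"
      by (intro does_Cond does_setr rep_addr(4)[OF r1] refl)
       (use 1 rep_setr_stk[OF r1, of d] same_trans[OF _ same_setr_stk[of d d], of I s s1] rep_read(6)[OF r1] r1 in
          \<open>auto simp: rep_addr[OF r1] rdr_def rep_def simp del: setr_simps\<close>, simp_all)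
  qed
  then show "\<exists>c q. \<forall>I a \<rho> s. rep v I a \<rho> s \<longrightarrow> does c q I s (\<lambda>s'. rep v I a \<rho> s' \<and> same I d s s' \<and> snd s' (base I + d) = rdr I (F I a \<rho>))" by blast
qed

lemma real_binary:
  assumes F: "implR v F" and G: "implR v G"
  shows "\<exists>c q. \<forall>I a \<rho> s. rep v I a \<rho> s \<longrightarrow>
     does c q I s (\<lambda>s'. rep v I a \<rho> s' \<and> same I d s s' \<and> snd s' (base I + d) = F I a \<rho> \<and> snd s' (base I + Suc d) = G I a \<rho>)"
proof -
  obtain c q where c: "\<And>I a \<rho> s. rep v I a \<rho> s \<Longrightarrow>
     does c q I s (\<lambda>s'. rep v I a \<rho> s' \<and> same I d s s' \<and> snd s' (base I + d) = F I a \<rho>)"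
    by (rule implRE[OF F, where d="d"], rule that)
  obtain c1 q1 where c1: "\<And>I a \<rho> s. rep v I a \<rho> s \<Longrightarrow>
     does c1 q1 I s (\<lambda>s'. rep v I a \<rho> s' \<and> same I (Suc d) s s' \<and> snd s' (base I + Suc d) = G I a \<rho>)"
    by (rule implRE[OF G, where d="Suc d"], rule that)
  have "does (Seq c c1) (q + q1) I s (\<lambda>s'. rep v I a \<rho> s' \<and> same I d s s' \<and> snd s' (base I + d) = F I a \<rho> \<and> snd s' (base I + Suc d) = G I a \<rho>)"
    if r: "rep v I a \<rho> s" for I a \<rho> s
  proof (rule does_Seq[OF c[OF r]], rule does_mono[OF c1], blast, intro conjI)
    fix s1 s2
    assume 1: "rep v I a \<rho> s1 \<and> same I d s s1 \<and> snd s1 (base I + d) = F I a \<rho>"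
      and 2: "rep v I a \<rho> s2 \<and> same I (Suc d) s1 s2 \<and> snd s2 (base I + Suc d) = G I a \<rho>"
    show "snd s2 (base I + d) = F I a \<rho>" using 1 2 by (auto simp: same_defs)
    show "same I d s s2" using 1 2 same_mono[of I "Suc d" s1 s2 d] same_trans[of I d s s1 s2] by auto
    show "rep v I a \<rho> s2" "snd s2 (base I + Suc d) = G I a \<rho>" using 2 by auto
  qed
  then show ?thesis by blast
qed

lemma implR_add:
  assumes F: "implR v F" and G: "implR v G" shows "implR v (\<lambda>I a \<rho>. F I a \<rho> + G I a \<rho>)"
  unfolding implR_def
proof
  fix d
  obtain c q where c: "\<And>I a \<rho> s. rep v I a \<rho> s \<Longrightarrow>
     does c q I s (\<lambda>s'. rep v I a \<rho> s' \<and> same I d s s' \<and> snd s' (base I + d) = F I a \<rho> \<and> snd s' (base I + Suc d) = G I a \<rho>)"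
    using real_binary[OF F G] by blast
  have "does (Seq c (RStore (rstA d) (RAdd (RMem (rstA d)) (RMem (rstA (Suc d)))))) (q + 1) I s (\<lambda>s'. rep v I a \<rho> s' \<and> same I d s s' \<and> snd s' (base I + d) = F I a \<rho> + G I a \<rho>)"
    if r: "rep v I a \<rho> s" for I a \<rho> s
  proof (rule does_Seq[OF c[OF r]])
    fix s1 assume 1: "rep v I a \<rho> s1 \<and> same I d s s1 \<and> snd s1 (base I + d) = F I a \<rho> \<and> snd s1 (base I + Suc d) = G I a \<rho>"
    then have r1: "rep v I a \<rho> s1" by blast
    show "does (RStore (rstA d) (RAdd (RMem (rstA d)) (RMem (rstA (Suc d))))) 1 I s1 (\<lambda>s'. rep v I a \<rho> s' \<and> same I d s s' \<and> snd s' (base I + d) = F I a \<rho> + G I a \<rho>)"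
      by (rule does_setr[OF rep_addr(4)[OF r1] refl])
       (use 1 rep_setr_stk[OF r1] same_trans[OF _ same_setr_stk[of d d]] in \<open>auto simp: rep_addr[OF r1]\<close>)
  qed
  then show "\<exists>c q. \<forall>I a \<rho> s. rep v I a \<rho> s \<longrightarrow> does c q I s (\<lambda>s'. rep v I a \<rho> s' \<and> same I d s s' \<and> snd s' (base I + d) = F I a \<rho> + G I a \<rho>)" by blast
qed

lemma implB_rless:
  assumes F: "implR v F" and G: "implR v G" shows "implB v (\<lambda>I a \<rho>. F I a \<rho> < G I a \<rho>)"
  unfolding implN_def implB_def
proof
  fix d
  obtain c q where c: "\<And>I a \<rho> s. rep v I a \<rho> s \<Longrightarrow>
     does c q I s (\<lambda>s'. rep v I a \<rho> s' \<and> same I d s s' \<and> snd s' (base I + d) = F I a \<rho> \<and> snd s' (base I + Suc d) = G I a \<rho>)"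
    using real_binary[OF F G] by blast
  let ?c = "Cond (RLess (RMem (rstA d)) (RMem (rstA (Suc d)))) (NStore (stkA d) (NConst 1)) (NStore (stkA d) (NConst 0))"
  have "does (Seq c ?c) (q + (1 + 1 + 1)) I s (\<lambda>s'. rep v I a \<rho> s' \<and> same I d s s' \<and> fst s' (sad I d) = of_bool (F I a \<rho> < G I a \<rho>))"
    if r: "rep v I a \<rho> s" for I a \<rho> s
  proof (rule does_Seq[OF c[OF r]])
    fix s1 assume 1: "rep v I a \<rho> s1 \<and> same I d s s1 \<and> snd s1 (base I + d) = F I a \<rho> \<and> snd s1 (base I + Suc d) = G I a \<rho>"
    then have r1: "rep v I a \<rho> s1" by blast
    show "does ?c (1 + 1 + 1) I s1 (\<lambda>s'. rep v I a \<rho> s' \<and> same I d s s' \<and> fst s' (sad I d) = of_bool (F I a \<rho> < G I a \<rho>))"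
      by (intro does_Cond does_setn rep_addr(2)[OF r1] refl)
       (use 1 rep_setn_stk[OF r1] same_trans[OF _ same_setn_stk[of d d], of I s s1] in \<open>auto simp: rep_addr[OF r1]\<close>)
  qed
  then show "\<exists>c q. \<forall>I a \<rho> s. rep v I a \<rho> s \<longrightarrow> does c q I s (\<lambda>s'. rep v I a \<rho> s' \<and> same I d s s' \<and> fst s' (sad I d) = of_bool (F I a \<rho> < G I a \<rho>))" by blast
qed

lemma implB_rle: "implR v F \<Longrightarrow> implR v G \<Longrightarrow> implB v (\<lambda>I a \<rho>. F I a \<rho> \<le> G I a \<rho>)"
  by (rule implB_cong[OF implB_not[OF implB_rless], of v G F]) auto

lemma implR_If:
  assumes P: "implB v P" and F: "implR v F" and G: "implR v G"
  shows "implR v (\<lambda>I a \<rho>. if P I a \<rho> then F I a \<rho> else G I a \<rho>)"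
  unfolding implR_def
proof
  fix d
  obtain c q where c: "\<And>I a \<rho> s. rep v I a \<rho> s \<Longrightarrow>
     does c q I s (\<lambda>s'. rep v I a \<rho> s' \<and> same I d s s' \<and> fst s' (sad I d) = of_bool (P I a \<rho>))"
    by (rule implNE[OF P[unfolded implB_def], where d="d"], rule that)
  obtain c1 q1 where c1: "\<And>I a \<rho> s. rep v I a \<rho> s \<Longrightarrow>
     does c1 q1 I s (\<lambda>s'. rep v I a \<rho> s' \<and> same I d s s' \<and> snd s' (base I + d) = F I a \<rho>)"
    by (rule implRE[OF F, where d="d"], rule that)
  obtain c2 q2 where c2: "\<And>I a \<rho> s. rep v I a \<rho> s \<Longrightarrow>
     does c2 q2 I s (\<lambda>s'. rep v I a \<rho> s' \<and> same I d s s' \<and> snd s' (base I + d) = G I a \<rho>)"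
    by (rule implRE[OF G, where d="d"], rule that)
  have "does (Seq c (Cond (NLess (NConst 0) (NMem (stkA d))) c1 c2)) (q + (1 + q1 + q2)) I s (\<lambda>s'. rep v I a \<rho> s' \<and> same I d s s' \<and> snd s' (base I + d) = (if P I a \<rho> then F I a \<rho> else G I a \<rho>))"
    if r: "rep v I a \<rho> s" for I a \<rho> s
    by (rule does_Seq[OF c[OF r]], rule does_Cond; rule does_mono; (rule c1 c2)?)
      (auto simp: rep_addr intro: same_trans split: if_splits)
  then show "\<exists>c q. \<forall>I a \<rho> s. rep v I a \<rho> s \<longrightarrow>
     does c q I s (\<lambda>s'. rep v I a \<rho> s' \<and> same I d s s' \<and> snd s' (base I + d) = (if P I a \<rho> then F I a \<rho> else G I a \<rho>))" by blast
qed

lemma implR_sum: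
  assumes G: "implR (Suc v) (\<lambda>I a \<rho>. g I a \<rho> (\<rho> v))"
    and ind: "\<And>I a \<rho> i. g I a (\<rho>(v := i)) i = g I a \<rho> i"
  shows "implR v (\<lambda>I a \<rho>. \<Sum>i<bnd I. g I a \<rho> i)"
  unfolding implR_def
proof
  fix d
  obtain c q where c: "\<And>I a \<rho> s. rep (Suc v) I a \<rho> s \<Longrightarrow>
     does c q I s (\<lambda>s'. rep (Suc v) I a \<rho> s' \<and> same I (Suc d) s s' \<and> snd s' (base I + Suc d) = g I a \<rho> (\<rho> v))"
    by (rule implRE[OF G, where d="Suc d"], rule that)
  let ?body = "Seq c (Seq (RStore (rstA d) (RAdd (RMem (rstA d)) (RMem (rstA (Suc d))))) (NStore (varA v) (NAdd (NMem (varA v)) (NConst 1))))"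
  let ?code = "Seq (RStore (rstA d) RZero) (Seq (NStore (varA v) (NConst 0)) (While (NLess (NMem (varA v)) (NMem (NConst (Suc 0)))) ?body))"
  have "does ?code (1 + (1 + (1 + [:3, 1, 3:] * (1 + (q + (1 + 1)))))) I s (\<lambda>s'. rep v I a \<rho> s' \<and> same I d s s' \<and> snd s' (base I + d) = (\<Sum>i<bnd I. g I a \<rho> i))"
    if r: "rep v I a \<rho> s" for I a \<rho> s
  proof -
    define Q where "Q i s' \<longleftrightarrow> rep (Suc v) I a (\<rho>(v := i)) s' \<and> same I d s s' \<and> snd s' (base I + d) = (\<Sum>i<i. g I a \<rho> i)" for i s'
    have W: "does (While (NLess (NMem (varA v)) (NMem (NConst (Suc 0)))) ?body) (1 + [:3, 1, 3:] * (1 + (q + (1 + 1)))) I s' (Q (bnd I))"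
      if Q0: "Q 0 s'" for s'
    proof (rule does_While[where Q=Q, OF _ _ Q0])
      fix i s1 assume "Q i s1"
      then have "rep (Suc v) I a (\<rho>(v := i)) s1" by (simp add: Q_def)
      then show "bval (NLess (NMem (varA v)) (NMem (NConst (Suc 0)))) s1 = (i < bnd I)"
        by (simp add: rep_read del: nval.simps)
    next
      fix i s1 assume i: "i < bnd I" and Q1: "Q i s1"
      then have r1: "rep (Suc v) I a (\<rho>(v := i)) s1" by (simp add: Q_def)
      show "does ?body (q + (1 + 1)) I s1 (Q (Suc i))"
      proof (rule does_Seq[OF c[OF r1]], rule does_Seq)
        fix s2 assume 2: "rep (Suc v) I a (\<rho>(v := i)) s2 \<and> same I (Suc d) s1 s2 \<and> snd s2 (base I + Suc d) = g I a (\<rho>(v := i)) ((\<rho>(v := i)) v)"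
        then have r2: "rep (Suc v) I a (\<rho>(v := i)) s2" by blast
        have f: "snd s2 (base I + d) = (\<Sum>i<i. g I a \<rho> i)"
          using Q1 2 by (auto simp: Q_def same_defs)
        have sm: "same I d s s2" using Q1 2 same_mono[of I "Suc d" s1 s2 d] same_trans[of I d s s1 s2] by (auto simp: Q_def)
        show "does (RStore (rstA d) (RAdd (RMem (rstA d)) (RMem (rstA (Suc d))))) 1 I s2
          (\<lambda>s'. rep (Suc v) I a (\<rho>(v := i)) s' \<and> same I d s s' \<and> snd s' (base I + d) = (\<Sum>i<Suc i. g I a \<rho> i))"
          apply (rule does_setr[OF rep_addr(4)[OF r2] refl])
          using 2 f sm rep_setr_stk[OF r2] same_trans[OF sm same_setr_stk[of d d]]
          by (simp add: rep_addr[OF r2] ind)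
      next
        fix s2 assume 2: "rep (Suc v) I a (\<rho>(v := i)) s2 \<and> same I d s s2 \<and> snd s2 (base I + d) = (\<Sum>i<Suc i. g I a \<rho> i)"
        then have r2: "rep (Suc v) I a (\<rho>(v := i)) s2" by blast
        have nv: "nval (NAdd (NMem (varA v)) (NConst 1)) s2 = Suc i" using rep_read(1)[OF r2, of v] by simp
        show "does (NStore (varA v) (NAdd (NMem (varA v)) (NConst 1))) 1 I s2 (Q (Suc i))"
          apply (rule does_setn[OF rep_addr(1)[OF r2] nv])
          using 2 rep_setn_var'[OF r2, of v "Suc i"] same_trans[OF _ same_setn_var, of I d s s2 v "Suc i"]
          unfolding Q_def by simp
      qed
    qed
    show ?thesis
    proof (rule does_Seq[where Q="\<lambda>s'. rep v I a \<rho> s' \<and> same I d s s' \<and> snd s' (base I + d) = 0"])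
      show "does (RStore (rstA d) RZero) 1 I s (\<lambda>s'. rep v I a \<rho> s' \<and> same I d s s' \<and> snd s' (base I + d) = 0)"
        by (rule does_setr[OF rep_addr(4)[OF r] refl]) (simp add: rep_setr_stk[OF r] same_setr_stk)
    next
      fix s1 assume 1: "rep v I a \<rho> s1 \<and> same I d s s1 \<and> snd s1 (base I + d) = 0"
      then have r1: "rep v I a \<rho> s1" by blast
      show "does (Seq (NStore (varA v) (NConst 0)) (While (NLess (NMem (varA v)) (NMem (NConst (Suc 0)))) ?body)) (1 + (1 + [:3, 1, 3:] * (1 + (q + (1 + 1))))) I s1
         (\<lambda>s'. rep v I a \<rho> s' \<and> same I d s s' \<and> snd s' (base I + d) = (\<Sum>i<bnd I. g I a \<rho> i))"
      proof (rule does_Seq[where Q="Q 0"])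
        show "does (NStore (varA v) (NConst 0)) 1 I s1 (Q 0)"
          apply (rule does_setn[OF rep_addr(1)[OF r1] refl])
          using 1 rep_setn_var[OF r1, of "0"] same_trans[OF _ same_setn_var, of I d s s1 v 0]
          unfolding Q_def by simp
        fix s' assume "Q 0 s'"
        from W[OF this] show "does (While (NLess (NMem (varA v)) (NMem (NConst (Suc 0)))) ?body) (1 + [:3, 1, 3:] * (1 + (q + (1 + 1)))) I s'
         (\<lambda>s'. rep v I a \<rho> s' \<and> same I d s s' \<and> snd s' (base I + d) = (\<Sum>i<bnd I. g I a \<rho> i))"
          by (rule does_mono) (auto simp: Q_def intro: rep_drop)
      qed
    qed
  qed
  then show "\<exists>c q. \<forall>I a \<rho> s. rep v I a \<rho> s \<longrightarrow>
     does c q I s (\<lambda>s'. rep v I a \<rho> s' \<and> same I d s s' \<and> snd s' (base I + d) = (\<Sum>i<bnd I. g I a \<rho> i))" by blast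
qed

section \<open>Bounded quantifiers, counting and search\<close>

lemma implB_ex:
  assumes "implB (Suc v) (\<lambda>I a \<rho>. P I a \<rho> (\<rho> v))" "\<And>I a \<rho> i. P I a (\<rho>(v := i)) i = P I a \<rho> i"
  shows "implB v (\<lambda>I a \<rho>. \<exists>i<bnd I. P I a \<rho> i)"
proof (rule implB_cong[OF implB_pos[OF implN_sum]])
  show "implN (Suc v) (\<lambda>I a \<rho>. of_bool (P I a \<rho> (\<rho> v)))" using assms(1) by (simp add: implB_def)
qed (simp_all only: assms(2), auto)

lemma implB_all:
  assumes "implB (Suc v) (\<lambda>I a \<rho>. P I a \<rho> (\<rho> v))" "\<And>I a \<rho> i. P I a (\<rho>(v := i)) i = P I a \<rho> i"
  shows "implB v (\<lambda>I a \<rho>. \<forall>i<bnd I. P I a \<rho> i)"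
proof (rule implB_cong[OF implB_not[OF implB_ex]])
  show "implB (Suc v) (\<lambda>I a \<rho>. \<not> P I a \<rho> (\<rho> v))" using assms(1) by (rule implB_not)
qed (simp_all only: assms(2), auto)

definition count :: "nat \<Rightarrow> (nat \<Rightarrow> bool) \<Rightarrow> nat" where "count b P = (\<Sum>i<b. of_bool (P i))"
text \<open>Minimisation without early exit: the indices preceding every witness are counted, which
  gives the least witness, or \<open>b\<close> if there is none.\<close>

definition first :: "nat \<Rightarrow> (nat \<Rightarrow> bool) \<Rightarrow> nat" where "first b P = count b (\<lambda>i. \<forall>j<b. j \<le> i \<longrightarrow> \<not> P j)"

lemma count_card: "count b P = card {i. i < b \<and> P i}"
  unfolding count_def by (simp add: sum.If_cases of_bool_def lessThan_def Int_def)

lemma first_props: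
  assumes "\<exists>j<b. P j" shows "first b P < b" "P (first b P)"
proof -
  define m where "m = (LEAST j. P j)"
  obtain j where j: "j < b" "P j" using assms by blast
  have m: "P m" "m < b" using j unfolding m_def by (auto intro: LeastI Least_le le_less_trans)
  have "{i. i < b \<and> (\<forall>j<b. j \<le> i \<longrightarrow> \<not> P j)} = {..<m}"
    using m not_less_Least[of _ P] unfolding m_def[symmetric] by (auto simp: not_le[symmetric])
  then have "first b P = m" by (simp add: first_def count_card)
  with m show "first b P < b" "P (first b P)" by auto
qed

lemma implN_count:
  assumes "implB (Suc v) (\<lambda>I a \<rho>. P I a \<rho> (\<rho> v))" "\<And>I a \<rho> i. P I a (\<rho>(v := i)) i = P I a \<rho> i"
  shows "implN v (\<lambda>I a \<rho>. count (bnd I) (\<lambda>i. P I a \<rho> i))"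
  unfolding count_def by (rule implN_sum) (use assms in \<open>auto simp: implB_def\<close>)

lemma implN_first:
  assumes "implB (Suc (Suc v)) (\<lambda>I a \<rho>. P I a \<rho> (\<rho> (Suc v)))"
    "\<And>I a \<rho> i j. P I a (\<rho>(Suc v := i)) j = P I a \<rho> j" "\<And>I a \<rho> i j. P I a (\<rho>(v := i)) j = P I a \<rho> j"
  shows "implN v (\<lambda>I a \<rho>. first (bnd I) (\<lambda>i. P I a \<rho> i))"
  unfolding first_def
  by (rule implN_count, rule implB_all, rule implB_imp, rule implB_le, rule implN_var, simp, rule implN_var, simp, rule implB_not, rule assms)
    (auto simp: assms)

section \<open>Compilation of array programs\<close>

lemma implP_id: "implP (\<lambda>I a. a)"
  unfolding implP_def
proof (intro allI exI impI)
  fix d I a \<rho> s assume "rep 0 I a \<rho> s"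
  then show "does Skip 1 I s (\<lambda>s'. rep 0 I a \<rho> s' \<and> sameP I d s s')"
    unfolding does_def by (intro exI[of _ 1] exI[of _ s]) (use exec_Skip in \<open>auto simp: same_defs\<close>)
qed

lemma implP_seq:
  assumes f: "implP f" and g: "implP g" shows "implP (\<lambda>I a. g I (f I a))"
  unfolding implP_def
proof
  fix d
  obtain c q where c: "\<And>I a \<rho> s. rep 0 I a \<rho> s \<Longrightarrow> does c q I s (\<lambda>s'. rep 0 I (f I a) \<rho> s' \<and> sameP I d s s')"
    by (rule implPE[OF f, where d=d], rule that)
  obtain c1 q1 where c1: "\<And>I a \<rho> s. rep 0 I a \<rho> s \<Longrightarrow> does c1 q1 I s (\<lambda>s'. rep 0 I (g I a) \<rho> s' \<and> sameP I d s s')"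
    by (rule implPE[OF g, where d=d], rule that)
  have "does (Seq c c1) (q + q1) I s (\<lambda>s'. rep 0 I (g I (f I a)) \<rho> s' \<and> sameP I d s s')" if "rep 0 I a \<rho> s" for I a \<rho> s
    by (rule does_Seq[OF c[OF that]], rule does_mono[OF c1]) (auto intro: sameP_trans)
  then show "\<exists>c q. \<forall>I a \<rho> s. rep 0 I a \<rho> s \<longrightarrow> does c q I s (\<lambda>s'. rep 0 I (g I (f I a)) \<rho> s' \<and> sameP I d s s')" by blast
qed

lemma implP_If:
  assumes P: "implB 0 (\<lambda>I a \<rho>. P I a)" and f: "implP f" and g: "implP g"
  shows "implP (\<lambda>I a. if P I a then f I a else g I a)"
  unfolding implP_def
proof
  fix d
  obtain c0 q0 where c0: "\<And>I a \<rho> s. rep 0 I a \<rho> s \<Longrightarrow>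
     does c0 q0 I s (\<lambda>s'. rep 0 I a \<rho> s' \<and> same I d s s' \<and> fst s' (sad I d) = of_bool (P I a))"
    by (rule implNE[OF P[unfolded implB_def], where d="d"], rule that)
  obtain c q where c: "\<And>I a \<rho> s. rep 0 I a \<rho> s \<Longrightarrow> does c q I s (\<lambda>s'. rep 0 I (f I a) \<rho> s' \<and> sameP I d s s')"
    by (rule implPE[OF f, where d=d], rule that)
  obtain c1 q1 where c1: "\<And>I a \<rho> s. rep 0 I a \<rho> s \<Longrightarrow> does c1 q1 I s (\<lambda>s'. rep 0 I (g I a) \<rho> s' \<and> sameP I d s s')"
    by (rule implPE[OF g, where d=d], rule that)
  have "does (Seq c0 (Cond (NLess (NConst 0) (NMem (stkA d))) c c1)) (q0 + (1 + q + q1)) I s (\<lambda>s'. rep 0 I (if P I a then f I a else g I a) \<rho> s' \<and> sameP I d s s')" if r: "rep 0 I a \<rho> s" for I a \<rho> s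
    by (rule does_Seq[OF c0[OF r]], rule does_Cond; rule does_mono; (rule c c1)?)
      (auto simp: rep_addr intro: sameP_trans[OF same_sameP] split: if_splits)
  then show "\<exists>c q. \<forall>I a \<rho> s. rep 0 I a \<rho> s \<longrightarrow> does c q I s (\<lambda>s'. rep 0 I (if P I a then f I a else g I a) \<rho> s' \<and> sameP I d s s')" by blast
qed

text \<open>The counter lives on the stack at level \<open>d\<close>, since the body may overwrite
  all variables; the code of the body is the one for level \<open>Suc d\<close>.\<close>

lemma implP_loop:
  assumes f: "implP f" shows "implP (\<lambda>I a. (f I ^^ bnd I) a)"
  unfolding implP_def
proof
  fix d
  obtain c q where c: "\<And>I a \<rho> s. rep 0 I a \<rho> s \<Longrightarrow> does c q I s (\<lambda>s'. rep 0 I (f I a) \<rho> s' \<and> sameP I (Suc d) s s')"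
    by (rule implPE[OF f, where d="Suc d"], rule that)
  let ?body = "Seq c (NStore (stkA d) (NAdd (NMem (stkA d)) (NConst 1)))"
  have "does (Seq (NStore (stkA d) (NConst 0)) (While (NLess (NMem (stkA d)) (NMem (NConst (Suc 0)))) ?body)) (1 + (1 + [:3, 1, 3:] * (1 + (q + 1)))) I s
     (\<lambda>s'. rep 0 I ((f I ^^ bnd I) a) \<rho> s' \<and> sameP I d s s')" if r: "rep 0 I a \<rho> s" for I a \<rho> s
  proof -
    define Q where "Q i s' \<longleftrightarrow> rep 0 I ((f I ^^ i) a) \<rho> s' \<and> sameP I d s s' \<and> fst s' (sad I d) = i" for i s'
    show ?thesis
    proof (rule does_Seq[where Q="Q 0"])
      show "does (NStore (stkA d) (NConst 0)) 1 I s (Q 0)"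
        by (rule does_setn[OF rep_addr(2)[OF r] refl]) (simp add: Q_def rep_setn_stk[OF r] same_sameP[OF same_setn_stk])
      fix s0 assume Q0: "Q 0 s0"
      have "does (While (NLess (NMem (stkA d)) (NMem (NConst (Suc 0)))) ?body) (1 + [:3, 1, 3:] * (1 + (q + 1))) I s0 (Q (bnd I))"
      proof (rule does_While[where Q=Q, OF _ _ Q0])
        fix i s1 assume Q1: "Q i s1"
        then have r1: "rep 0 I ((f I ^^ i) a) \<rho> s1" by (simp add: Q_def)
        show "bval (NLess (NMem (stkA d)) (NMem (NConst (Suc 0)))) s1 = (i < bnd I)"
          using Q1 by (simp add: Q_def rep_read[OF r1] rep_addr[OF r1] del: One_nat_def) (use r1 in \<open>simp add: rep_def\<close>)
        show "does ?body (q + 1) I s1 (Q (Suc i))"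
        proof (rule does_Seq[OF c[OF r1]])
          fix s2 assume 2: "rep 0 I (f I ((f I ^^ i) a)) \<rho> s2 \<and> sameP I (Suc d) s1 s2"
          then have r2: "rep 0 I (f I ((f I ^^ i) a)) \<rho> s2" by blast
          have f: "fst s2 (sad I d) = i" using Q1 2 by (auto simp: Q_def same_defs)
          have sm: "sameP I d s s2" using Q1 2 sameP_mono[of I "Suc d" s1 s2 d] sameP_trans[of I d s s1 s2] by (auto simp: Q_def)
          show "does (NStore (stkA d) (NAdd (NMem (stkA d)) (NConst 1))) 1 I s2 (Q (Suc i))"
            by (rule does_setn[OF rep_addr(2)[OF r2] refl])
              (use f rep_setn_stk[OF r2] sameP_trans[OF sm same_sameP[OF same_setn_stk[of d d]]] in \<open>simp add: Q_def rep_addr[OF r2]\<close>)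
        qed
      qed
      then show "does (While (NLess (NMem (stkA d)) (NMem (NConst (Suc 0)))) ?body) (1 + [:3, 1, 3:] * (1 + (q + 1))) I s0
          (\<lambda>s'. rep 0 I ((f I ^^ bnd I) a) \<rho> s' \<and> sameP I d s s')"
        by (rule does_mono) (auto simp: Q_def)
    qed
  qed
  then show "\<exists>c q. \<forall>I a \<rho> s. rep 0 I a \<rho> s \<longrightarrow> does c q I s (\<lambda>s'. rep 0 I ((f I ^^ bnd I) a) \<rho> s' \<and> sameP I d s s')" by blast
qed

definition upd :: "nat \<Rightarrow> (state \<Rightarrow> arrays \<Rightarrow> nat \<Rightarrow> nat) \<Rightarrow> state \<Rightarrow> arrays \<Rightarrow> arrays" where
  "upd j F I a = a(j := (\<lambda>i. if i < bnd I then F I a i else a j i))"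

text \<open>Two passes make the assignment simultaneous: the first evaluates all new entries into
  array 15, so that every right-hand side sees the old array \<open>j\<close>, and the second copies
  them.\<close>

lemma implP_upd:
  assumes F: "implN (Suc 0) (\<lambda>I a \<rho>. F I a (\<rho> 0))" and j: "j < 15"
  shows "implP (upd j F)"
  unfolding implP_def
proof
  fix d
  obtain c q where c: "\<And>I a \<rho> s. rep (Suc 0) I a \<rho> s \<Longrightarrow>
     does c q I s (\<lambda>s'. rep (Suc 0) I a \<rho> s' \<and> same I d s s' \<and> fst s' (sad I d) = F I a (\<rho> 0))"
    by (rule implNE[OF F, where d="d"], rule that)
  let ?B1 = "Seq c (Seq (NStore (arrA 15 (NMem (varA 0))) (NMem (stkA d))) (NStore (varA 0) (NAdd (NMem (varA 0)) (NConst 1))))"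
  let ?B2 = "Seq (NStore (arrA j (NMem (varA 0))) (NMem (arrA 15 (NMem (varA 0))))) (NStore (varA 0) (NAdd (NMem (varA 0)) (NConst 1)))"
  let ?I = "NStore (varA 0) (NConst 0)"
  let ?b = "NLess (NMem (varA 0)) (NMem (NConst (Suc 0)))"
  let ?q1 = "1 + [:3, 1, 3:] * (1 + (q + (1 + 1)))"
  let ?q2 = "1 + [:3, 1, 3:] * (1 + (1 + 1))"
  have "does (Seq ?I (Seq (While ?b ?B1) (Seq ?I (While ?b ?B2)))) (1 + (?q1 + (1 + ?q2))) I s (\<lambda>s'. rep 0 I (upd j F I a) \<rho> s' \<and> sameP I d s s')"
    if r: "rep 0 I a \<rho> s" for I a \<rho> s
  proof -
    define Q1 where "Q1 i s' \<longleftrightarrow> rep (Suc 0) I a (\<rho>(0 := i)) s' \<and> sameP I d s s' \<and> (\<forall>k<i. fst s' (aad I 15 k) = F I a k)" for i s'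
    define a' where "a' i = a(j := (\<lambda>k. if k < i then F I a k else a j k))" for i
    define Q2 where "Q2 i s' \<longleftrightarrow> rep (Suc 0) I (a' i) (\<rho>(0 := i)) s' \<and> sameP I d s s' \<and> (\<forall>k<bnd I. fst s' (aad I 15 k) = F I a k)" for i s'
    have b: "bval ?b s1 = (i < bnd I)" if "rep (Suc 0) I b (\<rho>(0 := i)) s1" for b i s1
      using that by (simp add: rep_read del: nval.simps)
    have W1: "does (While ?b ?B1) ?q1 I s' (Q1 (bnd I))" if Q0: "Q1 0 s'" for s'
    proof (rule does_While[where Q=Q1, OF _ _ Q0])
      fix i s1 assume Q1: "Q1 i s1"
      then have r1: "rep (Suc 0) I a (\<rho>(0 := i)) s1" by (simp add: Q1_def)
      show "bval ?b s1 = (i < bnd I)" using b[OF r1] .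
      show "does ?B1 (q + (1 + 1)) I s1 (Q1 (Suc i))"
      proof (rule does_Seq[OF c[OF r1]], rule does_Seq)
        fix s2 assume 2: "rep (Suc 0) I a (\<rho>(0 := i)) s2 \<and> same I d s1 s2 \<and> fst s2 (sad I d) = F I a ((\<rho>(0 := i)) 0)"
        then have r2: "rep (Suc 0) I a (\<rho>(0 := i)) s2" by blast
        have sm: "sameP I d s s2" using Q1 2 sameP_trans[of I d s s1 s2] same_sameP by (auto simp: Q1_def)
        have ad: "nval (arrA 15 (NMem (varA 0))) s2 = aad I 15 i" using rep_addr(3)[OF r2] rep_read(1)[OF r2, of 0] by simp
        have "rep (Suc 0) I a (\<rho>(0 := i)) (setn (aad I 15 i) x s2)" for x
          using r2 by (auto simp: rep_def aad_eq eq_commute[of _ "aad I 15 i"])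
        then show "does (NStore (arrA 15 (NMem (varA 0))) (NMem (stkA d))) 1 I s2
            (\<lambda>s'. rep (Suc 0) I a (\<rho>(0 := i)) s' \<and> sameP I d s s' \<and> (\<forall>k<Suc i. fst s' (aad I 15 k) = F I a k))"
          apply (intro does_setn[OF ad rep_read(2)[OF r2]])
          using 2 Q1 sameP_trans[OF sm sameP_setn_arr]
          by (auto simp: Q1_def same_def aad_eq less_Suc_eq)
      next
        fix s2 assume 2: "rep (Suc 0) I a (\<rho>(0 := i)) s2 \<and> sameP I d s s2 \<and> (\<forall>k<Suc i. fst s2 (aad I 15 k) = F I a k)"
        then have r2: "rep (Suc 0) I a (\<rho>(0 := i)) s2" by blast
        have nv: "nval (NAdd (NMem (varA 0)) (NConst 1)) s2 = Suc i" using rep_read(1)[OF r2, of 0] by simp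
        show "does (NStore (varA 0) (NAdd (NMem (varA 0)) (NConst 1))) 1 I s2 (Q1 (Suc i))"
          apply (rule does_setn[OF rep_addr(1)[OF r2] nv])
          using 2 rep_setn_var'[OF r2, of 0 "Suc i"] sameP_trans[OF _ same_sameP[OF same_setn_var], of I d s s2 0 "Suc i"]
          unfolding Q1_def by simp
      qed
    qed
    have W2: "does (While ?b ?B2) ?q2 I s' (Q2 (bnd I))" if Q0: "Q2 0 s'" for s'
    proof (rule does_While[where Q=Q2, OF _ _ Q0])
      fix i s1 assume Q1: "Q2 i s1"
      then have r1: "rep (Suc 0) I (a' i) (\<rho>(0 := i)) s1" by (simp add: Q2_def)
      show "bval ?b s1 = (i < bnd I)" using b[OF r1] .
      assume i: "i < bnd I"
      show "does ?B2 (1 + 1) I s1 (Q2 (Suc i))"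
      proof (rule does_Seq)
        have v: "nval (NMem (varA 0)) s1 = i" using rep_read(1)[OF r1, of 0] by simp
        have ad: "nval (arrA j (NMem (varA 0))) s1 = aad I j i" using rep_addr(3)[OF r1] v by simp
        have vl: "nval (NMem (arrA 15 (NMem (varA 0)))) s1 = F I a i" using rep_addr(3)[OF r1] v Q1 i by (simp add: Q2_def)
        have eq: "(a' i)(j := (a' i j)(i := F I a i)) = a' (Suc i)" by (auto simp: a'_def less_Suc_eq fun_eq_iff)
        show "does (NStore (arrA j (NMem (varA 0))) (NMem (arrA 15 (NMem (varA 0))))) 1 I s1
            (\<lambda>s'. rep (Suc 0) I (a' (Suc i)) (\<rho>(0 := i)) s' \<and> sameP I d s s' \<and> (\<forall>k<bnd I. fst s' (aad I 15 k) = F I a k))"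
          apply (intro does_setn[OF ad vl])
          using Q1 j rep_setn_arr[OF r1 j, of i "F I a i"] sameP_trans[OF _ sameP_setn_arr, of I d s s1 j i "F I a i"]
          by (auto simp: Q2_def aad_eq eq)
      next
        fix s2 assume 2: "rep (Suc 0) I (a' (Suc i)) (\<rho>(0 := i)) s2 \<and> sameP I d s s2 \<and> (\<forall>k<bnd I. fst s2 (aad I 15 k) = F I a k)"
        then have r2: "rep (Suc 0) I (a' (Suc i)) (\<rho>(0 := i)) s2" by blast
        have nv: "nval (NAdd (NMem (varA 0)) (NConst 1)) s2 = Suc i" using rep_read(1)[OF r2, of 0] by simp
        show "does (NStore (varA 0) (NAdd (NMem (varA 0)) (NConst 1))) 1 I s2 (Q2 (Suc i))"
          apply (rule does_setn[OF rep_addr(1)[OF r2] nv])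
          using 2 rep_setn_var'[OF r2, of 0 "Suc i"] sameP_trans[OF _ same_sameP[OF same_setn_var], of I d s s2 0 "Suc i"]
          unfolding Q2_def by simp
      qed
    qed
    have a0: "a' 0 = a" by (simp add: a'_def)
    have S1: "does ?I 1 I s (Q1 0)"
      apply (rule does_setn[OF rep_addr(1)[OF r] refl])
      using rep_setn_var[OF r, of 0] same_sameP[OF same_setn_var, of I d s 0 0] unfolding Q1_def by simp
    have S2: "does ?I 1 I s2 (Q2 0)" if Q: "Q1 (bnd I) s2" for s2
    proof -
      have r2: "rep (Suc 0) I a (\<rho>(0 := bnd I)) s2" using Q by (simp add: Q1_def)
      show ?thesis
        apply (rule does_setn[OF rep_addr(1)[OF r2] refl])
        using Q rep_setn_var'[OF r2, of 0 0] sameP_trans[OF _ same_sameP[OF same_setn_var], of I d s s2 0 0]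
        unfolding Q2_def Q1_def a0 by simp
    qed
    have u: "a' (bnd I) = upd j F I a" by (simp add: a'_def upd_def)
    show ?thesis
      by (rule does_Seq[OF S1], rule does_Seq[OF W1], assumption, rule does_Seq[OF S2], assumption, rule does_mono[OF W2], assumption)
        (auto simp: Q2_def u intro: rep_drop)
  qed
  then show "\<exists>c q. \<forall>I a \<rho> s. rep 0 I a \<rho> s \<longrightarrow> does c q I s (\<lambda>s'. rep 0 I (upd j F I a) \<rho> s' \<and> sameP I d s s')" by blast
qed

text \<open>Products by repeated addition. Cell 1 counts down from \<open>n\<close> while
  \<open>3 * n\<close> is added to cell 2, which initially holds the genus; adding
  \<open>3 + n\<close> completes \<open>base I\<close>. Cell 1 must then become
  \<open>bnd I\<close>, so the second loop counts in the cell at address \<open>base I\<close>,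
  which ends at 0.\<close>

definition boot_code :: com where
  "boot_code =
    (let n = NMem (NConst 0); m1 = NMem (NConst 1); m2 = NMem (NConst 2); n3 = NAdd n (NAdd n n)
     in Seq (NStore (NConst 1) n)
       (Seq (While (NLess (NConst 0) m1) (Seq (NStore (NConst 2) (NAdd m2 n3)) (NStore (NConst 1) (NSub m1 (NConst 1)))))
       (Seq (NStore (NConst 2) (NAdd m2 (NAdd (NConst 3) n)))
       (Seq (NStore m2 n)
       (Seq (NStore (NConst 1) (NAdd (NConst 3) n))
            (While (NLess (NConst 0) (NMem m2)) (Seq (NStore (NConst 1) (NAdd m1 n3)) (NStore m2 (NSub (NMem m2) (NConst 1))))))))))"

lemma startup:
  assumes z: "\<And>i. bnd I \<le> i \<Longrightarrow> fst I i = 0"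
  shows "does boot_code (1 + ((1 + [:0, 1:] * (1 + (1 + 1))) + (1 + (1 + (1 + (1 + [:0, 1:] * (1 + (1 + 1)))))))) I I
    (rep 0 I (\<lambda>_ _. 0) \<rho>)"
proof -
  define n where "n = fst I 0"
  have b3: "bnd I = 3 + n + 3 * n * n" "base I = fst I 2 + (3 + n + 3 * n * n)" by (auto simp: base_def bnd_def n_def)
  have n: "poly [:0, 1:] (fst I 0) = n" by (simp add: n_def)
  define Q where "Q i s \<longleftrightarrow> fst s 1 = n - i \<and> fst s 2 = fst I 2 + 3 * n * i \<and> (\<forall>k. k \<noteq> 1 \<and> k \<noteq> 2 \<longrightarrow> fst s k = fst I k) \<and> snd s = snd I" for i s
  define R where "R i s \<longleftrightarrow> fst s 1 = 3 + n + 3 * n * i \<and> fst s 2 = base I \<and> fst s (base I) = n - i \<and> (\<forall>k. k \<noteq> 1 \<and> k \<noteq> 2 \<and> k \<noteq> base I \<longrightarrow> fst s k = fst I k) \<and> snd s = snd I" for i s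
  have bb: "base I \<noteq> 0" "base I \<noteq> Suc 0" "base I \<noteq> 2" "base I > 2" using base_ge[of I] by auto
  show ?thesis unfolding boot_code_def Let_def
  proof (rule does_Seq[where Q="Q 0"])
    show "does (NStore (NConst 1) (NMem (NConst 0))) 1 I I (Q 0)"
      by (rule does_setn[OF refl refl]) (auto simp: Q_def n_def)
    fix s assume Q0: "Q 0 s"
    show "does (Seq (While (NLess (NConst 0) (NMem (NConst 1))) (Seq (NStore (NConst 2) (NAdd (NMem (NConst 2)) (NAdd (NMem (NConst 0)) (NAdd (NMem (NConst 0)) (NMem (NConst 0)))))) (NStore (NConst 1) (NSub (NMem (NConst 1)) (NConst 1)))))
       (Seq (NStore (NConst 2) (NAdd (NMem (NConst 2)) (NAdd (NConst 3) (NMem (NConst 0)))))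
       (Seq (NStore (NMem (NConst 2)) (NMem (NConst 0)))
       (Seq (NStore (NConst 1) (NAdd (NConst 3) (NMem (NConst 0))))
            (While (NLess (NConst 0) (NMem (NMem (NConst 2)))) (Seq (NStore (NConst 1) (NAdd (NMem (NConst 1)) (NAdd (NMem (NConst 0)) (NAdd (NMem (NConst 0)) (NMem (NConst 0)))))) (NStore (NMem (NConst 2)) (NSub (NMem (NMem (NConst 2))) (NConst 1)))))))))
      ((1 + [:0, 1:] * (1 + (1 + 1))) + (1 + (1 + (1 + (1 + [:0, 1:] * (1 + (1 + 1))))))) I s (rep 0 I (\<lambda>_ _. 0) \<rho>)"
    proof (rule does_Seq[where Q="Q n"])
      show "does (While (NLess (NConst 0) (NMem (NConst 1))) (Seq (NStore (NConst 2) (NAdd (NMem (NConst 2)) (NAdd (NMem (NConst 0)) (NAdd (NMem (NConst 0)) (NMem (NConst 0)))))) (NStore (NConst 1) (NSub (NMem (NConst 1)) (NConst 1)))))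
        (1 + [:0, 1:] * (1 + (1 + 1))) I s (Q n)"
      proof (rule does_While_iter[where Q=Q, OF _ _ Q0 n])
        fix i s assume Qi: "Q i s"
        show "bval (NLess (NConst 0) (NMem (NConst 1))) s = (i < n)" using Qi by (auto simp: Q_def)
        show "does (Seq (NStore (NConst 2) (NAdd (NMem (NConst 2)) (NAdd (NMem (NConst 0)) (NAdd (NMem (NConst 0)) (NMem (NConst 0)))))) (NStore (NConst 1) (NSub (NMem (NConst 1)) (NConst 1)))) (1+1) I s (Q (Suc i))"
        proof (rule does_Seq)
          show "does (NStore (NConst 2) (NAdd (NMem (NConst 2)) (NAdd (NMem (NConst 0)) (NAdd (NMem (NConst 0)) (NMem (NConst 0)))))) 1 I s (\<lambda>s'. s' = setn 2 (fst s 2 + (fst s 0 + (fst s 0 + fst s 0))) s)"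
            by (rule does_setn[OF refl refl]) simp
          fix s' assume "s' = setn 2 (fst s 2 + (fst s 0 + (fst s 0 + fst s 0))) s"
          then show "does (NStore (NConst 1) (NSub (NMem (NConst 1)) (NConst 1))) 1 I s' (Q (Suc i))"
            by (intro does_setn[OF refl refl]) (use Qi in \<open>auto simp: Q_def n_def\<close>)
        qed
      qed
      fix s assume Qn: "Q n s"
      show "does (Seq (NStore (NConst 2) (NAdd (NMem (NConst 2)) (NAdd (NConst 3) (NMem (NConst 0)))))
       (Seq (NStore (NMem (NConst 2)) (NMem (NConst 0)))
       (Seq (NStore (NConst 1) (NAdd (NConst 3) (NMem (NConst 0))))
            (While (NLess (NConst 0) (NMem (NMem (NConst 2)))) (Seq (NStore (NConst 1) (NAdd (NMem (NConst 1)) (NAdd (NMem (NConst 0)) (NAdd (NMem (NConst 0)) (NMem (NConst 0)))))) (NStore (NMem (NConst 2)) (NSub (NMem (NMem (NConst 2))) (NConst 1))))))))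
        (1 + (1 + (1 + (1 + [:0, 1:] * (1 + (1 + 1)))))) I s (rep 0 I (\<lambda>_ _. 0) \<rho>)"
      proof (rule does_Seq[where Q="\<lambda>s'. s' = setn 2 (base I) s"], goal_cases)
        case 1
        have "nval (NAdd (NMem (NConst 2)) (NAdd (NConst 3) (NMem (NConst 0)))) s = base I"
          using Qn by (simp add: Q_def b3 n_def)
        then show ?case by (intro does_setn) simp_all
      next
        case (2 s1)
        show ?case
        proof (rule does_Seq[where Q="\<lambda>s'. s' = setn (base I) n (setn 2 (base I) s)"], goal_cases)
          case 1
          have "nval (NMem (NConst 0)) s1 = n" using Qn 2 by (simp add: Q_def n_def)
          then show ?case using 2 by (intro does_setn) simp_all
        next
          case (2 s2)
          have "R 0 (setn 1 (3 + n) s2)" using Qn bb 2 by (auto simp: Q_def R_def n_def)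
          moreover have "nval (NAdd (NConst 3) (NMem (NConst 0))) s2 = 3 + n" using Qn 2 bb by (auto simp: Q_def n_def)
          ultimately have "does (NStore (NConst 1) (NAdd (NConst 3) (NMem (NConst 0)))) 1 I s2 (R 0)" by (intro does_setn) simp_all
          then show ?case
          proof (rule does_Seq)
        fix s assume R0: "R 0 s"
        have "does (While (NLess (NConst 0) (NMem (NMem (NConst 2)))) (Seq (NStore (NConst 1) (NAdd (NMem (NConst 1)) (NAdd (NMem (NConst 0)) (NAdd (NMem (NConst 0)) (NMem (NConst 0)))))) (NStore (NMem (NConst 2)) (NSub (NMem (NMem (NConst 2))) (NConst 1)))))
           (1 + [:0, 1:] * (1 + (1 + 1))) I s (R n)"
        proof (rule does_While_iter[where Q=R, OF _ _ R0 n])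
          fix i s assume Ri: "R i s"
          show "bval (NLess (NConst 0) (NMem (NMem (NConst 2)))) s = (i < n)" using Ri by (auto simp: R_def)
          show "does (Seq (NStore (NConst 1) (NAdd (NMem (NConst 1)) (NAdd (NMem (NConst 0)) (NAdd (NMem (NConst 0)) (NMem (NConst 0)))))) (NStore (NMem (NConst 2)) (NSub (NMem (NMem (NConst 2))) (NConst 1)))) (1+1) I s (R (Suc i))"
          proof (rule does_Seq)
            show "does (NStore (NConst 1) (NAdd (NMem (NConst 1)) (NAdd (NMem (NConst 0)) (NAdd (NMem (NConst 0)) (NMem (NConst 0)))))) 1 I s (\<lambda>s'. s' = setn 1 (fst s 1 + (fst s 0 + (fst s 0 + fst s 0))) s)"
              by (rule does_setn[OF refl refl]) simp
            fix s' assume "s' = setn 1 (fst s 1 + (fst s 0 + (fst s 0 + fst s 0))) s"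
            then show "does (NStore (NMem (NConst 2)) (NSub (NMem (NMem (NConst 2))) (NConst 1))) 1 I s' (R (Suc i))"
              by (intro does_setn[OF refl refl]) (use Ri bb in \<open>auto simp: R_def n_def\<close>)
          qed
        qed
        then have "does (While (NLess (NConst 0) (NMem (NMem (NConst 2)))) (Seq (NStore (NConst 1) (NAdd (NMem (NConst 1)) (NAdd (NMem (NConst 0)) (NAdd (NMem (NConst 0)) (NMem (NConst 0)))))) (NStore (NMem (NConst 2)) (NSub (NMem (NMem (NConst 2))) (NConst 1)))))
           (1 + [:0, 1:] * (1 + (1 + 1))) I s (rep 0 I (\<lambda>_ _. 0) \<rho>)"
        proof (rule does_mono)
          fix s' assume R: "R n s'"
          have "fst s' (aad I j i) = 0" for i j
          proof -
            have "aad I j i \<noteq> base I" "bnd I \<le> aad I j i" using base_ge[of I] by (auto simp: aad_def)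
            then show ?thesis using R z[of "aad I j i"] by (auto simp: R_def)
          qed
          then show "rep 0 I (\<lambda>_ _. 0) \<rho> s'" using R base_ge[of I] bb by (auto simp: rep_def R_def b3 n_def)
        qed
        then show "does (While (NLess (NConst 0) (NMem (NMem (NConst 2)))) (Seq (NStore (NConst 1) (NAdd (NMem (NConst 1)) (NAdd (NMem (NConst 0)) (NAdd (NMem (NConst 0)) (NMem (NConst 0)))))) (NStore (NMem (NConst 2)) (NSub (NMem (NMem (NConst 2))) (NConst 1)))))
           (1 + [:0, 1:] * (1 + (1 + 1))) I s (rep 0 I (\<lambda>_ _. 0) \<rho>)" .
          qed
        qed
      qed
    qed
  qed
qed

text \<open>The first three cells are written after the loop, and cell 2 last of all, because cell 1
  is the loop bound and cell 2 the base of every array address.\<close>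

definition out_code :: com where
  "out_code = Seq (NStore (varA 0) (NConst 3))
     (Seq (While (NLess (NMem (varA 0)) (NMem (NConst (Suc 0))))
        (Seq (NStore (NMem (varA 0)) (NMem (arrA 3 (NMem (varA 0))))) (NStore (varA 0) (NAdd (NMem (varA 0)) (NConst 1)))))
     (Seq (NStore (NConst 0) (NMem (arrA 3 (NConst 0))))
     (Seq (NStore (NConst 1) (NMem (arrA 3 (NConst 1))))
          (NStore (NConst 2) (NMem (arrA 3 (NConst 2)))))))"

lemma copy_output:
  assumes r: "rep 0 I a \<rho> s"
  shows "does out_code (1 + ((1 + [:0, 1, 3:] * (1 + (1 + 1))) + (1 + (1 + 1)))) I s (\<lambda>s'. \<forall>i<bnd I. fst s' i = a 3 i)"
proof -
  define N where "N = bnd I - 3"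
  have N: "poly [:0, 1, 3:] (fst I 0) = N" "N + 3 = bnd I" by (simp_all add: N_def bnd_def algebra_simps)
  define Q where "Q i s \<longleftrightarrow> fst s 1 = bnd I \<and> fst s 2 = base I \<and> fst s (vad I 0) = i + 3 \<and> (\<forall>k. fst s (aad I 3 k) = a 3 k) \<and> (\<forall>k. 3 \<le> k \<and> k < i + 3 \<longrightarrow> fst s k = a 3 k)" for i and s :: state
  have ad: "nval (varA 0) s = vad I 0" "nval (arrA 3 e) s = aad I 3 (nval e s)" if "Q i s" for i s e
    using that by (auto simp: Q_def varA_def arrA_def vad_def aad_def)
  have ne: "k \<noteq> vad I 0" "k \<noteq> aad I j i" if "k < bnd I" for k i j
    using that base_ge[of I] by (auto simp: vad_def aad_def)
  show ?thesis unfolding out_code_def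
  proof (rule does_Seq[where Q="Q 0"])
    show "does (NStore (varA 0) (NConst 3)) 1 I s (Q 0)"
      by (rule does_setn[OF rep_addr(1)[OF r] refl]) (use r in \<open>auto simp: rep_def Q_def eq_commute[of _ "vad I 0"]\<close>)
    fix s assume Q0: "Q 0 s"
    show "does (Seq (While (NLess (NMem (varA 0)) (NMem (NConst (Suc 0))))
        (Seq (NStore (NMem (varA 0)) (NMem (arrA 3 (NMem (varA 0))))) (NStore (varA 0) (NAdd (NMem (varA 0)) (NConst 1)))))
     (Seq (NStore (NConst 0) (NMem (arrA 3 (NConst 0))))
     (Seq (NStore (NConst 1) (NMem (arrA 3 (NConst 1))))
          (NStore (NConst 2) (NMem (arrA 3 (NConst 2)))))))
       ((1 + [:0, 1, 3:] * (1 + (1 + 1))) + (1 + (1 + 1))) I s (\<lambda>s'. \<forall>i<bnd I. fst s' i = a 3 i)"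
    proof (rule does_Seq[where Q="Q N"])
      show "does (While (NLess (NMem (varA 0)) (NMem (NConst (Suc 0))))
        (Seq (NStore (NMem (varA 0)) (NMem (arrA 3 (NMem (varA 0))))) (NStore (varA 0) (NAdd (NMem (varA 0)) (NConst 1))))) (1 + [:0, 1, 3:] * (1 + (1 + 1))) I s (Q N)"
      proof (rule does_While_iter[where Q=Q, OF _ _ Q0 N(1)])
        fix i s assume Qi: "Q i s"
        show "bval (NLess (NMem (varA 0)) (NMem (NConst (Suc 0)))) s = (i < N)"
          using Qi N(2) by (simp add: ad[OF Qi]) (auto simp: Q_def)
        assume i: "i < N"
        define s1 where "s1 = setn (i + 3) (a 3 (i + 3)) s"
        have ib: "i + 3 < bnd I" using i N by simp
        have Q1: "fst s1 1 = bnd I \<and> fst s1 2 = base I \<and> fst s1 (vad I 0) = i + 3 \<and> (\<forall>k. fst s1 (aad I 3 k) = a 3 k) \<and> (\<forall>k. 3 \<le> k \<and> k < Suc i + 3 \<longrightarrow> fst s1 k = a 3 k)"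
          using Qi ne[OF ib] unfolding s1_def Q_def by (auto simp: less_Suc_eq dest!: sym[of _ "i+3"])
        then have ad1: "nval (varA 0) s1 = vad I 0" by (auto simp: varA_def vad_def)
        have ne': "\<forall>k. k < Suc i + 3 \<longrightarrow> k \<noteq> vad I 0" using ne(1) ib by auto
        show "does (Seq (NStore (NMem (varA 0)) (NMem (arrA 3 (NMem (varA 0))))) (NStore (varA 0) (NAdd (NMem (varA 0)) (NConst 1)))) (1 + 1) I s (Q (Suc i))"
          by (rule does_Seq[OF does_setn[where Q="\<lambda>s'. s' = s1"]], rule refl, rule refl, use Qi in \<open>simp add: ad[OF Qi] s1_def, simp add: Q_def\<close>,
              rule does_setn[OF refl refl]) (use Q1 ne' in \<open>auto simp: Q_def ad1 eq_commute[of _ "vad I 0"]\<close>)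
      qed
      fix s assume Qn: "Q N s"
      have ar: "fst s (aad I 3 k) = a 3 k" "fst s 2 = base I" for k using Qn by (auto simp: Q_def)
      have fin: "fst (setn 2 (a 3 2) (setn 1 (a 3 1) (setn 0 (a 3 0) s))) i = a 3 i" if "i < bnd I" for i
      proof (cases "i \<ge> 3")
        case True
        then show ?thesis using Qn that N by (auto simp: Q_def)
      next
        case False
        then have "i = 0 \<or> i = 1 \<or> i = 2" by auto
        then show ?thesis by auto
      qed
      have e: "nval (arrA 3 (NConst k)) s' = aad I 3 k" if "fst s' 2 = base I" for k s' using that by (simp add: arrA_def aad_def)
      show "does (Seq (NStore (NConst 0) (NMem (arrA 3 (NConst 0)))) (Seq (NStore (NConst 1) (NMem (arrA 3 (NConst 1)))) (NStore (NConst 2) (NMem (arrA 3 (NConst 2)))))) (1 + (1 + 1)) I s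
        (\<lambda>s'. \<forall>i<bnd I. fst s' i = a 3 i)"
        by (rule does_Seq[OF does_setn[where Q="\<lambda>s'. s' = setn 0 (a 3 0) s"]], rule refl, rule refl, simp add: e ar,
            rule does_Seq[OF does_setn[where Q="\<lambda>s'. s' = setn 1 (a 3 1) (setn 0 (a 3 0) s)"]], rule refl, rule refl, simp add: e ar,
            rule does_setn[OF refl, where x="a 3 2"])
          (use fin in \<open>simp_all add: e ar\<close>)
    qed
  qed
qed

lemma implP_program:
  assumes "implP f"
  shows "\<exists>P p. \<forall>I. (\<forall>i\<ge>bnd I. fst I i = 0) \<longrightarrow>
    (\<exists>t s. exec P I t s \<and> t \<le> poly p (fst I 0) \<and> (\<forall>i<bnd I. fst s i = f I (\<lambda>_ _. 0) 3 i))"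
proof -
  obtain c q where c: "\<And>I a \<rho> s. rep 0 I a \<rho> s \<Longrightarrow> does c q I s (\<lambda>s'. rep 0 I (f I a) \<rho> s' \<and> sameP I 0 s s')"
    by (rule implPE[OF assms, where d="0"], rule that)
  obtain q0 q1 where q0: "\<And>I \<rho>. (\<And>i. bnd I \<le> i \<Longrightarrow> fst I i = 0) \<Longrightarrow> does boot_code q0 I I (rep 0 I (\<lambda>_ _. 0) \<rho>)"
    and q1: "\<And>I \<rho> a s. rep 0 I a \<rho> s \<Longrightarrow> does out_code q1 I s (\<lambda>s'. \<forall>i<bnd I. fst s' i = a 3 i)"
    using startup copy_output that by blast
  have "does (Seq boot_code (Seq c out_code)) (q0 + (q + q1)) I I (\<lambda>s'. \<forall>i<bnd I. fst s' i = f I (\<lambda>_ _. 0) 3 i)"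
    if "\<forall>i\<ge>bnd I. fst I i = 0" for I
    by (rule does_Seq[OF q0], use that in blast, rule does_Seq[OF c], assumption, rule q1) blast
  then show ?thesis unfolding does_def by blast
qed

subsection \<open>Sides of edges and parity\<close>

text \<open>
  Edges are numbers below \<open>N\<close>; the two sides of the edge \<open>e\<close> are \<open>e\<close> and \<open>e + N\<close>.  A map \<open>F\<close> assigns
  to every side its class, which initially is the face on that side.  The set \<open>oc N F X\<close> is the
  boundary modulo 2 of \<open>X\<close> as a set of edges of the dual graph.
\<close>

definition ed :: "nat \<Rightarrow> nat \<Rightarrow> nat" where "ed N s = (if s < N then s else s - N)"
definition op :: "nat \<Rightarrow> nat \<Rightarrow> nat" where "op N s = (if s < N then s + N else s - N)"

definition pc :: "nat \<Rightarrow> (nat \<Rightarrow> nat) \<Rightarrow> nat set \<Rightarrow> nat \<Rightarrow> nat" where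
  "pc N F X c = (\<Sum>e\<in>X. of_bool (F e = c) + of_bool (F (e + N) = c))"

definition oc :: "nat \<Rightarrow> (nat \<Rightarrow> nat) \<Rightarrow> nat set \<Rightarrow> nat set" where
  "oc N F X = {c. odd (pc N F X c)}"

lemma pc_union: "finite X \<Longrightarrow> finite Y \<Longrightarrow> X \<inter> Y = {} \<Longrightarrow> pc N F (X \<union> Y) c = pc N F X c + pc N F Y c"
  unfolding pc_def by (rule sum.union_disjoint)

lemma pc_mono: "finite Y \<Longrightarrow> X \<subseteq> Y \<Longrightarrow> pc N F X c \<le> pc N F Y c"
  unfolding pc_def by (rule sum_mono2) auto

lemma pc_empty[simp]: "pc N F {} c = 0" by (simp add: pc_def)

lemma finite_oc[simp]: assumes "finite X" shows "finite (oc N F X)"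
proof -
  have "oc N F X \<subseteq> F ` X \<union> (\<lambda>e. F (e + N)) ` X"
  proof
    fix c assume "c \<in> oc N F X"
    then have "pc N F X c \<noteq> 0" by (auto simp: oc_def intro: odd_pos)
    then obtain e where "e \<in> X" "of_bool (F e = c) + of_bool (F (e + N) = c) \<noteq> (0::nat)"
      unfolding pc_def by (meson sum.not_neutral_contains_not_neutral)
    then show "c \<in> F ` X \<union> (\<lambda>e. F (e + N)) ` X" by (auto split: if_splits)
  qed
  then show ?thesis using assms finite_subset by blast
qed

text \<open>Edges of the intersection are counted twice, so taking boundaries is linear over the
  field with two elements.\<close>

lemma oc_symdiff: assumes "finite X" "finite Y"
  shows "oc N F (sym_diff X Y) = sym_diff (oc N F X) (oc N F Y)"
proof -
  have "odd (pc N F (sym_diff X Y) c) \<longleftrightarrow> (odd (pc N F X c) \<noteq> odd (pc N F Y c))" for c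
  proof -
    have 1: "pc N F X c = pc N F (X - Y) c + pc N F (X \<inter> Y) c"
      using pc_union[of "X - Y" "X \<inter> Y" N F c] assms by (simp add: Un_Diff_Int Diff_Int_distrib2 Int_Diff disjoint_iff)
    have 2: "pc N F Y c = pc N F (Y - X) c + pc N F (X \<inter> Y) c"
      using pc_union[of "Y - X" "Y \<inter> X" N F c] assms by (simp add: Un_Diff_Int Int_commute[of X Y] disjoint_iff)
    have 3: "pc N F (sym_diff X Y) c = pc N F (X - Y) c + pc N F (Y - X) c"
      by (rule pc_union) (use assms in auto)
    show ?thesis unfolding 1 2 3 by auto
  qed
  then show ?thesis by (auto simp: oc_def)
qed

lemma oc_empty[simp]: "oc N F {} = {}" by (simp add: oc_def)

lemma oc_single: "oc N F {e} = sym_diff {F e} {F (e + N)}"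
  by (auto simp: oc_def pc_def split: if_splits)

lemma oc_insert: assumes "finite X" "e \<notin> X" shows "oc N F (insert e X) = sym_diff (oc N F X) (sym_diff {F e} {F (e + N)})"
proof -
  have "insert e X = sym_diff X {e}" using assms(2) by auto
  then show ?thesis using oc_symdiff[of X "{e}" N F] assms(1) oc_single[of N F e] by simp
qed

lemma oc_remove: assumes "finite X" "e \<in> X" shows "oc N F (X - {e}) = sym_diff (oc N F X) (sym_diff {F e} {F (e + N)})"
proof -
  have "X - {e} = sym_diff X {e}" using assms(2) by auto
  then show ?thesis using oc_symdiff[of X "{e}" N F] assms(1) oc_single[of N F e] by simp
qed

definition mrg :: "nat \<Rightarrow> nat \<Rightarrow> (nat \<Rightarrow> nat) \<Rightarrow> nat \<Rightarrow> nat" where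
  "mrg a b F = (\<lambda>s. if F s = b then a else F s)"

lemma pc_mrg: "finite X \<Longrightarrow> a \<noteq> b \<Longrightarrow> pc N (mrg a b F) X c =
   (if c = b then 0 else if c = a then pc N F X a + pc N F X b else pc N F X c)"
  unfolding pc_def mrg_def by (auto simp: sum.distrib[symmetric] intro!: sum.cong)

lemma mrg_same: "mrg a a F = F" by (auto simp: mrg_def)

lemma oc_mrg: "finite X \<Longrightarrow> a \<noteq> b \<Longrightarrow> oc N (mrg a b F) X =
   oc N F X - {a, b} \<union> (if (a \<in> oc N F X) \<noteq> (b \<in> oc N F X) then {a} else {})"
  unfolding oc_def by (auto simp: pc_mrg split: if_splits)

text \<open>Deleting \<open>e\<close> and identifying the classes of its sides contracts a dual
  edge. If the classes differ, removing \<open>e\<close> flips both parities or neither, so only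
  their sum matters: the new class is odd iff exactly one of the old ones was.\<close>

lemma oc_free_card:
  assumes S: "finite S"
  shows "card (oc N (mrg (F e) (F (e + N)) F) (S - {e})) \<le> card (oc N F S)"
proof (cases "F e = F (e + N)")
  case True
  have "oc N F (S - {e}) = oc N F S" by (cases "e \<in> S") (use True S in \<open>auto simp: oc_remove\<close>)
  then show ?thesis using True by (simp add: mrg_same)
next
  case False
  let ?a = "F e" and ?b = "F (e + N)"
  have 1: "oc N (mrg ?a ?b F) (S - {e}) = oc N F S - {?a, ?b} \<union> (if (?a \<in> oc N F S) \<noteq> (?b \<in> oc N F S) then {?a} else {})"
  proof (cases "e \<in> S")
    case True
    then show ?thesis using False S by (subst oc_mrg) (auto simp: oc_remove split: if_splits)
  qed (use False S in \<open>simp add: oc_mrg\<close>)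
  show ?thesis
  proof (cases "(?a \<in> oc N F S) \<noteq> (?b \<in> oc N F S)")
    case True
    then obtain x where x: "x \<in> oc N F S" "x \<in> {?a, ?b}" by auto
    have "card (oc N (mrg ?a ?b F) (S - {e})) \<le> card (oc N F S - {x}) + 1"
    proof -
      have "oc N (mrg ?a ?b F) (S - {e}) \<subseteq> insert ?a (oc N F S - {x})" using 1 True x by auto
      then have "card (oc N (mrg ?a ?b F) (S - {e})) \<le> card (insert ?a (oc N F S - {x}))" using S by (intro card_mono) auto
      then show ?thesis using card_insert_le_m1[of "Suc (card (oc N F S - {x}))" "oc N F S - {x}" ?a] by simp
    qed
    also have "\<dots> = card (oc N F S)" using x S by (metis Suc_eq_plus1 card_Suc_Diff1 finite_oc)
    finally show ?thesis .
  next
    case False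
    then have "oc N (mrg ?a ?b F) (S - {e}) \<subseteq> oc N F S" using 1 by auto
    then show ?thesis using S by (intro card_mono) auto
  qed
qed

text \<open>Cycles of the contracted dual graph lift: either \<open>X\<close> was already a cycle,
  or the contracted edge \<open>e\<close> closes it.\<close>

lemma oc_free_ext:
  assumes X: "finite X" "e \<notin> X" and o: "oc N (mrg (F e) (F (e + N)) F) X = {}"
  shows "oc N F X = {} \<or> oc N F (insert e X) = {}"
proof (cases "F e = F (e + N)")
  case True then show ?thesis using o by (simp add: mrg_same)
next
  case False
  from o[unfolded oc_mrg[OF X(1) False]] have
    1: "oc N F X \<subseteq> {F e, F (e + N)}" "F e \<in> oc N F X \<longleftrightarrow> F (e + N) \<in> oc N F X"
    by (auto split: if_splits)
  show ?thesis
  proof (cases "F e \<in> oc N F X")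
    case True
    then show ?thesis using 1 False by (auto simp: oc_insert[OF X])
  qed (use 1 in auto)
qed

subsection \<open>Threads\<close>

text \<open>A walk in the dual graph. It enters an edge at the side \<open>op N (ss ! i)\<close> and
  leaves it at \<open>ss ! i\<close>, into a class with exactly two alive sides, so that the next
  edge is forced.\<close>

definition thread :: "nat \<Rightarrow> (nat \<Rightarrow> nat) \<Rightarrow> nat set \<Rightarrow> nat list \<Rightarrow> bool" where
  "thread N F Al ss \<longleftrightarrow> ss \<noteq> [] \<and> distinct (map (ed N) ss) \<and> (\<forall>s\<in>set ss. ed N s \<in> Al) \<and>
     (\<forall>i. Suc i < length ss \<longrightarrow> F (ss ! i) = F (op N (ss ! Suc i)) \<and> pc N F Al (F (ss ! i)) = 2)"

definition chn :: "(nat \<Rightarrow> bool) \<Rightarrow> nat \<Rightarrow> nat \<Rightarrow> nat" where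
  "chn \<chi> a b = card {i. a \<le> i \<and> i < b \<and> \<chi> i \<noteq> \<chi> (Suc i)}"

lemma chn_add: assumes "a \<le> b" "b \<le> c" shows "chn \<chi> a c = chn \<chi> a b + chn \<chi> b c"
proof -
  have "{i. a \<le> i \<and> i < c \<and> \<chi> i \<noteq> \<chi> (Suc i)} = {i. a \<le> i \<and> i < b \<and> \<chi> i \<noteq> \<chi> (Suc i)} \<union> {i. b \<le> i \<and> i < c \<and> \<chi> i \<noteq> \<chi> (Suc i)}"
    using assms by auto
  then show ?thesis unfolding chn_def by (simp add: card_Un_disjoint disjoint_iff)
qed

lemma chn_ge: assumes "a \<le> b" "\<chi> a \<noteq> \<chi> b" shows "1 \<le> chn \<chi> a b"
proof -
  have "\<exists>i. a \<le> i \<and> i < b \<and> \<chi> i \<noteq> \<chi> (Suc i)"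
  proof (rule ccontr)
    assume H: "\<not> ?thesis"
    have "a + k \<le> b \<Longrightarrow> \<chi> (a + k) = \<chi> a" for k
      by (induction k) (use H in auto)
    from this[of "b - a"] show False using assms by simp
  qed
  then show ?thesis unfolding chn_def by (simp add: Suc_le_eq card_gt_0_iff) blast
qed

text \<open>An inner class of the walk contains one side of each of two consecutive edges and no
  other alive side. Hence it is odd exactly where membership in \<open>S\<close> changes, and it is
  empty once \<open>P\<close> is removed. Only the outer classes at the two ends can become
  odd.\<close>

lemma thread_potential:
  assumes T: "thread N F Al ss" and Al: "finite Al" "Al \<subseteq> {..<N}" and S: "S \<subseteq> Al"
    and k: "length ss = Suc k" and P: "P = ed N ` set ss"
  defines "\<chi> \<equiv> \<lambda>i. ed N (ss ! i) \<in> S"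
  shows "card (oc N F (S - P)) + chn \<chi> 0 k \<le> card (oc N F S) + of_bool (\<chi> 0) + of_bool (\<chi> k)"
proof -
  let ?e = "\<lambda>i. ed N (ss ! i)" and ?c = "\<lambda>i. F (ss ! i)"
  have fS: "finite S" using S Al finite_subset by blast
  have dist: "?e i = ?e j \<Longrightarrow> i \<le> k \<Longrightarrow> j \<le> k \<Longrightarrow> i = j" for i j
    using T k by (auto simp: thread_def distinct_conv_nth) (metis le_imp_less_Suc)
  have mem: "?e i \<in> Al" if "i \<le> k" for i using T k that by (auto simp: thread_def)
  have link: "?c i = F (op N (ss ! Suc i))" "pc N F Al (?c i) = 2" if "i < k" for i using T k that by (auto simp: thread_def)
  define g where "g c e = (of_bool (F e = c) + of_bool (F (e + N) = c) :: nat)" for c e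
  have gs: "g c (ed N s) = of_bool (F s = c) + of_bool (F (op N s) = c)" for c s
    by (auto simp: g_def ed_def op_def)
  have pcg: "pc N F X c = (\<Sum>e\<in>X. g c e)" for X c by (simp add: pc_def g_def)
  \<comment> \<open>Both consecutive edges contribute at least 1 to a total of 2, so each
    contributes exactly 1 and every other edge 0.\<close>
  have inner: "g (?c i) e = of_bool (e = ?e i) + of_bool (e = ?e (Suc i))" if i: "i < k" and e: "e \<in> Al" for i e
  proof -
    have ne: "?e i \<noteq> ?e (Suc i)" using dist[of i "Suc i"] i by auto
    have "pc N F Al (?c i) = g (?c i) (?e i) + (g (?c i) (?e (Suc i)) + (\<Sum>e\<in>Al - {?e i} - {?e (Suc i)}. g (?c i) e))"
      unfolding pcg using mem[of i] mem[of "Suc i"] i ne Al(1)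
      by (subst sum.remove[of Al "?e i"], simp_all, subst sum.remove[of "Al - {?e i}" "?e (Suc i)"], simp_all)
    moreover have "g (?c i) (?e i) \<ge> 1" "g (?c i) (?e (Suc i)) \<ge> 1" using link(1)[OF i] by (simp_all add: gs)
    ultimately have "g (?c i) (?e i) = 1" "g (?c i) (?e (Suc i)) = 1" "(\<Sum>e\<in>Al - {?e i} - {?e (Suc i)}. g (?c i) e) = 0"
      using link(2)[OF i] by linarith+
    then show ?thesis using e ne Al(1) by (cases "e = ?e i"; cases "e = ?e (Suc i)") auto
  qed
  have pin: "pc N F X (?c i) = of_bool (?e i \<in> X) + of_bool (?e (Suc i) \<in> X)" if i: "i < k" and X: "X \<subseteq> Al" for i X
  proof -
    have fX: "finite X" using X Al finite_subset by blast
    have "pc N F X (?c i) = (\<Sum>e\<in>X. of_bool (e = ?e i) + of_bool (e = ?e (Suc i)))"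
      unfolding pcg by (rule sum.cong) (use inner[OF i] X in auto)
    also have "\<dots> = of_bool (?e i \<in> X) + of_bool (?e (Suc i) \<in> X)"
      using fX by (simp add: sum.distrib of_bool_def)
    finally show ?thesis .
  qed
  have PAl: "P \<subseteq> Al" using T unfolding P thread_def by auto
  have Pm: "?e i \<in> P" if "i \<le> k" for i using that k unfolding P by auto
  define D where "D = {i. 0 \<le> i \<and> i < k \<and> \<chi> i \<noteq> \<chi> (Suc i)}"
  have Dodd: "?c ` D \<subseteq> oc N F S" using pin[OF _ S] by (auto simp: D_def oc_def \<chi>_def)
  \<comment> \<open>A class determines the edges it joins: for \<open>?c i = ?c j\<close> the edges
    at \<open>i\<close> and \<open>Suc i\<close> are among those at \<open>j\<close> and
    \<open>Suc j\<close>, and the edges of a walk are distinct.\<close>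
  have inj: "inj_on ?c {..<k}"
  proof (rule inj_onI)
    fix i j assume ij: "i \<in> {..<k}" "j \<in> {..<k}" "?c i = ?c j"
    have "g (?c i) (?e i) = 1" "g (?c i) (?e (Suc i)) = 1"
      using inner[of i] ij mem dist[of i "Suc i"] by auto
    then have g1: "g (?c j) (?e i) \<noteq> 0" "g (?c j) (?e (Suc i)) \<noteq> 0" using ij(3) by simp_all
    have g2: "?e i = ?e j \<or> ?e i = ?e (Suc j)"
    proof (rule ccontr)
      assume "\<not> ?thesis"
      moreover have "g (?c j) (?e i) = of_bool (?e i = ?e j) + of_bool (?e i = ?e (Suc j))"
        by (rule inner) (use ij mem[of i] in simp_all)
      ultimately show False using g1(1) by simp
    qed
    have g3: "?e (Suc i) = ?e j \<or> ?e (Suc i) = ?e (Suc j)"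
    proof (rule ccontr)
      assume "\<not> ?thesis"
      moreover have "g (?c j) (?e (Suc i)) = of_bool (?e (Suc i) = ?e j) + of_bool (?e (Suc i) = ?e (Suc j))"
        by (rule inner) (use ij mem[of "Suc i"] in simp_all)
      ultimately show False using g1(2) by simp
    qed
    from g2 have "i = j \<or> i = Suc j" using dist[of i j] dist[of i "Suc j"] ij by auto
    moreover from g3 have "Suc i = j \<or> i = j" using dist[of "Suc i" j] dist[of "Suc i" "Suc j"] ij by auto
    ultimately show "i = j" by auto
  qed
  have sub: "oc N F (S - P) \<subseteq> (oc N F S - ?c ` D) \<union> (if \<chi> 0 then {F (op N (ss ! 0))} else {}) \<union> (if \<chi> k then {?c k} else {})"
  proof
    fix c assume c: "c \<in> oc N F (S - P)"
    have ni: "c \<noteq> ?c i" if "i < k" for i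
    proof
      assume "c = ?c i"
      then have "pc N F (S - P) c = 0" using pin[OF that, of "S - P"] S Pm[of i] Pm[of "Suc i"] that by auto
      then show False using c by (simp add: oc_def)
    qed
    show "c \<in> (oc N F S - ?c ` D) \<union> (if \<chi> 0 then {F (op N (ss ! 0))} else {}) \<union> (if \<chi> k then {?c k} else {})"
    proof (cases "c \<in> oc N F S")
      case True
      then show ?thesis using ni by (auto simp: D_def)
    next
      case False
      have "pc N F S c = pc N F (S - P) c + pc N F (S \<inter> P) c"
        using pc_union[of "S - P" "S \<inter> P" N F c] fS by (simp add: Un_Diff_Int Int_Diff disjoint_iff)
      then have "pc N F (S \<inter> P) c \<noteq> 0" using False c by (auto simp: oc_def intro: odd_pos)
      then obtain e where e: "e \<in> S \<inter> P" "g c e \<noteq> 0" unfolding pcg by (meson sum.not_neutral_contains_not_neutral)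
      then obtain i where i: "i \<le> k" "e = ?e i" using k unfolding P by (auto simp: in_set_conv_nth less_Suc_eq_le)
      have "c = ?c i \<or> c = F (op N (ss ! i))" using e(2) unfolding i(2) gs by (auto split: if_splits)
      then show ?thesis
      proof
        assume "c = ?c i"
        then show ?thesis using ni[of i] i e by (cases "i = k") (auto simp: \<chi>_def)
      next
        assume a: "c = F (op N (ss ! i))"
        show ?thesis
        proof (cases i)
          case 0 then show ?thesis using a i e by (auto simp: \<chi>_def)
        next
          case (Suc j)
          then show ?thesis using a ni[of j] link(1)[of j] i by auto
        qed
      qed
    qed
  qed
  have "card (oc N F (S - P)) \<le> card ((oc N F S - ?c ` D) \<union> (if \<chi> 0 then {F (op N (ss ! 0))} else {}) \<union> (if \<chi> k then {?c k} else {}))"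
    by (rule card_mono[OF _ sub]) (use fS in auto)
  also have "\<dots> \<le> card (oc N F S - ?c ` D) + of_bool (\<chi> 0) + of_bool (\<chi> k)"
    by (intro order_trans[OF card_Un_le] add_mono) auto
  finally have "card (oc N F (S - P)) \<le> card (oc N F S - ?c ` D) + of_bool (\<chi> 0) + of_bool (\<chi> k)" .
  moreover have "card (oc N F S - ?c ` D) = card (oc N F S) - card (?c ` D)"
    by (rule card_Diff_subset) (use Dodd fS in \<open>auto simp: D_def\<close>)
  moreover have "card (?c ` D) \<le> card (oc N F S)" by (rule card_mono) (use Dodd fS in auto)
  moreover have "card (?c ` D) = chn \<chi> 0 k" unfolding chn_def D_def[symmetric]
    by (rule card_image) (rule inj_on_subset[OF inj], auto simp: D_def)
  ultimately show ?thesis by linarith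
qed

text \<open>Let the edge at \<open>j\<close> be in \<open>S\<close>. If one half of the walk lies in
  \<open>S\<close>, its weight \<open>h\<close>, taken four times, pays 2 for that edge and 2 for
  new odd classes at the ends. Otherwise membership changes on both sides of \<open>j\<close>, and
  the two odd classes that vanish pay for the edge; an end lying in \<open>S\<close> is paid for by
  a further change on its way to the nearest position outside \<open>S\<close>.\<close>

lemma thread_cut_bound:
  fixes w :: "nat \<Rightarrow> real"
  assumes T: "thread N F Al ss" and Al: "finite Al" "Al \<subseteq> {..<N}" and S: "S \<subseteq> Al"
    and j: "j < length ss" and P: "P = ed N ` set ss" and w: "\<And>e. e \<in> Al \<Longrightarrow> w e \<ge> 0"
    and h: "0 \<le> h" "h \<le> (\<Sum>i\<le>j. w (ed N (ss ! i)))" "h \<le> (\<Sum>i=j..<length ss. w (ed N (ss ! i)))"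
  shows "h * (2 * of_bool (ed N (ss ! j) \<in> S) + real (card (oc N F (S - P)))) \<le> h * real (card (oc N F S)) + 4 * (\<Sum>e\<in>S \<inter> P. w e)"
proof -
  obtain k where k: "length ss = Suc k" using j by (cases "length ss") auto
  let ?e = "\<lambda>i. ed N (ss ! i)"
  define \<chi> where "\<chi> = (\<lambda>i. ed N (ss ! i) \<in> S)"
  have B: "card (oc N F (S - P)) + chn \<chi> 0 k \<le> card (oc N F S) + of_bool (\<chi> 0) + of_bool (\<chi> k)"
    using thread_potential[OF T Al S k P] unfolding \<chi>_def .
  have jk: "j \<le> k" using j k by simp
  have fS: "finite S" using S Al finite_subset by blast
  have W0: "0 \<le> (\<Sum>e\<in>S \<inter> P. w e)" by (rule sum_nonneg) (use w S in auto)
  have inj: "inj_on ?e {..k}" using T k by (auto simp: thread_def distinct_conv_nth inj_on_def less_Suc_eq_le)+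
  have W: "(\<Sum>i\<in>J. w (?e i)) \<le> (\<Sum>e\<in>S \<inter> P. w e)" if J: "J \<subseteq> {..k}" "\<forall>i\<in>J. \<chi> i" for J
  proof -
    have "(\<Sum>i\<in>J. w (?e i)) = (\<Sum>e\<in>?e ` J. w e)"
      by (subst sum.reindex) (use inj_on_subset[OF inj J(1)] in auto)
    also have "\<dots> \<le> (\<Sum>e\<in>S \<inter> P. w e)"
      by (rule sum_mono2) (use J k fS w S in \<open>auto simp: P \<chi>_def less_Suc_eq_le intro!: imageI\<close>)
    finally show ?thesis .
  qed
  show ?thesis
  proof (cases "\<chi> j")
    case False
    have "of_bool (\<chi> 0) \<le> chn \<chi> 0 j" using chn_ge[of 0 j \<chi>] False by auto
    moreover have "of_bool (\<chi> k) \<le> chn \<chi> j k" using chn_ge[of j k \<chi>] False jk by auto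
    ultimately have "card (oc N F (S - P)) \<le> card (oc N F S)" using B chn_add[of 0 j k \<chi>] jk by simp
    then have "h * real (card (oc N F (S - P))) \<le> h * real (card (oc N F S))" using h(1) by (simp add: mult_left_mono)
    then show ?thesis using False W0 by (simp add: \<chi>_def)
  next
    case True
    show ?thesis
    proof (cases "(\<forall>i\<le>j. \<chi> i) \<or> (\<forall>i. j \<le> i \<and> i \<le> k \<longrightarrow> \<chi> i)")
      case all: True
      then have "h \<le> (\<Sum>e\<in>S \<inter> P. w e)"
      proof
        assume "\<forall>i\<le>j. \<chi> i"
        then show ?thesis using W[of "{..j}"] h(2) jk by force
      next
        assume "\<forall>i. j \<le> i \<and> i \<le> k \<longrightarrow> \<chi> i"
        then show ?thesis using W[of "{j..<length ss}"] h(3) jk k by force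
      qed
      moreover have "card (oc N F (S - P)) \<le> card (oc N F S) + 2" using B by (auto simp: of_bool_def split: if_splits)
      then have "h * real (card (oc N F (S - P))) \<le> h * (real (card (oc N F S)) + 2)" using h(1) by (intro mult_left_mono) auto
      ultimately show ?thesis using True by (simp add: \<chi>_def algebra_simps)
    next
      case False
      then obtain i1 i2 where i: "i1 \<le> j" "\<not> \<chi> i1" "j \<le> i2" "i2 \<le> k" "\<not> \<chi> i2" by blast
      have "of_bool (\<chi> 0) \<le> chn \<chi> 0 i1" using chn_ge[of 0 i1 \<chi>] i by auto
      moreover have "1 \<le> chn \<chi> i1 j" using chn_ge[of i1 j \<chi>] i True by auto
      moreover have "1 \<le> chn \<chi> j i2" using chn_ge[of j i2 \<chi>] i True by auto
      moreover have "of_bool (\<chi> k) \<le> chn \<chi> i2 k" using chn_ge[of i2 k \<chi>] i by auto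
      moreover have "chn \<chi> 0 k = chn \<chi> 0 i1 + chn \<chi> i1 j + chn \<chi> j i2 + chn \<chi> i2 k"
        using chn_add[of 0 i1 j \<chi>] chn_add[of 0 j i2 \<chi>] chn_add[of 0 i2 k \<chi>] i by simp
      ultimately have "card (oc N F (S - P)) + 2 \<le> card (oc N F S)" using B by simp
      then have "real (card (oc N F (S - P))) + 2 \<le> real (card (oc N F S))" by linarith
      then have "h * (real (card (oc N F (S - P))) + 2) \<le> h * real (card (oc N F S))" using h(1) by (intro mult_left_mono) auto
      then show ?thesis using True W0 by (simp add: \<chi>_def algebra_simps)
    qed
  qed
qed

section \<open>Counting sides, parity kernels and digons\<close>

lemma pc_card:
  assumes "finite Al" "Al \<subseteq> {..<N}"
  shows "finite {s. ed N s \<in> Al \<and> F s = c}" "pc N F Al c = card {s. ed N s \<in> Al \<and> F s = c}"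
proof -
  let ?A = "{e\<in>Al. F e = c}" and ?B = "{e\<in>Al. F (e + N) = c}"
  have eq: "{s. ed N s \<in> Al \<and> F s = c} = ?A \<union> (\<lambda>e. e + N) ` ?B"
  proof (intro set_eqI iffI)
    fix s assume s: "s \<in> {s. ed N s \<in> Al \<and> F s = c}"
    show "s \<in> ?A \<union> (\<lambda>e. e + N) ` ?B"
    proof (cases "s < N")
      case False
      then have "s = (s - N) + N" "s - N \<in> ?B" using s by (auto simp: ed_def)
      then show ?thesis by blast
    qed (use s in \<open>auto simp: ed_def\<close>)
  qed (use assms(2) in \<open>auto simp: ed_def\<close>)
  show "finite {s. ed N s \<in> Al \<and> F s = c}" unfolding eq using assms by auto
  have "card {s. ed N s \<in> Al \<and> F s = c} = card ?A + card ?B" unfolding eq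
    by (subst card_Un_disjoint) (use assms in \<open>auto simp: card_image\<close>)
  also have "\<dots> = pc N F Al c" unfolding pc_def using assms(1)
    by (simp add: sum.distrib of_bool_def sum.If_cases Int_def)
  finally show "pc N F Al c = card {s. ed N s \<in> Al \<and> F s = c}" by simp
qed

lemma pc_total:
  assumes "finite Al" "finite D" "F ` Al \<union> (\<lambda>e. F (e + N)) ` Al \<subseteq> D"
  shows "(\<Sum>c\<in>D. pc N F Al c) = 2 * card Al"
proof -
  have "(\<Sum>c\<in>D. pc N F Al c) = (\<Sum>e\<in>Al. \<Sum>c\<in>D. of_bool (F e = c) + of_bool (F (e + N) = c))"
    unfolding pc_def by (rule sum.swap)
  also have "\<dots> = (\<Sum>e\<in>Al. 2)"
    by (rule sum.cong) (use assms in \<open>auto simp: sum.distrib of_bool_def image_subset_iff\<close>)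
  finally show ?thesis by simp
qed

text \<open>Rank-nullity as an inequality of cardinalities:
  \<open>X \<mapsto> B X \<inter> D\<close> is linear over two elements, so every nonempty fibre is
  a translate of the kernel, and there are at most \<open>2 ^ card D\<close> fibres.\<close>

lemma parity_kernel:
  assumes fin: "finite \<X>" and D: "finite D"
    and cl: "\<And>X Y. X \<in> \<X> \<Longrightarrow> Y \<in> \<X> \<Longrightarrow> sym_diff X Y \<in> \<X>"
    and ad: "\<And>X Y. X \<in> \<X> \<Longrightarrow> Y \<in> \<X> \<Longrightarrow> B (sym_diff X Y) = sym_diff (B X) (B Y)"
  shows "card \<X> \<le> 2 ^ card D * card {X\<in>\<X>. B X \<inter> D = {}}"
proof -
  let ?K = "{X\<in>\<X>. B X \<inter> D = {}}"
  have f: "card {X\<in>\<X>. B X \<inter> D = Q} \<le> card ?K" for Q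
  proof (cases "{X\<in>\<X>. B X \<inter> D = Q} = {}")
    case True
    then show ?thesis by (metis card.empty le0)
  next
    case False
    then obtain Y where Y: "Y \<in> \<X>" "B Y \<inter> D = Q" by auto
    show ?thesis
    proof (rule card_inj_on_le)
      show "inj_on (\<lambda>X. sym_diff X Y) {X\<in>\<X>. B X \<inter> D = Q}" by (rule inj_onI) auto
      show "(\<lambda>X. sym_diff X Y) ` {X\<in>\<X>. B X \<inter> D = Q} \<subseteq> ?K"
      proof
        fix Z assume "Z \<in> (\<lambda>X. sym_diff X Y) ` {X\<in>\<X>. B X \<inter> D = Q}"
        then obtain X where X: "X \<in> \<X>" "B X \<inter> D = Q" "Z = sym_diff X Y" by auto
        have "B Z = sym_diff (B X) (B Y)" using X Y ad by simp
        then have "B Z \<inter> D = sym_diff (B X \<inter> D) (B Y \<inter> D)" by blast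
        then have "B Z \<inter> D = {}" using X(2) Y(2) by simp
        then show "Z \<in> ?K" using X Y cl by simp
      qed
    qed (use fin in auto)
  qed
  have "\<X> = (\<Union>Q\<in>Pow D. {X\<in>\<X>. B X \<inter> D = Q})"
  proof (intro set_eqI iffI)
    fix X assume "X \<in> \<X>"
    then show "X \<in> (\<Union>Q\<in>Pow D. {X\<in>\<X>. B X \<inter> D = Q})" by (intro UN_I[of "B X \<inter> D"]) simp_all
  next
    fix X assume "X \<in> (\<Union>Q\<in>Pow D. {X\<in>\<X>. B X \<inter> D = Q})"
    then show "X \<in> \<X>" by (elim UN_E) simp
  qed
  then have "card \<X> = card (\<Union>Q\<in>Pow D. {X\<in>\<X>. B X \<inter> D = Q})" by simp
  also have "\<dots> \<le> (\<Sum>Q\<in>Pow D. card {X\<in>\<X>. B X \<inter> D = Q})" by (rule card_UN_le) (use D in auto)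
  also have "\<dots> \<le> (\<Sum>Q\<in>Pow D. card ?K)" by (rule sum_mono) (rule f)
  finally show ?thesis using D by (simp add: card_Pow)
qed

definition dlink :: "nat \<Rightarrow> (nat \<Rightarrow> nat) \<Rightarrow> nat set \<Rightarrow> (nat \<times> nat) set" where
  "dlink N F Al = {(e, f). e \<in> Al \<and> f \<in> Al \<and> (\<exists>s t. ed N s = e \<and> ed N t = f \<and> F s = F t \<and> pc N F Al (F s) = 2)}"

text \<open>The intersection discards the reflexive pairs that the closure adds outside
  \<open>Al\<close>. The quotient \<open>Al // trel N F Al\<close> is the set of threads.\<close>

definition trel :: "nat \<Rightarrow> (nat \<Rightarrow> nat) \<Rightarrow> nat set \<Rightarrow> (nat \<times> nat) set" where
  "trel N F Al = (dlink N F Al)\<^sup>* \<inter> Al \<times> Al"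

lemma equiv_trel: "equiv Al (trel N F Al)"
proof (rule equivI)
  show "trel N F Al \<subseteq> Al \<times> Al" by (auto simp: trel_def)
  show "refl_on Al (trel N F Al)" by (auto simp: refl_on_def trel_def)
  have "sym (dlink N F Al)" unfolding sym_def dlink_def by auto metis
  then show "sym (trel N F Al)" unfolding trel_def by (metis sym_rtrancl sym_Int sym_def mem_Sigma_iff)
  show "trans (trel N F Al)" by (auto simp: trans_def trel_def)
qed

lemma trel_closed:
  assumes "\<And>e f. (e, f) \<in> dlink N F Al \<Longrightarrow> e \<in> X \<Longrightarrow> f \<in> X" "(e, f) \<in> trel N F Al" "e \<in> X"
  shows "f \<in> X"
proof -
  have "(e, f) \<in> (dlink N F Al)\<^sup>*" using assms(2) by (simp add: trel_def)
  then show ?thesis by induction (use assms in auto)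
qed

text \<open>Each of the two edges contributes at least 1 to \<open>pc N F Al c = 2\<close>, hence
  exactly 1, and nothing is left for other edges.\<close>

lemma digon_parity:
  assumes Al: "finite Al" "Al \<subseteq> {..<N}" and X: "X \<subseteq> Al" and ef: "e \<in> Al" "f \<in> Al" "e \<noteq> f"
    "ed N s = e" "ed N t = f" "F s = c" "F t = c" and c: "pc N F Al c = 2"
  shows "pc N F X c = of_bool (e \<in> X) + of_bool (f \<in> X)"
proof -
  define g where "g d = (of_bool (F d = c) + of_bool (F (d + N) = c) :: nat)" for d
  have pcg: "pc N F X c = (\<Sum>e\<in>X. g e)" for X by (simp add: pc_def g_def)
  have ge: "g e \<ge> 1" "g f \<ge> 1" using ef by (auto simp: g_def ed_def split: if_splits)
  have "pc N F Al c = g e + (g f + (\<Sum>d\<in>Al - {e} - {f}. g d))"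
    unfolding pcg using ef Al(1)
    by (subst sum.remove[of Al e], simp_all, subst sum.remove[of "Al - {e}" f], simp_all)
  then have 1: "g e = 1" "g f = 1" "(\<Sum>d\<in>Al - {e} - {f}. g d) = 0" using c ge by linarith+
  have "g d = of_bool (d = e) + of_bool (d = f)" if "d \<in> Al" for d
    using 1 that ef(3) Al(1) by (cases "d = e"; cases "d = f") auto
  then have "pc N F X c = (\<Sum>d\<in>X. of_bool (d = e) + of_bool (d = f))" unfolding pcg using X by (intro sum.cong) auto
  moreover have "finite X" using X Al finite_subset by blast
  ultimately show ?thesis by (simp add: sum.distrib of_bool_def)
qed

section \<open>Contracted graphs and the number of threads\<close>

locale wg =
  fixes N n :: nat and E :: "nat set" and eu ev :: "nat \<Rightarrow> nat" and w :: "nat \<Rightarrow> real"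
  assumes E_sub: "E \<subseteq> {..<N}" and ends: "e \<in> E \<Longrightarrow> eu e < n" "e \<in> E \<Longrightarrow> ev e < n"
    and w_nonneg: "e \<in> E \<Longrightarrow> 0 \<le> w e"
begin

lemma finite_E[simp]: "finite E" using E_sub finite_subset by blast
lemma finite_sub: "Al \<subseteq> E \<Longrightarrow> finite Al" using finite_E finite_subset by blast

definition cutE :: "nat set \<Rightarrow> nat set" where "cutE U = {e\<in>E. (eu e \<in> U) \<noteq> (ev e \<in> U)}"
definition lcut :: "(nat \<Rightarrow> nat) \<Rightarrow> nat set \<Rightarrow> nat set \<Rightarrow> nat set" where
  "lcut C Al L = {e\<in>Al. (C (eu e) \<in> L) \<noteq> (C (ev e) \<in> L)}"

text \<open>
  The even sets, i.e. the cycles of the dual graph, fall into at most \<open>q\<close> classes modulo cuts of the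
  contracted graph.  In this form the genus bound survives all contractions and deletions.
\<close>

definition topo :: "nat \<Rightarrow> nat set \<Rightarrow> (nat \<Rightarrow> nat) \<Rightarrow> (nat \<Rightarrow> nat) \<Rightarrow> bool" where
  "topo q Al F C \<longleftrightarrow> (\<exists>\<Psi>. (\<forall>X\<subseteq>Al. oc N F X = {} \<longrightarrow> \<Psi> X < q) \<and>
     (\<forall>X\<subseteq>Al. \<forall>Y\<subseteq>Al. oc N F X = {} \<and> oc N F Y = {} \<and> \<Psi> X = (\<Psi> Y :: nat) \<longrightarrow> (\<exists>L. sym_diff X Y = lcut C Al L)))"

lemma topoE:
  assumes "topo q Al F C"
  obtains \<Psi> where "\<And>X. X \<subseteq> Al \<Longrightarrow> oc N F X = {} \<Longrightarrow> \<Psi> X < q"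
    "\<And>X Y. X \<subseteq> Al \<Longrightarrow> Y \<subseteq> Al \<Longrightarrow> oc N F X = {} \<Longrightarrow> oc N F Y = {} \<Longrightarrow> \<Psi> X = \<Psi> Y \<Longrightarrow> \<exists>L. sym_diff X Y = lcut C Al L"
proof -
  from assms obtain \<Psi> where p: "(\<forall>X\<subseteq>Al. oc N F X = {} \<longrightarrow> \<Psi> X < q) \<and>
     (\<forall>X\<subseteq>Al. \<forall>Y\<subseteq>Al. oc N F X = {} \<and> oc N F Y = {} \<and> \<Psi> X = \<Psi> Y \<longrightarrow> (\<exists>L. sym_diff X Y = lcut C Al L))"
    unfolding topo_def by (elim exE) (rule that)
  show ?thesis
  proof (rule that[of \<Psi>])
    fix X Y assume "X \<subseteq> Al" "Y \<subseteq> Al" "oc N F X = {}" "oc N F Y = {}" "\<Psi> X = \<Psi> Y"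
    then show "\<exists>L. sym_diff X Y = lcut C Al L" using p[THEN conjunct2, rule_format, of X Y] by simp
  qed (use p in simp)
qed

text \<open>Deletion. By \<open>oc_free_ext\<close> every even set of the smaller graph extends to
  an even set of the larger one, and the class of this extension is used; a cut minus
  \<open>e\<close> is a cut of the smaller graph.\<close>

lemma topo_free:
  assumes t: "topo q Al F C" and Al: "Al \<subseteq> E" and e: "e \<in> Al"
  shows "topo q (Al - {e}) (mrg (F e) (F (e + N)) F) C"
proof -
  obtain \<Psi> where \<Psi>: "\<And>X. X \<subseteq> Al \<Longrightarrow> oc N F X = {} \<Longrightarrow> \<Psi> X < q"
    "\<And>X Y. X \<subseteq> Al \<Longrightarrow> Y \<subseteq> Al \<Longrightarrow> oc N F X = {} \<Longrightarrow> oc N F Y = {} \<Longrightarrow> \<Psi> X = \<Psi> Y \<Longrightarrow> \<exists>L. sym_diff X Y = lcut C Al L"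
    by (rule topoE[OF t], rule that)
  define ext where "ext X = (if oc N F X = {} then X else insert e X)" for X
  have ext: "oc N F (ext X) = {}" "ext X \<subseteq> Al" "ext X - {e} = X"
    if "X \<subseteq> Al - {e}" "oc N (mrg (F e) (F (e + N)) F) X = {}" for X
    using oc_free_ext[of X e N F] that finite_sub[OF Al] finite_subset[of X Al] e unfolding ext_def by (auto split: if_splits)
  show ?thesis unfolding topo_def
  proof (intro exI[of _ "\<lambda>X. \<Psi> (ext X)"] conjI allI impI)
    fix X assume "X \<subseteq> Al - {e}" "oc N (mrg (F e) (F (e + N)) F) X = {}"
    then show "\<Psi> (ext X) < q" using ext \<Psi>(1) by simp
  next
    fix X Y assume X: "X \<subseteq> Al - {e}" and Y: "Y \<subseteq> Al - {e}"
      and h: "oc N (mrg (F e) (F (e + N)) F) X = {} \<and> oc N (mrg (F e) (F (e + N)) F) Y = {} \<and> \<Psi> (ext X) = \<Psi> (ext Y)"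
    obtain L where L: "sym_diff (ext X) (ext Y) = lcut C Al L" using \<Psi>(2)[of "ext X" "ext Y"] ext X Y h by blast
    have "sym_diff (ext X) (ext Y) - {e} = sym_diff (ext X - {e}) (ext Y - {e})" by blast
    then have "sym_diff X Y = sym_diff (ext X) (ext Y) - {e}" using ext(3)[OF X] ext(3)[OF Y] h by simp
    also have "\<dots> = lcut C (Al - {e}) L" unfolding L lcut_def by auto
    finally show "\<exists>L. sym_diff X Y = lcut C (Al - {e}) L" by blast
  qed
qed

text \<open>Contraction, with the same \<open>\<Psi>\<close>. Even sets avoiding \<open>P\<close>
  that agree under \<open>\<Psi>\<close> differ by a cut avoiding \<open>e\<close>; such a cut does
  not separate \<open>x\<close> from \<open>y\<close>, so it is still a cut after the
  merger.\<close>

lemma topo_merge: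
  assumes t: "topo q Al F C" and P: "P \<subseteq> Al" "e \<in> P" "{C (eu e), C (ev e)} = {x, y}"
    and C': "\<And>v. C' v = (if C v = y then x else C v)"
    and Pxy: "\<And>f. f \<in> P \<Longrightarrow> {C (eu f), C (ev f)} = {x, y}"
  shows "topo q (Al - P) F C'"
proof -
  obtain \<Psi> where \<Psi>: "\<And>X. X \<subseteq> Al \<Longrightarrow> oc N F X = {} \<Longrightarrow> \<Psi> X < q"
    "\<And>X Y. X \<subseteq> Al \<Longrightarrow> Y \<subseteq> Al \<Longrightarrow> oc N F X = {} \<Longrightarrow> oc N F Y = {} \<Longrightarrow> \<Psi> X = \<Psi> Y \<Longrightarrow> \<exists>L. sym_diff X Y = lcut C Al L"
    by (rule topoE[OF t], rule that)
  show ?thesis unfolding topo_def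
  proof (intro exI[of _ \<Psi>] conjI allI impI)
    fix X assume "X \<subseteq> Al - P" "oc N F X = {}"
    then show "\<Psi> X < q" using \<Psi>(1)[of X] by blast
  next
    fix X Y assume X: "X \<subseteq> Al - P" and Y: "Y \<subseteq> Al - P" and h: "oc N F X = {} \<and> oc N F Y = {} \<and> \<Psi> X = \<Psi> Y"
    obtain L where L: "sym_diff X Y = lcut C Al L" using \<Psi>(2)[of X Y] X Y h by blast
    have "e \<notin> lcut C Al L" using L X Y P by blast
    then have xy: "x \<in> L \<longleftrightarrow> y \<in> L" using P by (auto simp: lcut_def doubleton_eq_iff)
    have "C' v \<in> L \<longleftrightarrow> C v \<in> L" for v using xy by (simp add: C')
    then have "lcut C' (Al - P) L = lcut C Al L - P" by (auto simp: lcut_def)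
    also have "\<dots> = sym_diff X Y - P" using L by simp
    also have "\<dots> = sym_diff X Y" using X Y by blast
    finally show "\<exists>L. sym_diff X Y = lcut C' (Al - P) L" by metis
  qed
qed

text \<open>Let m, t, d and f be the numbers of alive edges, of threads, of classes with two sides
  and of classes with more. Counting sides gives 2d + 3f \<le> 2m. The sets even at all digons are
  unions of threads, so m \<le> d + t. Unions of threads are even at the digons, so even sets among
  them are a kernel for the larger classes alone, and t \<le> f + G + \<open>card LB\<close>.
  Eliminating m, d and f proves the bound.\<close>

lemma theta_bound:
  assumes Al: "Al \<subseteq> E" and t: "topo (2 ^ G) Al F C" and no1: "\<And>c. pc N F Al c \<noteq> 1"
    and LB: "finite LB" "\<And>e. e \<in> Al \<Longrightarrow> C (eu e) \<in> LB \<and> C (ev e) \<in> LB"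
  shows "card (Al // trel N F Al) \<le> 3 * (G + card LB)"
proof -
  have fAl: "finite Al" using Al by (rule finite_sub)
  have AlN: "Al \<subseteq> {..<N}" using Al E_sub by blast
  let ?R = "trel N F Al"
  let ?Th = "Al // ?R"
  have eqv: "equiv Al ?R" by (rule equiv_trel)
  have fTh: "finite ?Th" by (rule finite_quotient[OF fAl]) (auto simp: trel_def)
  define CL where "CL = F ` Al \<union> (\<lambda>e. F (e + N)) ` Al"
  have fCL: "finite CL" using fAl by (simp add: CL_def)
  define D where "D = {c\<in>CL. pc N F Al c = 2}"
  define D3 where "D3 = {c\<in>CL. pc N F Al c \<ge> 3}"
  have fD: "finite D" "finite D3" using fCL by (auto simp: D_def D3_def)
  have pc0: "pc N F Al c \<noteq> 0" if c: "c \<in> CL" for c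
  proof -
    obtain e where "e \<in> Al" "F e = c \<or> F (e + N) = c" using c by (auto simp: CL_def)
    then show ?thesis using fAl by (auto simp: pc_def)
  qed
  have CLeq: "CL = D \<union> D3"
  proof -
    have "pc N F Al c \<noteq> 2 \<Longrightarrow> pc N F Al c \<ge> 3" if "c \<in> CL" for c using pc0[OF that] no1[of c] by linarith
    then show ?thesis by (auto simp: D_def D3_def)
  qed
  have cnt: "2 * card D + 3 * card D3 \<le> 2 * card Al"
  proof -
    have "2 * card Al = (\<Sum>c\<in>D \<union> D3. pc N F Al c)" using pc_total[OF fAl fCL, of F N] CLeq by (simp add: CL_def)
    also have "\<dots> = (\<Sum>c\<in>D. pc N F Al c) + (\<Sum>c\<in>D3. pc N F Al c)"
      by (rule sum.union_disjoint) (use fD in \<open>auto simp: D_def D3_def\<close>)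
    also have "(\<Sum>c\<in>D. pc N F Al c) = 2 * card D" by (simp add: D_def)
    finally have "2 * card Al = 2 * card D + (\<Sum>c\<in>D3. pc N F Al c)" .
    moreover have "(\<Sum>c\<in>D3. 3) \<le> (\<Sum>c\<in>D3. pc N F Al c)" by (rule sum_mono) (auto simp: D3_def)
    ultimately show ?thesis by simp
  qed
  have closed: "f \<in> X" if X: "X \<subseteq> Al" "oc N F X \<inter> D = {}" and ef: "(e, f) \<in> dlink N F Al" "e \<in> X" for X e f
  proof (cases "e = f")
    case False
    obtain s t where st: "e \<in> Al" "f \<in> Al" "ed N s = e" "ed N t = f" "F s = F t" "pc N F Al (F s) = 2"
      using ef by (auto simp: dlink_def)
    have "F s \<in> CL"
    proof (cases "s < N")
      case True
      then have "s = e" using st(3) by (simp add: ed_def)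
      then show ?thesis using st(1) by (simp add: CL_def)
    next
      case False
      then have "s = e + N" using st(3) by (auto simp: ed_def)
      then show ?thesis using st(1) by (simp add: CL_def)
    qed
    then have "even (pc N F X (F s))" using X st by (auto simp: D_def oc_def)
    moreover have "pc N F X (F s) = of_bool (e \<in> X) + of_bool (f \<in> X)"
      by (rule digon_parity[OF fAl AlN X(1) st(1,2) False st(3,4)]) (use st in auto)
    ultimately show ?thesis using ef by (auto split: if_splits)
  qed (use ef in auto)
  have cls: "X = \<Union> {t\<in>?Th. t \<subseteq> X}" if X: "X \<subseteq> Al" "oc N F X \<inter> D = {}" for X
  proof (intro set_eqI iffI)
    fix e assume e: "e \<in> X"
    have "?R `` {e} \<subseteq> X"
    proof
      fix f assume "f \<in> ?R `` {e}"
      then show "f \<in> X" using trel_closed[of N F Al X e f] closed[OF X] e by (metis Image_singleton_iff)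
    qed
    moreover have "e \<in> ?R `` {e}" "?R `` {e} \<in> ?Th" using e X(1) equiv_class_self[OF eqv, of e] quotientI[of e Al ?R] by blast+
    ultimately show "e \<in> \<Union> {t\<in>?Th. t \<subseteq> X}" by blast
  qed auto
  have c1: "2 ^ card Al \<le> 2 ^ card D * (2 :: nat) ^ card ?Th"
  proof -
    have "card (Pow Al) \<le> 2 ^ card D * card {X\<in>Pow Al. oc N F X \<inter> D = {}}"
      by (rule parity_kernel) (use fAl fD finite_subset[OF _ fAl] in \<open>auto simp: oc_symdiff\<close>)
    also have "card {X\<in>Pow Al. oc N F X \<inter> D = {}} \<le> card (Pow ?Th)"
    proof (rule card_inj_on_le[where f="\<lambda>X. {t\<in>?Th. t \<subseteq> X}"])
      show "inj_on (\<lambda>X. {t\<in>?Th. t \<subseteq> X}) {X\<in>Pow Al. oc N F X \<inter> D = {}}"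
      proof (rule inj_onI)
        fix X Y assume X: "X \<in> {X\<in>Pow Al. oc N F X \<inter> D = {}}" and Y: "Y \<in> {X\<in>Pow Al. oc N F X \<inter> D = {}}"
          and eq: "{t\<in>?Th. t \<subseteq> X} = {t\<in>?Th. t \<subseteq> Y}"
        have "X = \<Union> {t\<in>?Th. t \<subseteq> X}" by (rule cls) (use X in auto)
        also have "\<dots> = Y" unfolding eq by (rule cls[symmetric]) (use Y in auto)
        finally show "X = Y" .
      qed
    qed (use fTh in auto)
    finally show ?thesis using fAl fTh by (simp add: card_Pow)
  qed
  have c1': "card Al \<le> card D + card ?Th"
    using c1 by (simp add: power_add[symmetric])
  define \<X> where "\<X> = \<Union> ` Pow ?Th"
  have disj: "s \<inter> t = {}" if "s \<in> ?Th" "t \<in> ?Th" "s \<noteq> t" for s t using quotient_disj[OF eqv that(1,2)] that(3) by blast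
  have ne: "t \<noteq> {}" if "t \<in> ?Th" for t using in_quotient_imp_non_empty[OF eqv that] .
  have injU: "inj_on \<Union> (Pow ?Th)"
  proof (rule inj_onI)
    fix S T assume S: "S \<in> Pow ?Th" and T: "T \<in> Pow ?Th" and eq: "\<Union> S = \<Union> T"
    have "A \<subseteq> B" if AB: "A \<subseteq> ?Th" "B \<subseteq> ?Th" "\<Union> A = \<Union> B" for A B
    proof
      fix t assume t: "t \<in> A"
      then obtain x where x: "x \<in> t" using ne[of t] AB(1) by blast
      then have "x \<in> \<Union> B" using AB(3) t by blast
      then obtain t' where t': "t' \<in> B" "x \<in> t'" by blast
      have "t = t'" by (rule ccontr) (use disj[of t t'] x t t' AB(1,2) in blast)
      then show "t \<in> B" using t' by simp
    qed
    from this[of S T] this[of T S] show "S = T" using S T eq by simp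
  qed
  have cX: "card \<X> = 2 ^ card ?Th" unfolding \<X>_def using card_image[OF injU] fTh by (simp add: card_Pow)
  have XAl: "X \<subseteq> Al" if "X \<in> \<X>" for X using that in_quotient_imp_subset[OF eqv] unfolding \<X>_def by blast
  have Xcl: "sym_diff X Y \<in> \<X>" if XY: "X \<in> \<X>" "Y \<in> \<X>" for X Y
  proof -
    obtain S T where ST: "S \<subseteq> ?Th" "T \<subseteq> ?Th" "X = \<Union> S" "Y = \<Union> T" using XY by (auto simp: \<X>_def)
    have d: "\<Union> A - \<Union> B = \<Union> (A - B)" if "A \<subseteq> ?Th" "B \<subseteq> ?Th" for A B
    proof (intro set_eqI iffI)
      fix x assume "x \<in> \<Union> (A - B)"
      then obtain t where t: "t \<in> A" "t \<notin> B" "x \<in> t" by blast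
      have "x \<notin> t'" if "t' \<in> B" for t' using disj[of t t'] t that \<open>A \<subseteq> ?Th\<close> \<open>B \<subseteq> ?Th\<close> by blast
      then show "x \<in> \<Union> A - \<Union> B" using t by blast
    qed blast
    have "sym_diff X Y = \<Union> ((S - T) \<union> (T - S))" unfolding ST(3,4) d[OF ST(1,2)] d[OF ST(2,1)] by (simp only: Union_Un_distrib)
    moreover have "(S - T) \<union> (T - S) \<in> Pow ?Th" using ST(1,2) by blast
    ultimately show ?thesis unfolding \<X>_def by (rule image_eqI)
  qed
  \<comment> \<open>If both sides of a digon belong to one edge, that edge contributes 0 or 2;
    otherwise the two edges of the digon lie in the same thread, hence both or neither in
    \<open>X\<close>.\<close>
  have XD: "oc N F X \<inter> D = {}" if X: "X \<in> \<X>" for X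
  proof (rule ccontr)
    assume "\<not> ?thesis"
    then obtain c where c: "odd (pc N F X c)" "c \<in> CL" "pc N F Al c = 2" by (auto simp: oc_def D_def)
    have "card {s. ed N s \<in> Al \<and> F s = c} = 2" using c(3) pc_card(2)[OF fAl AlN, of F c] by simp
    then obtain s t where st: "{s. ed N s \<in> Al \<and> F s = c} = {s, t}" "s \<noteq> t" unfolding card_2_iff by blast
    have stm: "ed N s \<in> Al" "ed N t \<in> Al" "F s = c" "F t = c" using st by auto
    have "even (pc N F X c)"
    proof (cases "ed N s = ed N t")
      case True
      then have "F (ed N s) = c" "F (ed N s + N) = c" using stm st(2) by (auto simp: ed_def split: if_splits)
      have "s' = s \<or> s' = t" if "ed N s' \<in> Al" "F s' = c" for s' using st that by auto
      then have "ed N s' = ed N s" if "ed N s' \<in> Al" "F s' = c" for s' using that True by metis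
      moreover have "ed N e = e" "ed N (e + N) = e" if "e \<in> Al" for e using that AlN by (auto simp: ed_def)
      ultimately have oth: "F e \<noteq> c" "F (e + N) \<noteq> c" if "e \<in> Al" "e \<noteq> ed N s" for e using that by metis+
      have "pc N F X c = (\<Sum>e\<in>X. if e = ed N s then 2 else 0)" unfolding pc_def
        by (rule sum.cong) (use oth XAl[OF X] \<open>F (ed N s) = c\<close> \<open>F (ed N s + N) = c\<close> in auto)
      also have "even \<dots>" by (rule dvd_sum) auto
      finally show ?thesis .
    next
      case False
      have "pc N F X c = of_bool (ed N s \<in> X) + of_bool (ed N t \<in> X)"
        by (rule digon_parity[OF fAl AlN XAl[OF X] stm(1,2) False refl refl stm(3,4) c(3)])
      moreover have "ed N s \<in> X \<longleftrightarrow> ed N t \<in> X"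
      proof -
        have "(ed N s, ed N t) \<in> dlink N F Al" unfolding dlink_def
          by (intro CollectI case_prodI conjI exI[of _ s] exI[of _ t]) (use stm c(3) in simp_all)
        then have "(ed N s, ed N t) \<in> ?R" unfolding trel_def using stm by blast
        then have "?R `` {ed N s} = ?R `` {ed N t}" using equiv_class_eq[OF eqv] by blast
        moreover obtain S where S: "S \<subseteq> ?Th" "X = \<Union> S" using X by (auto simp: \<X>_def)
        moreover have "e \<in> X \<longleftrightarrow> ?R `` {e} \<in> S" if e: "e \<in> Al" for e
        proof
          assume "e \<in> X"
          then obtain t where t: "t \<in> S" "e \<in> t" using S by blast
          have "?R `` {e} \<in> ?Th" "e \<in> ?R `` {e}" using e equiv_class_self[OF eqv e] by (auto intro: quotientI)
          then have "t = ?R `` {e}" using disj[of t "?R `` {e}"] t S(1) by blast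
          then show "?R `` {e} \<in> S" using t by simp
        next
          assume "?R `` {e} \<in> S"
          then show "e \<in> X" using S(2) e equiv_class_self[OF eqv] by blast
        qed
        ultimately show ?thesis using stm by metis
      qed
      ultimately show ?thesis by auto
    qed
    then show False using c by simp
  qed
  obtain \<Psi> where \<Psi>: "\<And>X. X \<subseteq> Al \<Longrightarrow> oc N F X = {} \<Longrightarrow> \<Psi> X < (2::nat) ^ G"
    "\<And>X Y. X \<subseteq> Al \<Longrightarrow> Y \<subseteq> Al \<Longrightarrow> oc N F X = {} \<Longrightarrow> oc N F Y = {} \<Longrightarrow> \<Psi> X = \<Psi> Y \<Longrightarrow> \<exists>L. sym_diff X Y = lcut C Al L"
    by (rule topoE[OF t], rule that)
  let ?Z = "{X. X \<subseteq> Al \<and> oc N F X = {}}"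
  have fZ: "finite ?Z" using fAl by (auto intro: finite_subset[of _ "Pow Al"])
  \<comment> \<open>Each fibre of \<open>\<Psi>\<close> is a translate of a set of cuts, and cuts
    depend only on which labels of \<open>LB\<close> are chosen.\<close>
  have cZ: "card ?Z \<le> 2 ^ G * 2 ^ card LB"
  proof -
    have lc: "lcut C Al ` UNIV \<subseteq> lcut C Al ` Pow LB"
    proof
      fix X assume "X \<in> lcut C Al ` UNIV"
      then obtain L where "X = lcut C Al L" by auto
      also have "\<dots> = lcut C Al (L \<inter> LB)" using LB(2) by (auto simp: lcut_def)
      finally show "X \<in> lcut C Al ` Pow LB" by blast
    qed
    have fib: "card {X\<in>?Z. \<Psi> X = i} \<le> 2 ^ card LB" for i
    proof (cases "{X\<in>?Z. \<Psi> X = i} = {}")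
      case True
      show ?thesis unfolding True by simp
    next
      case False
      then obtain Y where Y: "Y \<subseteq> Al" "oc N F Y = {}" "\<Psi> Y = i" by auto
      have "card {X\<in>?Z. \<Psi> X = i} \<le> card (lcut C Al ` Pow LB)"
      proof (rule card_inj_on_le)
        show "inj_on (\<lambda>X. sym_diff X Y) {X\<in>?Z. \<Psi> X = i}" by (rule inj_onI) auto
        show "(\<lambda>X. sym_diff X Y) ` {X\<in>?Z. \<Psi> X = i} \<subseteq> lcut C Al ` Pow LB"
        proof
          fix Z assume "Z \<in> (\<lambda>X. sym_diff X Y) ` {X\<in>?Z. \<Psi> X = i}"
          then obtain X where "X \<subseteq> Al" "oc N F X = {}" "\<Psi> X = i" "Z = sym_diff X Y" by auto
          then obtain L where "Z = lcut C Al L" using \<Psi>(2)[of X Y] Y by auto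
          then show "Z \<in> lcut C Al ` Pow LB" using lc by blast
        qed
      qed (use LB in auto)
      also have "\<dots> \<le> 2 ^ card LB" using card_image_le[of "Pow LB" "lcut C Al"] LB by (simp add: card_Pow)
      finally show ?thesis .
    qed
    have "?Z = (\<Union>i<2^G. {X\<in>?Z. \<Psi> X = i})" using \<Psi>(1) by auto
    then have "card ?Z = card (\<Union>i<2^G. {X\<in>?Z. \<Psi> X = i})" by (rule arg_cong)
    also have "\<dots> \<le> (\<Sum>i<2^G. card {X\<in>?Z. \<Psi> X = i})" by (rule card_UN_le) simp
    also have "\<dots> \<le> (\<Sum>i<(2::nat)^G. 2 ^ card LB)" by (rule sum_mono) (rule fib)
    finally show ?thesis by simp
  qed
  have "card \<X> \<le> 2 ^ card D3 * card {X\<in>\<X>. oc N F X \<inter> D3 = {}}"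
  proof (rule parity_kernel)
    show "finite \<X>" using fTh by (simp add: \<X>_def)
    show "oc N F (sym_diff X Y) = sym_diff (oc N F X) (oc N F Y)" if "X \<in> \<X>" "Y \<in> \<X>" for X Y
      by (rule oc_symdiff) (use XAl that fAl finite_subset in blast)+
  qed (use fD Xcl in auto)
  also have "{X\<in>\<X>. oc N F X \<inter> D3 = {}} \<subseteq> ?Z"
  proof
    fix X assume X: "X \<in> {X\<in>\<X>. oc N F X \<inter> D3 = {}}"
    then have XA: "X \<subseteq> Al" "oc N F X \<inter> D = {}" using XAl XD by auto
    have "oc N F X \<subseteq> CL"
    proof
      fix c assume "c \<in> oc N F X"
      then have "pc N F X c \<noteq> 0" by (auto simp: oc_def intro: odd_pos)
      then obtain e where "e \<in> X" "of_bool (F e = c) + of_bool (F (e + N) = c) \<noteq> (0::nat)"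
        unfolding pc_def by (meson sum.not_neutral_contains_not_neutral)
      then show "c \<in> CL" using XA by (auto simp: CL_def split: if_splits)
    qed
    then show "X \<in> ?Z" using X XA CLeq by auto
  qed
  then have "card {X\<in>\<X>. oc N F X \<inter> D3 = {}} \<le> card ?Z" by (rule card_mono[OF fZ])
  then have "2 ^ card D3 * card {X\<in>\<X>. oc N F X \<inter> D3 = {}} \<le> 2 ^ card D3 * (2 ^ G * 2 ^ card LB)" using cZ by simp
  finally have "(2::nat) ^ card ?Th \<le> 2 ^ (card D3 + (G + card LB))" using cX by (simp add: power_add)
  then have "card ?Th \<le> card D3 + (G + card LB)" by simp
  moreover have "t \<le> 3 * (G + l)" if "t \<le> f + (G + l)" "2 * d + 3 * f \<le> 2 * m" "m \<le> d + t" for t f l d m :: nat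
  proof -
    have "3 * f \<le> 2 * t" using that by simp
    moreover have "3 * t \<le> 3 * f + 3 * (G + l)" using that(1) by simp
    ultimately show ?thesis by simp
  qed
  ultimately show ?thesis using cnt c1' by blast
qed

lemma dlink_even_closed:
  assumes Al: "Al \<subseteq> E" and X: "X \<subseteq> Al" "oc N F X = {}" and ef: "(e, f) \<in> dlink N F Al" "e \<in> X"
  shows "f \<in> X"
proof (cases "e = f")
  case False
  obtain s t where st: "e \<in> Al" "f \<in> Al" "ed N s = e" "ed N t = f" "F s = F t" "pc N F Al (F s) = 2"
    using ef by (auto simp: dlink_def)
  have "even (pc N F X (F s))" using X by (auto simp: oc_def)
  moreover have "pc N F X (F s) = of_bool (e \<in> X) + of_bool (f \<in> X)"
    by (rule digon_parity[OF finite_sub[OF Al] _ X(1) st(1,2) False st(3,4)]) (use st Al E_sub in auto)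
  ultimately show ?thesis using ef by (auto split: if_splits)
qed (use ef in auto)

section \<open>Clusters that meet few threads\<close>

context
  fixes Al F C
  assumes Al: "Al \<subseteq> E" and even_cuts: "\<And>L. oc N F (lcut C Al L) = {}"
    and proper: "\<And>e. e \<in> Al \<Longrightarrow> C (eu e) \<noteq> C (ev e)"
begin

text \<open>A class with a single alive side would be odd in the cut around the cluster at one end
  of that edge.\<close>

lemma no_pc1: "pc N F Al c \<noteq> 1"
proof
  assume 1: "pc N F Al c = 1"
  then have "\<exists>e\<in>Al. of_bool (F e = c) + of_bool (F (e + N) = c) \<noteq> (0::nat)"
    unfolding pc_def by (metis (mono_tags, lifting) sum.neutral zero_neq_one)
  then obtain e where e: "e \<in> Al" "of_bool (F e = c) + of_bool (F (e + N) = c) \<noteq> (0::nat)" by blast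
  let ?X = "lcut C Al {C (eu e)}"
  have X: "?X \<subseteq> Al" by (auto simp: lcut_def)
  have eX: "e \<in> ?X" using e(1) proper[OF e(1)] by (simp add: lcut_def eq_commute)
  have "pc N F {e} c \<le> pc N F ?X c" "pc N F ?X c \<le> pc N F Al c"
    by (rule pc_mono, use finite_sub[OF Al] X eX finite_subset in auto)+
  moreover have "pc N F {e} c \<noteq> 0" using e by (simp add: pc_def)
  ultimately have "pc N F ?X c = 1" using 1 by linarith
  then have "c \<in> oc N F ?X" by (simp add: oc_def)
  then show False using even_cuts by blast
qed

text \<open>An even cut contains both edges of a digon or neither. In particular all edges of a
  thread join the same two clusters.\<close>

lemma trel_label: assumes "(e, f) \<in> trel N F Al" shows "e \<in> lcut C Al L \<longleftrightarrow> f \<in> lcut C Al L"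
proof -
  have s: "(f, e) \<in> trel N F Al" using assms equiv_trel[of Al N F] by (meson equiv_def symE)
  have "f' \<in> lcut C Al L" if "(e', f') \<in> trel N F Al" "e' \<in> lcut C Al L" for e' f'
    by (rule trel_closed[OF _ that]) (rule dlink_even_closed[OF Al _ even_cuts], auto simp: lcut_def)
  then show ?thesis using s assms by blast
qed

lemma lcut_single: "e \<in> lcut C Al {x} \<longleftrightarrow> e \<in> Al \<and> (C (eu e) = x \<or> C (ev e) = x)"
  using proper[of e] by (auto simp: lcut_def)

definition touching :: "nat \<Rightarrow> nat set set" where
  "touching x = {t \<in> Al // trel N F Al. \<exists>e\<in>t. e \<in> lcut C Al {x}}"

lemma finite_threads: "finite (Al // trel N F Al)"
  by (rule finite_quotient) (use finite_sub[OF Al] in \<open>auto simp: trel_def\<close>)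

text \<open>There are at most \<open>3 * (G + card LB) \<le> 6 * card LB\<close> threads, each
  touching at most two clusters: at most 12 incidences per cluster on average.\<close>

lemma small_label:
  assumes t: "topo (2 ^ G) Al F C"
    and LB: "finite LB" "LB \<noteq> {}" "\<And>e. e \<in> Al \<Longrightarrow> C (eu e) \<in> LB \<and> C (ev e) \<in> LB" "G \<le> card LB"
  shows "\<exists>x\<in>LB. card (touching x) \<le> 12"
proof (rule ccontr)
  assume "\<not> ?thesis"
  then have H: "13 \<le> card (touching x)" if "x \<in> LB" for x using that by force
  let ?Th = "Al // trel N F Al"
  have th: "card ?Th \<le> 3 * (G + card LB)" by (rule theta_bound[OF Al t no_pc1 LB(1,3)])
  have two: "card {x\<in>LB. \<exists>e\<in>t. e \<in> lcut C Al {x}} \<le> 2" if t: "t \<in> ?Th" for t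
  proof -
    obtain e where e: "e \<in> Al" "t = trel N F Al `` {e}" using t by (rule quotientE)
    have "{x\<in>LB. \<exists>e\<in>t. e \<in> lcut C Al {x}} \<subseteq> {C (eu e), C (ev e)}"
    proof
      fix x assume "x \<in> {x\<in>LB. \<exists>e\<in>t. e \<in> lcut C Al {x}}"
      then obtain f where "(e, f) \<in> trel N F Al" "f \<in> lcut C Al {x}" using e by auto
      then show "x \<in> {C (eu e), C (ev e)}" using trel_label[of e f "{x}"] by (auto simp: lcut_single)
    qed
    then have "card {x\<in>LB. \<exists>e\<in>t. e \<in> lcut C Al {x}} \<le> card {C (eu e), C (ev e)}" by (rule card_mono[rotated]) simp
    also have "\<dots> \<le> 2" using card_insert_le_m1[of 2 "{C (ev e)}" "C (eu e)"] by simp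
    finally show ?thesis .
  qed
  have "13 * card LB = (\<Sum>x\<in>LB. 13)" by simp
  also have "\<dots> \<le> (\<Sum>x\<in>LB. card (touching x))" by (rule sum_mono) (rule H)
  also have "\<dots> = (\<Sum>x\<in>LB. \<Sum>t\<in>?Th. of_bool (\<exists>e\<in>t. e \<in> lcut C Al {x}))"
    unfolding touching_def using finite_threads by (simp add: of_bool_def sum.If_cases Int_def)
  also have "\<dots> = (\<Sum>t\<in>?Th. \<Sum>x\<in>LB. of_bool (\<exists>e\<in>t. e \<in> lcut C Al {x}))" by (rule sum.swap)
  also have "\<dots> = (\<Sum>t\<in>?Th. card {x\<in>LB. \<exists>e\<in>t. e \<in> lcut C Al {x}})"
    using LB(1) by (simp add: of_bool_def sum.If_cases Int_def)
  also have "\<dots> \<le> (\<Sum>t\<in>?Th. 2)" by (rule sum_mono) (rule two)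
  also have "\<dots> \<le> 2 * (3 * (G + card LB))" using th by simp
  also have "\<dots> \<le> 12 * card LB" using LB(4) by simp
  finally show False using LB by (simp add: card_gt_0_iff)
qed

lemma small_label_weight:
  assumes x: "card (touching x) \<le> 12" and B: "0 \<le> B" "\<And>t. t \<in> Al // trel N F Al \<Longrightarrow> (\<Sum>e\<in>t. w e) \<le> 2 * B"
  shows "(\<Sum>e\<in>lcut C Al {x}. w e) \<le> 24 * B"
proof -
  have fT: "finite (touching x)" using finite_threads by (simp add: touching_def)
  have tAl: "t \<subseteq> Al" if "t \<in> touching x" for t using that in_quotient_imp_subset[OF equiv_trel, of t Al N F] by (simp add: touching_def)
  have ft: "finite t" if "t \<in> touching x" for t using tAl[OF that] finite_sub[OF Al] finite_subset by blast
  have sub: "lcut C Al {x} \<subseteq> \<Union> (touching x)"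
  proof
    fix e assume e: "e \<in> lcut C Al {x}"
    then have "e \<in> Al" by (simp add: lcut_def)
    then have "trel N F Al `` {e} \<in> Al // trel N F Al" "e \<in> trel N F Al `` {e}"
      using equiv_class_self[OF equiv_trel] by (auto intro: quotientI)
    then show "e \<in> \<Union> (touching x)" using e unfolding touching_def by blast
  qed
  have "(\<Sum>e\<in>lcut C Al {x}. w e) \<le> (\<Sum>e\<in>\<Union> (touching x). w e)"
    by (rule sum_mono2) (use fT ft sub tAl Al w_nonneg in blast)+
  also have "\<dots> = (\<Sum>t\<in>touching x. \<Sum>e\<in>t. w e)"
  proof (subst sum.Union_disjoint)
    show "\<forall>A\<in>touching x. finite A" using ft by blast
    show "\<forall>A\<in>touching x. \<forall>B\<in>touching x. A \<noteq> B \<longrightarrow> A \<inter> B = {}"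
      using quotient_disj[OF equiv_trel] unfolding touching_def by blast
  qed simp
  also have "\<dots> \<le> (\<Sum>t\<in>touching x. 2 * B)" by (rule sum_mono) (use B in \<open>auto simp: touching_def\<close>)
  also have "\<dots> = real (card (touching x)) * (2 * B)" by simp
  also have "\<dots> \<le> 12 * (2 * B)" using x B by (intro mult_right_mono) auto
  finally show ?thesis by simp
qed

text \<open>Each neighbouring cluster has a thread of its own, because all edges of a thread have
  the same two end clusters.\<close>

lemma small_label_nbrs:
  assumes x: "card (touching x) \<le> 12"
  shows "card {y. \<exists>e\<in>Al. {C (eu e), C (ev e)} = {x, y}} \<le> 12"
proof -
  have fT: "finite (touching x)" using finite_threads by (simp add: touching_def)
  define ch where "ch y = (SOME e. e \<in> Al \<and> {C (eu e), C (ev e)} = {x, y})" for y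
  let ?Y = "{y. \<exists>e\<in>Al. {C (eu e), C (ev e)} = {x, y}}"
  have ch: "ch y \<in> Al" "{C (eu (ch y)), C (ev (ch y))} = {x, y}" if "y \<in> ?Y" for y
  proof -
    have "\<exists>e. e \<in> Al \<and> {C (eu e), C (ev e)} = {x, y}" using that by blast
    from someI_ex[OF this] show "ch y \<in> Al" "{C (eu (ch y)), C (ev (ch y))} = {x, y}" unfolding ch_def by (rule conjunct1, rule conjunct2)
  qed
  have "card ?Y \<le> card (touching x)"
  proof (rule card_inj_on_le[where f="\<lambda>y. trel N F Al `` {ch y}"])
    show "inj_on (\<lambda>y. trel N F Al `` {ch y}) ?Y"
    proof (rule inj_onI)
      fix y y' assume y: "y \<in> ?Y" "y' \<in> ?Y" "trel N F Al `` {ch y} = trel N F Al `` {ch y'}"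
      then have r: "(ch y, ch y') \<in> trel N F Al"
        using eq_equiv_class[OF y(3) equiv_trel ch(1)[OF y(2)]] by blast
      have "ch y \<in> lcut C Al {z} \<longleftrightarrow> z = x \<or> z = y" "ch y' \<in> lcut C Al {z} \<longleftrightarrow> z = x \<or> z = y'" for z
        using ch[OF y(1)] ch[OF y(2)] by (auto simp: lcut_single doubleton_eq_iff)
      then have "(z = x \<or> z = y) = (z = x \<or> z = y')" for z using trel_label[OF r, of "{z}"] by simp
      moreover have "y \<noteq> x" "y' \<noteq> x" using ch[OF y(1)] ch[OF y(2)] proper[of "ch y"] proper[of "ch y'"] by (auto simp: doubleton_eq_iff)
      ultimately show "y = y'" by metis
    qed
    show "(\<lambda>y. trel N F Al `` {ch y}) ` ?Y \<subseteq> touching x"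
    proof
      fix t assume "t \<in> (\<lambda>y. trel N F Al `` {ch y}) ` ?Y"
      then obtain y where y: "y \<in> ?Y" "t = trel N F Al `` {ch y}" by blast
      have "ch y \<in> t" "t \<in> Al // trel N F Al" using y ch(1)[OF y(1)] equiv_class_self[OF equiv_trel] by (auto intro: quotientI)
      moreover have "ch y \<in> lcut C Al {x}" using ch[OF y(1)] by (auto simp: lcut_single doubleton_eq_iff)
      ultimately show "t \<in> touching x" by (auto simp: touching_def)
    qed
  qed (rule fT)
  then show ?thesis using x by simp
qed

end

end

subsection \<open>Walks through digons\<close>

text \<open>Both ways for a walk to end are covered: at a class that is no digon, where the
  condition is void, and at a digon leading to an edge visited before.\<close>

definition stopped :: "nat \<Rightarrow> (nat \<Rightarrow> nat) \<Rightarrow> nat set \<Rightarrow> nat list \<Rightarrow> bool" where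
  "stopped N F Al ss \<longleftrightarrow> (\<forall>t. ed N t \<in> Al \<and> t \<noteq> last ss \<and> F t = F (last ss) \<and> pc N F Al (F t) = 2 \<longrightarrow> ed N t \<in> ed N ` set ss)"

lemma digon_two:
  assumes "finite Al" "Al \<subseteq> {..<N}" "pc N F Al c = 2" "ed N a \<in> Al" "F a = c" "ed N b \<in> Al" "F b = c" "a \<noteq> b" "ed N t \<in> Al" "F t = c"
  shows "t = a \<or> t = b"
proof -
  have "card {s. ed N s \<in> Al \<and> F s = c} = 2" using assms(3) pc_card(2)[OF assms(1,2), of F c] by simp
  then obtain p q where pq: "{s. ed N s \<in> Al \<and> F s = c} = {p, q}" unfolding card_2_iff by blast
  have "a \<in> {p, q}" "b \<in> {p, q}" "t \<in> {p, q}" using assms unfolding pq[symmetric] by auto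
  then show ?thesis using assms(8) by auto
qed

lemma op_op: "s < 2 * N \<Longrightarrow> op N (op N s) = s" by (auto simp: op_def)
lemma ed_op[simp]: "s < 2 * N \<Longrightarrow> ed N (op N s) = ed N s" by (auto simp: op_def ed_def)
lemma ed_lt: "ed N s < N \<Longrightarrow> s < 2 * N" by (auto simp: ed_def split: if_splits)
lemma ed_eq: "ed N s = ed N t \<Longrightarrow> ed N s < N \<Longrightarrow> s = t \<or> s = op N t" by (auto simp: ed_def op_def split: if_splits)

text \<open>A digon at the forward side of a visited edge leads to the next edge of
  \<open>ss\<close>; one at the backward side leads to the previous edge or, at the start, to the
  second edge of \<open>ss'\<close>, which begins at the other side of the same edge. Where a walk
  ends, \<open>stopped\<close> takes over.\<close>

lemma walk_cover_half:
  assumes Al: "finite Al" "Al \<subseteq> {..<N}" and T: "thread N F Al ss" "thread N F Al ss'" and hd: "hd ss' = op N (hd ss)"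
    and st: "stopped N F Al ss" "stopped N F Al ss'" and e: "e \<in> ed N ` set ss" and ef: "(e, f) \<in> dlink N F Al"
  shows "f \<in> ed N ` set ss \<union> ed N ` set ss'"
proof -
  obtain s t where s: "e \<in> Al" "f \<in> Al" "ed N s = e" "ed N t = f" "F s = F t" "pc N F Al (F s) = 2"
    using ef by (auto simp: dlink_def)
  obtain j where j: "j < length ss" "e = ed N (ss ! j)" using e by (auto simp: in_set_conv_nth)
  have m: "ed N (ss ! i) \<in> Al" if "i < length ss" for i using T(1) that by (auto simp: thread_def)
  have m': "ed N (ss' ! i) \<in> Al" if "i < length ss'" for i using T(2) that by (auto simp: thread_def)
  have lt: "a < 2 * N" if "ed N a \<in> Al" for a using that Al(2) ed_lt by blast
  have lk: "F (ss ! i) = F (op N (ss ! Suc i))" "ss ! i \<noteq> op N (ss ! Suc i)" if "Suc i < length ss" for i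
  proof -
    show "F (ss ! i) = F (op N (ss ! Suc i))" using T(1) that by (auto simp: thread_def)
    have "ed N (ss ! i) \<noteq> ed N (ss ! Suc i)" using T(1) that by (auto simp: thread_def distinct_conv_nth)
    then show "ss ! i \<noteq> op N (ss ! Suc i)" using lt[OF m[OF that]] by auto
  qed
  have lk': "F (ss' ! i) = F (op N (ss' ! Suc i))" "ss' ! i \<noteq> op N (ss' ! Suc i)" if "Suc i < length ss'" for i
  proof -
    show "F (ss' ! i) = F (op N (ss' ! Suc i))" using T(2) that by (auto simp: thread_def)
    have "ed N (ss' ! i) \<noteq> ed N (ss' ! Suc i)" using T(2) that by (auto simp: thread_def distinct_conv_nth)
    then show "ss' ! i \<noteq> op N (ss' ! Suc i)" using lt[OF m'[OF that]] by auto
  qed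
  have ne: "ss \<noteq> []" "ss' \<noteq> []" using T by (auto simp: thread_def)
  show ?thesis
  proof (cases "t = s")
    case True then show ?thesis using s e by auto
  next
    case ts: False
    have "s = ss ! j \<or> s = op N (ss ! j)" by (rule ed_eq) (use j s Al in auto)
    then show ?thesis
    proof
      assume sj: "s = ss ! j"
      show ?thesis
      proof (cases "Suc j < length ss")
        case True
        have "t = ss ! j \<or> t = op N (ss ! Suc j)"
          by (rule digon_two[OF Al s(6) m[OF j(1)] _ _ _ lk(2)[OF True]])
            (use sj lk(1)[OF True] m[OF True] lt[OF m[OF True]] s(2,4,5) in simp_all)
        then have "t = op N (ss ! Suc j)" using ts sj by simp
        then have "f = ed N (ss ! Suc j)" using s(4) lt[OF m[OF True]] by simp
        then show ?thesis using True by auto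
      next
        case False
        then have "j = length ss - 1" using j by simp
        then have la: "last ss = s" using sj by (simp add: last_conv_nth ne)
        have "ed N t \<in> ed N ` set ss" using st(1)[unfolded stopped_def, rule_format, of t] ts s unfolding la by simp
        then show ?thesis using s(4) by simp
      qed
    next
      assume sj: "s = op N (ss ! j)"
      show ?thesis
      proof (cases j)
        case 0
        then have s0: "s = ss' ! 0" using sj hd ne by (simp add: hd_conv_nth)
        show ?thesis
        proof (cases "Suc 0 < length ss'")
          case True
          have "t = ss' ! 0 \<or> t = op N (ss' ! Suc 0)"
            by (rule digon_two[OF Al s(6) _ _ _ _ lk'(2)[OF True]])
              (use s0 lk'(1)[OF True] m'[OF True] lt[OF m'[OF True]] s(1-5) in simp_all)
          then have "t = op N (ss' ! Suc 0)" using ts s0 by simp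
          then have "f = ed N (ss' ! Suc 0)" using s(4) lt[OF m'[OF True]] by simp
          then show ?thesis using True by auto
        next
          case False
          then have la: "last ss' = s" using ne(2) s0 by (cases ss') auto
          have "ed N t \<in> ed N ` set ss'" using st(2)[unfolded stopped_def, rule_format, of t] ts s unfolding la by simp
          then show ?thesis using s(4) by simp
        qed
      next
        case (Suc i)
        then have i: "Suc i < length ss" using j by simp
        have "t = ss ! i \<or> t = op N (ss ! Suc i)"
          by (rule digon_two[OF Al s(6) m _ _ _ lk(2)[OF i]])
            (use sj lk(1)[OF i] m[OF i] lt[OF m[OF i]] s(1-5) i Suc in simp_all)
        then have "t = ss ! i" using ts sj Suc by simp
        then have "f = ed N (ss ! i)" using s(4) by simp
        then show ?thesis using i by auto
      qed
    qed
  qed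
qed

text \<open>The walks from the two sides of an edge exhaust its thread, so the heavier one carries
  at least half of its weight.\<close>

lemma walk_cover:
  assumes Al: "finite Al" "Al \<subseteq> {..<N}" and T: "thread N F Al ss" "thread N F Al ss'" and hd: "hd ss' = op N (hd ss)"
    and st: "stopped N F Al ss" "stopped N F Al ss'" and r: "(ed N (hd ss), f) \<in> trel N F Al"
  shows "f \<in> ed N ` set ss \<union> ed N ` set ss'"
proof (rule trel_closed[OF _ r])
  have "ss \<noteq> []" using T by (auto simp: thread_def)
  then show "ed N (hd ss) \<in> ed N ` set ss \<union> ed N ` set ss'" by auto
  have "ed N (hd ss) \<in> Al" using T(1) \<open>ss \<noteq> []\<close> by (auto simp: thread_def)
  then have "hd ss < 2 * N" using Al ed_lt by blast
  then have hd': "hd ss = op N (hd ss')" using hd by (simp add: op_op)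
  show "f \<in> ed N ` set ss \<union> ed N ` set ss'" if "(e, f) \<in> dlink N F Al" "e \<in> ed N ` set ss \<union> ed N ` set ss'" for e f
    using that walk_cover_half[OF Al T hd st] walk_cover_half[OF Al T(2,1) hd' st(2,1)] by blast
qed

subsection \<open>The invariant\<close>

locale alg = wg +
  fixes A :: "nat set" and \<beta> :: real and a g :: nat
  assumes A: "A \<subseteq> {..<n}" "card A = a" "1 \<le> a" and beta: "0 < \<beta>"
    and thickE: "\<And>U. U \<noteq> {} \<Longrightarrow> U \<subset> {..<n} \<Longrightarrow> \<beta> \<le> sum w (cutE U)"
    and loopfree: "\<And>e. e \<in> E \<Longrightarrow> eu e \<noteq> ev e"
begin

definition kap :: real where "kap = \<beta> / (72 * real a)"
lemma kap_pos: "0 < kap" using A beta by (simp add: kap_def)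

lemma finA: "finite A" using A finite_subset by blast

text \<open>
  \<open>C v\<close> is the representative of the cluster of \<open>v\<close>, and \<open>K v\<close> is \<open>0\<close> if that cluster is unmarked and
  \<open>r + 1\<close> if it has been attached to the apex \<open>r\<close>.
\<close>

definition alive :: "(nat \<Rightarrow> nat) \<Rightarrow> (nat \<Rightarrow> nat) \<Rightarrow> nat set" where
  "alive C K = {e\<in>E. K (eu e) = 0 \<and> K (ev e) = 0 \<and> C (eu e) \<noteq> C (ev e)}"

text \<open>
  \<open>TH\<close> are the tree edges from merging clusters and \<open>Rem\<close> the edges of the threads along which
  clusters have been merged; these pay for the tree edges and for the odd classes of a cut.
\<close>

definition core :: "(nat \<Rightarrow> nat) \<Rightarrow> nat set \<Rightarrow> (nat \<Rightarrow> nat) \<Rightarrow> nat set \<Rightarrow> nat set \<Rightarrow> bool" where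
  "core C Al F TH Rem \<longleftrightarrow> topo (2 ^ (2 * g)) Al F C \<and> Al \<subseteq> E \<and> TH \<subseteq> E \<and> Rem \<subseteq> E \<and> Rem \<inter> Al = {} \<and>
     (\<forall>e\<in>Rem. C (eu e) = C (ev e)) \<and>
     (\<forall>U. kap / 2 * (2 * real (card (TH \<inter> cutE U)) + real (card (oc N F (cutE U \<inter> Al)))) \<le> 4 * sum w (cutE U \<inter> Rem))"

lemma finite_cutE[simp]: "finite (cutE U)" by (rule finite_sub) (auto simp: cutE_def)

lemma sum_w_mono: "X \<subseteq> Y \<Longrightarrow> Y \<subseteq> E \<Longrightarrow> sum w X \<le> sum w Y"
  by (rule sum_mono2) (use finite_sub w_nonneg in auto)

lemma sum_w_nonneg: "X \<subseteq> E \<Longrightarrow> 0 \<le> sum w X" by (rule sum_nonneg) (use w_nonneg in auto)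

lemma sum_w_Un: "X \<subseteq> E \<Longrightarrow> Y \<subseteq> E \<Longrightarrow> sum w (X \<union> Y) \<le> sum w X + sum w Y"
  using sum_Un[of X Y w] finite_sub sum_w_nonneg[of "X \<inter> Y"] by fastforce

lemma core_free:
  assumes "core C Al F TH Rem" "e \<in> Al"
  shows "core C (Al - {e}) (mrg (F e) (F (e + N)) F) TH Rem"
  unfolding core_def
proof (intro conjI allI)
  have c: "topo (2 ^ (2 * g)) Al F C" "Al \<subseteq> E" "TH \<subseteq> E" "Rem \<subseteq> E" "Rem \<inter> Al = {}" "\<forall>e\<in>Rem. C (eu e) = C (ev e)"
    "\<And>U. kap / 2 * (2 * real (card (TH \<inter> cutE U)) + real (card (oc N F (cutE U \<inter> Al)))) \<le> 4 * sum w (cutE U \<inter> Rem)"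
    using assms(1) unfolding core_def by auto
  show "topo (2 ^ (2 * g)) (Al - {e}) (mrg (F e) (F (e + N)) F) C" using topo_free[OF c(1,2) assms(2)] .
  show "Al - {e} \<subseteq> E" "TH \<subseteq> E" "Rem \<subseteq> E" "Rem \<inter> (Al - {e}) = {}" "\<forall>e\<in>Rem. C (eu e) = C (ev e)" using c by auto
  fix U
  have "cutE U \<inter> (Al - {e}) = (cutE U \<inter> Al) - {e}" by auto
  then have "card (oc N (mrg (F e) (F (e + N)) F) (cutE U \<inter> (Al - {e}))) \<le> card (oc N F (cutE U \<inter> Al))"
    using oc_free_card[of "cutE U \<inter> Al" N F e] by simp
  then have "kap / 2 * (2 * real (card (TH \<inter> cutE U)) + real (card (oc N (mrg (F e) (F (e + N)) F) (cutE U \<inter> (Al - {e})))))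
     \<le> kap / 2 * (2 * real (card (TH \<inter> cutE U)) + real (card (oc N F (cutE U \<inter> Al))))"
    using kap_pos by (intro mult_left_mono) auto
  then show "kap / 2 * (2 * real (card (TH \<inter> cutE U)) + real (card (oc N (mrg (F e) (F (e + N)) F) (cutE U \<inter> (Al - {e})))))
     \<le> 4 * sum w (cutE U \<inter> Rem)" using c(7)[of U] by linarith
qed

text \<open>For a union of clusters the right-hand side of the potential inequality is 0, because
  \<open>Rem\<close> lies inside clusters. So evenness of the contracted cuts is contained in that
  inequality.\<close>

lemma core_even: assumes "core C Al F TH Rem" shows "oc N F (lcut C Al L) = {}"
proof -
  let ?U = "{v. C v \<in> L}"
  have c: "Al \<subseteq> E" "\<forall>e\<in>Rem. C (eu e) = C (ev e)"
    "kap / 2 * (2 * real (card (TH \<inter> cutE ?U)) + real (card (oc N F (cutE ?U \<inter> Al)))) \<le> 4 * sum w (cutE ?U \<inter> Rem)"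
    using assms unfolding core_def by auto
  have 1: "cutE ?U \<inter> Al = lcut C Al L" using c(1) by (auto simp: cutE_def lcut_def)
  have 2: "cutE ?U \<inter> Rem = {}" using c(2) by (auto simp: cutE_def)
  have "kap / 2 * (2 * real (card (TH \<inter> cutE ?U)) + real (card (oc N F (lcut C Al L)))) \<le> 0" using c(3) unfolding 1 2 by simp
  then have "2 * real (card (TH \<inter> cutE ?U)) + real (card (oc N F (lcut C Al L))) \<le> 0" using kap_pos by (simp add: mult_le_0_iff)
  then have "card (oc N F (lcut C Al L)) = 0" by linarith
  moreover have "finite (lcut C Al L)" using finite_sub[OF c(1)] by (auto simp: lcut_def)
  ultimately show ?thesis by simp
qed

lemma thread_trel:
  assumes T: "thread N F Al ss" and Al: "Al \<subseteq> E" and s: "s \<in> set ss" "t \<in> set ss"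
  shows "(ed N s, ed N t) \<in> trel N F Al"
proof -
  have m: "ed N (ss ! i) \<in> Al" if "i < length ss" for i using T that by (auto simp: thread_def)
  have lt: "x < 2 * N" if "ed N x \<in> Al" for x using that Al E_sub ed_lt[of N x] by blast
  have d: "(ed N (ss ! i), ed N (ss ! Suc i)) \<in> dlink N F Al" if i: "Suc i < length ss" for i
    unfolding dlink_def
    by (intro CollectI case_prodI conjI exI[of _ "ss ! i"] exI[of _ "op N (ss ! Suc i)"])
      (use T i m[of i] m[OF i] lt[OF m[OF i]] in \<open>auto simp: thread_def\<close>)
  have "(ed N (ss ! 0), ed N (ss ! i)) \<in> trel N F Al" if "i < length ss" for i using that
  proof (induction i)
    case 0
    then show ?case using m[of 0] by (auto simp: trel_def)
  next
    case (Suc i)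
    then show ?case using d[of i] m[of "Suc i"] m[of 0] by (auto simp: trel_def intro: rtrancl_into_rtrancl)
  qed
  then have "(ed N (ss ! 0), ed N s) \<in> trel N F Al" "(ed N (ss ! 0), ed N t) \<in> trel N F Al" using s by (metis in_set_conv_nth)+
  then show ?thesis using equiv_trel[of Al N F] by (meson equiv_def symE transE)
qed

lemma thread_labels:
  assumes c: "core C Al F TH Rem" and proper: "\<And>e. e \<in> Al \<Longrightarrow> C (eu e) \<noteq> C (ev e)"
    and T: "thread N F Al ss" and e: "e \<in> ed N ` set ss" "{C (eu e), C (ev e)} = {x, y}" and f: "f \<in> ed N ` set ss"
  shows "{C (eu f), C (ev f)} = {x, y}"
proof -
  have Al: "Al \<subseteq> E" using c by (simp add: core_def)
  have "(e, f) \<in> trel N F Al" using thread_trel[OF T Al] e f by auto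
  then have "f \<in> lcut C Al {z}" if "e \<in> lcut C Al {z}" for z using trel_label[OF Al core_even[OF c] proper] that by blast
  moreover have "e \<in> Al" "f \<in> Al" using e f T by (auto simp: thread_def)
  ultimately have fz: "C (eu f) = z \<or> C (ev f) = z" if "C (eu e) = z \<or> C (ev e) = z" for z
    using that lcut_single[OF Al core_even[OF c] proper] by blast
  have "x \<noteq> y" using proper[OF \<open>e \<in> Al\<close>] e(2) by (auto simp: doubleton_eq_iff)
  then show ?thesis using fz[of x] fz[of y] e(2) by (auto simp: doubleton_eq_iff)
qed

text \<open>The potential inequality changes by one application of \<open>thread_cut_bound\<close>
  with \<open>h = kap / 2\<close>: the edge \<open>e\<close> joins \<open>TH\<close>, and the walk
  moves from the alive edges to \<open>Rem\<close>.\<close>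

lemma core_merge:
  assumes c: "core C Al F TH Rem" and proper: "\<And>e. e \<in> Al \<Longrightarrow> C (eu e) \<noteq> C (ev e)"
    and T: "thread N F Al ss" and P: "P = ed N ` set ss" and j: "j < length ss" "e = ed N (ss ! j)"
    and h: "kap / 2 \<le> (\<Sum>i\<le>j. w (ed N (ss ! i)))" "kap / 2 \<le> (\<Sum>i=j..<length ss. w (ed N (ss ! i)))"
    and xy: "{C (eu e), C (ev e)} = {x, y}" and C': "\<And>v. C' v = (if C v = y then x else C v)"
  shows "core C' (Al - P) F (insert e TH) (Rem \<union> P)"
  unfolding core_def
proof (intro conjI allI)
  have c': "topo (2 ^ (2 * g)) Al F C" "Al \<subseteq> E" "TH \<subseteq> E" "Rem \<subseteq> E" "Rem \<inter> Al = {}" "\<forall>e\<in>Rem. C (eu e) = C (ev e)"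
    "\<And>U. kap / 2 * (2 * real (card (TH \<inter> cutE U)) + real (card (oc N F (cutE U \<inter> Al)))) \<le> 4 * sum w (cutE U \<inter> Rem)"
    using c unfolding core_def by auto
  have PAl: "P \<subseteq> Al" using T by (auto simp: P thread_def)
  have eP: "e \<in> P" using j by (auto simp: P)
  have lab: "{C (eu f), C (ev f)} = {x, y}" if "f \<in> P" for f
    using thread_labels[OF c proper T _ xy] eP that unfolding P by blast
  show "topo (2 ^ (2 * g)) (Al - P) F C'" by (rule topo_merge[OF c'(1) PAl eP xy C' lab])
  show "Al - P \<subseteq> E" "insert e TH \<subseteq> E" "Rem \<union> P \<subseteq> E" "(Rem \<union> P) \<inter> (Al - P) = {}" using c' PAl eP by auto
  show "\<forall>e\<in>Rem \<union> P. C' (eu e) = C' (ev e)" using c'(6) lab by (auto simp: C' doubleton_eq_iff)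
  fix U
  let ?S = "cutE U \<inter> Al"
  have B: "kap / 2 * (2 * of_bool (e \<in> ?S) + real (card (oc N F (?S - P)))) \<le> kap / 2 * real (card (oc N F ?S)) + 4 * (\<Sum>e\<in>?S \<inter> P. w e)"
    unfolding j(2)
    by (rule thread_cut_bound[OF T finite_sub[OF c'(2)] _ _ j(1) P]) (use c' E_sub w_nonneg kap_pos h in auto)
  have s1: "?S - P = cutE U \<inter> (Al - P)" by auto
  have s2: "?S \<inter> P = cutE U \<inter> P" using PAl by auto
  have s3: "sum w (cutE U \<inter> (Rem \<union> P)) = sum w (cutE U \<inter> Rem) + sum w (cutE U \<inter> P)"
    unfolding Int_Un_distrib by (rule sum.union_disjoint) (use c' PAl in auto)
  have "card (insert e TH \<inter> cutE U) \<le> card (TH \<inter> cutE U) + of_bool (e \<in> ?S)"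
  proof (cases "e \<in> cutE U")
    case True
    then have "insert e TH \<inter> cutE U = insert e (TH \<inter> cutE U)" by auto
    then show ?thesis using True eP PAl card_insert_le_m1[of "Suc (card (TH \<inter> cutE U))" "TH \<inter> cutE U" e] by auto
  next
    case False
    then have "insert e TH \<inter> cutE U = TH \<inter> cutE U" by auto
    then show ?thesis by simp
  qed
  then have "real (card (insert e TH \<inter> cutE U)) \<le> real (card (TH \<inter> cutE U)) + of_bool (e \<in> ?S)"
    by (cases "e \<in> ?S") auto
  then have "kap / 2 * (2 * real (card (insert e TH \<inter> cutE U)) + real (card (oc N F (cutE U \<inter> (Al - P)))))
    \<le> kap / 2 * (2 * (real (card (TH \<inter> cutE U)) + of_bool (e \<in> ?S)) + real (card (oc N F (cutE U \<inter> (Al - P)))))"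
    using kap_pos by (intro mult_left_mono) auto
  then show "kap / 2 * (2 * real (card (insert e TH \<inter> cutE U)) + real (card (oc N F (cutE U \<inter> (Al - P))))) \<le> 4 * sum w (cutE U \<inter> (Rem \<union> P))"
    using B c'(7)[of U] unfolding s1 s2 s3 by (simp add: algebra_simps)
qed

section \<open>Forests by fundamental cuts\<close>

definition tadj :: "nat set \<Rightarrow> (nat \<times> nat) set" where
  "tadj T = {(x, y). \<exists>e\<in>T. {x, y} = {eu e, ev e}}"

lemma tadj_sym: "(x, y) \<in> (tadj T)\<^sup>* \<Longrightarrow> (y, x) \<in> (tadj T)\<^sup>*"
proof -
  have "sym (tadj T)" by (auto simp: sym_def tadj_def insert_commute)
  then show "(x, y) \<in> (tadj T)\<^sup>* \<Longrightarrow> (y, x) \<in> (tadj T)\<^sup>*" using sym_rtrancl by (metis symE)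
qed

lemma tadj_mono: "T \<subseteq> T' \<Longrightarrow> (x, y) \<in> (tadj T)\<^sup>* \<Longrightarrow> (x, y) \<in> (tadj T')\<^sup>*"
  by (erule rtrancl_mono[THEN subsetD, rotated]) (auto simp: tadj_def)

lemma cutE_symdiff: "cutE (sym_diff U V) = sym_diff (cutE U) (cutE V)" by (auto simp: cutE_def)

text \<open>Acyclicity is expressed by fundamental cuts: each edge is alone in some cut. If the new
  edge crosses the old witness \<open>U\<close>, the symmetric difference with \<open>X\<close>
  repairs it, since \<open>X\<close> is crossed by the new edge but by no old one.\<close>

lemma forest_insert:
  assumes "\<forall>e\<in>T. \<exists>U. T \<inter> cutE U = {e}" "T \<inter> cutE X = {}" "e' \<in> cutE X"
  shows "\<forall>e\<in>insert e' T. \<exists>U. insert e' T \<inter> cutE U = {e}"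
proof
  fix e assume e: "e \<in> insert e' T"
  show "\<exists>U. insert e' T \<inter> cutE U = {e}"
  proof (cases "e = e'")
    case True
    then show ?thesis using assms(2,3) by (intro exI[of _ X]) auto
  next
    case False
    then obtain U where U: "T \<inter> cutE U = {e}" using e assms(1) by blast
    show ?thesis
    proof (cases "e' \<in> cutE U")
      case True
      have "insert e' T \<inter> cutE (sym_diff U X) = {e}" unfolding cutE_symdiff
      proof (intro set_eqI iffI)
        fix f assume "f \<in> insert e' T \<inter> sym_diff (cutE U) (cutE X)"
        then show "f \<in> {e}" using True assms(2,3) U by blast
      next
        fix f assume "f \<in> {e}"
        then show "f \<in> insert e' T \<inter> sym_diff (cutE U) (cutE X)" using assms(2) U by blast
      qed
      then show ?thesis by blast
    next
      case False
      then show ?thesis using U by (intro exI[of _ U]) auto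
    qed
  qed
qed

text \<open>
  \<open>opp K U\<close> are the vertices that \<open>U\<close> separates from their apex, \<open>DS\<close> the edges from them to unmarked
  vertices, and \<open>Qp\<close> the pairs of a separated cluster and an unmarked cluster adjacent to it.  As
  clusters get marked, the weight of \<open>DS\<close> becomes weight in the cut and each pair in \<open>Qp\<close> may become
  an edge of \<open>TM\<close>.
\<close>

definition opp :: "(nat \<Rightarrow> nat) \<Rightarrow> nat set \<Rightarrow> nat set" where
  "opp K U = {v. v < n \<and> K v \<noteq> 0 \<and> (v \<in> U) \<noteq> (K v - 1 \<in> U)}"
definition bad :: "(nat \<Rightarrow> nat) \<Rightarrow> (nat \<Rightarrow> nat) \<Rightarrow> nat set \<Rightarrow> nat set" where
  "bad C K U = C ` opp K U"
definition DS :: "(nat \<Rightarrow> nat) \<Rightarrow> nat set \<Rightarrow> nat set" where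
  "DS K U = {e\<in>E. (eu e \<in> opp K U \<and> K (ev e) = 0) \<or> (ev e \<in> opp K U \<and> K (eu e) = 0)}"
definition Emm :: "(nat \<Rightarrow> nat) \<Rightarrow> nat set" where
  "Emm K = {e\<in>E. K (eu e) \<noteq> 0 \<and> K (ev e) \<noteq> 0}"
definition Qp :: "(nat \<Rightarrow> nat) \<Rightarrow> (nat \<Rightarrow> nat) \<Rightarrow> nat set \<Rightarrow> (nat \<times> nat) set" where
  "Qp C K U = {(x, y). x \<in> bad C K U \<and> (\<exists>e\<in>E. (C (eu e) = x \<and> C (ev e) = y \<and> K (ev e) = 0) \<or> (C (ev e) = x \<and> C (eu e) = y \<and> K (eu e) = 0))}"
definition inner :: "(nat \<Rightarrow> nat) \<Rightarrow> nat \<Rightarrow> nat set" where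
  "inner C x = {e\<in>E. C (eu e) = x \<and> C (ev e) = x}"

definition labels_ok :: "(nat \<Rightarrow> nat) \<Rightarrow> (nat \<Rightarrow> nat) \<Rightarrow> bool" where
  "labels_ok C K \<longleftrightarrow> (\<forall>v<n. C v < n \<and> C (C v) = C v \<and> K (C v) = K v) \<and>
     (\<forall>v<n. K v \<noteq> 0 \<longrightarrow> (\<exists>r\<in>A. K v = Suc r)) \<and> (\<forall>r\<in>A. K r = Suc r)"
definition tree_ok :: "(nat \<Rightarrow> nat) \<Rightarrow> (nat \<Rightarrow> nat) \<Rightarrow> nat set \<Rightarrow> bool" where
  "tree_ok C K T \<longleftrightarrow> T \<subseteq> E \<and> (\<forall>e\<in>T. C (eu e) = C (ev e) \<or> (K (eu e) = K (ev e) \<and> K (eu e) \<noteq> 0)) \<and>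
     (\<forall>v<n. (v, C v) \<in> (tadj T)\<^sup>* \<and> (\<forall>r. K v = Suc r \<longrightarrow> (v, r) \<in> (tadj T)\<^sup>*)) \<and>
     (\<forall>e\<in>T. \<exists>U. T \<inter> cutE U = {e})"
text \<open>\<open>hs\<close> records whether clusters have been merged yet, and \<open>hm\<close>
  is the weight of the lightest walk used. Before the first merger all clusters are singletons; this
  is the content of the second clause when \<open>hs\<close> is false.\<close>

definition split_ok :: "(nat \<Rightarrow> nat) \<Rightarrow> bool \<Rightarrow> real \<Rightarrow> bool" where
  "split_ok C hs hm \<longleftrightarrow> (hs \<longrightarrow> kap \<le> hm) \<and>
     (\<forall>U v v'. v < n \<and> v' < n \<and> C v = C v' \<and> v \<in> U \<and> v' \<notin> U \<longrightarrow> hs \<and> hm \<le> sum w (cutE U \<inter> inner C (C v)))"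
definition mark_ok :: "(nat \<Rightarrow> nat) \<Rightarrow> (nat \<Rightarrow> nat) \<Rightarrow> nat set \<Rightarrow> bool" where
  "mark_ok C K TM \<longleftrightarrow> TM \<subseteq> E \<and> (\<forall>U. kap * real (card (bad C K U)) + sum w (DS K U) \<le> 25 * sum w (cutE U \<inter> Emm K) \<and>
      card (TM \<inter> cutE U) + card (Qp C K U) \<le> 13 * card (bad C K U))"

text \<open>The program stores the forest \<open>T\<close> but not its division into merging and
  marking edges; that division and \<open>Rem\<close> are bookkeeping of the proof and hence
  quantified.\<close>

definition INV :: "(nat \<Rightarrow> nat) \<Rightarrow> (nat \<Rightarrow> nat) \<Rightarrow> (nat \<Rightarrow> nat) \<Rightarrow> nat set \<Rightarrow> bool \<Rightarrow> real \<Rightarrow> bool" where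
  "INV C K F T hs hm \<longleftrightarrow> labels_ok C K \<and> tree_ok C K T \<and> split_ok C hs hm \<and>
     (\<exists>TH TM Rem. T \<subseteq> TH \<union> TM \<and> core C (alive C K) F TH Rem \<and> mark_ok C K TM)"

section \<open>Marking and merging preserve the invariant\<close>

lemma finite_opp[simp]: "finite (opp K U)" by (auto simp: opp_def)
lemma finite_bad[simp]: "finite (bad C K U)" by (simp add: bad_def)
lemma finite_Qp[simp]: "finite (Qp C K U)"
proof -
  have "Qp C K U \<subseteq> bad C K U \<times> (C ` (eu ` E \<union> ev ` E))" by (auto simp: Qp_def)
  then show ?thesis by (rule finite_subset) simp
qed

text \<open>The vertex set of an unmarked cluster is a cut without tree edges, since these lie
  inside a cluster or join vertices marked with the same apex.\<close>

lemma tree_insert: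
  assumes L: "labels_ok C K" and T: "tree_ok C K T" and e: "e \<in> E"
    and x: "K x = 0" "x < n" and cr: "(C (eu e) = x) \<noteq> (C (ev e) = x)"
  shows "\<forall>f\<in>insert e T. \<exists>U. insert e T \<inter> cutE U = {f}"
proof (rule forest_insert)
  show "\<forall>e\<in>T. \<exists>U. T \<inter> cutE U = {e}" using T by (simp add: tree_ok_def)
  show "e \<in> cutE {v. C v = x}" using e cr by (auto simp: cutE_def)
  show "T \<inter> cutE {v. C v = x} = {}"
  proof (rule ccontr)
    assume "T \<inter> cutE {v. C v = x} \<noteq> {}"
    then obtain f where f: "f \<in> T" "(C (eu f) = x) \<noteq> (C (ev f) = x)" by (auto simp: cutE_def)
    have fE: "f \<in> E" using f T by (auto simp: tree_ok_def)
    have K: "K (eu f) = K (ev f)" "K (eu f) \<noteq> 0" using f T by (auto simp: tree_ok_def)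
    have "K (C (eu f)) = K (eu f)" "K (C (ev f)) = K (ev f)" using L ends[OF fE] by (auto simp: labels_ok_def)
    then show False using f(2) K x by auto
  qed
qed

text \<open>Every edge leaving the cluster \<open>x\<close> is alive or runs to one of the
  \<open>a\<close> apex groups, and thickness bounds the total weight from below.\<close>

lemma mark_weights:
  assumes L: "labels_ok C K" and x: "x < n" "C x = x" "K x = 0"
    and Lr: "\<And>r. Lr r = {e\<in>E. (C (eu e) = x \<and> K (ev e) = Suc r) \<or> (C (ev e) = x \<and> K (eu e) = Suc r)}"
    and m: "\<And>r'. r' \<in> A \<Longrightarrow> sum w (Lr r') \<le> M"
  shows "\<beta> \<le> sum w (lcut C (alive C K) {x}) + real a * M"
proof -
  let ?X = "{v. v < n \<and> C v = x}"
  have KC: "K (C v) = K v" if "v < n" for v using L that by (auto simp: labels_ok_def)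
  obtain r where r: "r \<in> A" using A(2,3) by fastforce
  have "r < n" "K r \<noteq> 0" using r A L by (auto simp: labels_ok_def)
  then have "r \<notin> ?X" using KC[of r] x by auto
  then have "\<beta> \<le> sum w (cutE ?X)" by (intro thickE) (use x \<open>r < n\<close> in auto)
  also have "\<dots> \<le> sum w (lcut C (alive C K) {x} \<union> (cutE ?X - lcut C (alive C K) {x}))" by (rule sum_w_mono) (auto simp: cutE_def lcut_def alive_def)
  also have "\<dots> \<le> sum w (lcut C (alive C K) {x}) + sum w (cutE ?X - lcut C (alive C K) {x})"
    by (rule sum_w_Un) (auto simp: cutE_def lcut_def alive_def)
  also have "sum w (cutE ?X - lcut C (alive C K) {x}) \<le> (\<Sum>e\<in>cutE ?X - lcut C (alive C K) {x}. \<Sum>r\<in>A. if e \<in> Lr r then w e else 0)"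
  proof (rule sum_mono)
    fix e assume e: "e \<in> cutE ?X - lcut C (alive C K) {x}"
    then have eE: "e \<in> E" by (auto simp: cutE_def)
    have en: "eu e < n" "ev e < n" using ends[OF eE] by auto
    have cr: "(C (eu e) = x) \<noteq> (C (ev e) = x)" using e en by (auto simp: cutE_def)
    obtain v where v: "v < n" "C v \<noteq> x" "(C (eu e) = x \<and> v = ev e) \<or> (C (ev e) = x \<and> v = eu e)" using cr en by blast
    have "K v \<noteq> 0"
    proof
      assume "K v = 0"
      then have "e \<in> lcut C (alive C K) {x}" using v eE cr KC[OF en(1)] KC[OF en(2)] x by (auto simp: lcut_def alive_def)
      then show False using e by blast
    qed
    then obtain r where r: "r \<in> A" "K v = Suc r" using L v(1) by (auto simp: labels_ok_def)
    have "e \<in> Lr r" using v(3) r eE by (auto simp: Lr)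
    then have "w e = (if e \<in> Lr r then w e else 0)" by simp
    also have "\<dots> \<le> (\<Sum>r\<in>A. if e \<in> Lr r then w e else 0)"
      by (rule member_le_sum) (use r finA w_nonneg[OF eE] in auto)
    finally show "w e \<le> (\<Sum>r\<in>A. if e \<in> Lr r then w e else 0)" .
  qed
  also have "\<dots> = (\<Sum>r\<in>A. \<Sum>e\<in>cutE ?X - lcut C (alive C K) {x}. if e \<in> Lr r then w e else 0)" by (rule sum.swap)
  also have "\<dots> \<le> (\<Sum>r\<in>A. M)"
  proof (rule sum_mono)
    fix r assume r: "r \<in> A"
    have "(\<Sum>e\<in>cutE ?X - lcut C (alive C K) {x}. if e \<in> Lr r then w e else 0) = sum w ((cutE ?X - lcut C (alive C K) {x}) \<inter> Lr r)"
      by (simp add: sum.If_cases)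
    also have "\<dots> \<le> sum w (Lr r)" by (rule sum_w_mono) (auto simp: Lr)
    finally show "(\<Sum>e\<in>cutE ?X - lcut C (alive C K) {x}. if e \<in> Lr r then w e else 0) \<le> M" using m[OF r] by simp
  qed
  also have "\<dots> = real a * M" using A by simp
  finally show ?thesis by simp
qed

text \<open>Three cases for a set \<open>U\<close>. If no vertex of \<open>x\<close> is separated
  from \<open>r\<close>, a new tree edge in the cut is paid for by a pair that leaves
  \<open>Qp\<close>. If all are separated, each edge from \<open>x\<close> to the group either
  becomes charged weight in the cut or leaves \<open>DS\<close>. If \<open>U\<close> splits
  \<open>x\<close>, the cut contains weight at least \<open>hm > B\<close> inside the
  cluster.\<close>

lemma mark_step:
  assumes I: "INV C K F T hs hm" and x: "x < n" "C x = x" "K x = 0"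
    and nb: "card {y. \<exists>e\<in>alive C K. {C (eu e), C (ev e)} = {x, y}} \<le> 12"
    and Lr: "\<And>r. Lr r = {e\<in>E. (C (eu e) = x \<and> K (ev e) = Suc r) \<or> (C (ev e) = x \<and> K (eu e) = Suc r)}"
    and B: "0 \<le> B" "sum w (lcut C (alive C K) {x}) \<le> 24 * B" "48 * B \<le> sum w (Lr r)" "\<And>r'. r' \<in> A \<Longrightarrow> sum w (Lr r') \<le> sum w (Lr r)"
    and hB: "\<not> (hs \<and> hm \<le> B)" and e1: "e1 \<in> Lr r"
    and K': "\<And>v. K' v = (if C v = x then Suc r else K v)"
    and fr: "\<And>TH Rem. core C (alive C K) F TH Rem \<Longrightarrow> core C (alive C K') F' TH Rem"
  shows "INV C K' F' (insert e1 T) hs hm"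
proof -
  obtain TH TM Rem where L: "labels_ok C K" and T: "tree_ok C K T" and S: "split_ok C hs hm"
    and TT: "T \<subseteq> TH \<union> TM" and co: "core C (alive C K) F TH Rem" and mk: "mark_ok C K TM"
    using I unfolding INV_def by blast
  have KC: "K (C v) = K v" "C v < n" "C (C v) = C v" if "v < n" for v using L that by (auto simp: labels_ok_def)
  have e1E: "e1 \<in> E" using e1 by (simp add: Lr)
  have en: "eu e < n" "ev e < n" if "e \<in> E" for e using ends[OF that] .
  define p q where "p = (if C (eu e1) = x \<and> K (ev e1) = Suc r then eu e1 else ev e1)"
    and "q = (if C (eu e1) = x \<and> K (ev e1) = Suc r then ev e1 else eu e1)"
  have pq: "C p = x" "K q = Suc r" "p < n" "q < n" "{eu e1, ev e1} = {p, q}" using e1 en[OF e1E] by (auto simp: p_def q_def Lr)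
  have Cq: "C q \<noteq> x" using KC(1)[OF pq(4)] pq x by auto
  have K0: "K v = 0" if "v < n" "C v = x" for v using KC(1)[OF that(1)] that x by simp
  have rA: "r \<in> A" using L pq(2,4) unfolding labels_ok_def by fastforce
  have rn: "r < n" "K r = Suc r" using rA A L by (auto simp: labels_ok_def)
  have L': "labels_ok C K'" unfolding labels_ok_def
  proof (intro conjI allI impI ballI)
    fix v assume v: "v < n"
    show "C v < n" "C (C v) = C v" "K' (C v) = K' v" using KC[OF v] by (auto simp: K')
    assume "K' v \<noteq> 0"
    then show "\<exists>r\<in>A. K' v = Suc r" using L v rA by (auto simp: K' labels_ok_def split: if_splits)
  next
    fix r' assume r': "r' \<in> A"
    then have "K r' = Suc r'" "r' < n" using L A by (auto simp: labels_ok_def)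
    then show "K' r' = Suc r'" using K0[of r'] by (auto simp: K')
  qed
  have KK': "K' v = K v" if "v < n" "K v \<noteq> 0" for v using K0[of v] that by (auto simp: K')
  have T': "tree_ok C K' (insert e1 T)" unfolding tree_ok_def
  proof (intro conjI)
    show "insert e1 T \<subseteq> E" using e1E T by (auto simp: tree_ok_def)
    show "\<forall>e\<in>insert e1 T. \<exists>U. insert e1 T \<inter> cutE U = {e}"
      by (rule tree_insert[OF L T e1E x(3,1)]) (use pq(1,5) Cq in \<open>auto simp: doubleton_eq_iff\<close>)
    show "\<forall>e\<in>insert e1 T. C (eu e) = C (ev e) \<or> (K' (eu e) = K' (ev e) \<and> K' (eu e) \<noteq> 0)"
    proof
      fix e assume e: "e \<in> insert e1 T"
      show "C (eu e) = C (ev e) \<or> (K' (eu e) = K' (ev e) \<and> K' (eu e) \<noteq> 0)"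
      proof (cases "e = e1")
        case True
        have "K' p = Suc r" "K' q = Suc r" using pq KK'[of q] by (auto simp: K')
        then show ?thesis using pq(5) True by (auto simp: doubleton_eq_iff)
      next
        case False
        then have eT: "e \<in> T" using e by simp
        then have "C (eu e) = C (ev e) \<or> (K (eu e) = K (ev e) \<and> K (eu e) \<noteq> 0)" "e \<in> E" using T by (auto simp: tree_ok_def)
        then show ?thesis using KK'[of "eu e"] KK'[of "ev e"] en[of e] by auto
      qed
    qed
    have tm: "(u, v) \<in> (tadj (insert e1 T))\<^sup>*" if "(u, v) \<in> (tadj T)\<^sup>*" for u v by (rule tadj_mono[OF _ that]) auto
    show "\<forall>v<n. (v, C v) \<in> (tadj (insert e1 T))\<^sup>* \<and> (\<forall>r. K' v = Suc r \<longrightarrow> (v, r) \<in> (tadj (insert e1 T))\<^sup>*)"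
    proof (intro allI impI conjI)
      fix v assume v: "v < n"
      have tc: "(u, C u) \<in> (tadj (insert e1 T))\<^sup>*" if "u < n" for u using T that tm by (auto simp: tree_ok_def)
      show "(v, C v) \<in> (tadj (insert e1 T))\<^sup>*" by (rule tc[OF v])
      fix r' assume r': "K' v = Suc r'"
      show "(v, r') \<in> (tadj (insert e1 T))\<^sup>*"
      proof (cases "C v = x")
        case True
        have "(v, x) \<in> (tadj (insert e1 T))\<^sup>*" using tc[OF v] True by simp
        moreover have "(x, p) \<in> (tadj (insert e1 T))\<^sup>*" using tc[OF pq(3)] pq(1) tadj_sym by metis
        moreover have "(p, q) \<in> (tadj (insert e1 T))\<^sup>*" using pq(5) by (intro r_into_rtrancl) (auto simp: tadj_def)
        moreover have "(q, r) \<in> (tadj (insert e1 T))\<^sup>*" using T pq(2,4) tm by (auto simp: tree_ok_def)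
        ultimately have "(v, r) \<in> (tadj (insert e1 T))\<^sup>*" by (meson rtrancl_trans)
        moreover have "r' = r" using r' True by (simp add: K')
        ultimately show ?thesis by simp
      next
        case False
        then show ?thesis using r' T v tm by (auto simp: K' tree_ok_def)
      qed
    qed
  qed
  have bL: "\<beta> \<le> sum w (lcut C (alive C K) {x}) + real a * sum w (Lr r)"
    by (rule mark_weights[OF L x Lr]) (use B in auto)
  have a1: "1 \<le> real a" using A by simp
  have uL: "2 * sum w (lcut C (alive C K) {x}) \<le> sum w (Lr r)" using B by linarith
  have Lnn: "0 \<le> sum w (Lr r)" by (rule sum_w_nonneg) (auto simp: Lr)
  \<comment> \<open>With u the alive weight at \<open>x\<close> and L the weight to the group of
    \<open>r\<close>: \<beta> \<le> u + a L and u \<le> L / 2 give \<beta> \<le> 2 a L, hence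
    \<open>kap\<close> \<le> L / 36.\<close>
  have kL: "kap + sum w (lcut C (alive C K) {x}) \<le> sum w (Lr r)"
  proof -
    have "sum w (Lr r) \<le> real a * sum w (Lr r)" using a1 Lnn mult_right_mono[of 1 "real a" "sum w (Lr r)"] by simp
    then have "\<beta> \<le> 2 * real a * sum w (Lr r)" using bL uL Lnn by simp
    then have "\<beta> / (72 * real a) \<le> (2 * real a * sum w (Lr r)) / (72 * real a)" using a1 by (intro divide_right_mono) auto
    also have "\<dots> = sum w (Lr r) / 36" using a1 by simp
    finally have "kap \<le> sum w (Lr r) / 36" by (simp add: kap_def)
    then show ?thesis using uL Lnn by linarith
  qed
  have mk': "mark_ok C K' (insert e1 TM)" unfolding mark_ok_def
  proof (intro conjI allI)
    show "insert e1 TM \<subseteq> E" using mk e1E by (auto simp: mark_ok_def)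
    fix U
    have M1: "kap * real (card (bad C K U)) + sum w (DS K U) \<le> 25 * sum w (cutE U \<inter> Emm K)"
      and M2: "card (TM \<inter> cutE U) + card (Qp C K U) \<le> 13 * card (bad C K U)" using mk by (auto simp: mark_ok_def)
    define X where "X = {v. v < n \<and> C v = x}"
    define XO where "XO = {v\<in>X. (v \<in> U) \<noteq> (r \<in> U)}"
    have oppX: "v \<notin> X" if "v \<in> opp K U" for v using that K0 by (auto simp: opp_def X_def)
    have opp': "opp K' U = opp K U \<union> XO"
      using KK' K0 by (auto simp: opp_def XO_def X_def K' split: if_splits)
    have xbad: "x \<notin> bad C K U" using oppX by (auto simp: bad_def X_def opp_def)
    have Emm': "Emm K \<subseteq> Emm K'" by (auto simp: Emm_def K')
    have EmmE: "Emm K \<subseteq> E" "Emm K' \<subseteq> E" by (auto simp: Emm_def)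
    have Z0: "sum w (cutE U \<inter> Emm K) \<le> sum w (cutE U \<inter> Emm K')" by (rule sum_w_mono) (use Emm' in \<open>auto simp: cutE_def\<close>)
    have cTM: "card (insert e1 TM \<inter> cutE U) \<le> card (TM \<inter> cutE U) + of_bool (e1 \<in> cutE U)"
    proof (cases "e1 \<in> cutE U")
      case True
      then have "insert e1 TM \<inter> cutE U = insert e1 (TM \<inter> cutE U)" by auto
      then show ?thesis using True card_insert_le_m1[of "Suc (card (TM \<inter> cutE U))" "TM \<inter> cutE U" e1] by auto
    next
      case False
      then have "insert e1 TM \<inter> cutE U = TM \<inter> cutE U" by auto
      then show ?thesis by simp
    qed
    \<comment> \<open>Clusters separated before gain no pair, and they lose their pair with
      \<open>x\<close>.\<close>
    have Q0: "(b, y) \<in> Qp C K U" "y \<noteq> x" if bb: "b \<in> bad C K U" "(b, y) \<in> Qp C K' U" for b y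
    proof -
      obtain e where e: "e \<in> E" "(C (eu e) = b \<and> C (ev e) = y \<and> K' (ev e) = 0) \<or> (C (ev e) = b \<and> C (eu e) = y \<and> K' (eu e) = 0)"
        using bb(2) by (auto simp: Qp_def)
      then show "(b, y) \<in> Qp C K U" "y \<noteq> x" using bb(1) by (auto simp: Qp_def K' split: if_splits)
    qed
    show "kap * real (card (bad C K' U)) + sum w (DS K' U) \<le> 25 * sum w (cutE U \<inter> Emm K')"
      and "card (insert e1 TM \<inter> cutE U) + card (Qp C K' U) \<le> 13 * card (bad C K' U)"
    proof (atomize(full), cases "XO = {}")
      case True
      then have o: "opp K' U = opp K U" "bad C K' U = bad C K U" using opp' by (auto simp: bad_def)
      have "DS K' U \<subseteq> DS K U" unfolding DS_def o by (auto simp: K' split: if_splits)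
      then have "sum w (DS K' U) \<le> sum w (DS K U)" by (rule sum_w_mono) (auto simp: DS_def)
      moreover have "card (insert e1 TM \<inter> cutE U) + card (Qp C K' U) \<le> 13 * card (bad C K' U)"
      proof (cases "e1 \<in> cutE U")
        case False
        have "Qp C K' U \<subseteq> Qp C K U"
        proof (rule subrelI)
          fix b y assume by': "(b, y) \<in> Qp C K' U"
          then have "b \<in> bad C K U" using o(2) by (auto simp: Qp_def)
          from Q0(1)[OF this by'] show "(b, y) \<in> Qp C K U" .
        qed
        then have "card (Qp C K' U) \<le> card (Qp C K U)" by (intro card_mono) auto
        then show ?thesis using False cTM M2 o by simp
      next
        case c: True
        have "p \<in> X" using pq by (auto simp: X_def)
        then have pr: "(p \<in> U) = (r \<in> U)" using True by (auto simp: XO_def)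
        have "(p \<in> U) \<noteq> (q \<in> U)" using c pq(5) by (auto simp: cutE_def doubleton_eq_iff)
        then have "q \<in> opp K U" using pr pq by (auto simp: opp_def)
        then have qb: "C q \<in> bad C K U" by (auto simp: bad_def)
        have kp: "K p = 0" using K0 pq by simp
        \<comment> \<open>The marked end \<open>q\<close> was already separated from
          \<open>r\<close>, so this pair was counted; it disappears because \<open>x\<close> is now
          marked.\<close>
        have "(C q, x) \<in> Qp C K U" using qb e1E pq(1,5) kp by (auto simp: Qp_def doubleton_eq_iff)
        moreover have "Qp C K' U \<subseteq> Qp C K U - {(C q, x)}"
        proof (rule subrelI)
          fix b y assume by': "(b, y) \<in> Qp C K' U"
          then have "b \<in> bad C K U" using o(2) by (auto simp: Qp_def)
          from Q0[OF this by'] show "(b, y) \<in> Qp C K U - {(C q, x)}" by simp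
        qed
        ultimately have "card (Qp C K' U) < card (Qp C K U)" by (intro psubset_card_mono) auto
        then show ?thesis using c cTM M2 o by simp
      qed
      ultimately show "kap * real (card (bad C K' U)) + sum w (DS K' U) \<le> 25 * sum w (cutE U \<inter> Emm K') \<and>
         card (insert e1 TM \<inter> cutE U) + card (Qp C K' U) \<le> 13 * card (bad C K' U)" using M1 Z0 o by simp
    next
      case False
      have "C ` XO = {x}" using False by (auto simp: XO_def X_def)
      then have b': "bad C K' U = insert x (bad C K U)" unfolding bad_def opp' by auto
      then have cb: "card (bad C K' U) = Suc (card (bad C K U))" using xbad by simp
      let ?nb = "{y. \<exists>e\<in>alive C K. {C (eu e), C (ev e)} = {x, y}}"
      have fnb: "finite ?nb"
      proof -
        have "?nb \<subseteq> C ` (eu ` E \<union> ev ` E)" by (auto simp: alive_def doubleton_eq_iff)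
        then show ?thesis by (rule finite_subset) simp
      qed
      have Qs: "Qp C K' U \<subseteq> Qp C K U \<union> (\<lambda>y. (x, y)) ` ?nb"
      proof
        fix b assume b: "b \<in> Qp C K' U"
        obtain b1 y where by': "b = (b1, y)" by (cases b)
        show "b \<in> Qp C K U \<union> (\<lambda>y. (x, y)) ` ?nb"
        proof (cases "b1 \<in> bad C K U")
          case True
          then show ?thesis using Q0(1) b by' by blast
        next
          case nb: False
          then have b1: "b1 = x" using b by' b' by (auto simp: Qp_def)
          obtain e where e: "e \<in> E" "(C (eu e) = x \<and> C (ev e) = y \<and> K' (ev e) = 0) \<or> (C (ev e) = x \<and> C (eu e) = y \<and> K' (eu e) = 0)"
            using b by' b1 by (auto simp: Qp_def)
          have "e \<in> alive C K" using e K0[of "eu e"] K0[of "ev e"] en[OF e(1)] by (auto simp: alive_def K' split: if_splits)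
          moreover have "{C (eu e), C (ev e)} = {x, y}" using e by auto
          ultimately show ?thesis using by' b1 by blast
        qed
      qed
      have "card (Qp C K' U) \<le> card (Qp C K U \<union> (\<lambda>y. (x, y)) ` ?nb)" by (rule card_mono[OF _ Qs]) (use fnb in auto)
      also have "\<dots> \<le> card (Qp C K U) + 12"
        by (rule order_trans[OF card_Un_le]) (use nb card_image_le[OF fnb, of "\<lambda>y. (x, y)"] in linarith)
      \<comment> \<open>At most 12 new pairs and one new tree edge are balanced by one new separated
        cluster.\<close>
      finally have "card (insert e1 TM \<inter> cutE U) + card (Qp C K' U) \<le> 13 * card (bad C K' U)" using cTM M2 cb by (cases "e1 \<in> cutE U") auto
      moreover have "kap * real (card (bad C K' U)) + sum w (DS K' U) \<le> 25 * sum w (cutE U \<inter> Emm K')"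
      proof (cases "XO = X")
        case True
        \<comment> \<open>Edges to members of the group that are separated from \<open>r\<close> as
          well. They do not cross \<open>U\<close>, but their weight is released from
          \<open>DS\<close>.\<close>
        define LO where "LO = {e\<in>Lr r. eu e \<in> opp K U \<or> ev e \<in> opp K U}"
        have LrE: "Lr r \<subseteq> E" by (auto simp: Lr)
        have LODS: "LO \<subseteq> DS K U"
        proof
          fix e assume e: "e \<in> LO"
          then have "e \<in> E" by (auto simp: LO_def Lr)
          then show "e \<in> DS K U" using e K0[of "eu e"] K0[of "ev e"] en[of e] by (auto simp: LO_def Lr DS_def opp_def)
        qed
        have DS': "DS K' U \<subseteq> (DS K U - LO) \<union> lcut C (alive C K) {x}"
        proof
          fix e assume e: "e \<in> DS K' U"
          then have eE: "e \<in> E" by (auto simp: DS_def)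
          show "e \<in> (DS K U - LO) \<union> lcut C (alive C K) {x}"
          proof (cases "C (eu e) = x \<or> C (ev e) = x")
            case True
            then show ?thesis using e eE K0[of "eu e"] K0[of "ev e"] en[OF eE] by (auto simp: DS_def K' lcut_def alive_def split: if_splits)
          next
            case False
            then show ?thesis using e eE opp' by (auto simp: DS_def K' XO_def X_def LO_def Lr)
          qed
        qed
        have alE: "lcut C (alive C K) {x} \<subseteq> E" by (auto simp: lcut_def alive_def)
        have DSE: "DS K U \<subseteq> E" by (auto simp: DS_def)
        have "sum w (DS K' U) \<le> sum w ((DS K U - LO) \<union> lcut C (alive C K) {x})" by (rule sum_w_mono[OF DS']) (use alE DSE in auto)
        also have "\<dots> \<le> sum w (DS K U - LO) + sum w (lcut C (alive C K) {x})" by (rule sum_w_Un) (use alE DSE in auto)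
        also have "sum w (DS K U - LO) = sum w (DS K U) - sum w LO" by (rule sum_diff) (use LODS finite_sub[OF DSE] in auto)
        finally have d: "sum w (DS K' U) \<le> sum w (DS K U) - sum w LO + sum w (lcut C (alive C K) {x})" .
        have cutL: "Lr r - LO \<subseteq> cutE U \<inter> (Emm K' - Emm K)"
        proof
          fix e assume e: "e \<in> Lr r - LO"
          then have eE: "e \<in> E" by (auto simp: Lr)
          obtain p' q' where pq': "C p' = x" "K q' = Suc r" "{eu e, ev e} = {p', q'}" "p' < n" "q' < n"
            using e en[OF eE] by (auto simp: Lr insert_commute)
          have "p' \<in> X" using pq' by (simp add: X_def)
          then have "(p' \<in> U) \<noteq> (r \<in> U)" using True by (auto simp: XO_def)
          moreover have "q' \<notin> opp K U" using e pq'(3) by (auto simp: LO_def doubleton_eq_iff)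
          then have "(q' \<in> U) = (r \<in> U)" using pq' by (auto simp: opp_def)
          ultimately have "e \<in> cutE U" using pq'(3) eE by (auto simp: cutE_def doubleton_eq_iff)
          moreover have "K p' = 0" "K' p' \<noteq> 0" "K' q' \<noteq> 0" using pq' K0 KK'[of q'] by (auto simp: K')
          then have "e \<in> Emm K' - Emm K" using pq'(3) eE by (auto simp: Emm_def doubleton_eq_iff)
          ultimately show "e \<in> cutE U \<inter> (Emm K' - Emm K)" by blast
        qed
        have "sum w (cutE U \<inter> Emm K) + sum w (Lr r - LO) = sum w ((cutE U \<inter> Emm K) \<union> (Lr r - LO))"
          by (rule sum.union_disjoint[symmetric]) (use cutL finite_sub[OF LrE] in auto)
        also have "\<dots> \<le> sum w (cutE U \<inter> Emm K')" by (rule sum_w_mono) (use cutL Emm' EmmE in auto)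
        finally have z: "sum w (cutE U \<inter> Emm K) + sum w (Lr r - LO) \<le> sum w (cutE U \<inter> Emm K')" .
        have l: "sum w (Lr r - LO) = sum w (Lr r) - sum w LO" by (rule sum_diff) (use finite_sub[OF LrE] in \<open>auto simp: LO_def\<close>)
        have lnn: "0 \<le> sum w (Lr r - LO)" by (rule sum_w_nonneg) (use LrE in auto)
        show ?thesis using M1 d z l lnn kL unfolding cb by (simp add: algebra_simps)
      next
        case nX: False
        obtain v v' where vv: "v \<in> X" "v' \<in> X" "v \<in> U" "v' \<notin> U" using False nX by (auto simp: XO_def)
        have sp: "hs" "hm \<le> sum w (cutE U \<inter> inner C x)"
        proof -
          have "v < n \<and> v' < n \<and> C v = C v' \<and> v \<in> U \<and> v' \<notin> U" "C v = x" using vv by (auto simp: X_def)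
          then show "hs" "hm \<le> sum w (cutE U \<inter> inner C x)" using S[unfolded split_ok_def, THEN conjunct2, rule_format, of v v' U] by simp_all
        qed
        \<comment> \<open>A split cluster forces \<open>hs\<close>, so \<open>hB\<close> yields
          \<open>B < hm\<close>; the increase \<open>kap + 24 * B\<close> is then at most
          \<open>25 * hm\<close>.\<close>
        have Bh: "B < hm" "kap \<le> hm" using hB sp S by (auto simp: split_ok_def)
        have DSE: "DS K U \<subseteq> E" "lcut C (alive C K) {x} \<subseteq> E" by (auto simp: DS_def lcut_def alive_def)
        have "DS K' U \<subseteq> DS K U \<union> lcut C (alive C K) {x}"
        proof
          fix e assume e: "e \<in> DS K' U"
          then have eE: "e \<in> E" by (auto simp: DS_def)
          show "e \<in> DS K U \<union> lcut C (alive C K) {x}"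
          proof (cases "C (eu e) = x \<or> C (ev e) = x")
            case True
            then show ?thesis using e eE K0[of "eu e"] K0[of "ev e"] en[OF eE] by (auto simp: DS_def K' lcut_def alive_def split: if_splits)
          next
            case False
            then show ?thesis using e eE opp' by (auto simp: DS_def K' XO_def X_def)
          qed
        qed
        then have "sum w (DS K' U) \<le> sum w (DS K U \<union> lcut C (alive C K) {x})" by (rule sum_w_mono) (use DSE in auto)
        also have "\<dots> \<le> sum w (DS K U) + sum w (lcut C (alive C K) {x})" by (rule sum_w_Un) (use DSE in auto)
        finally have d: "sum w (DS K' U) \<le> sum w (DS K U) + 24 * B" using B by simp
        have inn: "inner C x \<subseteq> Emm K'" "inner C x \<inter> Emm K = {}" using K0 en by (auto simp: inner_def Emm_def K')
        have "sum w (cutE U \<inter> Emm K) + sum w (cutE U \<inter> inner C x) = sum w ((cutE U \<inter> Emm K) \<union> (cutE U \<inter> inner C x))"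
          by (rule sum.union_disjoint[symmetric]) (use inn in auto)
        also have "\<dots> \<le> sum w (cutE U \<inter> Emm K')" by (rule sum_w_mono) (use inn Emm' EmmE in auto)
        finally have z: "sum w (cutE U \<inter> Emm K) + sum w (cutE U \<inter> inner C x) \<le> sum w (cutE U \<inter> Emm K')" .
        show ?thesis using M1 d z sp Bh unfolding cb by (simp add: algebra_simps)
      qed
      ultimately show "kap * real (card (bad C K' U)) + sum w (DS K' U) \<le> 25 * sum w (cutE U \<inter> Emm K') \<and>
         card (insert e1 TM \<inter> cutE U) + card (Qp C K' U) \<le> 13 * card (bad C K' U)" by blast
    qed
  qed
  show ?thesis unfolding INV_def
    by (intro conjI L' T' S exI[of _ TH] exI[of _ "insert e1 TM"] exI[of _ Rem] fr[OF co] mk') (use TT in auto)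
qed

text \<open>The merged clusters are unmarked, so the separated clusters stay the same and pairs in
  \<open>Qp\<close> can only coincide. A set splitting the new cluster splits one of the old ones or
  separates the two, and in the latter case its cut contains the whole walk.\<close>

lemma merge_step:
  assumes I: "INV C K F T hs hm" and TH: "thread N F (alive C K) ss" and P: "P = ed N ` set ss"
    and j: "j < length ss" "e = ed N (ss ! j)" and B: "B = sum w P" "kap \<le> B"
    and h: "B / 2 \<le> (\<Sum>i\<le>j. w (ed N (ss ! i)))" "B / 2 \<le> (\<Sum>i=j..<length ss. w (ed N (ss ! i)))"
    and xy: "x = C (eu e)" "y = C (ev e)" and C': "\<And>v. C' v = (if C v = y then x else C v)"
    and hm': "hm' = (if hs \<and> hm \<le> B then hm else B)"
    and fr: "\<And>TH Rem. core C' (alive C K - P) F TH Rem \<Longrightarrow> core C' (alive C' K) F' TH Rem"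
  shows "INV C' K F' (insert e T) True hm'"
proof -
  obtain TH' TM Rem where L: "labels_ok C K" and T: "tree_ok C K T" and S: "split_ok C hs hm"
    and TT: "T \<subseteq> TH' \<union> TM" and co: "core C (alive C K) F TH' Rem" and mk: "mark_ok C K TM"
    using I unfolding INV_def by blast
  have eP: "e \<in> P" using j by (auto simp: P)
  have PAl: "P \<subseteq> alive C K" using TH by (auto simp: P thread_def)
  have al: "e \<in> E" "K (eu e) = 0" "K (ev e) = 0" "x \<noteq> y" using eP PAl xy by (auto simp: alive_def)
  have PE: "P \<subseteq> E" using PAl by (auto simp: alive_def)
  have KC: "K (C v) = K v" "C v < n" "C (C v) = C v" if "v < n" for v using L that by (auto simp: labels_ok_def)
  have en: "eu e < n" "ev e < n" if "e \<in> E" for e using ends[OF that] .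
  have xn: "x < n" "y < n" "K x = 0" "K y = 0" "C x = x" "C y = y"
    using KC[OF en(1)[OF al(1)]] KC[OF en(2)[OF al(1)]] al xy by auto
  have K0: "K v = 0" if "v < n" "C v = x \<or> C v = y" for v using KC(1)[OF that(1)] that xn by auto
  have lab: "{C (eu f), C (ev f)} = {x, y}" if "f \<in> P" for f
    using thread_labels[OF co _ TH, of e x y f] eP that xy unfolding P by (auto simp: alive_def)
  have co': "core C' (alive C K - P) F (insert e TH') (Rem \<union> P)"
  proof (rule core_merge[OF co _ TH P j _ _ _ C'])
    show "{C (eu e), C (ev e)} = {x, y}" using xy by simp
    show "kap / 2 \<le> (\<Sum>i\<le>j. w (ed N (ss ! i)))" "kap / 2 \<le> (\<Sum>i=j..<length ss. w (ed N (ss ! i)))" using h B by linarith+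
  qed (auto simp: alive_def)
  have L': "labels_ok C' K" unfolding labels_ok_def
    using KC xn al(4) L by (auto simp: C' labels_ok_def)
  have T': "tree_ok C' K (insert e T)" unfolding tree_ok_def
  proof (intro conjI)
    show "insert e T \<subseteq> E" using al T by (auto simp: tree_ok_def)
    show "\<forall>f\<in>insert e T. \<exists>U. insert e T \<inter> cutE U = {f}"
      by (rule tree_insert[OF L T al(1) xn(3,1)]) (use xy al(4) in auto)
    show "\<forall>f\<in>insert e T. C' (eu f) = C' (ev f) \<or> (K (eu f) = K (ev f) \<and> K (eu f) \<noteq> 0)"
      using T xy by (auto simp: tree_ok_def C')
    have tm: "(u, v) \<in> (tadj (insert e T))\<^sup>*" if "(u, v) \<in> (tadj T)\<^sup>*" for u v by (rule tadj_mono[OF _ that]) auto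
    show "\<forall>v<n. (v, C' v) \<in> (tadj (insert e T))\<^sup>* \<and> (\<forall>r. K v = Suc r \<longrightarrow> (v, r) \<in> (tadj (insert e T))\<^sup>*)"
    proof (intro allI impI conjI)
      fix v assume v: "v < n"
      have tc: "(u, C u) \<in> (tadj (insert e T))\<^sup>*" if "u < n" for u using T that tm by (auto simp: tree_ok_def)
      show "(v, r) \<in> (tadj (insert e T))\<^sup>*" if "K v = Suc r" for r using T tm v that by (auto simp: tree_ok_def)
      show "(v, C' v) \<in> (tadj (insert e T))\<^sup>*"
      proof (cases "C v = y")
        case False then show ?thesis using tc[OF v] by (simp add: C')
      next
        case True
        have "(v, y) \<in> (tadj (insert e T))\<^sup>*" using tc[OF v] True by simp
        moreover have "(y, ev e) \<in> (tadj (insert e T))\<^sup>*" using tc[OF en(2)[OF al(1)]] xy tadj_sym by metis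
        moreover have "(ev e, eu e) \<in> (tadj (insert e T))\<^sup>*" by (intro r_into_rtrancl) (auto simp: tadj_def)
        moreover have "(eu e, x) \<in> (tadj (insert e T))\<^sup>*" using tc[OF en(1)[OF al(1)]] xy by simp
        ultimately show ?thesis using True by (simp add: C')
      qed
    qed
  qed
  have S': "split_ok C' True hm'" unfolding split_ok_def
  proof (intro conjI allI impI)
    show "kap \<le> hm'" using S B by (auto simp: hm' split_ok_def)
  next
    fix U v v' assume v: "v < n \<and> v' < n \<and> C' v = C' v' \<and> v \<in> U \<and> v' \<notin> U"
    have inn: "inner C z \<subseteq> inner C' (C' u)" if "z = C u" for z u using that by (auto simp: inner_def C')
    have innE: "inner C' z \<subseteq> E" for z by (auto simp: inner_def)
    have key: "hm' \<le> sum w (cutE U \<inter> inner C' (C' v))" if s: "s < n" "s' < n" "C s = C s'" "s \<in> U" "s' \<notin> U" "C' s = C' v" for s s'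
    proof -
      have "hs" "hm \<le> sum w (cutE U \<inter> inner C (C s))"
        using S[unfolded split_ok_def, THEN conjunct2, rule_format, of s s' U] s by simp_all
      moreover have "sum w (cutE U \<inter> inner C (C s)) \<le> sum w (cutE U \<inter> inner C' (C' v))"
        by (rule sum_w_mono) (use inn[of "C s" s] innE s in auto)
      ultimately show ?thesis by (auto simp: hm')
    qed
    show "hm' \<le> sum w (cutE U \<inter> inner C' (C' v))"
    proof (cases "C v = C v'")
      case True
      then show ?thesis using key[of v v'] v by blast
    next
      case False
      then have C'v: "C' v = x" and cv: "(C v = x \<and> C v' = y) \<or> (C v = y \<and> C v' = x)" using v by (auto simp: C' split: if_splits)
      show ?thesis
      proof (cases "\<exists>s s'. s < n \<and> s' < n \<and> C s = C s' \<and> s \<in> U \<and> s' \<notin> U \<and> (C s = x \<or> C s = y)")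
        case True
        then obtain s s' where s: "s < n" "s' < n" "C s = C s'" "s \<in> U" "s' \<notin> U" "C s = x \<or> C s = y" by blast
        moreover have "C' s = C' v" using s(6) C'v by (auto simp: C')
        ultimately show ?thesis using key[of s s'] by blast
      next
        case ns: False
        have side: "s \<in> U \<longleftrightarrow> C s = C v" if "s < n" "C s = x \<or> C s = y" for s
          using ns v cv that by metis
        have "P \<subseteq> cutE U \<inter> inner C' (C' v)"
        proof
          fix f assume f: "f \<in> P"
          then have fE: "f \<in> E" using PE by blast
          have l: "{C (eu f), C (ev f)} = {x, y}" using lab[OF f] .
          then have "(eu f \<in> U) \<noteq> (ev f \<in> U)" using side[of "eu f"] side[of "ev f"] en[OF fE] al(4) cv by (auto simp: doubleton_eq_iff)
          moreover have "C' (eu f) = x" "C' (ev f) = x" using l by (auto simp: C' doubleton_eq_iff)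
          ultimately show "f \<in> cutE U \<inter> inner C' (C' v)" using fE C'v by (auto simp: cutE_def inner_def)
        qed
        then have "B \<le> sum w (cutE U \<inter> inner C' (C' v))" unfolding B(1) by (rule sum_w_mono) (use innE in auto)
        then show ?thesis by (auto simp: hm')
      qed
    qed
  qed simp
  have bad': "bad C' K U = bad C K U" for U
    unfolding bad_def by (rule image_cong[OF refl]) (use K0 in \<open>auto simp: opp_def C'\<close>)
  have mk': "mark_ok C' K TM" unfolding mark_ok_def
  proof (intro conjI allI)
    show "TM \<subseteq> E" using mk by (simp add: mark_ok_def)
    fix U
    show "kap * real (card (bad C' K U)) + sum w (DS K U) \<le> 25 * sum w (cutE U \<inter> Emm K)" using mk bad' by (simp add: mark_ok_def)
    have bxy: "b \<noteq> x" "b \<noteq> y" if "b \<in> bad C K U" for b using that K0 by (auto simp: bad_def opp_def)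
    have "Qp C' K U \<subseteq> (\<lambda>(b, l). (b, if l = y then x else l)) ` Qp C K U"
    proof
      fix q assume q: "q \<in> Qp C' K U"
      obtain b l where bl: "q = (b, l)" by (cases q)
      have b: "b \<in> bad C K U" using q bl bad' by (auto simp: Qp_def)
      obtain f where f: "f \<in> E" "(C' (eu f) = b \<and> C' (ev f) = l \<and> K (ev f) = 0) \<or> (C' (ev f) = b \<and> C' (eu f) = l \<and> K (eu f) = 0)"
        using q bl by (auto simp: Qp_def)
      from f(2) show "q \<in> (\<lambda>(b, l). (b, if l = y then x else l)) ` Qp C K U"
      proof
        assume h: "C' (eu f) = b \<and> C' (ev f) = l \<and> K (ev f) = 0"
        then have "(b, C (ev f)) \<in> Qp C K U" using b bxy[OF b] f(1) by (auto simp: Qp_def C' split: if_splits)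
        moreover have "l = (if C (ev f) = y then x else C (ev f))" using h by (simp add: C')
        ultimately show ?thesis unfolding bl by (intro image_eqI[of _ _ "(b, C (ev f))"]) auto
      next
        assume h: "C' (ev f) = b \<and> C' (eu f) = l \<and> K (eu f) = 0"
        then have "(b, C (eu f)) \<in> Qp C K U" using b bxy[OF b] f(1) by (auto simp: Qp_def C' split: if_splits)
        moreover have "l = (if C (eu f) = y then x else C (eu f))" using h by (simp add: C')
        ultimately show ?thesis unfolding bl by (intro image_eqI[of _ _ "(b, C (eu f))"]) auto
      qed
    qed
    then have "card (Qp C' K U) \<le> card ((\<lambda>(b, l). (b, if l = y then x else l)) ` Qp C K U)" by (intro card_mono) auto
    also have "\<dots> \<le> card (Qp C K U)" by (rule card_image_le) simp
    finally have "card (Qp C' K U) \<le> card (Qp C K U)" .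
    moreover have "card (TM \<inter> cutE U) + card (Qp C K U) \<le> 13 * card (bad C K U)" using mk by (simp add: mark_ok_def)
    ultimately show "card (TM \<inter> cutE U) + card (Qp C' K U) \<le> 13 * card (bad C' K U)" unfolding bad' by linarith
  qed
  show ?thesis unfolding INV_def
    by (intro conjI L' T' S' exI[of _ "insert e TH'"] exI[of _ TM] exI[of _ "Rem \<union> P"] fr[OF co'] mk') (use TT in auto)
qed

section \<open>Progress and the final thinness bound\<close>

definition LB :: "(nat \<Rightarrow> nat) \<Rightarrow> (nat \<Rightarrow> nat) \<Rightarrow> nat set" where
  "LB C K = {x. x < n \<and> C x = x \<and> K x = 0}"

text \<open>Take a cluster that meets at most 12 threads and its heaviest group. As marking is
  excluded, the group weighs less than \<open>48 * B\<close>, and thickness gives \<beta> \<le>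
  \<open>24 * B + real a * (48 * B)\<close> \<le> \<open>B * (72 * real a)\<close>.\<close>

lemma heavy_or_mark:
  assumes I: "INV C K F T hs hm" and big: "2 * g < card (LB C K)"
    and B: "0 \<le> B" "\<And>t. t \<in> alive C K // trel N F (alive C K) \<Longrightarrow> sum w t \<le> 2 * B"
    and Lr: "\<And>x r. Lr x r = {e\<in>E. (C (eu e) = x \<and> K (ev e) = Suc r) \<or> (C (ev e) = x \<and> K (eu e) = Suc r)}"
    and nomark: "\<And>x r. x < n \<Longrightarrow> C x = x \<Longrightarrow> K x = 0 \<Longrightarrow> card {y. \<exists>e\<in>alive C K. {C (eu e), C (ev e)} = {x, y}} \<le> 12 \<Longrightarrow>
       sum w (lcut C (alive C K) {x}) \<le> 24 * B \<Longrightarrow> r \<in> A \<Longrightarrow> 48 * B \<le> sum w (Lr x r) \<Longrightarrow> \<forall>r'\<in>A. sum w (Lr x r') \<le> sum w (Lr x r) \<Longrightarrow> False"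
  shows "kap \<le> B"
proof -
  obtain TH TM Rem where L: "labels_ok C K" and co: "core C (alive C K) F TH Rem"
    using I unfolding INV_def by blast
  have Al: "alive C K \<subseteq> E" by (auto simp: alive_def)
  have proper: "\<And>e. e \<in> alive C K \<Longrightarrow> C (eu e) \<noteq> C (ev e)" by (auto simp: alive_def)
  have tp: "topo (2 ^ (2 * g)) (alive C K) F C" using co by (simp add: core_def)
  have fL: "finite (LB C K)" by (auto simp: LB_def)
  have lb: "C (eu e) \<in> LB C K \<and> C (ev e) \<in> LB C K" if "e \<in> alive C K" for e
    using that L ends[of e] by (auto simp: alive_def LB_def labels_ok_def)
  obtain x where x: "x \<in> LB C K" "card (touching (alive C K) F C x) \<le> 12"
    using small_label[OF Al core_even[OF co] proper tp fL _ lb] big by fastforce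
  have u: "sum w (lcut C (alive C K) {x}) \<le> 24 * B"
    by (rule small_label_weight[OF Al core_even[OF co] proper x(2) B])
  have nb: "card {y. \<exists>e\<in>alive C K. {C (eu e), C (ev e)} = {x, y}} \<le> 12"
    by (rule small_label_nbrs[OF Al core_even[OF co] proper x(2)])
  have xx: "x < n" "C x = x" "K x = 0" using x by (auto simp: LB_def)
  have "A \<noteq> {}" using A by auto
  then obtain r where r: "r \<in> A" "\<forall>r'\<in>A. sum w (Lr x r') \<le> sum w (Lr x r)"
    using finA obtains_MAX[of A "\<lambda>r. sum w (Lr x r)"] by (metis Max_ge finite_imageI image_eqI)
  have "sum w (Lr x r) < 48 * B" using nomark[OF xx nb u r(1) _ r(2)] by force
  moreover have "\<beta> \<le> sum w (lcut C (alive C K) {x}) + real a * sum w (Lr x r)"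
    by (rule mark_weights[OF L xx Lr]) (use r in auto)
  moreover have "real a * sum w (Lr x r) \<le> real a * (48 * B)" using calculation(1) by (intro mult_left_mono) auto
  ultimately have "\<beta> \<le> 24 * B + real a * (48 * B)" using u by linarith
  also have "\<dots> \<le> real a * (24 * B) + real a * (48 * B)" using A B(1) mult_right_mono[of 1 "real a" "24 * B"] by (simp add: mult.commute)
  finally have "\<beta> \<le> B * (72 * real a)" by (simp add: algebra_simps)
  then show ?thesis unfolding kap_def using A by (simp add: pos_divide_le_eq)
qed

text \<open>In units of \<open>sum w (cutE U) / kap\<close> the merging edges cost 4 and the marking
  edges 13 * 25 = 325. The sum is rounded up to 400, and 400 * 72 = 28800.\<close>

lemma INV_thin:
  assumes I: "INV C K F T hs hm"
  shows "real (card (T \<inter> cutE U)) \<le> 30000 * real a / \<beta> * sum w (cutE U)"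
proof -
  obtain TH TM Rem where TT: "T \<subseteq> TH \<union> TM" and co: "core C (alive C K) F TH Rem" and mk: "mark_ok C K TM"
    using I unfolding INV_def by blast
  have E': "cutE U \<subseteq> E" by (auto simp: cutE_def)
  have z0: "0 \<le> sum w (cutE U)" by (rule sum_w_nonneg[OF E'])
  have "kap / 2 * (2 * real (card (TH \<inter> cutE U)) + real (card (oc N F (cutE U \<inter> alive C K)))) \<le> 4 * sum w (cutE U \<inter> Rem)"
    using co by (simp add: core_def)
  moreover have "kap / 2 * (2 * real (card (TH \<inter> cutE U))) \<le> kap / 2 * (2 * real (card (TH \<inter> cutE U)) + real (card (oc N F (cutE U \<inter> alive C K))))"
    using kap_pos by (intro mult_left_mono) auto
  moreover have "sum w (cutE U \<inter> Rem) \<le> sum w (cutE U)" by (rule sum_w_mono) (use E' in auto)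
  ultimately have 1: "kap * real (card (TH \<inter> cutE U)) \<le> 4 * sum w (cutE U)" by simp
  have "kap * real (card (bad C K U)) + sum w (DS K U) \<le> 25 * sum w (cutE U \<inter> Emm K)"
    and q: "card (TM \<inter> cutE U) \<le> 13 * card (bad C K U)" using mk unfolding mark_ok_def by (blast, meson add_leD1)
  moreover have "0 \<le> sum w (DS K U)" by (rule sum_w_nonneg) (auto simp: DS_def)
  moreover have "sum w (cutE U \<inter> Emm K) \<le> sum w (cutE U)" by (rule sum_w_mono) (use E' in auto)
  ultimately have b: "kap * real (card (bad C K U)) \<le> 25 * sum w (cutE U)" by linarith
  have "kap * real (card (TM \<inter> cutE U)) \<le> kap * (13 * real (card (bad C K U)))"
    using q kap_pos by (intro mult_left_mono) auto
  then have 2: "kap * real (card (TM \<inter> cutE U)) \<le> 325 * sum w (cutE U)" using b by simp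
  have "card (T \<inter> cutE U) \<le> card ((TH \<inter> cutE U) \<union> (TM \<inter> cutE U))" by (rule card_mono) (use TT in auto)
  also have "\<dots> \<le> card (TH \<inter> cutE U) + card (TM \<inter> cutE U)" by (rule card_Un_le)
  finally have "kap * real (card (T \<inter> cutE U)) \<le> kap * (real (card (TH \<inter> cutE U)) + real (card (TM \<inter> cutE U)))"
    using kap_pos by (intro mult_left_mono) auto
  then have "kap * real (card (T \<inter> cutE U)) \<le> 400 * sum w (cutE U)" using 1 2 z0 by (simp add: algebra_simps)
  then have "real (card (T \<inter> cutE U)) \<le> 400 * sum w (cutE U) / kap" using kap_pos by (simp add: pos_le_divide_eq mult.commute)
  also have "\<dots> = 28800 * real a / \<beta> * sum w (cutE U)" using beta A by (simp add: kap_def)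
  also have "\<dots> \<le> 30000 * real a / \<beta> * sum w (cutE U)" using z0 beta by (intro mult_right_mono divide_right_mono) auto
  finally show ?thesis .
qed

end

subsection \<open>Signed rotation systems\<close>

lemma cyclic_on_bij: assumes "cyclic_on f S" shows "bij_betw f S S"
proof -
  have S: "S \<noteq> {}" "\<And>s. s \<in> S \<Longrightarrow> S = orbit f s" using assms by (auto simp: cyclic_on_alldef)
  obtain s where s: "s \<in> S" using S by auto
  have "S \<subseteq> f ` S"
  proof
    fix t assume "t \<in> S"
    then have "t \<in> orbit f s" using S(2)[OF s] by simp
    then show "t \<in> f ` S" by (cases rule: orbit.cases) (use S(2)[OF s] s in auto)
  qed
  then have "f ` S = S" using cyclic_on_inI[OF assms] by blast
  then show ?thesis using finite_cyclic_on[OF assms] by (simp add: bij_betw_def eq_card_imp_inj_on)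
qed

locale rmap = wg "n * n" n E "\<lambda>e. e div n" "\<lambda>e. e mod n" w for n :: nat and E w +
  fixes H :: "nat ugraph" and rot :: "nat \<Rightarrow> nat \<Rightarrow> nat" and twi :: "nat set \<Rightarrow> bool" and F :: "nat \<Rightarrow> nat"
  assumes fs: "finite_simple_graph H" and VH: "vertices H \<subseteq> {..<n}" and rs: "rotation_system H rot"
begin

abbreviation "N \<equiv> n * n"
abbreviation "nb \<equiv> neighbours H"
abbreviation "tw u v \<equiv> twi {u, v}"

text \<open>
  \<open>sA v u\<close> and \<open>sB v u\<close> are the two sides of the edge \<open>uv\<close> as seen from \<open>v\<close>, after and before it in the
  rotation.  Side \<open>e\<close> versus \<open>e + N\<close> is fixed at the smaller end; at the larger end the two are
  exchanged unless the edge is twisted.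
\<close>

definition eid :: "nat \<Rightarrow> nat \<Rightarrow> nat" where "eid u v = (if u < v then u * n + v else v * n + u)"
definition sA :: "nat \<Rightarrow> nat \<Rightarrow> nat" where
  "sA v u = (if u < v then eid u v + (if tw u v then 0 else N) else eid u v)"
definition sB :: "nat \<Rightarrow> nat \<Rightarrow> nat" where
  "sB v u = (if v < u then eid u v + N else eid u v + (if tw u v then N else 0))"
definition EH :: "nat set" where "EH = {e. e div n < e mod n \<and> {e div n, e mod n} \<in> edges H}"
text \<open>One pair for each corner: the angle at \<open>v\<close> between consecutive neighbours
  lies in a single face, which touches the two bounding sides.\<close>

definition links :: "(nat \<times> nat) set" where "links = {(sA v u, sB v (rot v u)) | v u. u \<in> nb v}"

lemma nb_sym: "u \<in> nb v \<longleftrightarrow> v \<in> nb u" by (simp add: neighbours_def insert_commute)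
lemma edge_props: assumes "{u, v} \<in> edges H" shows "u \<noteq> v" "u \<in> vertices H" "v \<in> vertices H" "u < n" "v < n"
proof -
  have 1: "{u, v} \<subseteq> vertices H" "card {u, v} = 2" using assms fs unfolding finite_simple_graph_def by auto
  show "u \<noteq> v" "u \<in> vertices H" "v \<in> vertices H" using 1 by auto
  then show "u < n" "v < n" using VH by auto
qed
lemma nb_props: assumes "u \<in> nb v" shows "u \<noteq> v" "u \<in> vertices H" "v \<in> vertices H" "u < n" "v < n"
  using edge_props[of v u] assms by (auto simp: neighbours_def)

lemma eid_sym: "eid u v = eid v u" by (auto simp: eid_def)
lemma eid_dm: assumes "u < v" "v < n" shows "(u * n + v) div n = u" "(u * n + v) mod n = v" "u * n + v < N"
proof -
  show "(u * n + v) div n = u" "(u * n + v) mod n = v" using assms by auto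
  have "u * n + v < Suc u * n" using assms by simp
  also have "\<dots> \<le> n * n" using assms by (intro mult_right_mono) auto
  finally show "u * n + v < N" .
qed

lemma eid_EH: assumes "u \<in> nb v" shows "eid u v \<in> EH" "eid u v < N" "{eid u v div n, eid u v mod n} = {u, v}"
proof -
  have "u \<noteq> v" "u < n" "v < n" using nb_props[OF assms] by auto
  then consider "u < v" | "v < u" by linarith
  then have "eid u v \<in> EH \<and> eid u v < N \<and> {eid u v div n, eid u v mod n} = {u, v}"
    by cases (use assms \<open>u < n\<close> \<open>v < n\<close> eid_dm in \<open>auto simp: eid_def EH_def neighbours_def insert_commute\<close>)
  then show "eid u v \<in> EH" "eid u v < N" "{eid u v div n, eid u v mod n} = {u, v}" by auto
qed

lemma EH_eid: assumes "e \<in> EH" shows "e mod n \<in> nb (e div n)" "e div n < n" "e mod n < n" "e div n < e mod n" "e = eid (e div n) (e mod n)" "e < N"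
proof -
  have h: "e div n < e mod n" "{e div n, e mod n} \<in> edges H" using assms by (auto simp: EH_def)
  show "e mod n \<in> nb (e div n)" using h by (simp add: neighbours_def)
  show "e div n < n" "e mod n < n" using edge_props[OF h(2)] by auto
  show "e div n < e mod n" by (rule h)
  show e: "e = eid (e div n) (e mod n)" using h(1) by (simp add: eid_def)
  show "e < N" using eid_dm(3)[OF h(1)] edge_props[OF h(2)] e by (metis eid_def h(1))
qed

lemma sAB: "{sA v u, sB v u} = {eid u v, eid u v + N}" if "u \<in> nb v"
  using nb_props(1)[OF that] by (auto simp: sA_def sB_def)

lemma rot_bij: "bij_betw (rot v) (nb v) (nb v)"
proof (cases "nb v = {}")
  case False
  then have "v \<in> vertices H" using nb_props by blast
  then show ?thesis using rs False cyclic_on_bij by (auto simp: rotation_system_def)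
qed (simp add: bij_betw_def)

lemma finite_nb: "finite (nb v)" using nb_props(4) finite_subset[of "nb v" "{..<n}"] by blast

definition gg :: "nat \<Rightarrow> nat \<Rightarrow> nat" where "gg c e = of_bool (F e = c) + of_bool (F (e + N) = c)"

lemma gg_AB: "u \<in> nb v \<Longrightarrow> gg c (eid u v) = of_bool (F (sA v u) = c) + of_bool (F (sB v u) = c)"
  using nb_props(1)[of u v] by (auto simp: gg_def sA_def sB_def)

lemma finite_EH: "finite EH" using EH_eid(6) finite_subset[of EH "{..<N}"] by blast

definition Cl :: "nat set" where "Cl = F ` EH \<union> (\<lambda>e. F (e + N)) ` EH"

section \<open>Even cuts, dual connectivity and Euler's formula\<close>

context
  assumes link: "\<And>v u. u \<in> nb v \<Longrightarrow> F (sA v u) = F (sB v (rot v u))" and EHE: "EH \<subseteq> E"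
begin

text \<open>Around every vertex the sides of a class pair up at the corners. Summation over
  \<open>U\<close> counts edges inside \<open>U\<close> twice, so modulo 2 only the cut
  remains.\<close>

lemma cut_even: "oc N F (cutE U \<inter> EH) = {}"
proof -
  have "even (pc N F (cutE U \<inter> EH) c)" for c
  proof -
    define D where "D = {(v, u). v \<in> U \<and> u \<in> nb v}"
    define V where "V = {v\<in>U. v < n}"
    have fV: "finite V" by (simp add: V_def)
    have De: "D = Sigma V nb" using nb_props by (auto simp: D_def V_def)
    have fD: "finite D" unfolding De using fV finite_nb by auto
    have "(\<Sum>(v, u)\<in>D. gg c (eid u v)) = (\<Sum>v\<in>V. \<Sum>u\<in>nb v. gg c (eid u v))"
      unfolding De by (rule sum.Sigma[symmetric]) (use fV finite_nb in auto)
    also have "\<dots> = (\<Sum>v\<in>V. 2 * (\<Sum>u\<in>nb v. of_bool (F (sA v u) = c)))"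
    proof (rule sum.cong[OF refl])
      fix v
      have "(\<Sum>u\<in>nb v. gg c (eid u v)) = (\<Sum>u\<in>nb v. of_bool (F (sA v u) = c)) + (\<Sum>u\<in>nb v. of_bool (F (sB v u) = c))"
        by (simp add: gg_AB sum.distrib)
      also have "(\<Sum>u\<in>nb v. of_bool (F (sB v u) = c)) = (\<Sum>u\<in>nb v. of_bool (F (sB v (rot v u)) = c))"
        by (rule sum.reindex_bij_betw[OF rot_bij, symmetric])
      also have "\<dots> = (\<Sum>u\<in>nb v. of_bool (F (sA v u) = c))" by (rule sum.cong) (auto simp: link)
      finally show "(\<Sum>u\<in>nb v. gg c (eid u v)) = 2 * (\<Sum>u\<in>nb v. of_bool (F (sA v u) = c))" by simp
    qed
    finally have ev: "even (\<Sum>(v, u)\<in>D. gg c (eid u v))" by (simp add: dvd_sum)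
    \<comment> \<open>Darts starting in \<open>U\<close> are divided by whether they start at the
      smaller or at the larger end; either kind corresponds to edge numbers.\<close>
    let ?D1 = "{(v, u)\<in>D. v < u}" and ?D2 = "{(v, u)\<in>D. u < v}"
    have "D = ?D1 \<union> ?D2" using nb_props(1) by (force simp: D_def)
    then have "(\<Sum>(v, u)\<in>D. gg c (eid u v)) = (\<Sum>(v, u)\<in>?D1 \<union> ?D2. gg c (eid u v))" by simp
    also have "\<dots> = (\<Sum>(v, u)\<in>?D1. gg c (eid u v)) + (\<Sum>(v, u)\<in>?D2. gg c (eid u v))"
      by (rule sum.union_disjoint) (use fD in \<open>auto intro: finite_subset\<close>)
    also have "(\<Sum>(v, u)\<in>?D1. gg c (eid u v)) = (\<Sum>e\<in>{e\<in>EH. e div n \<in> U}. gg c e)"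
    proof (rule sum.reindex_bij_witness[where j="\<lambda>(v, u). eid u v" and i="\<lambda>e. (e div n, e mod n)"], goal_cases)
      case (1 a)
      obtain v u where a: "a = (v, u)" "v < u" "u \<in> nb v" using 1 by (auto simp: D_def)
      then show ?case using eid_dm(1,2)[OF a(2) nb_props(4)[OF a(3)]] by (simp add: eid_def)
    next
      case (2 a)
      obtain v u where a: "a = (v, u)" "v < u" "u \<in> nb v" "v \<in> U" using 2 by (auto simp: D_def)
      then show ?case using eid_EH(1)[OF a(3)] eid_dm(1,2)[OF a(2) nb_props(4)[OF a(3)]] by (simp add: eid_def)
    next
      case (3 e)
      then show ?case using EH_eid(5)[of e] by (auto simp: eid_sym)
    next
      case (4 e)
      then show ?case using EH_eid[of e] by (auto simp: D_def)
    qed auto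
    also have "(\<Sum>(v, u)\<in>?D2. gg c (eid u v)) = (\<Sum>e\<in>{e\<in>EH. e mod n \<in> U}. gg c e)"
    proof (rule sum.reindex_bij_witness[where j="\<lambda>(v, u). eid u v" and i="\<lambda>e. (e mod n, e div n)"], goal_cases)
      case (1 a)
      obtain v u where a: "a = (v, u)" "u < v" "u \<in> nb v" using 1 by (auto simp: D_def)
      then show ?case using eid_dm(1,2)[OF a(2) nb_props(5)[OF a(3)]] by (simp add: eid_def)
    next
      case (2 a)
      obtain v u where a: "a = (v, u)" "u < v" "u \<in> nb v" "v \<in> U" using 2 by (auto simp: D_def)
      then show ?case using eid_EH(1)[OF a(3)] eid_dm(1,2)[OF a(2) nb_props(5)[OF a(3)]] by (simp add: eid_def)
    next
      case (3 e)
      then show ?case using EH_eid(5)[of e] by (auto simp: eid_sym)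
    next
      case (4 e)
      then show ?case using EH_eid[of e] nb_sym by (auto simp: D_def)
    qed auto
    also have "(\<Sum>e\<in>{e\<in>EH. e div n \<in> U}. gg c e) + (\<Sum>e\<in>{e\<in>EH. e mod n \<in> U}. gg c e) =
       (\<Sum>e\<in>EH. of_bool (e div n \<in> U) * gg c e + of_bool (e mod n \<in> U) * gg c e)"
      using finite_EH by (simp add: sum.distrib of_bool_def if_distrib[of "\<lambda>x. x * _"] sum.If_cases Int_def cong: if_cong)
    also have "\<dots> = (\<Sum>e\<in>EH. of_bool (e \<in> cutE U) * gg c e + 2 * (of_bool (e div n \<in> U \<and> e mod n \<in> U) * gg c e))"
      by (rule sum.cong) (use EHE in \<open>auto simp: cutE_def\<close>)
    also have "\<dots> = (\<Sum>e\<in>EH. of_bool (e \<in> cutE U) * gg c e) + 2 * (\<Sum>e\<in>EH. of_bool (e div n \<in> U \<and> e mod n \<in> U) * gg c e)"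
      by (simp add: sum.distrib sum_distrib_left)
    also have "(\<Sum>e\<in>EH. of_bool (e \<in> cutE U) * gg c e) = pc N F (cutE U \<inter> EH) c"
      using finite_EH unfolding pc_def gg_def[symmetric]
      by (simp add: of_bool_def if_distrib[of "\<lambda>x. x * _"] sum.If_cases Int_def conj_commute cong: if_cong)
    finally show ?thesis using ev by simp
  qed
  then show ?thesis by (simp add: oc_def)
qed

text \<open>Connectivity of the dual graph in algebraic form: \<open>S\<close> is a dual path
  between the two classes or any set with the same boundary.\<close>

definition scl :: "nat \<Rightarrow> nat \<Rightarrow> bool" where
  "scl s t \<longleftrightarrow> (\<exists>S\<subseteq>EH. oc N F S = sym_diff {F s} {F t})"

lemma scl_refl: "scl s s" unfolding scl_def by (rule exI[of _ "{}"]) simp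
lemma scl_sym: "scl s t \<Longrightarrow> scl t s" unfolding scl_def by (metis Un_commute)
lemma scl_trans: assumes "scl s t" "scl t u" shows "scl s u"
proof -
  obtain S T where ST: "S \<subseteq> EH" "oc N F S = sym_diff {F s} {F t}" "T \<subseteq> EH" "oc N F T = sym_diff {F t} {F u}"
    using assms by (auto simp: scl_def)
  have "oc N F (sym_diff S T) = sym_diff (oc N F S) (oc N F T)"
    by (rule oc_symdiff) (use finite_subset[OF ST(1) finite_EH] finite_subset[OF ST(3) finite_EH] in auto)
  also have "\<dots> = sym_diff {F s} {F u}" unfolding ST(2,4) by auto
  finally show ?thesis unfolding scl_def using ST by (intro exI[of _ "sym_diff S T"]) auto
qed
lemma scl_F: "F s = F t \<Longrightarrow> scl s t" using scl_refl[of s] by (simp add: scl_def)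
lemma scl_edge: "e \<in> EH \<Longrightarrow> scl e (e + N)" unfolding scl_def by (rule exI[of _ "{e}"]) (simp add: oc_single)

lemma scl_sides: assumes "u \<in> nb v" "s \<in> {eid u v, eid u v + N}" "t \<in> {eid u v, eid u v + N}" shows "scl s t"
  using scl_edge[OF eid_EH(1)[OF assms(1)]] assms(2,3) scl_refl scl_sym by auto

text \<open>Turning around \<open>v\<close> alternates between passing a corner and crossing an
  edge.\<close>

lemma scl_vertex: assumes "u \<in> nb v" "u' \<in> nb v" shows "scl (sA v u) (sA v u')"
proof -
  have cyc: "cyclic_on (rot v) (nb v)" using rs assms(1) nb_props(3)[OF assms(1)] by (auto simp: rotation_system_def)
  have "u' \<in> orbit (rot v) u" using cyc assms by (auto simp: cyclic_on_alldef)
  then show ?thesis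
  proof induction
    have st: "scl (sA v y) (sA v (rot v y))" if y: "y \<in> nb v" for y
    proof -
      have ry: "rot v y \<in> nb v" using cyclic_on_inI[OF cyc y] .
      have "scl (sA v y) (sB v (rot v y))" by (rule scl_F) (rule link[OF y])
      moreover have "scl (sB v (rot v y)) (sA v (rot v y))" by (rule scl_sides[OF ry]) (use sAB[OF ry] in auto)
      ultimately show ?thesis by (rule scl_trans)
    qed
    case base
    then show ?case using st assms by blast
    case (step y)
    have "y \<in> nb v" using step(1) cyc assms(1) by (auto simp: cyclic_on_alldef)
    then show ?case using st step(2) scl_trans by blast
  qed
qed

definition hconn :: "(nat \<times> nat) set" where
  "hconn = {(u, v). u \<in> vertices H \<and> v \<in> vertices H \<and> (u, v) \<in> {(x, y). {x, y} \<in> edges H}\<^sup>*}"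

lemma hconn_equiv: "equiv (vertices H) hconn"
proof (rule equivI)
  have "sym ({(x, y). {x, y} \<in> edges H})" by (auto simp: sym_def insert_commute)
  then have "sym ({(x, y). {x, y} \<in> edges H}\<^sup>*)" by (rule sym_rtrancl)
  then show "sym hconn" unfolding hconn_def sym_def by blast
  show "trans hconn" unfolding hconn_def trans_def by auto
qed (auto simp: hconn_def refl_on_def)

lemma comp_eq: "components H = vertices H // hconn" by (simp add: components_def hconn_def)

lemma scl_conn: assumes "(v, v') \<in> {(x, y). {x, y} \<in> edges H}\<^sup>*" "u \<in> nb v" "u' \<in> nb v'" shows "scl (sA v u) (sA v' u')"
  using assms
proof (induction arbitrary: u' rule: rtrancl_induct)
  case base
  then show ?case by (rule scl_vertex)
next
  case (step y z)
  have zy: "z \<in> nb y" "y \<in> nb z" using step(2) by (auto simp: neighbours_def insert_commute)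
  have "scl (sA v u) (sA y z)" by (rule step.IH[OF step.prems(1) zy(1)])
  moreover have "scl (sA y z) (sA z y)"
    by (rule scl_sides[OF zy(1)]) (use sAB[OF zy(1)] sAB[OF zy(2)] eid_sym[of y z] in auto)
  moreover have "scl (sA z y) (sA z u')" by (rule scl_vertex[OF zy(2) step.prems(2)])
  ultimately show ?case using scl_trans by blast
qed

lemma finV: "finite (vertices H)" using fs by (simp add: finite_simple_graph_def)

definition root :: "nat set \<Rightarrow> nat" where "root c = (SOME v. v \<in> c)"
definition Rt :: "nat set" where "Rt = root ` components H"

lemma root_in: "c \<in> components H \<Longrightarrow> root c \<in> c"
  using in_quotient_imp_non_empty[OF hconn_equiv, of c] unfolding comp_eq root_def by (simp add: some_in_eq)

lemma card_Rt: "card Rt = card (components H)"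
proof -
  have "inj_on root (components H)"
  proof (rule inj_onI)
    fix c d assume "c \<in> components H" "d \<in> components H" "root c = root d"
    then show "c = d" using root_in quotient_disj[OF hconn_equiv] unfolding comp_eq by (metis disjoint_iff comp_eq)
  qed
  then show ?thesis unfolding Rt_def by (rule card_image)
qed

lemma Rt_sub: "Rt \<subseteq> vertices H"
  using root_in in_quotient_imp_subset[OF hconn_equiv] unfolding Rt_def comp_eq by blast

lemma root_of: assumes "v \<in> vertices H" obtains r where "r \<in> Rt" "(v, r) \<in> hconn"
proof -
  let ?c = "hconn `` {v}"
  have "?c \<in> components H" unfolding comp_eq using assms by (rule quotientI)
  then show thesis using that[of "root ?c"] root_in by (auto simp: Rt_def)
qed

lemma hconn_nb: assumes "(v, r) \<in> hconn" "nb v = {}" shows "r = v"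
proof -
  have "(v, r) \<in> {(x, y). {x, y} \<in> edges H}\<^sup>*" using assms by (simp add: hconn_def)
  then show ?thesis by (cases rule: converse_rtranclE) (use assms in \<open>auto simp: neighbours_def\<close>)
qed

lemma iso_Rt: "{v\<in>vertices H. nb v = {}} \<subseteq> Rt" using root_of hconn_nb by blast

text \<open>A reference class for every component that has an edge. The face of an isolated vertex
  is not a class, which is why \<open>card_RF\<close> counts these vertices separately.\<close>

definition RF :: "nat set" where "RF = (\<lambda>r. F (sA r (SOME u. u \<in> nb r))) ` {r\<in>Rt. nb r \<noteq> {}}"

lemma card_RF: "card RF + card {v\<in>vertices H. nb v = {}} \<le> card (components H)"
proof -
  have fR: "finite Rt" using Rt_sub finV finite_subset by blast
  have "card RF \<le> card {r\<in>Rt. nb r \<noteq> {}}" unfolding RF_def by (rule card_image_le) (use fR in auto)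
  moreover have "{r\<in>Rt. nb r \<noteq> {}} \<inter> {v\<in>vertices H. nb v = {}} = {}" by auto
  then have "card {r\<in>Rt. nb r \<noteq> {}} + card {v\<in>vertices H. nb v = {}} = card ({r\<in>Rt. nb r \<noteq> {}} \<union> {v\<in>vertices H. nb v = {}})"
    by (rule card_Un_disjoint[symmetric, rotated 2]) (use fR finV in auto)
  moreover have "\<dots> \<le> card Rt" by (rule card_mono[OF fR]) (use iso_Rt in auto)
  ultimately show ?thesis using card_Rt by linarith
qed

text \<open>Follow a path of the component from an edge of the class to the root, turning around
  each vertex on the way.\<close>

lemma RF_reach: assumes c: "c \<in> Cl" shows "\<exists>S\<subseteq>EH. \<exists>r\<in>RF. oc N F S = sym_diff {c} {r}"
proof -
  obtain e s where e: "e \<in> EH" "s \<in> {e, e + N}" "c = F s" using c by (auto simp: Cl_def)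
  define v u where "v = e div n" and "u = e mod n"
  have u: "u \<in> nb v" "e = eid u v" using EH_eid[OF e(1)] eid_sym by (auto simp: v_def u_def)
  obtain r where r: "r \<in> Rt" "(v, r) \<in> hconn" using root_of[OF nb_props(3)[OF u(1)]] .
  have nr: "nb r \<noteq> {}"
  proof
    assume "nb r = {}"
    then have "v = r" using hconn_nb[of r v] r(2) hconn_equiv by (meson equiv_def symE)
    then show False using u \<open>nb r = {}\<close> by auto
  qed
  define u' where "u' = (SOME u. u \<in> nb r)"
  have u': "u' \<in> nb r" using nr unfolding u'_def by (simp add: some_in_eq)
  have "scl s (sA v u)" by (rule scl_sides[OF u(1)]) (use e u sAB[OF u(1)] in auto)
  moreover have "scl (sA v u) (sA r u')" by (rule scl_conn[OF _ u(1) u']) (use r in \<open>auto simp: hconn_def\<close>)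
  ultimately have "scl s (sA r u')" by (rule scl_trans)
  moreover have "F (sA r u') \<in> RF" using r nr by (auto simp: RF_def u'_def)
  ultimately show ?thesis unfolding scl_def e(3) by blast
qed

text \<open>Two counts, with classes \<open>NF\<close> and vertices \<open>NR\<close> other than the
  references. Dual paths realise every parity pattern on \<open>NF\<close>, so there are at most
  \<open>2 ^ (card EH - card NF)\<close> even sets. The cuts given by subsets of \<open>NR\<close>
  are distinct, so every class of even sets modulo cuts has at least \<open>2 ^ card NR\<close>
  members. Euler's formula bounds the remaining exponent by \<open>G\<close>, and
  \<open>\<Psi>\<close> numbers the classes.\<close>

lemma topo_initial:
  assumes genus: "card EH + 2 * card (components H) \<le> card (vertices H) + card Cl + card {v\<in>vertices H. nb v = {}} + G"
  shows "topo (2 ^ G) EH F (\<lambda>v. v)"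
proof -
  have fE: "finite EH" by (rule finite_EH)
  define NR where "NR = vertices H - Rt"
  define NF where "NF = Cl - RF"
  have fCl: "finite Cl" using fE by (simp add: Cl_def)
  have fNF: "finite NF" "finite NR" using fCl finV by (auto simp: NF_def NR_def)
  let ?Z = "{X. X \<subseteq> EH \<and> oc N F X = {}}"
  have fZ: "finite ?Z" using fE by (auto intro: finite_subset[of _ "Pow EH"])
  have fin: "finite X" if "X \<subseteq> EH" for X using that fE finite_subset by blast
  have lc: "lcut (\<lambda>v. v) EH L = cutE L \<inter> EH" for L using EHE by (auto simp: lcut_def cutE_def)
  have lcZ: "lcut (\<lambda>v. v) EH L \<in> ?Z" for L using cut_even by (auto simp: lc)
  have lsd: "sym_diff (lcut (\<lambda>v. v) EH L) (lcut (\<lambda>v. v) EH L') = lcut (\<lambda>v. v) EH (sym_diff L L')" for L L' by (auto simp: lcut_def)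
  have Zsd: "sym_diff X Y \<in> ?Z" if "X \<in> ?Z" "Y \<in> ?Z" for X Y using that oc_symdiff[of X Y N F] fin by auto
  have SQ: "\<exists>S\<subseteq>EH. oc N F S \<inter> NF = Q" if "Q \<subseteq> NF" for Q
  proof -
    have "finite Q" using that fNF finite_subset by blast
    then show ?thesis using that
    proof (induction Q)
      case empty
      then show ?case by (intro exI[of _ "{}"]) simp
    next
      case (insert c Q)
      then obtain S where S: "S \<subseteq> EH" "oc N F S \<inter> NF = Q" by auto
      obtain T r where T: "T \<subseteq> EH" "r \<in> RF" "oc N F T = sym_diff {c} {r}" using RF_reach[of c] insert.prems by (auto simp: NF_def)
      have "oc N F (sym_diff S T) = sym_diff (oc N F S) (sym_diff {c} {r})" using oc_symdiff[of S T N F] fin S T by simp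
      moreover have "c \<in> NF" "r \<notin> NF" using insert.prems T by (auto simp: NF_def)
      ultimately have "oc N F (sym_diff S T) \<inter> NF = sym_diff (oc N F S \<inter> NF) {c}" by auto
      also have "\<dots> = insert c Q" using S(2) insert.hyps by auto
      finally show ?case using S T by (intro exI[of _ "sym_diff S T"]) auto
    qed
  qed
  define sq where "sq Q = (SOME S. S \<subseteq> EH \<and> oc N F S \<inter> NF = Q)" for Q
  have sq: "sq Q \<subseteq> EH" "oc N F (sq Q) \<inter> NF = Q" if "Q \<subseteq> NF" for Q
  proof -
    from someI_ex[OF SQ[OF that]] have "sq Q \<subseteq> EH \<and> oc N F (sq Q) \<inter> NF = Q" unfolding sq_def .
    then show "sq Q \<subseteq> EH" "oc N F (sq Q) \<inter> NF = Q" by simp_all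
  qed
  have c1: "card ?Z * 2 ^ card NF \<le> 2 ^ card EH"
  proof -
    have "card (?Z \<times> Pow NF) \<le> card (Pow EH)"
    proof (rule card_inj_on_le[where f="\<lambda>(X, Q). sym_diff X (sq Q)"])
      show "inj_on (\<lambda>(X, Q). sym_diff X (sq Q)) (?Z \<times> Pow NF)"
      proof (rule inj_onI, clarify)
        fix X Q X' Q' assume X: "X \<subseteq> EH" "oc N F X = {}" "X' \<subseteq> EH" "oc N F X' = {}" and Q: "Q \<subseteq> NF" "Q' \<subseteq> NF"
          and eq: "sym_diff X (sq Q) = sym_diff X' (sq Q')"
        have "oc N F (sym_diff X (sq Q)) = oc N F (sq Q)" using oc_symdiff[of X "sq Q" N F] fin X sq Q by simp
        moreover have "oc N F (sym_diff X' (sq Q')) = oc N F (sq Q')" using oc_symdiff[of X' "sq Q'" N F] fin X sq Q by simp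
        ultimately have "Q = Q'" using eq sq(2)[OF Q(1)] sq(2)[OF Q(2)] by simp
        moreover have "X = X'"
        proof -
          have "sym_diff (sym_diff X (sq Q)) (sq Q) = sym_diff (sym_diff X' (sq Q)) (sq Q)" using eq \<open>Q = Q'\<close> by simp
          moreover have "sym_diff (sym_diff A B) B = A" for A B :: "nat set" by blast
          ultimately show ?thesis by simp
        qed
        ultimately show "X = X' \<and> Q = Q'" by simp
      qed
      show "(\<lambda>(X, Q). sym_diff X (sq Q)) ` (?Z \<times> Pow NF) \<subseteq> Pow EH"
      proof (rule image_subsetI)
        fix p assume "p \<in> ?Z \<times> Pow NF"
        then obtain X Q where p: "p = (X, Q)" "X \<subseteq> EH" "Q \<subseteq> NF" by auto
        then show "(case p of (X, Q) \<Rightarrow> sym_diff X (sq Q)) \<in> Pow EH" using sq(1)[OF p(3)] by auto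
      qed
    qed (use fE in simp)
    then show ?thesis using fE fNF by (simp add: card_cartesian_product card_Pow)
  qed
  define R where "R = {(X, Y). X \<in> ?Z \<and> Y \<in> ?Z \<and> (\<exists>L. sym_diff X Y = lcut (\<lambda>v. v) EH L)}"
  have eqR: "equiv ?Z R"
  proof (rule equivI)
    show "R \<subseteq> ?Z \<times> ?Z" by (auto simp: R_def)
    have "sym_diff X X = lcut (\<lambda>v. v) EH {}" for X by (simp add: lcut_def)
    then show "refl_on ?Z R" unfolding refl_on_def R_def by blast
    show "sym R" unfolding sym_def R_def by (auto simp: Un_commute)
    show "trans R" unfolding trans_def
    proof (intro allI impI)
      fix X Y W assume h: "(X, Y) \<in> R" "(Y, W) \<in> R"
      obtain L L' where L: "sym_diff X Y = lcut (\<lambda>v. v) EH L" "sym_diff Y W = lcut (\<lambda>v. v) EH L'" using h by (auto simp: R_def)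
      have "sym_diff X W = sym_diff (sym_diff X Y) (sym_diff Y W)" by blast
      also have "\<dots> = lcut (\<lambda>v. v) EH (sym_diff L L')" unfolding L by (rule lsd)
      finally show "(X, W) \<in> R" using h unfolding R_def by blast
    qed
  qed
  have cls: "2 ^ card NR \<le> card c" if c: "c \<in> ?Z // R" for c
  proof -
    obtain X where X: "X \<in> ?Z" "c = R `` {X}" using c by (rule quotientE)
    have "card (Pow NR) \<le> card c"
    proof (rule card_inj_on_le[where f="\<lambda>U. sym_diff X (lcut (\<lambda>v. v) EH U)"])
      show "finite c" using X fZ by (auto simp: R_def intro: finite_subset[of _ ?Z])
      show "(\<lambda>U. sym_diff X (lcut (\<lambda>v. v) EH U)) ` Pow NR \<subseteq> c"
      proof
        fix Y assume "Y \<in> (\<lambda>U. sym_diff X (lcut (\<lambda>v. v) EH U)) ` Pow NR"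
        then obtain U where Y: "Y = sym_diff X (lcut (\<lambda>v. v) EH U)" by blast
        have "sym_diff X Y = lcut (\<lambda>v. v) EH U" unfolding Y by blast
        moreover have "Y \<in> ?Z" unfolding Y by (rule Zsd[OF X(1) lcZ])
        ultimately show "Y \<in> c" using X by (auto simp: R_def)
      qed
      show "inj_on (\<lambda>U. sym_diff X (lcut (\<lambda>v. v) EH U)) (Pow NR)"
      proof (rule inj_onI)
        fix U U' assume U: "U \<in> Pow NR" "U' \<in> Pow NR" and eq: "sym_diff X (lcut (\<lambda>v. v) EH U) = sym_diff X (lcut (\<lambda>v. v) EH U')"
        have "sym_diff X (sym_diff X A) = A" for A by blast
        then have "lcut (\<lambda>v. v) EH U = lcut (\<lambda>v. v) EH U'" using eq by metis
        then have e0: "lcut (\<lambda>v. v) EH (sym_diff U U') = {}" using lsd[of U U'] by simp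
        define W where "W = sym_diff U U'"
        have WN: "W \<subseteq> NR" using U by (auto simp: W_def)
        \<comment> \<open>An empty cut makes \<open>W\<close> a union of components, but
          \<open>W\<close> contains no root.\<close>
        have cl: "y \<in> W" if "x \<in> W" "{x, y} \<in> edges H" for x y
        proof (rule ccontr)
          assume "y \<notin> W"
          have yx: "y \<in> nb x" using that by (simp add: neighbours_def)
          have "eid y x \<in> lcut (\<lambda>v. v) EH W" using eid_EH[OF yx] \<open>y \<notin> W\<close> that(1) by (auto simp: lcut_def doubleton_eq_iff)
          then show False using e0 by (simp add: W_def)
        qed
        have "W = {}"
        proof (rule ccontr)
          assume "W \<noteq> {}"
          then obtain x where x: "x \<in> W" by blast
          then obtain r where r: "r \<in> Rt" "(x, r) \<in> hconn" using root_of[of x] WN by (auto simp: NR_def)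
          have "(x, r) \<in> {(x, y). {x, y} \<in> edges H}\<^sup>*" using r by (simp add: hconn_def)
          then have "r \<in> W" by induction (use x cl in auto)
          then show False using r WN by (auto simp: NR_def)
        qed
        then show "U = U'" by (auto simp: W_def)
      qed
    qed
    then show ?thesis using fNF by (simp add: card_Pow)
  qed
  have fQ: "finite (?Z // R)" by (rule finite_quotient[OF fZ]) (auto simp: R_def)
  have "card (?Z // R) * 2 ^ card NR = (\<Sum>c\<in>?Z // R. 2 ^ card NR)" by simp
  also have "\<dots> \<le> (\<Sum>c\<in>?Z // R. card c)" by (rule sum_mono) (rule cls)
  also have "\<dots> = card (\<Union> (?Z // R))"
  proof (rule card_Union_disjoint[symmetric])
    show "pairwise disjnt (?Z // R)" unfolding pairwise_def disjnt_def using quotient_disj[OF eqR] by blast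
    show "finite c" if "c \<in> ?Z // R" for c using in_quotient_imp_subset[OF eqR that] fZ finite_subset by blast
  qed
  also have "\<Union> (?Z // R) = ?Z" by (rule Union_quotient[OF eqR])
  finally have c2: "card (?Z // R) * 2 ^ card NR \<le> card ?Z" .
  have "card (?Z // R) * 2 ^ (card NR + card NF) = card (?Z // R) * 2 ^ card NR * 2 ^ card NF" by (simp add: power_add)
  also have "\<dots> \<le> card ?Z * 2 ^ card NF" by (rule mult_right_mono[OF c2]) simp
  also have "\<dots> \<le> 2 ^ card EH" by (rule c1)
  also have "\<dots> \<le> 2 ^ (card NR + card NF + G)"
  proof (rule power_increasing)
    have "card NR = card (vertices H) - card (components H)" unfolding NR_def
      using card_Diff_subset[OF finite_subset[OF Rt_sub finV] Rt_sub] card_Rt by simp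
    moreover have "card (components H) \<le> card (vertices H)" using card_mono[OF finV Rt_sub] card_Rt by simp
    moreover have "card Cl - card RF \<le> card NF" unfolding NF_def by (rule diff_card_le_card_Diff) (use finite_subset[OF Rt_sub finV] in \<open>auto simp: RF_def\<close>)
    ultimately show "card EH \<le> card NR + card NF + G" using genus card_RF by linarith
  qed simp
  finally have "card (?Z // R) * 2 ^ (card NR + card NF) \<le> 2 ^ G * 2 ^ (card NR + card NF)" by (simp add: power_add mult.commute)
  then have cQ: "card (?Z // R) \<le> 2 ^ G" by simp
  obtain h where h: "bij_betw h (?Z // R) {0..<card (?Z // R)}" using ex_bij_betw_finite_nat[OF fQ] by blast
  show ?thesis unfolding topo_def
  proof (intro exI[of _ "\<lambda>X. h (R `` {X})"] conjI allI impI)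
    fix X assume X: "X \<subseteq> EH" "oc N F X = {}"
    then have "R `` {X} \<in> ?Z // R" by (intro quotientI) simp
    then have "h (R `` {X}) \<in> {0..<card (?Z // R)}" using h by (auto simp: bij_betw_def)
    then show "h (R `` {X}) < 2 ^ G" using cQ by simp
  next
    fix X Y assume X: "X \<subseteq> EH" "Y \<subseteq> EH" and hh: "oc N F X = {} \<and> oc N F Y = {} \<and> h (R `` {X}) = h (R `` {Y})"
    have XY: "R `` {X} \<in> ?Z // R" "R `` {Y} \<in> ?Z // R" using X hh by (auto intro!: quotientI)
    then have "R `` {X} = R `` {Y}" using h hh by (auto simp: bij_betw_def inj_on_def)
    then have "(X, Y) \<in> R" using eq_equiv_class[OF _ eqR] X hh by blast
    then show "\<exists>L. sym_diff X Y = lcut (\<lambda>v. v) EH L" by (auto simp: R_def)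
  qed
qed

end

section \<open>Facial walks versus classes of sides\<close>

definition flags :: "(nat \<times> nat \<times> bool) set" where "flags = {(u, v, b). {u, v} \<in> edges H}"
abbreviation "fstep \<equiv> face_step H rot twi"
text \<open>Reversal of a facial walk: the same side of the same edge, traversed in the opposite
  direction.\<close>

definition mu :: "nat \<times> nat \<times> bool \<Rightarrow> nat \<times> nat \<times> bool" where
  "mu = (\<lambda>(u, v, b). (v, u, \<not> (b \<noteq> tw u v)))"
text \<open>The side along which the facial walk runs, in the numbering fixed at the smaller end of
  the edge.\<close>

definition sdf :: "nat \<times> nat \<times> bool \<Rightarrow> nat" where
  "sdf = (\<lambda>(u, v, b). if u < v then eid u v + (if b then N else 0) else eid u v + (if b \<noteq> tw u v then 0 else N))"

lemma mu_mu: "mu (mu y) = y" by (cases y) (auto simp: mu_def insert_commute)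
lemma mu_flags: "y \<in> flags \<Longrightarrow> mu y \<in> flags" by (auto simp: mu_def flags_def insert_commute)

lemma inv_rot: assumes "u \<in> nb v" shows "inv_into (nb v) (rot v) u \<in> nb v" "rot v (inv_into (nb v) (rot v) u) = u" "inv_into (nb v) (rot v) (rot v u) = u" "rot v u \<in> nb v"
proof -
  have b: "inj_on (rot v) (nb v)" "rot v ` nb v = nb v" using rot_bij[of v] by (auto simp: bij_betw_def)
  show "inv_into (nb v) (rot v) u \<in> nb v" "rot v (inv_into (nb v) (rot v) u) = u" using assms b(2) by (metis inv_into_into, metis f_inv_into_f)
  show "inv_into (nb v) (rot v) (rot v u) = u" using b(1) assms by (rule inv_into_f_f)
  show "rot v u \<in> nb v" using assms b(2) by blast
qed

lemma fstep_flags: assumes "y \<in> flags" shows "fstep y \<in> flags" "fstep (mu (fstep y)) = mu y"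
proof -
  obtain u v b where y: "y = (u, v, b)" by (cases y)
  have u: "u \<in> nb v" using assms y by (auto simp: flags_def neighbours_def insert_commute)
  show "fstep y \<in> flags" using inv_rot[OF u] by (auto simp: y face_step_def flags_def Let_def neighbours_def)
  show "fstep (mu (fstep y)) = mu y" using inv_rot[OF u] by (auto simp: y face_step_def mu_def Let_def insert_commute)
qed

lemma finite_flags: "finite flags"
proof -
  have "flags \<subseteq> {..<n} \<times> {..<n} \<times> UNIV" using edge_props by (auto simp: flags_def)
  then show ?thesis by (rule finite_subset) simp
qed

text \<open>\<open>orbit\<close> contains positive iterates only, so a return is required: on the
  finite set of flags, \<open>fstep\<close> is injective with inverse \<open>mu\<close> after
  \<open>fstep\<close> after \<open>mu\<close>.\<close>

lemma flag_in_orbit: assumes y: "y \<in> flags" shows "y \<in> orbit fstep y"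
proof -
  have it: "(fstep ^^ k) y \<in> flags" for k by (induction k) (use y fstep_flags in auto)
  have inj: "inj_on fstep flags"
    by (rule inj_on_inverseI[where g="\<lambda>y. mu (fstep (mu y))"]) (simp add: fstep_flags mu_mu)
  have injk: "inj_on (fstep ^^ k) flags" for k
  proof (induction k)
    case (Suc k)
    have "(fstep ^^ k) ` flags \<subseteq> flags"
    proof (rule image_subsetI)
      fix z assume "z \<in> flags"
      then show "(fstep ^^ k) z \<in> flags" by (induction k) (use fstep_flags in auto)
    qed
    then show ?case using comp_inj_on[OF Suc.IH inj_on_subset[OF inj]] by (simp add: comp_def)
  qed simp
  have "\<not> inj_on (\<lambda>k. (fstep ^^ k) y) UNIV"
  proof
    assume "inj_on (\<lambda>k. (fstep ^^ k) y) UNIV"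
    then have "infinite (range (\<lambda>k. (fstep ^^ k) y))" by (simp add: range_inj_infinite)
    moreover have "range (\<lambda>k. (fstep ^^ k) y) \<subseteq> flags" using it by (intro image_subsetI)
    ultimately show False using finite_subset[OF _ finite_flags] by metis
  qed
  then have "\<exists>i j. i < j \<and> (fstep ^^ i) y = (fstep ^^ j) y" unfolding inj_on_def by (metis linorder_neqE_nat)
  then obtain i j where ij: "i < j" "(fstep ^^ i) y = (fstep ^^ j) y" by blast
  have "(fstep ^^ j) y = (fstep ^^ i) ((fstep ^^ (j - i)) y)" using ij(1) funpow_add[of i "j - i" fstep] by simp
  then have "(fstep ^^ i) y = (fstep ^^ i) ((fstep ^^ (j - i)) y)" using ij(2) by simp
  then have "y = (fstep ^^ (j - i)) y" using inj_onD[OF injk[of i]] y it by blast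
  then show ?thesis using ij(1) by (auto simp: orbit_altdef intro!: exI[of _ "j - i"])
qed

text \<open>The face without a direction, as the set of the orbits of both traversals.\<close>

definition O2 where "O2 y = {orbit fstep y, orbit fstep (mu y)}"

lemma O2_mu: "O2 (mu y) = O2 y" by (simp add: O2_def mu_mu insert_commute)
lemma O2_step: assumes "y \<in> flags" shows "O2 (fstep y) = O2 y"
proof -
  have "orbit fstep (fstep y) = orbit fstep y" by (rule self_in_orbit_step[OF flag_in_orbit[OF assms]])
  moreover have m: "mu (fstep y) \<in> flags" using mu_flags fstep_flags(1)[OF assms] by blast
  have "orbit fstep (mu y) = orbit fstep (mu (fstep y))"
    using self_in_orbit_step[OF flag_in_orbit[OF m]] fstep_flags(2)[OF assms] by simp
  ultimately show ?thesis by (simp add: O2_def)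
qed

lemma sdf_eq: assumes "y \<in> flags" "y' \<in> flags" "sdf y = sdf y'" shows "O2 y = O2 y'"
proof -
  obtain u v b u' v' b' where y: "y = (u, v, b)" "y' = (u', v', b')" by (cases y, cases y')
  have u: "u \<in> nb v" "u' \<in> nb v'" using assms y by (auto simp: flags_def neighbours_def insert_commute)
  have lt: "eid u v < N" "eid u' v' < N" using eid_EH(2) u by auto
  have ed: "ed N (sdf (u, v, b)) = eid u v" "ed N (sdf (u', v', b')) = eid u' v'" using lt by (auto simp: sdf_def ed_def)
  then have ee: "eid u v = eid u' v'" using assms(3) y by simp
  then have uv: "{u, v} = {u', v'}" using eid_EH(3)[OF u(1)] eid_EH(3)[OF u(2)] by simp
  have N0: "N > 0" using lt(1) by (metis gr0I not_less0)
  have ne: "u \<noteq> v" using nb_props[OF u(1)] by simp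
  have "y' = y \<or> y' = mu y"
    using uv assms(3) N0 ne ee by (auto simp: y sdf_def mu_def doubleton_eq_iff insert_commute split: if_splits)
  then show ?thesis using O2_mu[of y] by auto
qed

lemma link_sdf: assumes "u \<in> nb v"
  shows "(u, v, \<not> tw u v) \<in> flags" "sdf (u, v, \<not> tw u v) = sA v u" "sdf (fstep (u, v, \<not> tw u v)) = sB v (rot v u)"
proof -
  show "(u, v, \<not> tw u v) \<in> flags" using assms by (auto simp: flags_def neighbours_def insert_commute)
  show "sdf (u, v, \<not> tw u v) = sA v u" by (auto simp: sdf_def sA_def)
  have "fstep (u, v, \<not> tw u v) = (v, rot v u, True)" by (simp add: face_step_def)
  then show "sdf (fstep (u, v, \<not> tw u v)) = sB v (rot v u)"
    by (auto simp: sdf_def sB_def eid_sym insert_commute)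
qed

text \<open>Passing a corner is one step of a facial walk, so linked sides belong to the same
  face.\<close>

lemma sdf_link: assumes "(s, t) \<in> links\<^sup>* \<or> (s, t) \<in> (links \<union> links\<inverse>)\<^sup>*" "y \<in> flags" "sdf y = s" "y' \<in> flags" "sdf y' = t" shows "O2 y = O2 y'"
proof -
  have "(s, t) \<in> (links \<union> links\<inverse>)\<^sup>*" using assms(1) by (meson in_rtrancl_UnI)
  then have "\<exists>y'\<in>flags. sdf y' = t \<and> O2 y' = O2 y"
  proof induction
    case base
    then show ?case using assms by blast
  next
    case (step a b)
    then obtain ya where ya: "ya \<in> flags" "sdf ya = a" "O2 ya = O2 y" by blast
    have "\<exists>u v. u \<in> nb v \<and> ((a = sA v u \<and> b = sB v (rot v u)) \<or> (b = sA v u \<and> a = sB v (rot v u)))"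
      using step(2) by (auto simp: links_def)
    then obtain u v where uv: "u \<in> nb v" "(a = sA v u \<and> b = sB v (rot v u)) \<or> (b = sA v u \<and> a = sB v (rot v u))" by blast
    let ?z = "(u, v, \<not> tw u v)"
    note lk = link_sdf[OF uv(1)]
    have fz: "fstep ?z \<in> flags" "O2 (fstep ?z) = O2 ?z" using fstep_flags(1)[OF lk(1)] O2_step[OF lk(1)] by auto
    from uv(2) show ?case
    proof
      assume h: "a = sA v u \<and> b = sB v (rot v u)"
      then have "O2 ya = O2 ?z" using sdf_eq[OF ya(1) lk(1)] ya(2) lk(2) by simp
      then show ?case using fz lk(3) h ya(3) by (intro bexI[of _ "fstep ?z"]) auto
    next
      assume h: "b = sA v u \<and> a = sB v (rot v u)"
      then have "O2 ya = O2 (fstep ?z)" using sdf_eq[OF ya(1) fz(1)] ya(2) lk(3) by simp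
      then show ?case using fz lk h ya(3) by (intro bexI[of _ ?z]) auto
    qed
  qed
  then show ?thesis using sdf_eq assms(4,5) by metis
qed

text \<open>By \<open>cl\<close> a class lies within one face, so there are at least as many classes
  as faces, and a face has at most two orbits. This is the direction in which a genus bound limits
  the number of edges.\<close>

lemma faces_le:
  assumes cl: "\<And>s t. ed N s \<in> EH \<Longrightarrow> ed N t \<in> EH \<Longrightarrow> F s = F t \<Longrightarrow> (s, t) \<in> (links \<union> links\<inverse>)\<^sup>*"
  shows "card (orbit fstep ` flags) \<le> 2 * card (F ` EH \<union> (\<lambda>e. F (e + N)) ` EH)"
proof -
  let ?Cl = "F ` EH \<union> (\<lambda>e. F (e + N)) ` EH"
  have fCl: "finite ?Cl" using finite_EH by simp
  define pick where "pick c = (SOME y. y \<in> flags \<and> F (sdf y) = c)" for c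
  have edf: "ed N (sdf y) \<in> EH" "F (sdf y) \<in> ?Cl" if "y \<in> flags" for y
  proof -
    obtain u v b where y: "y = (u, v, b)" by (cases y)
    have u: "u \<in> nb v" using that y by (auto simp: flags_def neighbours_def insert_commute)
    have *: "sdf y = eid u v \<or> sdf y = eid u v + N" by (auto simp: y sdf_def)
    then show "ed N (sdf y) \<in> EH" using eid_EH(1,2)[OF u] by (auto simp: ed_def)
    show "F (sdf y) \<in> ?Cl" using * eid_EH(1)[OF u] by auto
  qed
  have "orbit fstep ` flags \<subseteq> (\<Union>c\<in>?Cl. O2 (pick c))"
  proof
    fix O' assume "O' \<in> orbit fstep ` flags"
    then obtain y where y: "y \<in> flags" "O' = orbit fstep y" by blast
    let ?c = "F (sdf y)"
    have "\<exists>z. z \<in> flags \<and> F (sdf z) = ?c" using y by blast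
    from someI_ex[OF this] have p: "pick ?c \<in> flags" "F (sdf (pick ?c)) = ?c" unfolding pick_def by auto
    have "(sdf y, sdf (pick ?c)) \<in> (links \<union> links\<inverse>)\<^sup>*" by (rule cl[OF edf(1)[OF y(1)] edf(1)[OF p(1)]]) (use p in simp)
    then have "O2 y = O2 (pick ?c)" using sdf_link[of "sdf y" "sdf (pick ?c)" y "pick ?c"] y p by blast
    moreover have "O' \<in> O2 y" using y by (simp add: O2_def)
    ultimately show "O' \<in> (\<Union>c\<in>?Cl. O2 (pick c))" using edf(2)[OF y(1)] by blast
  qed
  then have "card (orbit fstep ` flags) \<le> card (\<Union>c\<in>?Cl. O2 (pick c))"
    by (rule card_mono[rotated]) (intro finite_UN_I fCl, simp add: O2_def)
  also have "\<dots> \<le> (\<Sum>c\<in>?Cl. card (O2 (pick c)))" by (rule card_UN_le[OF fCl])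
  also have "\<dots> \<le> (\<Sum>c\<in>?Cl. 2)"
    by (rule sum_mono) (simp add: O2_def card_insert_if)
  finally show ?thesis by simp
qed

lemma card_EH: "card EH = card (edges H)"
proof (rule bij_betw_same_card[of "\<lambda>e. {e div n, e mod n}"])
  show "bij_betw (\<lambda>e. {e div n, e mod n}) EH (edges H)" unfolding bij_betw_def
  proof (intro conjI inj_onI set_eqI iffI)
    fix e e' assume e: "e \<in> EH" "e' \<in> EH" and eq: "{e div n, e mod n} = {e' div n, e' mod n}"
    have "e div n = e' div n" "e mod n = e' mod n" using eq EH_eid(4)[OF e(1)] EH_eid(4)[OF e(2)] by (auto simp: doubleton_eq_iff)
    then show "e = e'" by (metis div_mult_mod_eq)
  next
    fix x assume "x \<in> (\<lambda>e. {e div n, e mod n}) ` EH"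
    then show "x \<in> edges H" by (auto simp: EH_def)
  next
    fix x assume x: "x \<in> edges H"
    then have "card x = 2" using fs by (simp add: finite_simple_graph_def)
    then obtain u v where uv: "x = {u, v}" by (auto simp: card_2_iff)
    then have "u \<in> nb v" using x by (simp add: neighbours_def insert_commute)
    then show "x \<in> (\<lambda>e. {e div n, e mod n}) ` EH" using eid_EH[of u v] uv by (intro image_eqI[of _ _ "eid u v"]) simp_all
  qed
qed

text \<open>On surfaces of either orientability the Euler genus is at most \<open>2 * g\<close>;
  this is the origin of the exponent.\<close>

lemma initial_core:
  assumes link: "\<And>v u. u \<in> nb v \<Longrightarrow> F (sA v u) = F (sB v (rot v u))" and EHE: "EH \<subseteq> E"
    and cl: "\<And>s t. ed N s \<in> EH \<Longrightarrow> ed N t \<in> EH \<Longrightarrow> F s = F t \<Longrightarrow> (s, t) \<in> (links \<union> links\<inverse>)\<^sup>*"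
    and emb: "embedding_on k g H rot twi"
  shows "topo (2 ^ (2 * g)) EH F (\<lambda>v. v)" "oc N F (cutE U \<inter> EH) = {}"
proof -
  show "oc N F (cutE U \<inter> EH) = {}" by (rule cut_even[OF link EHE])
  have "euler_genus H rot twi \<le> 2 * int g" using emb by (auto simp: embedding_on_def split: orientability.splits if_splits)
  moreover have "card (orbit fstep ` flags) \<le> 2 * card Cl" unfolding Cl_def by (rule faces_le[OF cl])
  moreover have "num_faces H rot twi = card (orbit fstep ` flags) div 2 + card {v\<in>vertices H. nb v = {}}"
    unfolding num_faces_def flags_def ..
  ultimately have "card EH + 2 * card (components H) \<le> card (vertices H) + card Cl + card {v\<in>vertices H. nb v = {}} + 2 * g"
    unfolding euler_genus_def card_EH by linarith
  then have gn: "card EH + 2 * card (components H) \<le> card (vertices H) + card Cl + card {v\<in>vertices H. nb v = {}} + 2 * g" .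
  show "topo (2 ^ (2 * g)) EH F (\<lambda>v. v)" by (rule topo_initial) (use link EHE gn in auto)
qed

end

subsection \<open>The algorithm\<close>

text \<open>
  Arrays: 0 and 1 hold \<open>C\<close> and \<open>K\<close>, 2 the side classes \<open>F\<close>, 3 the forest, 4 the current walk and 5 the
  heaviest one (the \<open>i\<close>-th edge of a walk carries \<open>i + 1\<close>), 6 the current side, 7 the lightest walk
  along which clusters have been merged so far, 8 the edges whose two sides are to be identified,
  10 a loop counter; 9 and 12 to 14 are scratch.
\<close>

abbreviation nn :: "state \<Rightarrow> nat" where "nn I \<equiv> fst I 0"
definition nsq :: "state \<Rightarrow> nat" where "nsq I = nn I * nn I"
text \<open>The start \<open>k * nn I\<close> of a matrix row, written as a sum because products
  cannot be compiled; it has this value only for \<open>k\<close> up to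
  \<open>bnd I\<close>.\<close>

definition rowm :: "state \<Rightarrow> nat \<Rightarrow> nat" where "rowm I k = (\<Sum>i<bnd I. if i < k then nn I else 0)"
text \<open>The quotient of \<open>e\<close> by the number of vertices, found by counting the matrix
  rows that end at or before \<open>e\<close>.\<close>

definition eu :: "state \<Rightarrow> nat \<Rightarrow> nat" where "eu I e = count (bnd I) (\<lambda>k. 0 < nn I \<and> rowm I (k + 1) \<le> e)"
definition ev :: "state \<Rightarrow> nat \<Rightarrow> nat" where "ev I e = e - rowm I (eu I e)"
definition adjG :: "state \<Rightarrow> nat \<Rightarrow> nat \<Rightarrow> bool" where
  "adjG I u v \<longleftrightarrow> u < nn I \<and> v < nn I \<and> rdn I (3 + nn I + (rowm I u + v)) = 1"
definition inA :: "state \<Rightarrow> nat \<Rightarrow> bool" where "inA I u \<longleftrightarrow> u < nn I \<and> rdn I (3 + u) = 1"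
definition isE :: "state \<Rightarrow> nat \<Rightarrow> bool" where "isE I e \<longleftrightarrow> e < nsq I \<and> eu I e < ev I e \<and> adjG I (eu I e) (ev I e)"
definition wt :: "state \<Rightarrow> nat \<Rightarrow> real" where "wt I e = rdr I e"

definition alv :: "state \<Rightarrow> arrays \<Rightarrow> nat \<Rightarrow> bool" where
  "alv I a e \<longleftrightarrow> isE I e \<and> a 1 (eu I e) = 0 \<and> a 1 (ev I e) = 0 \<and> a 0 (eu I e) \<noteq> a 0 (ev I e)"
definition als :: "state \<Rightarrow> arrays \<Rightarrow> nat \<Rightarrow> bool" where "als I a s \<longleftrightarrow> alv I a (ed (nsq I) s)"
definition cnt :: "state \<Rightarrow> arrays \<Rightarrow> nat \<Rightarrow> nat" where
  "cnt I a s = count (bnd I) (\<lambda>t. als I a t \<and> a 2 t = a 2 s)"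
text \<open>Meaningful if \<open>cnt I a s = 2\<close> and \<open>s\<close> is alive: exactly one
  index then satisfies the condition, and the sum returns it.\<close>

definition par :: "state \<Rightarrow> arrays \<Rightarrow> nat \<Rightarrow> nat" where
  "par I a s = (\<Sum>t<bnd I. if als I a t \<and> a 2 t = a 2 s \<and> t \<noteq> s then t else 0)"
definition nxt :: "state \<Rightarrow> arrays \<Rightarrow> nat \<Rightarrow> nat" where "nxt I a s = op (nsq I) (par I a s)"
definition wsum :: "nat \<Rightarrow> state \<Rightarrow> arrays \<Rightarrow> real" where
  "wsum j I a = (\<Sum>e<bnd I. if a j e \<noteq> 0 then wt I e else 0)"

definition wcond :: "state \<Rightarrow> arrays \<Rightarrow> bool" where
  "wcond I a \<longleftrightarrow> als I a (a 6 0) \<and> cnt I a (a 6 0) = 2 \<and> a 4 (ed (nsq I) (nxt I a (a 6 0))) = 0"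
text \<open>Array 9 holds 0 if the walk stops and otherwise the next side plus 1. It is computed
  first because the other two assignments change what \<open>wcond\<close> reads.\<close>

definition wstep :: "state \<Rightarrow> arrays \<Rightarrow> arrays" where
  "wstep I a = upd 6 (\<lambda>I a i. if a 9 0 \<noteq> 0 then a 9 0 - 1 else a 6 0) I
     (upd 4 (\<lambda>I a e. if a 9 0 \<noteq> 0 \<and> e = ed (nsq I) (a 9 0 - 1) then a 4 (ed (nsq I) (a 6 0)) + 1 else a 4 e) I
     (upd 9 (\<lambda>I a i. if wcond I a then nxt I a (a 6 0) + 1 else 0) I a))"
definition winit :: "state \<Rightarrow> arrays \<Rightarrow> arrays" where
  "winit I a = upd 6 (\<lambda>I a i. a 10 0) I
     (upd 4 (\<lambda>I a e. if als I a (a 10 0) \<and> e = ed (nsq I) (a 10 0) then 1 else 0) I a)"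
definition wkeep :: "state \<Rightarrow> arrays \<Rightarrow> arrays" where
  "wkeep I a = (if wsum 5 I a < wsum 4 I a then upd 5 (\<lambda>I a e. a 4 e) I a else a)"
definition cinc :: "state \<Rightarrow> arrays \<Rightarrow> arrays" where "cinc = upd 10 (\<lambda>I a i. a 10 0 + 1)"
definition czero :: "state \<Rightarrow> arrays \<Rightarrow> arrays" where "czero = upd 10 (\<lambda>I a i. 0)"
definition trial :: "state \<Rightarrow> arrays \<Rightarrow> arrays" where
  "trial I a = cinc I (wkeep I ((wstep I ^^ bnd I) (winit I a)))"
definition best :: "state \<Rightarrow> arrays \<Rightarrow> arrays" where
  "best I a = (trial I ^^ bnd I) (czero I (upd 5 (\<lambda>I a e. 0) I a))"

definition fstep1 :: "state \<Rightarrow> arrays \<Rightarrow> arrays" where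
  "fstep1 I a = cinc I (if a 8 (a 10 0) \<noteq> 0
     then upd 2 (\<lambda>I a s. if a 2 s = a 2 (a 10 0 + nsq I) then a 2 (a 10 0) else a 2 s) I a else a)"
definition floop :: "state \<Rightarrow> arrays \<Rightarrow> arrays" where "floop I a = (fstep1 I ^^ bnd I) (czero I a)"

definition nlab :: "state \<Rightarrow> arrays \<Rightarrow> nat" where
  "nlab I a = count (bnd I) (\<lambda>x. x < nn I \<and> a 0 x = x \<and> a 1 x = 0)"
definition ends :: "state \<Rightarrow> arrays \<Rightarrow> nat \<Rightarrow> nat \<Rightarrow> nat \<Rightarrow> bool" where
  "ends I a e x y \<longleftrightarrow> (a 0 (eu I e) = x \<and> a 0 (ev I e) = y) \<or> (a 0 (eu I e) = y \<and> a 0 (ev I e) = x)"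
definition nbc :: "state \<Rightarrow> arrays \<Rightarrow> nat \<Rightarrow> nat" where
  "nbc I a x = count (bnd I) (\<lambda>y. \<exists>e<bnd I. alv I a e \<and> ends I a e x y)"
definition uw :: "state \<Rightarrow> arrays \<Rightarrow> nat \<Rightarrow> real" where
  "uw I a x = (\<Sum>e<bnd I. if alv I a e \<and> (a 0 (eu I e) = x \<or> a 0 (ev I e) = x) then wt I e else 0)"
definition inL :: "state \<Rightarrow> arrays \<Rightarrow> nat \<Rightarrow> nat \<Rightarrow> nat \<Rightarrow> bool" where
  "inL I a x r e \<longleftrightarrow> isE I e \<and> ((a 0 (eu I e) = x \<and> a 1 (ev I e) = r + 1) \<or> (a 0 (ev I e) = x \<and> a 1 (eu I e) = r + 1))"
definition lw :: "state \<Rightarrow> arrays \<Rightarrow> nat \<Rightarrow> nat \<Rightarrow> real" where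
  "lw I a x r = (\<Sum>e<bnd I. if inL I a x r e then wt I e else 0)"
text \<open>In this case \<open>split_ok\<close> shows that the current walk is heavy enough for a
  merger.\<close>

definition low :: "state \<Rightarrow> arrays \<Rightarrow> bool" where
  "low I a \<longleftrightarrow> (\<exists>e<bnd I. a 7 e \<noteq> 0) \<and> wsum 7 I a \<le> wsum 5 I a"
definition mk :: "state \<Rightarrow> arrays \<Rightarrow> nat \<Rightarrow> nat \<Rightarrow> bool" where
  "mk I a x r \<longleftrightarrow> x < nn I \<and> a 0 x = x \<and> a 1 x = 0 \<and> nbc I a x \<le> 12 \<and> uw I a x \<le> real 24 * wsum 5 I a \<and>
     real 48 * wsum 5 I a \<le> lw I a x r \<and> (\<forall>r'<bnd I. lw I a x r' \<le> lw I a x r) \<and> \<not> low I a"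

text \<open>To be read from the inside out. Array 8 is filled while the cluster is still unmarked,
  since it flags the edges that cease to be alive.\<close>

definition domark :: "state \<Rightarrow> arrays \<Rightarrow> arrays" where
  "domark I a = floop I
    (upd 1 (\<lambda>I a v. if v < nn I \<and> a 0 v = a 12 0 then a 13 0 + 1 else a 1 v) I
    (upd 3 (\<lambda>I a e. if e = a 14 0 then 1 else a 3 e) I
    (upd 8 (\<lambda>I a e. of_bool (alv I a e \<and> (a 0 (eu I e) = a 12 0 \<or> a 0 (ev I e) = a 12 0))) I
    (upd 14 (\<lambda>I a i. first (bnd I) (\<lambda>e. inL I a (a 12 0) (a 13 0) e)) I
    (upd 13 (\<lambda>I a i. first (bnd I) (\<lambda>r. mk I a (a 12 0) r)) I
    (upd 12 (\<lambda>I a i. first (bnd I) (\<lambda>x. \<exists>r<bnd I. mk I a x r)) I a))))))"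

definition mid :: "state \<Rightarrow> arrays \<Rightarrow> nat \<Rightarrow> bool" where
  "mid I a e \<longleftrightarrow> a 5 e \<noteq> 0 \<and>
     wsum 5 I a \<le> real 2 * (\<Sum>f<bnd I. if a 5 f \<noteq> 0 \<and> a 5 f \<le> a 5 e then wt I f else 0) \<and>
     wsum 5 I a \<le> real 2 * (\<Sum>f<bnd I. if a 5 f \<noteq> 0 \<and> a 5 e \<le> a 5 f then wt I f else 0)"
text \<open>The edges of the walk disappear without any identification of classes, whereas the other
  edges between the two clusters are flagged in array 8 and deleted by \<open>floop\<close>.\<close>

definition domerge :: "state \<Rightarrow> arrays \<Rightarrow> arrays" where
  "domerge I a = floop I
    (upd 0 (\<lambda>I a v. if v < nn I \<and> a 0 v = a 13 0 then a 12 0 else a 0 v) I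
    (upd 3 (\<lambda>I a e. if e = a 14 0 then 1 else a 3 e) I
    (upd 7 (\<lambda>I a e. if low I a then a 7 e else a 5 e) I
    (upd 8 (\<lambda>I a e. of_bool (alv I a e \<and> a 5 e = 0 \<and> ends I a e (a 12 0) (a 13 0))) I
    (upd 13 (\<lambda>I a i. a 0 (ev I (a 14 0))) I
    (upd 12 (\<lambda>I a i. a 0 (eu I (a 14 0))) I
    (upd 14 (\<lambda>I a i. first (bnd I) (\<lambda>e. mid I a e)) I a)))))))"
definition round1 :: "state \<Rightarrow> arrays \<Rightarrow> arrays" where
  "round1 I a = (if \<exists>x<bnd I. \<exists>r<bnd I. mk I a x r then domark I a else domerge I a)"
definition round :: "state \<Rightarrow> arrays \<Rightarrow> arrays" where
  "round I a = (if fst I 2 + fst I 2 < nlab I a then round1 I (best I a) else a)"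

definition eidI :: "state \<Rightarrow> nat \<Rightarrow> nat \<Rightarrow> nat" where
  "eidI I u v = (if u < v then rowm I u + v else rowm I v + u)"
definition twI :: "state \<Rightarrow> nat \<Rightarrow> nat \<Rightarrow> bool" where
  "twI I u v \<longleftrightarrow> rdn I (3 + nn I + (nsq I + nsq I) + (rowm I u + v)) = 1"
definition sAI :: "state \<Rightarrow> nat \<Rightarrow> nat \<Rightarrow> nat" where
  "sAI I v u = (if u < v then eidI I u v + (if twI I u v then 0 else nsq I) else eidI I u v)"
definition sBI :: "state \<Rightarrow> nat \<Rightarrow> nat \<Rightarrow> nat" where
  "sBI I v u = (if v < u then eidI I u v + nsq I else eidI I u v + (if twI I u v then nsq I else 0))"
definition rotI :: "state \<Rightarrow> nat \<Rightarrow> nat \<Rightarrow> nat" where "rotI I v u = rdn I (3 + nn I + nsq I + (rowm I v + u))"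
text \<open>The counter is read as a matrix position, that is as a dart, so every corner is visited;
  relabelling a whole class is a naive union operation.\<close>

definition linit :: "state \<Rightarrow> arrays \<Rightarrow> arrays" where
  "linit I a = cinc I (if a 10 0 < nsq I \<and> adjG I (eu I (a 10 0)) (ev I (a 10 0)) \<and> \<not> inA I (eu I (a 10 0)) \<and> \<not> inA I (ev I (a 10 0))
     then upd 2 (\<lambda>I a s. if a 2 s = a 2 (sBI I (ev I (a 10 0)) (rotI I (ev I (a 10 0)) (eu I (a 10 0))))
       then a 2 (sAI I (ev I (a 10 0)) (eu I (a 10 0))) else a 2 s) I a else a)"
definition init :: "state \<Rightarrow> arrays \<Rightarrow> arrays" where
  "init I a = (linit I ^^ bnd I) (czero I (upd 2 (\<lambda>I a s. s) I (upd 1 (\<lambda>I a v. if inA I v then v + 1 else 0) I (upd 0 (\<lambda>I a v. v) I a))))"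
definition main :: "state \<Rightarrow> arrays \<Rightarrow> arrays" where
  "main I a = (round I ^^ bnd I) (init I a)"

section \<open>The algorithm is a polynomial-time program\<close>

lemma implN_lift1:
  assumes "\<And>v k. k < v \<Longrightarrow> implN v (\<lambda>I a \<rho>. f I a (\<rho> k))" "implN v F"
  shows "implN v (\<lambda>I a \<rho>. f I a (F I a \<rho>))"
  by (rule implN_let[OF assms(2), where g="\<lambda>I a \<rho> x. f I a x"]) (auto intro: assms(1))

lemma implR_mult: "implR v F \<Longrightarrow> implR v (\<lambda>I a \<rho>. real k * F I a \<rho>)"
proof (induction k)
  case 0
  then show ?case using implR_0 by simp
next
  case (Suc k)
  then show ?case using implR_add[OF Suc.prems Suc.IH[OF Suc.prems]] by (simp add: algebra_simps)
qed

lemma implN_ofbool: "implB v P \<Longrightarrow> implN v (\<lambda>I a \<rho>. of_bool (P I a \<rho>))" by (simp add: implB_def)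

text \<open>With these rules resolution follows the syntax of a definition, so compiling it needs no
  further thought.\<close>

lemmas rules0 = implN_const implN_var implN_n implN_bnd implN_g implN_arr implN_rdn implN_add implN_sub implN_If implN_sum implN_count implN_first implN_ofbool
  implB_less implB_le implB_eq implB_not implB_conj implB_disj implB_imp implB_ex implB_all
  implR_0 implR_rdr implR_add implR_mult implR_If implR_sum implB_rless implB_rle

lemma sum_lt_le: "k \<le> b \<Longrightarrow> (\<Sum>i<b. if i < k then c else 0) = k * (c::nat)"
proof -
  assume "k \<le> b"
  then have "{..<b} \<inter> {i. i < k} = {..<k}" by auto
  then show ?thesis by (simp add: sum.If_cases)
qed

lemma bnd_ge: "nn I \<le> bnd I" "2 * nsq I \<le> bnd I" "nsq I \<le> bnd I" by (auto simp: bnd_def nsq_def)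

lemma implN_nsq: "implN v (\<lambda>I a \<rho>. nsq I)"
proof (rule implN_cong)
  show "implN v (\<lambda>I a \<rho>. \<Sum>i<bnd I. if i < nn I then nn I else 0)" by (rule rules0 | simp)+
qed (simp add: sum_lt_le bnd_ge nsq_def)

lemma implN_rowm: "implN v F \<Longrightarrow> implN v (\<lambda>I a \<rho>. rowm I (F I a \<rho>))"
proof (rule implN_lift1[where f="\<lambda>I a. rowm I"])
  fix v k :: nat assume "k < v"
  then show "implN v (\<lambda>I a \<rho>. rowm I (\<rho> k))" unfolding rowm_def by - (rule rules0 | simp)+
qed

lemma implN_eu: "implN v F \<Longrightarrow> implN v (\<lambda>I a \<rho>. eu I (F I a \<rho>))"
proof (rule implN_lift1[where f="\<lambda>I a. eu I"])
  fix v k :: nat assume "k < v"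
  then show "implN v (\<lambda>I a \<rho>. eu I (\<rho> k))" unfolding eu_def by - (rule rules0 implN_rowm | simp)+
qed

lemma implN_ev: "implN v F \<Longrightarrow> implN v (\<lambda>I a \<rho>. ev I (F I a \<rho>))"
  unfolding ev_def by (rule rules0 implN_rowm implN_eu | assumption)+

lemma implB_adjG: "implN v F \<Longrightarrow> implN v G \<Longrightarrow> implB v (\<lambda>I a \<rho>. adjG I (F I a \<rho>) (G I a \<rho>))"
  unfolding adjG_def by (rule rules0 implN_rowm | assumption)+
lemma implB_inA: "implN v F \<Longrightarrow> implB v (\<lambda>I a \<rho>. inA I (F I a \<rho>))"
  unfolding inA_def by (rule rules0 | assumption)+
lemma implB_isE: "implN v F \<Longrightarrow> implB v (\<lambda>I a \<rho>. isE I (F I a \<rho>))"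
  unfolding isE_def by (rule rules0 implN_eu implN_ev implB_adjG implN_nsq | assumption)+
lemma implR_wt: "implN v F \<Longrightarrow> implR v (\<lambda>I a \<rho>. wt I (F I a \<rho>))"
  unfolding wt_def by (rule implR_rdr)

lemmas rules1 = rules0 implN_nsq implN_rowm implN_eu implN_ev implB_adjG implB_inA implB_isE implR_wt

lemma implB_alv: "implN v F \<Longrightarrow> implB v (\<lambda>I a \<rho>. alv I a (F I a \<rho>))"
  unfolding alv_def by (rule rules1 | assumption | simp)+
lemma implN_ed: "implN v F \<Longrightarrow> implN v (\<lambda>I a \<rho>. ed (nsq I) (F I a \<rho>))"
  unfolding ed_def by (rule rules1 | assumption)+
lemma implN_op: "implN v F \<Longrightarrow> implN v (\<lambda>I a \<rho>. op (nsq I) (F I a \<rho>))"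
  unfolding op_def by (rule rules1 | assumption)+
lemma implB_als: "implN v F \<Longrightarrow> implB v (\<lambda>I a \<rho>. als I a (F I a \<rho>))"
  unfolding als_def by (rule implB_alv implN_ed | assumption)+

lemmas rules2 = rules1 implB_alv implN_ed implN_op implB_als

lemma implN_cnt: "implN v F \<Longrightarrow> implN v (\<lambda>I a \<rho>. cnt I a (F I a \<rho>))"
proof (rule implN_lift1[where f="cnt"])
  fix v k :: nat assume "k < v"
  then show "implN v (\<lambda>I a \<rho>. cnt I a (\<rho> k))" unfolding cnt_def by - (rule rules2 | simp)+
qed
lemma implN_par: "implN v F \<Longrightarrow> implN v (\<lambda>I a \<rho>. par I a (F I a \<rho>))"
proof (rule implN_lift1[where f="par"])
  fix v k :: nat assume "k < v"
  then show "implN v (\<lambda>I a \<rho>. par I a (\<rho> k))" unfolding par_def by - (rule rules2 | simp)+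
qed
lemma implN_nxt: "implN v F \<Longrightarrow> implN v (\<lambda>I a \<rho>. nxt I a (F I a \<rho>))"
  unfolding nxt_def by (rule implN_op implN_par | assumption)+
lemma implR_wsum: "j < 15 \<Longrightarrow> implR v (\<lambda>I a \<rho>. wsum j I a)"
  unfolding wsum_def by (rule rules2 | simp)+
lemma implB_wcond: "implB v (\<lambda>I a \<rho>. wcond I a)"
  unfolding wcond_def by (rule rules2 implN_cnt implN_nxt | simp)+

lemmas rules3 = rules2 implN_cnt implN_nxt implR_wsum implB_wcond

lemma implP_wstep: "implP wstep" unfolding wstep_def
  by (rule implP_seq[of _ "upd 6 _"] implP_seq[of _ "upd 4 _"] implP_upd rules3 | simp)+
lemma implP_winit: "implP winit" unfolding winit_def
  by (rule implP_seq[of _ "upd 6 _"] implP_upd rules3 | simp)+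
lemma implP_wkeep: "implP wkeep" unfolding wkeep_def
  by (rule implP_If implP_id implP_upd rules3 | simp)+
lemma implP_cinc: "implP cinc" unfolding cinc_def by (rule implP_upd rules3 | simp)+
lemma implP_czero: "implP czero" unfolding czero_def by (rule implP_upd rules3 | simp)+
lemma implP_trial: "implP trial" unfolding trial_def
  by (rule implP_seq[OF _ implP_cinc] implP_seq[OF _ implP_wkeep] implP_seq[OF implP_winit] implP_loop implP_wstep)+
lemma implP_best: "implP best" unfolding best_def
  by (rule implP_seq[OF _ implP_loop[OF implP_trial]], rule implP_seq[OF _ implP_czero]) (rule implP_upd rules3 | simp)+
lemma implP_fstep1: "implP fstep1" unfolding fstep1_def
  by (rule implP_seq[OF _ implP_cinc]) (rule implP_If implP_id implP_upd rules3 | simp)+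
lemma implP_floop: "implP floop" unfolding floop_def
  by (rule implP_seq[OF implP_czero implP_loop[OF implP_fstep1]])

lemma implN_nlab: "implN v (\<lambda>I a \<rho>. nlab I a)" unfolding nlab_def by (rule rules3 | simp)+
lemma implB_ends: "implN v E \<Longrightarrow> implN v X \<Longrightarrow> implN v Y \<Longrightarrow> implB v (\<lambda>I a \<rho>. ends I a (E I a \<rho>) (X I a \<rho>) (Y I a \<rho>))"
  unfolding ends_def by (rule rules3 | assumption | simp)+
lemma implB_inL: "implN v X \<Longrightarrow> implN v R \<Longrightarrow> implN v E \<Longrightarrow> implB v (\<lambda>I a \<rho>. inL I a (X I a \<rho>) (R I a \<rho>) (E I a \<rho>))"
  unfolding inL_def by (rule rules3 | assumption | simp)+
lemma implN_nbc: "k < v \<Longrightarrow> implN v (\<lambda>I a \<rho>. nbc I a (\<rho> k))"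
  unfolding nbc_def by (rule rules3 implB_ends | simp)+
lemma implR_uw: "k < v \<Longrightarrow> implR v (\<lambda>I a \<rho>. uw I a (\<rho> k))"
  unfolding uw_def by (rule rules3 | simp)+
lemma implR_lw: "k < v \<Longrightarrow> l < v \<Longrightarrow> implR v (\<lambda>I a \<rho>. lw I a (\<rho> k) (\<rho> l))"
  unfolding lw_def by (rule rules3 implB_inL | simp)+
lemma implB_low: "implB v (\<lambda>I a \<rho>. low I a)" unfolding low_def by (rule rules3 | simp)+
lemma implB_mk: "k < v \<Longrightarrow> l < v \<Longrightarrow> implB v (\<lambda>I a \<rho>. mk I a (\<rho> k) (\<rho> l))"
  unfolding mk_def by (rule implN_nbc implR_uw implR_lw implB_low rules3 | simp)+
lemma implB_mid: "k < v \<Longrightarrow> implB v (\<lambda>I a \<rho>. mid I a (\<rho> k))"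
  unfolding mid_def by (rule rules3 | simp)+

lemmas rules4 = implB_mk implB_mid implB_low implB_ends implB_inL implN_nlab rules3

text \<open>\<open>implB_mk\<close> is stated for variables, so the array entry is bound to one
  first.\<close>

lemma implN_mk12: "implN v (\<lambda>I a \<rho>. first (bnd I) (\<lambda>r. mk I a (a 12 0) r))"
  by (rule implN_let[where F="\<lambda>I a \<rho>. a 12 0" and g="\<lambda>I a \<rho> x. first (bnd I) (\<lambda>r. mk I a x r)"]) (rule rules4 | simp)+

lemma implP_domark: "implP domark" unfolding domark_def
  apply (rule implP_seq[OF _ implP_floop])
  apply (rule implP_seq[of _ "upd 1 _"] implP_seq[of _ "upd 3 _"] implP_seq[of _ "upd 8 _"] implP_seq[of _ "upd 14 _"] implP_seq[of _ "upd 13 _"])+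
  apply (rule implP_upd implN_mk12 rules4 | simp)+
  done
lemma implP_domerge: "implP domerge" unfolding domerge_def
  apply (rule implP_seq[OF _ implP_floop])
  apply (rule implP_seq[of _ "upd 0 _"] implP_seq[of _ "upd 3 _"] implP_seq[of _ "upd 7 _"] implP_seq[of _ "upd 8 _"] implP_seq[of _ "upd 13 _"] implP_seq[of _ "upd 12 _"])+
  apply (rule implP_upd rules4 | simp)+
  done
lemma implP_round1: "implP round1" unfolding round1_def
  by (rule implP_If implP_domark implP_domerge rules4 | simp)+
lemma implP_round: "implP round" unfolding round_def
  by (rule implP_If implP_id implP_seq[OF implP_best implP_round1] rules4 | simp)+

lemma implN_eidI: "implN v F \<Longrightarrow> implN v G \<Longrightarrow> implN v (\<lambda>I a \<rho>. eidI I (F I a \<rho>) (G I a \<rho>))"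
  unfolding eidI_def by (rule rules4 | assumption)+
lemma implB_twI: "implN v F \<Longrightarrow> implN v G \<Longrightarrow> implB v (\<lambda>I a \<rho>. twI I (F I a \<rho>) (G I a \<rho>))"
  unfolding twI_def by (rule rules4 | assumption)+
lemma implN_sAI: "implN v F \<Longrightarrow> implN v G \<Longrightarrow> implN v (\<lambda>I a \<rho>. sAI I (F I a \<rho>) (G I a \<rho>))"
  unfolding sAI_def by (rule rules4 implN_eidI implB_twI | assumption)+
lemma implN_sBI: "implN v F \<Longrightarrow> implN v G \<Longrightarrow> implN v (\<lambda>I a \<rho>. sBI I (F I a \<rho>) (G I a \<rho>))"
  unfolding sBI_def by (rule rules4 implN_eidI implB_twI | assumption)+
lemma implN_rotI: "implN v F \<Longrightarrow> implN v G \<Longrightarrow> implN v (\<lambda>I a \<rho>. rotI I (F I a \<rho>) (G I a \<rho>))"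
  unfolding rotI_def by (rule rules4 | assumption)+
lemma implP_linit: "implP linit" unfolding linit_def
  by (rule implP_seq[OF _ implP_cinc]) (rule implP_If implP_id implP_upd implN_sAI implN_sBI implN_rotI rules4 | simp)+
lemma implP_init: "implP init" unfolding init_def
  apply (rule implP_seq[OF _ implP_loop[OF implP_linit]], rule implP_seq[OF _ implP_czero])
  apply (rule implP_seq[of _ "upd 2 _"] implP_seq[of _ "upd 1 _"])+
  apply (rule implP_upd rules4 | simp)+
  done
lemma implP_main: "implP main" unfolding main_def
  by (rule implP_seq[OF implP_init implP_loop[OF implP_round]])

subsection \<open>Correctness\<close>

lemma index_less: assumes "u < n" "v < n" shows "u * n + v < n * (n::nat)"
proof -
  have "u * n + v < Suc u * n" using assms by simp
  also have "\<dots> \<le> n * n" using assms by (intro mult_right_mono) auto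
  finally show ?thesis .
qed

locale prob =
  fixes n a g :: nat and G :: "nat ugraph" and A :: "nat set" and z :: "nat set \<Rightarrow> real"
    and k :: orientability and rot :: "nat \<Rightarrow> nat \<Rightarrow> nat" and twi :: "nat set \<Rightarrow> bool" and \<beta> :: real
  assumes a1: "1 \<le> a" and fsG: "finite_simple_graph G" and VG: "vertices G = {..<n}" and AV: "A \<subseteq> vertices G" "card A = a"
    and emb: "embedding_on k g (delete_vertices G A) rot twi" and z0: "\<forall>e\<in>edges G. 0 \<le> z e" and b0: "0 < \<beta>"
    and tG: "thick G z \<beta>"
begin

definition I :: state where "I = input_state n G A k g rot twi z"
abbreviation "N \<equiv> n * n"
abbreviation "H \<equiv> delete_vertices G A"
definition E :: "nat set" where "E = {e. e < N \<and> e div n < e mod n \<and> {e div n, e mod n} \<in> edges G}"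

lemma I_simps[simp]: "fst I 0 = n" "fst I 2 = g" by (auto simp: I_def input_state_def Let_def)
lemma bndI: "bnd I = 3 + n + 3 * (n * n)" by (simp add: bnd_def)
lemma nsqI[simp]: "nsq I = n * n" by (simp add: nsq_def)
lemma I_zero: "bnd I \<le> i \<Longrightarrow> fst I i = 0" unfolding bndI by (auto simp: I_def input_state_def Let_def)

lemma rdI: assumes "i < N"
  shows "rdn I (3 + n + i) = of_bool ({i div n, i mod n} \<in> edges G)"
    "rdn I (3 + n + N + i) = (if {i div n, i mod n} \<in> edges H then rot (i div n) (i mod n) else 0)"
    "rdn I (3 + n + (N + N) + i) = of_bool ({i div n, i mod n} \<in> edges H \<and> twi {i div n, i mod n})"
    "rdr I i = (if {i div n, i mod n} \<in> edges G then z {i div n, i mod n} else 0)"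
  using assms unfolding rdn_def rdr_def bndI by (auto simp: I_def input_state_def Let_def entry_def)

lemma rdA: "i < n \<Longrightarrow> rdn I (3 + i) = of_bool (i \<in> A)"
  unfolding rdn_def bndI by (auto simp: I_def input_state_def Let_def)

lemma rowmI: "j \<le> bnd I \<Longrightarrow> rowm I j = j * n" unfolding rowm_def by (simp add: sum_lt_le)

lemma euI: assumes "e < N" shows "eu I e = e div n" "ev I e = e mod n"
proof -
  have n0: "0 < n" using assms by (cases n) auto
  have en: "e div n < n" using assms by (simp add: less_mult_imp_div_less)
  have "{i. i < bnd I \<and> (0 < fst I 0 \<and> rowm I (i + 1) \<le> e)} = {..<e div n}"
  proof (intro set_eqI iffI)
    fix i assume i: "i \<in> {i. i < bnd I \<and> (0 < fst I 0 \<and> rowm I (i + 1) \<le> e)}"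
    then have "(i + 1) * n \<le> e" using rowmI[of "i + 1"] by simp
    then have "i + 1 \<le> e div n" using n0 by (simp add: less_eq_div_iff_mult_less_eq)
    then show "i \<in> {..<e div n}" by simp
  next
    fix i assume i: "i \<in> {..<e div n}"
    then have "(i + 1) * n \<le> (e div n) * n" by (intro mult_right_mono) auto
    then have "(i + 1) * n \<le> e" using div_times_less_eq_dividend[of e n] by linarith
    moreover have "i < bnd I" using i en bndI by simp
    ultimately show "i \<in> {i. i < bnd I \<and> (0 < fst I 0 \<and> rowm I (i + 1) \<le> e)}" using rowmI[of "i + 1"] n0 by simp
  qed
  then show eu: "eu I e = e div n" unfolding eu_def count_card by simp
  have "rowm I (e div n) = e div n * n" using en bndI by (intro rowmI) simp
  then show "ev I e = e mod n" unfolding ev_def eu by (simp add: minus_div_mult_eq_mod)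
qed

lemma rowm_lt: "u < n \<Longrightarrow> rowm I u = u * n" by (rule rowmI) (simp add: bndI)

lemma adjI: "adjG I u v \<longleftrightarrow> {u, v} \<in> edges G"
proof (cases "u < n \<and> v < n")
  case True
  then have "u * n + v < N" by (simp add: index_less)
  then show ?thesis using True rdI(1)[of "u * n + v"] by (simp add: adjG_def rowm_lt)
next
  case False
  then have "{u, v} \<notin> edges G" using fsG VG unfolding finite_simple_graph_def by auto
  then show ?thesis using False by (auto simp: adjG_def)
qed

lemma inAI: "inA I u \<longleftrightarrow> u \<in> A" using rdA[of u] AV VG by (auto simp: inA_def)

lemma isEI: "isE I e \<longleftrightarrow> e \<in> E"
  by (cases "e < N") (auto simp: isE_def E_def euI adjI)

lemma wtI: "e \<in> E \<Longrightarrow> wt I e = z {e div n, e mod n}" using rdI(4)[of e] by (auto simp: wt_def E_def)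
lemma E_lt: "e \<in> E \<Longrightarrow> e < N" by (simp add: E_def)
lemma E_bnd: "e \<in> E \<Longrightarrow> e < bnd I" using E_lt bndI by fastforce
lemma E_eu: "e \<in> E \<Longrightarrow> eu I e = e div n" "e \<in> E \<Longrightarrow> ev I e = e mod n" using euI E_lt by auto

lemma edge_id: assumes "u < v" "{u, v} \<in> edges G" shows "u * n + v \<in> E" "(u * n + v) div n = u" "(u * n + v) mod n = v"
proof -
  have "u < n" "v < n" using assms fsG VG unfolding finite_simple_graph_def by auto
  then show "(u * n + v) div n = u" "(u * n + v) mod n = v" by auto
  then show "u * n + v \<in> E" using assms index_less[OF \<open>u < n\<close> \<open>v < n\<close>] by (simp add: E_def)
qed

definition eset :: "nat \<Rightarrow> nat set" where "eset e = {e div n, e mod n}"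

lemma eset_bij: "bij_betw eset E (edges G)" unfolding bij_betw_def
proof (intro conjI inj_onI set_eqI iffI)
  fix e e' assume e: "e \<in> E" "e' \<in> E" and eq: "eset e = eset e'"
  have "e div n = e' div n" "e mod n = e' mod n" using eq e by (auto simp: E_def eset_def doubleton_eq_iff)
  then show "e = e'" by (metis div_mult_mod_eq)
next
  fix x assume "x \<in> eset ` E"
  then show "x \<in> edges G" by (auto simp: E_def eset_def)
next
  fix x assume x: "x \<in> edges G"
  then have "card x = 2" using fsG by (simp add: finite_simple_graph_def)
  then obtain u v where uv: "x = {u, v}" "u \<noteq> v" by (auto simp: card_2_iff)
  have "\<exists>u v. x = {u, v} \<and> u < v" using uv by (metis insert_commute linorder_neqE_nat)
  then obtain u v where "x = {u, v}" "u < v" by blast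
  then show "x \<in> eset ` E" using edge_id[of u v] x by (intro image_eqI[of _ _ "u * n + v"]) (simp_all add: eset_def)
qed

sublocale w0: wg "n * n" n E "\<lambda>e. e div n" "\<lambda>e. e mod n" "wt I"
proof
  show "E \<subseteq> {..<N}" by (auto simp: E_def)
  fix e assume e: "e \<in> E"
  have "{e div n, e mod n} \<subseteq> {..<n}" using e fsG VG unfolding finite_simple_graph_def E_def by auto
  then show "e div n < n" "e mod n < n" by auto
  show "0 \<le> wt I e" using wtI[OF e] z0 e by (auto simp: E_def)
qed

lemma cut_bij: "bij_betw eset (w0.cutE U) (cut G U)"
proof -
  have c: "eset e \<in> cut G U \<longleftrightarrow> e \<in> w0.cutE U" if e: "e \<in> E" for e
  proof -
    have ne: "e div n \<noteq> e mod n" "{e div n, e mod n} \<in> edges G" using e by (auto simp: E_def)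
    have "card ({e div n, e mod n} \<inter> U) = 1 \<longleftrightarrow> (e div n \<in> U) \<noteq> (e mod n \<in> U)"
      using ne(1) by (cases "e div n \<in> U"; cases "e mod n \<in> U") auto
    then show ?thesis using e ne by (auto simp: cut_def w0.cutE_def eset_def)
  qed
  show ?thesis unfolding bij_betw_def
  proof
    have s: "w0.cutE U \<subseteq> E" by (auto simp: w0.cutE_def)
    then show "inj_on eset (w0.cutE U)" using eset_bij inj_on_subset by (auto simp: bij_betw_def)
    show "eset ` w0.cutE U = cut G U"
    proof (intro set_eqI iffI)
      fix x assume "x \<in> eset ` w0.cutE U"
      then show "x \<in> cut G U" using c s by blast
    next
      fix x assume x: "x \<in> cut G U"
      then have "x \<in> eset ` E" using eset_bij by (auto simp: bij_betw_def cut_def)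
      then show "x \<in> eset ` w0.cutE U" using c x by blast
    qed
  qed
qed

lemma cut_sum: "(\<Sum>e\<in>cut G U. z e) = sum (wt I) (w0.cutE U)"
proof -
  have "sum (wt I) (w0.cutE U) = (\<Sum>e\<in>w0.cutE U. z (eset e))"
    by (rule sum.cong) (auto simp: w0.cutE_def wtI eset_def)
  also have "\<dots> = (\<Sum>e\<in>cut G U. z e)" by (rule sum.reindex_bij_betw[OF cut_bij])
  finally show ?thesis by simp
qed

sublocale alg "n * n" n E "\<lambda>e. e div n" "\<lambda>e. e mod n" "wt I" A \<beta> a g
proof
  show "A \<subseteq> {..<n}" "card A = a" "1 \<le> a" "0 < \<beta>" using AV VG a1 b0 by auto
  show "\<beta> \<le> sum (wt I) (w0.cutE U)" if "U \<noteq> {}" "U \<subset> {..<n}" for U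
    using tG that VG cut_sum[of U] by (auto simp: thick_def)
  show "e div n \<noteq> e mod n" if "e \<in> E" for e using that by (auto simp: E_def)
qed

section \<open>The mathematical state stored in the arrays\<close>

definition Cf :: "arrays \<Rightarrow> nat \<Rightarrow> nat" where "Cf s v = (if v < n then s 0 v else v)"
definition Kf :: "arrays \<Rightarrow> nat \<Rightarrow> nat" where "Kf s v = (if v < n then s 1 v else 0)"
text \<open>Indices outside the range get fresh classes \<open>bnd I + t\<close>. As stored labels
  are below \<open>bnd I\<close>, these never meet the class of a real side, and identifications can
  be stated for all arguments.\<close>

definition Ff :: "arrays \<Rightarrow> nat \<Rightarrow> nat" where "Ff s t = (if t < bnd I then s 2 t else bnd I + t)"
definition Tf :: "arrays \<Rightarrow> nat set" where "Tf s = {e. e < N \<and> s 3 e = 1}"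
definition Hs :: "arrays \<Rightarrow> bool" where "Hs s \<longleftrightarrow> (\<exists>e<bnd I. s 7 e \<noteq> 0)"
abbreviation "Al s \<equiv> alive (Cf s) (Kf s)"

definition Inv :: "arrays \<Rightarrow> bool" where
  "Inv s \<longleftrightarrow> INV (Cf s) (Kf s) (Ff s) (Tf s) (Hs s) (wsum 7 I s) \<and> (\<forall>t<bnd I. s 2 t < bnd I)"

lemma E_ends: "e \<in> E \<Longrightarrow> e div n < n" "e \<in> E \<Longrightarrow> e mod n < n" using w0.ends by auto

lemma alvI: "alv I s e \<longleftrightarrow> e \<in> Al s"
  by (cases "e \<in> E") (simp_all add: alv_def isEI alive_def E_eu Cf_def Kf_def E_ends)
lemma alsI: "als I s t \<longleftrightarrow> ed N t \<in> Al s" by (simp add: als_def alvI)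
lemma Al_E: "Al s \<subseteq> E" by (auto simp: alive_def)
lemma Al_N: "Al s \<subseteq> {..<N}" using Al_E w0.E_sub by blast
lemma finite_Al: "finite (Al s)" using Al_E w0.finite_sub by blast
lemma N_bnd: "2 * N < bnd I" by (simp add: bndI)
lemma side_bnd: "ed N t \<in> Al s \<Longrightarrow> t < bnd I" using ed_lt[of N t] Al_N N_bnd by fastforce

lemma cntI: "als I s t \<Longrightarrow> cnt I s t = pc N (Ff s) (Al s) (Ff s t)"
proof -
  assume t: "als I s t"
  then have tb: "t < bnd I" using side_bnd alsI by blast
  have "{i. i < bnd I \<and> (als I s i \<and> s 2 i = s 2 t)} = {i. ed N i \<in> Al s \<and> Ff s i = Ff s t}"
    using side_bnd[of _ s] tb by (auto simp: alsI Ff_def)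
  then show ?thesis unfolding cnt_def count_card pc_card(2)[OF finite_Al Al_N] by simp
qed

lemma parI: assumes s: "als I s p" and p2: "pc N (Ff s) (Al s) (Ff s p) = 2"
  shows "ed N (par I s p) \<in> Al s" "par I s p \<noteq> p" "Ff s (par I s p) = Ff s p"
    "\<And>t. ed N t \<in> Al s \<Longrightarrow> t \<noteq> p \<Longrightarrow> Ff s t = Ff s p \<Longrightarrow> t = par I s p"
proof -
  have pa: "ed N p \<in> Al s" using s alsI by simp
  have "card {t. ed N t \<in> Al s \<and> Ff s t = Ff s p} = 2" using p2 pc_card(2)[OF finite_Al Al_N] by simp
  then obtain x y where xy: "{t. ed N t \<in> Al s \<and> Ff s t = Ff s p} = {x, y}" "x \<noteq> y" unfolding card_2_iff by blast
  have "p \<in> {x, y}" using pa unfolding xy(1)[symmetric] by simp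
  then obtain q where q: "{t. ed N t \<in> Al s \<and> Ff s t = Ff s p} = {p, q}" "q \<noteq> p" using xy by (metis insert_commute insert_iff singletonD)
  have qm: "ed N q \<in> Al s" "Ff s q = Ff s p" using q(1) by auto
  have pb: "p < bnd I" "q < bnd I" using side_bnd pa qm by auto
  have eq: "als I s t \<and> s 2 t = s 2 p \<and> t \<noteq> p \<longleftrightarrow> t = q" if "t < bnd I" for t
  proof -
    have "als I s t \<and> s 2 t = s 2 p \<longleftrightarrow> t \<in> {t. ed N t \<in> Al s \<and> Ff s t = Ff s p}" using that pb by (simp add: alsI Ff_def)
    then show ?thesis unfolding q(1) using q(2) by auto
  qed
  have "par I s p = (\<Sum>t<bnd I. if t = q then t else 0)" unfolding par_def by (rule sum.cong) (use eq in auto)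
  also have "\<dots> = q" using pb by simp
  finally have pq: "par I s p = q" .
  show "ed N (par I s p) \<in> Al s" "par I s p \<noteq> p" "Ff s (par I s p) = Ff s p" using pq qm q by auto
  show "t = par I s p" if "ed N t \<in> Al s" "t \<noteq> p" "Ff s t = Ff s p" for t
  proof -
    have "t \<in> {p, q}" unfolding q(1)[symmetric] using that by simp
    then show ?thesis using that pq by simp
  qed
qed

section \<open>The walks computed by the program\<close>

definition REP :: "arrays \<Rightarrow> nat \<Rightarrow> nat list \<Rightarrow> bool" where
  "REP s j ss \<longleftrightarrow> (\<forall>i<length ss. s j (ed N (ss ! i)) = Suc i) \<and> (\<forall>e<bnd I. s j e \<noteq> 0 \<longrightarrow> e \<in> ed N ` set ss)"

lemma upd_same[simp]: "i < bnd I \<Longrightarrow> upd j f I s j i = f I s i" by (simp add: upd_def)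
lemma upd_other[simp]: "j' \<noteq> j \<Longrightarrow> upd j f I s j' = s j'" by (simp add: upd_def)
lemma bnd0[simp]: "0 < bnd I" by (simp add: bndI)

lemma view_cong: "s' 0 = s 0 \<Longrightarrow> s' 1 = s 1 \<Longrightarrow> s' 2 = s 2 \<Longrightarrow> Cf s' = Cf s \<and> Kf s' = Kf s \<and> Ff s' = Ff s"
  by (auto simp: Cf_def Kf_def Ff_def fun_eq_iff)

lemma REP_thread_bnd: "thread N (Ff s) (Al s) ss \<Longrightarrow> t \<in> set ss \<Longrightarrow> ed N t < bnd I"
  using E_bnd Al_E by (fastforce simp: thread_def)

definition WI :: "arrays \<Rightarrow> arrays \<Rightarrow> nat list \<Rightarrow> bool" where
  "WI s0 s ss \<longleftrightarrow> (\<forall>j. j \<noteq> 4 \<and> j \<noteq> 6 \<and> j \<noteq> 9 \<longrightarrow> s j = s0 j) \<and> thread N (Ff s0) (Al s0) ss \<and> s 6 0 = last ss \<and> REP s 4 ss"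

lemma WI_view: assumes "\<forall>j. j \<noteq> 4 \<and> j \<noteq> 6 \<and> j \<noteq> 9 \<longrightarrow> s j = s0 j"
  shows "Cf s = Cf s0" "Kf s = Kf s0" "Ff s = Ff s0" using view_cong[of s s0] assms by auto

lemma wstep_frame: "j \<noteq> 4 \<and> j \<noteq> 6 \<and> j \<noteq> 9 \<Longrightarrow> wstep I s j = s j" by (simp add: wstep_def)
lemma wstep_no: assumes "\<not> wcond I s" shows "\<And>e. e < bnd I \<Longrightarrow> wstep I s 4 e = s 4 e" "wstep I s 6 0 = s 6 0"
  using assms by (auto simp: wstep_def)

lemma wstep_yes: assumes "wcond I s"
  shows "wstep I s 6 0 = nxt I s (s 6 0)"
    "\<And>e. e < bnd I \<Longrightarrow> wstep I s 4 e = (if e = ed N (nxt I s (s 6 0)) then s 4 (ed N (s 6 0)) + 1 else s 4 e)"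
  using assms by (auto simp: wstep_def)

lemma wcond_cong: assumes "\<forall>j. j \<noteq> 4 \<and> j \<noteq> 6 \<and> j \<noteq> 9 \<longrightarrow> s' j = s j" "s' 6 0 = s 6 0" "\<And>e. e < bnd I \<Longrightarrow> s' 4 e = s 4 e"
  shows "wcond I s' = wcond I s"
proof -
  have v: "Cf s' = Cf s" "Kf s' = Kf s" "Ff s' = Ff s" using WI_view[OF assms(1)] by auto
  have als': "als I s' t = als I s t" for t by (simp add: alsI v)
  have s2: "s' 2 = s 2" using assms(1) by simp
  have c: "cnt I s' t = cnt I s t" "nxt I s' t = nxt I s t" for t unfolding cnt_def nxt_def par_def als' s2 by auto
  show ?thesis
  proof (cases "als I s (s 6 0) \<and> cnt I s (s 6 0) = 2")
    case True
    then have "ed N (par I s (s 6 0)) \<in> Al s" using parI(1)[of s "s 6 0"] cntI[of s "s 6 0"] by simp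
    moreover have "par I s (s 6 0) < 2 * N" using calculation Al_N ed_lt by blast
    ultimately have "ed N (nxt I s (s 6 0)) < bnd I" using E_bnd Al_E by (auto simp: nxt_def)
    then show ?thesis unfolding wcond_def c als' assms(2) using assms(3) by simp
  next
    case False
    then show ?thesis unfolding wcond_def c als' assms(2) by blast
  qed
qed

text \<open>Either the walk is extended by the forced edge, or the recorded walk is unchanged; a
  stopped walk stays stopped, so surplus iterations do no harm.\<close>

lemma wstep_WI: assumes W: "WI s0 s ss"
  shows "(wcond I s \<and> (\<exists>t. WI s0 (wstep I s) (ss @ [t]))) \<or> (\<not> wcond I s \<and> WI s0 (wstep I s) ss \<and> \<not> wcond I (wstep I s))"
proof -
  have fr: "\<forall>j. j \<noteq> 4 \<and> j \<noteq> 6 \<and> j \<noteq> 9 \<longrightarrow> s j = s0 j" and T: "thread N (Ff s0) (Al s0) ss" and p: "s 6 0 = last ss" and R: "REP s 4 ss"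
    using W by (auto simp: WI_def)
  have v: "Cf s = Cf s0" "Kf s = Kf s0" "Ff s = Ff s0" using WI_view[OF fr] by auto
  have fr': "\<forall>j. j \<noteq> 4 \<and> j \<noteq> 6 \<and> j \<noteq> 9 \<longrightarrow> wstep I s j = s0 j" using fr wstep_frame[of _ s] by metis
  have sn: "ss \<noteq> []" using T by (simp add: thread_def)
  show ?thesis
  proof (cases "wcond I s")
    case False
    note no = wstep_no[OF False]
    have Rb: "ed N (ss ! i) < bnd I" if "i < length ss" for i using REP_thread_bnd[OF T] that by simp
    have "REP (wstep I s) 4 ss" using R no(1) Rb unfolding REP_def by (auto simp: no)
    then have "WI s0 (wstep I s) ss" using fr' T p no by (simp add: WI_def)
    moreover have "wcond I (wstep I s) = wcond I s" by (rule wcond_cong) (use wstep_frame no in auto)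
    ultimately show ?thesis using False by simp
  next
    case True
    let ?p = "last ss" and ?q = "par I s (last ss)"
    define t where "t = nxt I s ?p"
    have c: "als I s ?p" "cnt I s ?p = 2" "s 4 (ed N t) = 0" using True by (auto simp: wcond_def p t_def)
    have p2: "pc N (Ff s) (Al s) (Ff s ?p) = 2" using c cntI by simp
    note pr = parI[OF c(1) p2]
    have q2: "?q < 2 * N" using pr(1) Al_N ed_lt by blast
    have t: "t = op N ?q" "ed N t = ed N ?q" "op N t = ?q" using q2 by (auto simp: t_def nxt_def op_op)
    have tA: "ed N t \<in> Al s" using pr(1) t by simp
    have tb: "ed N t < bnd I" using tA E_bnd Al_E by blast
    have tn: "ed N t \<notin> ed N ` set ss"
    proof
      assume "ed N t \<in> ed N ` set ss"
      then obtain i where "i < length ss" "ed N t = ed N (ss ! i)" by (auto simp: in_set_conv_nth)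
      then show False using R c(3) by (simp add: REP_def)
    qed
    have T': "thread N (Ff s0) (Al s0) (ss @ [t])" unfolding thread_def
    proof (intro conjI allI impI)
      show "ss @ [t] \<noteq> []" by simp
      show "distinct (map (ed N) (ss @ [t]))" using T tn by (auto simp: thread_def)
      show "\<forall>s\<in>set (ss @ [t]). ed N s \<in> Al s0" using T tA v by (auto simp: thread_def)
      fix i assume i: "Suc i < length (ss @ [t])"
      have "Ff s0 ((ss @ [t]) ! i) = Ff s0 (op N ((ss @ [t]) ! Suc i)) \<and> pc N (Ff s0) (Al s0) (Ff s0 ((ss @ [t]) ! i)) = 2"
      proof (cases "Suc i < length ss")
        case True
        then have nth: "(ss @ [t]) ! i = ss ! i" "(ss @ [t]) ! Suc i = ss ! Suc i" by (simp_all add: nth_append)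
        show ?thesis unfolding nth using T True unfolding thread_def by blast
      next
        case False
        then have il: "Suc i = length ss" using i by simp
        then have "i = length ss - 1" "i < length ss" by simp_all
        then have "(ss @ [t]) ! i = ?p" "(ss @ [t]) ! Suc i = t" using sn il by (simp_all add: nth_append last_conv_nth)
        then show ?thesis using pr(3) p2 t(3) v by simp
      qed
      then show "Ff s0 ((ss @ [t]) ! i) = Ff s0 (op N ((ss @ [t]) ! Suc i))" "pc N (Ff s0) (Al s0) (Ff s0 ((ss @ [t]) ! i)) = 2" by auto
    qed
    note yes = wstep_yes[OF True, unfolded p, folded t_def]
    have lastp: "s 4 (ed N ?p) = length ss"
    proof -
      have "s 4 (ed N (ss ! (length ss - 1))) = Suc (length ss - 1)" using R sn by (simp add: REP_def)
      then show ?thesis using sn by (simp add: last_conv_nth)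
    qed
    have R': "REP (wstep I s) 4 (ss @ [t])" unfolding REP_def
    proof (intro conjI allI impI)
      fix i assume i: "i < length (ss @ [t])"
      show "wstep I s 4 (ed N ((ss @ [t]) ! i)) = Suc i"
      proof (cases "i < length ss")
        case True
        then have m: "ss ! i \<in> set ss" by simp
        have "ed N (ss ! i) \<in> ed N ` set ss" by (rule imageI[OF m])
        then have "ed N (ss ! i) \<noteq> ed N t" using tn by metis
        moreover have "ed N (ss ! i) < bnd I" using REP_thread_bnd[OF T] m by blast
        ultimately have "ed N (ss ! i) < bnd I" "ed N (ss ! i) \<noteq> ed N t" by simp_all
        then show ?thesis using True R yes(2) by (simp add: REP_def nth_append)
      next
        case False
        then have "i = length ss" using i by simp
        then show ?thesis using yes(2)[OF tb] lastp by (simp add: nth_append)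
      qed
    next
      fix e assume e: "e < bnd I" "wstep I s 4 e \<noteq> 0"
      then show "e \<in> ed N ` set (ss @ [t])" using yes(2)[OF e(1)] R by (auto simp: REP_def split: if_splits)
    qed
    have "WI s0 (wstep I s) (ss @ [t])" using fr' T' R' yes(1) by (simp add: WI_def)
    then show ?thesis using True by blast
  qed
qed

lemma walk_iter: assumes "WI s0 s [t0]"
  shows "\<exists>ss. WI s0 ((wstep I ^^ i) s) ss \<and> hd ss = t0 \<and> (length ss = Suc i \<or> \<not> wcond I ((wstep I ^^ i) s))"
proof (induction i)
  case 0
  then show ?case using assms by (intro exI[of _ "[t0]"]) simp
next
  case (Suc i)
  then obtain ss where ss: "WI s0 ((wstep I ^^ i) s) ss" "hd ss = t0" "length ss = Suc i \<or> \<not> wcond I ((wstep I ^^ i) s)" by blast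
  have sn: "ss \<noteq> []" using ss(1) by (auto simp: WI_def thread_def)
  from wstep_WI[OF ss(1)] show ?case
  proof
    assume "wcond I ((wstep I ^^ i) s) \<and> (\<exists>t. WI s0 (wstep I ((wstep I ^^ i) s)) (ss @ [t]))"
    then obtain t where "WI s0 (wstep I ((wstep I ^^ i) s)) (ss @ [t])" "length ss = Suc i" using ss(3) by blast
    then show ?case using ss(2) sn by (intro exI[of _ "ss @ [t]"]) auto
  next
    assume "\<not> wcond I ((wstep I ^^ i) s) \<and> WI s0 (wstep I ((wstep I ^^ i) s)) ss \<and> \<not> wcond I (wstep I ((wstep I ^^ i) s))"
    then show ?case using ss(2) by (intro exI[of _ ss]) auto
  qed
qed

lemma thread_length: assumes "thread N F (Al s) ss" shows "length ss \<le> N"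
proof -
  have "length ss = card (ed N ` set ss)" using assms distinct_card[of "map (ed N) ss"] by (simp add: thread_def)
  also have "\<dots> \<le> card {..<N}" by (rule card_mono) (use assms Al_N in \<open>auto simp: thread_def\<close>)
  finally show ?thesis by simp
qed

lemma WI_stopped: assumes W: "WI s0 s ss" and nc: "\<not> wcond I s" shows "stopped N (Ff s0) (Al s0) ss"
  unfolding stopped_def
proof (intro allI impI)
  fix t assume t: "ed N t \<in> Al s0 \<and> t \<noteq> last ss \<and> Ff s0 t = Ff s0 (last ss) \<and> pc N (Ff s0) (Al s0) (Ff s0 t) = 2"
  have fr: "\<forall>j. j \<noteq> 4 \<and> j \<noteq> 6 \<and> j \<noteq> 9 \<longrightarrow> s j = s0 j" and T: "thread N (Ff s0) (Al s0) ss" and p: "s 6 0 = last ss" and R: "REP s 4 ss"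
    using W by (auto simp: WI_def)
  have v: "Cf s = Cf s0" "Kf s = Kf s0" "Ff s = Ff s0" using WI_view[OF fr] by auto
  have "last ss \<in> set ss" using T by (auto simp: thread_def)
  then have pa: "als I s (last ss)" using T by (auto simp: alsI v thread_def)
  have p2: "pc N (Ff s) (Al s) (Ff s (last ss)) = 2" using t unfolding v by metis
  have tp: "t = par I s (last ss)" by (rule parI(4)[OF pa p2]) (use t v in auto)
  have "s 4 (ed N (nxt I s (last ss))) \<noteq> 0" using nc pa p2 cntI[OF pa] by (simp add: wcond_def p)
  moreover have "t < 2 * N" using t Al_N[of s0] ed_lt[of N t] by blast
  then have "ed N (nxt I s (last ss)) = ed N t" by (simp add: nxt_def tp[symmetric])
  moreover have "ed N t < bnd I" using t E_bnd Al_E by blast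
  ultimately show "ed N t \<in> ed N ` set ss" using R by (auto simp: REP_def)
qed

lemma wsum_REP: assumes "REP s j ss" "\<And>t. t \<in> set ss \<Longrightarrow> ed N t \<in> E"
  shows "wsum j I s = sum (wt I) (ed N ` set ss)"
proof -
  have "s j e \<noteq> 0 \<longleftrightarrow> e \<in> ed N ` set ss" if "e < bnd I" for e
    using assms(1) that by (auto simp: REP_def in_set_conv_nth)
  then have "{..<bnd I} \<inter> {e. s j e \<noteq> 0} = ed N ` set ss" using assms(2) E_bnd by auto
  then show ?thesis unfolding wsum_def by (simp add: sum.If_cases)
qed

lemma wsum_zero: "(\<And>e. e < bnd I \<Longrightarrow> s j e = 0) \<Longrightarrow> wsum j I s = 0" unfolding wsum_def by simp

lemma winit_simps: "winit I s 6 0 = s 10 0" "\<And>e. e < bnd I \<Longrightarrow> winit I s 4 e = (if als I s (s 10 0) \<and> e = ed N (s 10 0) then 1 else 0)"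
  "j \<noteq> 4 \<Longrightarrow> j \<noteq> 6 \<Longrightarrow> winit I s j = s j"
  by (auto simp: winit_def)

lemma walk_run:
  defines "s' s \<equiv> (wstep I ^^ bnd I) (winit I s)"
  shows "\<And>j. j \<noteq> 4 \<Longrightarrow> j \<noteq> 6 \<Longrightarrow> j \<noteq> 9 \<Longrightarrow> s' s j = s j"
    "als I s (s 10 0) \<Longrightarrow> \<exists>ss. thread N (Ff s) (Al s) ss \<and> stopped N (Ff s) (Al s) ss \<and> hd ss = s 10 0 \<and> REP (s' s) 4 ss"
    "\<not> als I s (s 10 0) \<Longrightarrow> e < bnd I \<Longrightarrow> s' s 4 e = 0"
proof -
  have frw: "(wstep I ^^ i) t j = t j" if "j \<noteq> 4" "j \<noteq> 6" "j \<noteq> 9" for i t j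
    by (induction i) (use that wstep_frame in auto)
  show "s' s j = s j" if "j \<noteq> 4" "j \<noteq> 6" "j \<noteq> 9" for j unfolding s'_def using that by (simp add: frw winit_simps)
  show "\<exists>ss. thread N (Ff s) (Al s) ss \<and> stopped N (Ff s) (Al s) ss \<and> hd ss = s 10 0 \<and> REP (s' s) 4 ss" if al: "als I s (s 10 0)"
  proof -
    have eb: "ed N (s 10 0) < bnd I" "ed N (s 10 0) \<in> Al s" using al alsI E_bnd Al_E by blast+
    have "WI s (winit I s) [s 10 0]" unfolding WI_def
      using eb al by (auto simp: winit_simps thread_def REP_def split: if_splits)
    from walk_iter[OF this, of "bnd I"] obtain ss where ss: "WI s (s' s) ss" "hd ss = s 10 0" "length ss = Suc (bnd I) \<or> \<not> wcond I (s' s)"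
      unfolding s'_def by blast
    have T: "thread N (Ff s) (Al s) ss" using ss(1) by (simp add: WI_def)
    \<comment> \<open>A walk visits distinct edges, of which there are fewer than
      \<open>bnd I\<close>, so it must have stopped.\<close>
    then have "length ss \<noteq> Suc (bnd I)" using thread_length N_bnd by fastforce
    then have "stopped N (Ff s) (Al s) ss" using WI_stopped[OF ss(1)] ss(3) by blast
    then show ?thesis using T ss by (auto simp: WI_def)
  qed
  show "s' s 4 e = 0" if na: "\<not> als I s (s 10 0)" and e: "e < bnd I"
  proof -
    have "(wstep I ^^ i) (winit I s) 6 0 = s 10 0 \<and> (\<forall>e<bnd I. (wstep I ^^ i) (winit I s) 4 e = 0)" for i
    proof (induction i)
      case 0
      then show ?case using na by (simp add: winit_simps)
    next
      case (Suc i)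
      let ?t = "(wstep I ^^ i) (winit I s)"
      have "als I ?t (s 10 0) = als I s (s 10 0)" using view_cong[of ?t s] by (simp add: alsI frw winit_simps)
      then have "\<not> wcond I ?t" using na Suc by (simp add: wcond_def)
      from wstep_no[OF this] show ?case using Suc by simp
    qed
    then show ?thesis unfolding s'_def using e by blast
  qed
qed

text \<open>Only strictly heavier walks replace array 5, so it may stay 0 as long as no walk of
  positive weight has been found.\<close>

definition bestI :: "arrays \<Rightarrow> arrays \<Rightarrow> nat \<Rightarrow> bool" where
  "bestI s0 s i \<longleftrightarrow> (\<forall>j. j \<notin> {4, 5, 6, 9, 10} \<longrightarrow> s j = s0 j) \<and> s 10 0 = i \<and>
     ((\<forall>e<bnd I. s 5 e = 0) \<or> (\<exists>ss. thread N (Ff s0) (Al s0) ss \<and> REP s 5 ss)) \<and>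
     (\<forall>t<i. ed N t \<in> Al s0 \<longrightarrow> (\<exists>ss. thread N (Ff s0) (Al s0) ss \<and> stopped N (Ff s0) (Al s0) ss \<and> hd ss = t \<and> sum (wt I) (ed N ` set ss) \<le> wsum 5 I s))"

lemma trial_step: assumes B: "bestI s0 s i" shows "bestI s0 (trial I s) (Suc i)"
proof -
  define s1 where "s1 = (wstep I ^^ bnd I) (winit I s)"
  have fr: "\<forall>j. j \<notin> {4, 5, 6, 9, 10} \<longrightarrow> s j = s0 j" and i: "s 10 0 = i"
    and c: "(\<forall>e<bnd I. s 5 e = 0) \<or> (\<exists>ss. thread N (Ff s0) (Al s0) ss \<and> REP s 5 ss)"
    and m: "\<forall>t<i. ed N t \<in> Al s0 \<longrightarrow> (\<exists>ss. thread N (Ff s0) (Al s0) ss \<and> stopped N (Ff s0) (Al s0) ss \<and> hd ss = t \<and> sum (wt I) (ed N ` set ss) \<le> wsum 5 I s)"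
    using B unfolding bestI_def by auto
  have v: "Cf s = Cf s0" "Kf s = Kf s0" "Ff s = Ff s0" using view_cong[of s s0] fr by auto
  have s1j: "s1 j = s j" if "j \<noteq> 4" "j \<noteq> 6" "j \<noteq> 9" for j using that unfolding s1_def by (simp add: walk_run(1))
  have w5: "wsum 5 I s1 = wsum 5 I s" unfolding wsum_def using s1j[of 5] by simp
  define s2 where "s2 = wkeep I s1"
  have tr: "trial I s = cinc I s2" by (simp add: trial_def s1_def s2_def)
  have s2j: "s2 j = s1 j" if "j \<noteq> 5" for j using that by (simp add: s2_def wkeep_def)
  have s25: "(wsum 5 I s1 < wsum 4 I s1 \<and> (\<forall>e<bnd I. s2 5 e = s1 4 e)) \<or> (\<not> wsum 5 I s1 < wsum 4 I s1 \<and> s2 5 = s1 5)" by (simp add: s2_def wkeep_def)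
  have ww: "wsum 5 I s2 = max (wsum 5 I s) (wsum 4 I s1)"
    using s25 w5 by (auto simp: wsum_def max_def)
  have tj: "trial I s j = s2 j" if "j \<noteq> 10" for j unfolding tr cinc_def using that by simp
  have w5': "wsum 5 I (trial I s) = wsum 5 I s2" unfolding wsum_def using tj[of 5] by simp
  have walk: "(als I s i \<longrightarrow> (\<exists>ss. thread N (Ff s0) (Al s0) ss \<and> stopped N (Ff s0) (Al s0) ss \<and> hd ss = i \<and> REP s1 4 ss)) \<and> (\<not> als I s i \<longrightarrow> (\<forall>e<bnd I. s1 4 e = 0))"
    using walk_run(2,3)[of s, folded s1_def] unfolding i v by blast
  show ?thesis unfolding bestI_def
  proof (intro conjI allI impI)
    fix j :: nat assume j: "j \<notin> {4, 5, 6, 9, 10}"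
    then show "trial I s j = s0 j" using tj[of j] s2j[of j] s1j[of j] fr by simp
  next
    show "trial I s 10 0 = Suc i" unfolding tr cinc_def using s2j[of 10] s1j[of 10] i by simp
  next
    show "(\<forall>e<bnd I. trial I s 5 e = 0) \<or> (\<exists>ss. thread N (Ff s0) (Al s0) ss \<and> REP (trial I s) 5 ss)"
      using s25
    proof
      assume h: "wsum 5 I s1 < wsum 4 I s1 \<and> (\<forall>e<bnd I. s2 5 e = s1 4 e)"
      show ?thesis
      proof (cases "als I s i")
        case True
        then obtain ss where ss: "thread N (Ff s0) (Al s0) ss" "REP s1 4 ss" using walk by blast
        have "REP (trial I s) 5 ss" using ss(2) h REP_thread_bnd[OF ss(1)] unfolding REP_def by (auto simp: tj)
        then show ?thesis using ss(1) by blast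
      next
        case False
        then show ?thesis using walk h tj[of 5] by simp
      qed
    next
      assume h: "\<not> wsum 5 I s1 < wsum 4 I s1 \<and> s2 5 = s1 5"
      then have "trial I s 5 = s 5" using tj[of 5] s1j[of 5] by simp
      then show ?thesis using c by (simp add: REP_def)
    qed
  next
    fix t assume t: "t < Suc i" "ed N t \<in> Al s0"
    show "\<exists>ss. thread N (Ff s0) (Al s0) ss \<and> stopped N (Ff s0) (Al s0) ss \<and> hd ss = t \<and> sum (wt I) (ed N ` set ss) \<le> wsum 5 I (trial I s)"
    proof (cases "t = i")
      case False
      then obtain ss where "thread N (Ff s0) (Al s0) ss \<and> stopped N (Ff s0) (Al s0) ss \<and> hd ss = t \<and> sum (wt I) (ed N ` set ss) \<le> wsum 5 I s" using m t by force
      then show ?thesis using ww w5' by (intro exI[of _ ss]) auto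
    next
      case True
      then have "als I s i" using t v by (simp add: alsI)
      then obtain ss where ss: "thread N (Ff s0) (Al s0) ss" "stopped N (Ff s0) (Al s0) ss" "hd ss = i" "REP s1 4 ss" using walk by blast
      have "wsum 4 I s1 = sum (wt I) (ed N ` set ss)" by (rule wsum_REP[OF ss(4)]) (use ss(1) Al_E in \<open>auto simp: thread_def\<close>)
      then show ?thesis using ss ww w5' True by (intro exI[of _ ss]) auto
    qed
  qed
qed

lemma best_spec: "bestI s (best I s) (bnd I)"
proof -
  let ?s = "czero I (upd 5 (\<lambda>I a e. 0) I s)"
  have "bestI s ?s 0" unfolding bestI_def by (auto simp: czero_def)
  then have "bestI s ((trial I ^^ i) ?s) i" for i by (induction i) (auto intro: trial_step)
  then show ?thesis unfolding best_def by blast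
qed

text \<open>The walks from both sides of one edge cover its thread, and neither is heavier than the
  best.\<close>

lemma best_threads:
  assumes t: "t \<in> Al s // trel N (Ff s) (Al s)"
  shows "sum (wt I) t \<le> 2 * wsum 5 I (best I s)"
proof -
  obtain e where e: "e \<in> Al s" "t = trel N (Ff s) (Al s) `` {e}" using t by (rule quotientE)
  have eN: "e < N" using e Al_N by blast
  have m: "\<exists>ss. thread N (Ff s) (Al s) ss \<and> stopped N (Ff s) (Al s) ss \<and> hd ss = p \<and> sum (wt I) (ed N ` set ss) \<le> wsum 5 I (best I s)" if "ed N p \<in> Al s" for p
    using best_spec[of s] side_bnd[OF that] that unfolding bestI_def by blast
  have e1: "ed N e = e" "ed N (op N e) = e" "op N e = e + N" using eN by (auto simp: ed_def op_def)
  obtain ss where ss: "thread N (Ff s) (Al s) ss" "stopped N (Ff s) (Al s) ss" "hd ss = e" "sum (wt I) (ed N ` set ss) \<le> wsum 5 I (best I s)" using m[of e] e e1 by auto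
  obtain ss' where ss': "thread N (Ff s) (Al s) ss'" "stopped N (Ff s) (Al s) ss'" "hd ss' = op N e" "sum (wt I) (ed N ` set ss') \<le> wsum 5 I (best I s)" using m[of "op N e"] e e1 by auto
  have "t \<subseteq> ed N ` set ss \<union> ed N ` set ss'"
  proof
    fix f assume "f \<in> t"
    then have "(e, f) \<in> trel N (Ff s) (Al s)" using e by simp
    then show "f \<in> ed N ` set ss \<union> ed N ` set ss'"
      using walk_cover[OF finite_Al Al_N ss(1) ss'(1) _ ss(2) ss'(2), of f] ss(3) ss'(3) e1 by simp
  qed
  moreover have sE: "ed N ` set ss \<subseteq> E" "ed N ` set ss' \<subseteq> E" using ss(1) ss'(1) Al_E[of s] unfolding thread_def by blast+
  ultimately have "sum (wt I) t \<le> sum (wt I) (ed N ` set ss \<union> ed N ` set ss')" by (intro sum_w_mono) auto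
  also have "\<dots> \<le> sum (wt I) (ed N ` set ss) + sum (wt I) (ed N ` set ss')" by (rule sum_w_Un[OF sE])
  finally show ?thesis using ss ss' by simp
qed

text \<open>The flagged edges are deleted one at a time, each by an instance of
  \<open>core_free\<close> for the classes reached so far.\<close>

lemma floop_spec:
  assumes lab: "\<forall>t<bnd I. s 2 t < bnd I" and Q: "\<And>e. e < bnd I \<Longrightarrow> s 8 e \<noteq> 0 \<Longrightarrow> e \<in> D" and D: "D \<subseteq> E"
  shows "\<And>j. j \<noteq> 2 \<Longrightarrow> j \<noteq> 10 \<Longrightarrow> floop I s j = s j" "\<forall>t<bnd I. floop I s 2 t < bnd I"
    "\<And>C TH Rem. core C D (Ff s) TH Rem \<Longrightarrow> core C (D - {e. e < bnd I \<and> s 8 e \<noteq> 0}) (Ff (floop I s)) TH Rem"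
proof -
  let ?s0 = "czero I s"
  let ?S = "\<lambda>i. (fstep1 I ^^ i) ?s0"
  have fj: "?S i j = s j" if "j \<noteq> 2" "j \<noteq> 10" for i j
    by (induction i) (use that in \<open>auto simp: czero_def fstep1_def cinc_def\<close>)
  have ct: "?S i 10 0 = i" for i
    by (induction i) (auto simp: czero_def fstep1_def cinc_def)
  have step2: "?S (Suc i) 2 t = (if s 8 i \<noteq> 0 then (if ?S i 2 t = ?S i 2 (i + N) then ?S i 2 i else ?S i 2 t) else ?S i 2 t)" if "t < bnd I" for i t
    using that ct[of i] fj[of 8 i] by (simp add: fstep1_def cinc_def)
  have l2: "\<forall>t<bnd I. ?S i 2 t < bnd I" if "i \<le> bnd I" for i
    using that
  proof (induction i)
    case 0
    then show ?case using lab by (simp add: czero_def)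
  next
    case (Suc i)
    then show ?case using step2 by simp
  qed
  show "floop I s j = s j" if "j \<noteq> 2" "j \<noteq> 10" for j unfolding floop_def using fj that by simp
  show "\<forall>t<bnd I. floop I s 2 t < bnd I" unfolding floop_def using l2 by simp
  show "core C (D - {e. e < bnd I \<and> s 8 e \<noteq> 0}) (Ff (floop I s)) TH Rem" if co: "core C D (Ff s) TH Rem" for C TH Rem
  proof -
    have "core C (D - {e. e < i \<and> s 8 e \<noteq> 0}) (Ff (?S i)) TH Rem" if "i \<le> bnd I" for i using that
    proof (induction i)
      case 0
      have "Ff ?s0 = Ff s" by (auto simp: Ff_def czero_def fun_eq_iff)
      then show ?case using co by simp
    next
      case (Suc i)
      have ib: "i < bnd I" using Suc by simp
      show ?case
      proof (cases "s 8 i \<noteq> 0")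
        case False
        have "{e. e < Suc i \<and> s 8 e \<noteq> 0} = {e. e < i \<and> s 8 e \<noteq> 0}" using False by (auto simp: less_Suc_eq)
        moreover have "Ff (?S (Suc i)) = Ff (?S i)" using step2[of _ i] False by (auto simp: Ff_def fun_eq_iff)
        ultimately show ?thesis using Suc by simp
      next
        case True
        have iE: "i \<in> D" using Q ib True by blast
        then have iN: "i < N" "i + N < bnd I" using D E_lt N_bnd by fastforce+
        have d: "D - {e. e < Suc i \<and> s 8 e \<noteq> 0} = (D - {e. e < i \<and> s 8 e \<noteq> 0}) - {i}" using True by (auto simp: less_Suc_eq)
        have l: "?S i 2 t < bnd I" if "t < bnd I" for t using l2[of i] Suc that by simp
        \<comment> \<open>Beyond the array the fresh classes differ from every stored label, so the
          identification leaves them alone.\<close>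
        have F: "Ff (?S (Suc i)) = mrg (Ff (?S i) i) (Ff (?S i) (i + N)) (Ff (?S i))"
        proof
          fix t
          show "Ff (?S (Suc i)) t = mrg (Ff (?S i) i) (Ff (?S i) (i + N)) (Ff (?S i)) t"
          proof (cases "t < bnd I")
            case t: True
            show ?thesis using step2[OF t, of i] True t ib iN unfolding Ff_def mrg_def by simp
          next
            case t: False
            then show ?thesis using l[OF iN(2)] iN unfolding Ff_def mrg_def by simp
          qed
        qed
        show ?thesis unfolding d F by (rule core_free) (use Suc iE in auto)
      qed
    qed
    then show ?thesis unfolding floop_def by blast
  qed
qed
end

text \<open>Take the least \<open>j\<close> whose prefix reaches half of the total; the prefix
  before \<open>j\<close> is then at most half, so the rest from \<open>j\<close> on is at least
  half.\<close>

lemma median_index: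
  fixes f :: "nat \<Rightarrow> real"
  assumes "0 < l" and nn: "\<And>i. i < l \<Longrightarrow> 0 \<le> f i"
  shows "\<exists>j<l. (\<Sum>i<l. f i) \<le> 2 * (\<Sum>i\<le>j. f i) \<and> (\<Sum>i<l. f i) \<le> 2 * (\<Sum>i=j..<l. f i)"
proof -
  let ?T = "\<Sum>i<l. f i"
  let ?P = "\<lambda>j. ?T \<le> 2 * (\<Sum>i\<le>j. f i)"
  have T0: "0 \<le> ?T" by (rule sum_nonneg) (use nn in auto)
  have "?P (l - 1)" using assms(1) T0 by (simp add: lessThan_Suc_atMost[symmetric])
  define j where "j = (LEAST j. ?P j)"
  have j: "?P j" "j \<le> l - 1" unfolding j_def by (rule LeastI[of ?P "l - 1"], fact, rule Least_le, fact)
  have jl: "j < l" using j assms by simp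
  have sp: "?T = (\<Sum>i<j. f i) + (\<Sum>i=j..<l. f i)"
    using sum.atLeastLessThan_concat[of 0 j l f] jl by (simp add: atLeast0LessThan)
  have "2 * (\<Sum>i<j. f i) \<le> ?T"
  proof (cases j)
    case 0
    then show ?thesis using T0 by simp
  next
    case (Suc m)
    then have "\<not> ?P m" using not_less_Least[of m ?P] unfolding j_def[symmetric] by simp
    then show ?thesis using Suc by (simp add: lessThan_Suc_atMost)
  qed
  then have "?T \<le> 2 * (\<Sum>i=j..<l. f i)" using sp by simp
  then show ?thesis using j(1) jl by blast
qed

section \<open>One round of the algorithm\<close>

context prob
begin

lemma Inv_cong: assumes "s' 0 = s 0" "s' 1 = s 1" "s' 2 = s 2" "s' 3 = s 3" "s' 7 = s 7" shows "Inv s' \<longleftrightarrow> Inv s"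
proof -
  have "Cf s' = Cf s" "Kf s' = Kf s" "Ff s' = Ff s" "Tf s' = Tf s" "Hs s' = Hs s" "wsum 7 I s' = wsum 7 I s"
    using view_cong[OF assms(1-3)] assms(4,5) by (auto simp: Tf_def Hs_def wsum_def)
  then show ?thesis using assms(3) by (simp add: Inv_def)
qed

lemma mk_cong: assumes "s' 0 = s 0" "s' 1 = s 1" "s' 5 = s 5" "s' 7 = s 7" shows "mk I s' = mk I s"
  unfolding mk_def nbc_def uw_def lw_def inL_def alv_def ends_def wsum_def low_def fun_eq_iff assms by blast

lemma low_cong: "s' 5 = s 5 \<Longrightarrow> s' 7 = s 7 \<Longrightarrow> low I s' = low I s" unfolding low_def wsum_def by simp

lemma sum_bnd: "(\<Sum>e<bnd I. if P e then wt I e else 0) = sum (wt I) {e. e < bnd I \<and> P e}"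
  by (simp add: sum.If_cases Int_def)

definition LrS :: "arrays \<Rightarrow> nat \<Rightarrow> nat \<Rightarrow> nat set" where
  "LrS s x r = {e\<in>E. (Cf s (e div n) = x \<and> Kf s (e mod n) = Suc r) \<or> (Cf s (e mod n) = x \<and> Kf s (e div n) = Suc r)}"

lemma inLI: "inL I s x r e \<longleftrightarrow> e \<in> LrS s x r"
  by (cases "e \<in> E") (simp_all add: inL_def isEI LrS_def E_eu Cf_def Kf_def E_ends)
lemma lwI: "lw I s x r = sum (wt I) (LrS s x r)"
proof -
  have "{e. e < bnd I \<and> inL I s x r e} = LrS s x r" using E_bnd by (auto simp: inLI LrS_def)
  then show ?thesis unfolding lw_def sum_bnd by simp
qed
lemma uwI: "uw I s x = sum (wt I) (w0.lcut (Cf s) (Al s) {x})"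
proof -
  have "alv I s e \<and> (s 0 (eu I e) = x \<or> s 0 (ev I e) = x) \<longleftrightarrow> e \<in> w0.lcut (Cf s) (Al s) {x}" for e
  proof (cases "e \<in> Al s")
    case True
    then have "e \<in> E" using Al_E by blast
    then show ?thesis using True by (auto simp: alvI w0.lcut_def alive_def E_eu Cf_def E_ends)
  qed (simp add: alvI w0.lcut_def)
  moreover have "w0.lcut (Cf s) (Al s) {x} \<subseteq> {..<bnd I}" using Al_E E_bnd by (auto simp: w0.lcut_def)
  ultimately have "{e. e < bnd I \<and> (alv I s e \<and> (s 0 (eu I e) = x \<or> s 0 (ev I e) = x))} = w0.lcut (Cf s) (Al s) {x}" by auto
  then show ?thesis unfolding uw_def sum_bnd by simp
qed
lemma endsI: "e \<in> E \<Longrightarrow> ends I s e x y \<longleftrightarrow> {Cf s (e div n), Cf s (e mod n)} = {x, y}"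
  by (auto simp: ends_def E_eu Cf_def E_ends doubleton_eq_iff)

lemma InvD: assumes "Inv s" shows "INV (Cf s) (Kf s) (Ff s) (Tf s) (Hs s) (wsum 7 I s)" "labels_ok (Cf s) (Kf s)" "\<forall>t<bnd I. s 2 t < bnd I"
  using assms by (auto simp: Inv_def INV_def)

lemma nbcI: assumes "Inv s" shows "nbc I s x = card {y. \<exists>e\<in>Al s. {Cf s (e div n), Cf s (e mod n)} = {x, y}}"
proof -
  have "{y. y < bnd I \<and> (\<exists>e<bnd I. alv I s e \<and> ends I s e x y)} = {y. \<exists>e\<in>Al s. {Cf s (e div n), Cf s (e mod n)} = {x, y}}"
  proof (intro set_eqI iffI)
    fix y assume "y \<in> {y. y < bnd I \<and> (\<exists>e<bnd I. alv I s e \<and> ends I s e x y)}"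
    then obtain e where "e \<in> Al s" "ends I s e x y" by (auto simp: alvI)
    then show "y \<in> {y. \<exists>e\<in>Al s. {Cf s (e div n), Cf s (e mod n)} = {x, y}}" using Al_E[of s] endsI[of e s x y] by blast
  next
    fix y assume "y \<in> {y. \<exists>e\<in>Al s. {Cf s (e div n), Cf s (e mod n)} = {x, y}}"
    then obtain e where e: "e \<in> Al s" "{Cf s (e div n), Cf s (e mod n)} = {x, y}" by blast
    then have eE: "e \<in> E" using Al_E by blast
    have "Cf s (e div n) < n" "Cf s (e mod n) < n" using InvD(2)[OF assms] E_ends[OF eE] by (auto simp: labels_ok_def)
    then have "y < bnd I" using e(2) bndI by (auto simp: doubleton_eq_iff)
    then show "y \<in> {y. y < bnd I \<and> (\<exists>e<bnd I. alv I s e \<and> ends I s e x y)}" using e endsI[OF eE] E_bnd[OF eE] by (auto simp: alvI)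
  qed
  then show ?thesis unfolding nbc_def count_card by simp
qed

lemma nlabI: "nlab I s = card (LB (Cf s) (Kf s))"
proof -
  have "{x. x < bnd I \<and> (x < fst I 0 \<and> s 0 x = x \<and> s 1 x = 0)} = LB (Cf s) (Kf s)"
    by (auto simp: LB_def Cf_def Kf_def bndI)
  then show ?thesis unfolding nlab_def count_card by simp
qed

lemma finite_LB: "finite (LB C K)" by (auto simp: LB_def)

lemma domark_ok:
  assumes V: "Inv t" and ex: "\<exists>x<bnd I. \<exists>r<bnd I. mk I t x r" and B0: "0 \<le> wsum 5 I t"
  shows "Inv (domark I t) \<and> card (LB (Cf (domark I t)) (Kf (domark I t))) < card (LB (Cf t) (Kf t))"
proof -
  define t1 where "t1 = upd 12 (\<lambda>I a i. first (bnd I) (\<lambda>x. \<exists>r<bnd I. mk I a x r)) I t"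
  define t2 where "t2 = upd 13 (\<lambda>I a i. first (bnd I) (\<lambda>r. mk I a (a 12 0) r)) I t1"
  define t3 where "t3 = upd 14 (\<lambda>I a i. first (bnd I) (\<lambda>e. inL I a (a 12 0) (a 13 0) e)) I t2"
  define t4 where "t4 = upd 8 (\<lambda>I a e. of_bool (alv I a e \<and> (a 0 (eu I e) = a 12 0 \<or> a 0 (ev I e) = a 12 0))) I t3"
  define t5 where "t5 = upd 3 (\<lambda>I a e. if e = a 14 0 then 1 else a 3 e) I t4"
  define t6 where "t6 = upd 1 (\<lambda>I a v. if v < nn I \<and> a 0 v = a 12 0 then a 13 0 + 1 else a 1 v) I t5"
  have dm: "domark I t = floop I t6" by (simp add: domark_def t1_def t2_def t3_def t4_def t5_def t6_def)
  define x where "x = t1 12 0"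
  define r where "r = t2 13 0"
  define e1 where "e1 = t3 14 0"
  have xf: "x = first (bnd I) (\<lambda>x. \<exists>r<bnd I. mk I t x r)" by (simp add: x_def t1_def)
  have x: "x < bnd I" "\<exists>r<bnd I. mk I t x r" unfolding xf using first_props[OF ex] by auto
  have mk1: "mk I t1 = mk I t" by (rule mk_cong) (simp_all add: t1_def)
  have rf: "r = first (bnd I) (\<lambda>r. mk I t x r)" by (simp add: r_def t2_def x_def mk1)
  have mkr: "mk I t x r" unfolding rf using first_props[OF x(2)] by auto
  have x12: "t2 12 0 = x" "t3 12 0 = x" "t5 12 0 = x" by (simp_all add: t2_def t3_def t4_def t5_def x_def)
  have r13: "t5 13 0 = r" "t2 13 0 = r" by (simp_all add: t3_def t4_def t5_def r_def)
  have L: "labels_ok (Cf t) (Kf t)" using InvD(2)[OF V] .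
  have xx: "x < n" "Cf t x = x" "Kf t x = 0" using mkr by (auto simp: mk_def Cf_def Kf_def)
  have nb: "card {y. \<exists>e\<in>Al t. {Cf t (e div n), Cf t (e mod n)} = {x, y}} \<le> 12" using mkr nbcI[OF V] by (simp add: mk_def)
  have u: "sum (wt I) (w0.lcut (Cf t) (Al t) {x}) \<le> 24 * wsum 5 I t" using mkr uwI by (simp add: mk_def)
  have l: "48 * wsum 5 I t \<le> sum (wt I) (LrS t x r)" using mkr lwI by (simp add: mk_def)
  have mx: "sum (wt I) (LrS t x r') \<le> sum (wt I) (LrS t x r)" if "r' \<in> A" for r'
    using mkr lwI that AV VG bndI by (auto simp: mk_def)
  have hB: "\<not> (Hs t \<and> wsum 7 I t \<le> wsum 5 I t)" using mkr by (simp add: mk_def low_def Hs_def)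
  have v2: "Cf t2 = Cf t" "Kf t2 = Kf t" using view_cong[of t2 t] by (auto simp: t2_def t1_def)
  \<comment> \<open>If the heaviest group were empty, \<open>B\<close> and with it the alive weight
    at \<open>x\<close> would be 0, contradicting thickness.\<close>
  have "\<exists>e<bnd I. inL I t2 x r e"
  proof (rule ccontr)
    assume "\<not> ?thesis"
    then have em: "LrS t x r = {}" using E_bnd by (auto simp: inLI LrS_def v2)
    have "\<beta> \<le> sum (wt I) (w0.lcut (Cf t) (Al t) {x}) + real a * sum (wt I) (LrS t x r)"
      by (rule mark_weights[OF L xx LrS_def]) (rule mx)
    then show False using u l em b0 by simp
  qed
  then have "inL I t2 x r (first (bnd I) (inL I t2 x r))" by (rule first_props(2))
  moreover have e1f: "e1 = first (bnd I) (inL I t2 x r)" by (simp add: e1_def t3_def x12 r13)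
  ultimately have e1: "e1 \<in> LrS t x r" by (simp add: inLI LrS_def v2)
  have e1E: "e1 \<in> E" using e1 by (simp add: LrS_def)
  have t60: "t6 0 = t 0" "t6 2 = t 2" "t6 7 = t 7" by (simp_all add: t6_def t5_def t4_def t3_def t2_def t1_def)
  have t61: "t6 1 v = (if v < n \<and> t 0 v = x then Suc r else t 1 v)" if "v < bnd I" for v
    using that x12 r13 by (simp add: t6_def t5_def t4_def t3_def t2_def t1_def)
  have e14: "t4 14 0 = e1" by (simp add: t4_def e1_def)
  have t63: "t6 3 e = (if e = e1 then 1 else t 3 e)" if "e < bnd I" for e
  proof -
    have "t6 3 e = (if e = t4 14 0 then 1 else t4 3 e)" using that by (simp add: t6_def t5_def)
    then show ?thesis unfolding e14 by (simp add: t4_def t3_def t2_def t1_def)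
  qed
  have v3: "Al t3 = Al t" "t3 0 = t 0" using view_cong[of t3 t] by (auto simp: t3_def t2_def t1_def)
  have t68: "t6 8 e \<noteq> 0 \<longleftrightarrow> e \<in> Al t \<and> (Cf t (e div n) = x \<or> Cf t (e mod n) = x)" if "e < bnd I" for e
  proof -
    have "t6 8 e = of_bool (alv I t3 e \<and> (t3 0 (eu I e) = x \<or> t3 0 (ev I e) = x))" using that x12 by (simp add: t6_def t5_def t4_def)
    then show ?thesis using Al_E[of t] by (auto simp: alvI v3 E_eu Cf_def E_ends subset_iff)
  qed
  let ?s = "floop I t6"
  have F6: "Ff t6 = Ff t" using t60 by (auto simp: Ff_def fun_eq_iff)
  have lab6: "\<forall>q<bnd I. t6 2 q < bnd I" using InvD(3)[OF V] t60 by simp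
  have Q6: "\<And>e. e < bnd I \<Longrightarrow> t6 8 e \<noteq> 0 \<Longrightarrow> e \<in> Al t" using t68 by blast
  note fl = floop_spec[where s=t6 and D="Al t", OF lab6 Q6 Al_E[of t]]
  have sC: "Cf ?s = Cf t" using fl(1)[of 0] t60 by (auto simp: Cf_def fun_eq_iff)
  have sK: "Kf ?s v = (if Cf t v = x then Suc r else Kf t v)" for v
    using fl(1)[of 1] t61[of v] xx bndI by (auto simp: Kf_def Cf_def)
  have sT: "Tf ?s = insert e1 (Tf t)"
    using fl(1)[of 3] t63 E_lt[OF e1E] N_bnd by (auto simp: Tf_def)
  have s7: "?s 7 = t 7" using fl(1)[of 7] t60 by simp
  have sH: "Hs ?s = Hs t" "wsum 7 I ?s = wsum 7 I t" unfolding Hs_def wsum_def s7 by auto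
  have Al': "alive (Cf t) (Kf ?s) = Al t - {e. e < bnd I \<and> t6 8 e \<noteq> 0}"
  proof (intro set_eqI iffI)
    fix e assume e: "e \<in> alive (Cf t) (Kf ?s)"
    then have "e \<in> Al t" "Cf t (e div n) \<noteq> x" "Cf t (e mod n) \<noteq> x" by (auto simp: alive_def sK split: if_splits)
    then show "e \<in> Al t - {e. e < bnd I \<and> t6 8 e \<noteq> 0}" using t68 by blast
  next
    fix e assume e: "e \<in> Al t - {e. e < bnd I \<and> t6 8 e \<noteq> 0}"
    then have "e < bnd I" using Al_E E_bnd by blast
    then have "Cf t (e div n) \<noteq> x" "Cf t (e mod n) \<noteq> x" using e t68[of e] by auto
    then show "e \<in> alive (Cf t) (Kf ?s)" using e by (auto simp: alive_def sK)
  qed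
  have "INV (Cf t) (Kf ?s) (Ff ?s) (insert e1 (Tf t)) (Hs t) (wsum 7 I t)"
  proof (rule mark_step[OF InvD(1)[OF V] xx nb LrS_def B0 u l mx hB e1 sK])
    fix TH Rem assume "core (Cf t) (Al t) (Ff t) TH Rem"
    then show "core (Cf t) (alive (Cf t) (Kf ?s)) (Ff ?s) TH Rem" unfolding Al' using fl(3) F6 by simp
  qed
  then have "Inv ?s" unfolding Inv_def sC sT sH using fl(2) by blast
  moreover have "LB (Cf ?s) (Kf ?s) = LB (Cf t) (Kf t) - {x}"
    unfolding sC LB_def using xx by (auto simp: sK split: if_splits)
  moreover have "x \<in> LB (Cf t) (Kf t)" using xx by (simp add: LB_def)
  ultimately show ?thesis unfolding dm using card_Diff1_less[OF finite_LB] by simp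
qed

lemma domerge_ok:
  assumes V: "Inv t" and kB: "kap \<le> wsum 5 I t" and T: "thread N (Ff t) (Al t) ss" and R: "REP t 5 ss"
  shows "Inv (domerge I t) \<and> card (LB (Cf (domerge I t)) (Kf (domerge I t))) < card (LB (Cf t) (Kf t))"
proof -
  define t1 where "t1 = upd 14 (\<lambda>I a i. first (bnd I) (\<lambda>e. mid I a e)) I t"
  define t2 where "t2 = upd 12 (\<lambda>I a i. a 0 (eu I (a 14 0))) I t1"
  define t3 where "t3 = upd 13 (\<lambda>I a i. a 0 (ev I (a 14 0))) I t2"
  define t4 where "t4 = upd 8 (\<lambda>I a e. of_bool (alv I a e \<and> a 5 e = 0 \<and> ends I a e (a 12 0) (a 13 0))) I t3"
  define t5 where "t5 = upd 7 (\<lambda>I a e. if low I a then a 7 e else a 5 e) I t4"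
  define t6 where "t6 = upd 3 (\<lambda>I a e. if e = a 14 0 then 1 else a 3 e) I t5"
  define t7 where "t7 = upd 0 (\<lambda>I a v. if v < nn I \<and> a 0 v = a 13 0 then a 12 0 else a 0 v) I t6"
  have dm: "domerge I t = floop I t7" by (simp add: domerge_def t1_def t2_def t3_def t4_def t5_def t6_def t7_def)
  define P where "P = ed N ` set ss"
  let ?e = "\<lambda>i. ed N (ss ! i)"
  have PAl: "P \<subseteq> Al t" using T by (auto simp: P_def thread_def)
  have PE: "P \<subseteq> E" using PAl Al_E by blast
  have Pset: "{f. f < bnd I \<and> t 5 f \<noteq> 0} = P" using R PE E_bnd unfolding P_def REP_def by (auto simp: in_set_conv_nth)
  have R1: "t 5 (?e i) = Suc i" if "i < length ss" for i using R that by (simp add: REP_def)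
  have inj: "inj_on ?e {..<length ss}" using R1 by (intro inj_onI) (metis lessThan_iff nat.inject)
  have Pi: "P = ?e ` {..<length ss}" unfolding P_def set_conv_nth image_Collect by blast
  have B: "wsum 5 I t = sum (wt I) P" unfolding wsum_def sum_bnd Pset ..
  have psum: "sum (wt I) {f. f < bnd I \<and> (t 5 f \<noteq> 0 \<and> Q (t 5 f))} = (\<Sum>i\<in>{i. i < length ss \<and> Q (Suc i)}. wt I (?e i))" for Q
  proof -
    have "{f. f < bnd I \<and> (t 5 f \<noteq> 0 \<and> Q (t 5 f))} = {f\<in>P. Q (t 5 f)}" using Pset by blast
    also have "\<dots> = ?e ` {i. i < length ss \<and> Q (Suc i)}" unfolding Pi using R1 by auto
    finally show ?thesis by (simp add: sum.reindex inj_on_subset[OF inj] subset_iff)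
  qed
  have sn: "ss \<noteq> []" using T by (simp add: thread_def)
  have Bs: "wsum 5 I t = (\<Sum>i<length ss. wt I (?e i))" unfolding B Pi by (simp add: sum.reindex[OF inj])
  have midI: "mid I t (?e j) \<longleftrightarrow> wsum 5 I t \<le> 2 * (\<Sum>i\<le>j. wt I (?e i)) \<and> wsum 5 I t \<le> 2 * (\<Sum>i=j..<length ss. wt I (?e i))" if j: "j < length ss" for j
  proof -
    have 1: "{i. i < length ss \<and> Suc i \<le> Suc j} = {..j}" "{i. i < length ss \<and> Suc j \<le> Suc i} = {j..<length ss}" using j by auto
    have 2: "sum (wt I) {f. f < bnd I \<and> (t 5 f \<noteq> 0 \<and> t 5 f \<le> Suc j)} = (\<Sum>i\<le>j. wt I (?e i))" using psum[of "\<lambda>k. k \<le> Suc j"] unfolding 1 .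
    have 3: "sum (wt I) {f. f < bnd I \<and> (t 5 f \<noteq> 0 \<and> Suc j \<le> t 5 f)} = (\<Sum>i=j..<length ss. wt I (?e i))" using psum[of "\<lambda>k. Suc j \<le> k"] unfolding 1 .
    show ?thesis unfolding mid_def sum_bnd R1[OF j] 2 3 by simp
  qed
  have wn: "0 \<le> wt I (?e i)" if "i < length ss" for i using w0.w_nonneg that PE unfolding Pi by blast
  obtain j0 where j0: "j0 < length ss" "mid I t (?e j0)"
    using median_index[of "length ss" "\<lambda>i. wt I (?e i)"] sn wn midI Bs by auto
  define e where "e = t1 14 0"
  have ef: "e = first (bnd I) (mid I t)" by (simp add: e_def t1_def)
  have "\<exists>e<bnd I. mid I t e" using j0 PE E_bnd unfolding Pi by blast
  from first_props[OF this] have e: "e < bnd I" "mid I t e" unfolding ef by auto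
  have eP: "e \<in> P" using e Pset by (auto simp: mid_def)
  then obtain j where j: "j < length ss" "e = ?e j" unfolding Pi by blast
  have h: "wsum 5 I t / 2 \<le> (\<Sum>i\<le>j. wt I (?e i))" "wsum 5 I t / 2 \<le> (\<Sum>i=j..<length ss. wt I (?e i))"
    using e(2) midI[OF j(1)] j(2) by auto
  have eE: "e \<in> E" "e \<in> Al t" using eP PE PAl by auto
  define x where "x = Cf t (e div n)"
  define y where "y = Cf t (e mod n)"
  have x12: "t2 12 0 = x" "t3 12 0 = x" "t6 12 0 = x"
    using eE by (simp_all add: t6_def t5_def t4_def t3_def t2_def e_def[symmetric] x_def E_eu Cf_def E_ends) (simp_all add: t1_def)
  have y13: "t3 13 0 = y" "t6 13 0 = y"
    using eE by (simp_all add: t6_def t5_def t4_def t3_def t2_def e_def[symmetric] y_def E_eu Cf_def E_ends) (simp_all add: t1_def)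
  have xy: "x \<noteq> y" using eE(2) by (auto simp: alive_def x_def y_def)
  have L: "labels_ok (Cf t) (Kf t)" using InvD(2)[OF V] .
  have xn: "x < n" "y < n" using L E_ends[OF eE(1)] by (auto simp: x_def y_def labels_ok_def)
  obtain TH Rem where co: "core (Cf t) (Al t) (Ff t) TH Rem" using InvD(1)[OF V] unfolding INV_def by blast
  have lab: "{Cf t (f div n), Cf t (f mod n)} = {x, y}" if "f \<in> P" for f
    by (rule thread_labels[OF co _ T, of e]) (use that eP x_def y_def in \<open>auto simp: P_def alive_def\<close>)
  have t7s: "t7 1 = t 1" "t7 2 = t 2" by (simp_all add: t7_def t6_def t5_def t4_def t3_def t2_def t1_def)
  have t70: "t7 0 v = (if v < n \<and> t 0 v = y then x else t 0 v)" if "v < bnd I" for v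
    using that x12 y13 by (simp add: t7_def t6_def t5_def t4_def t3_def t2_def t1_def)
  have e14: "t5 14 0 = e" by (simp add: t5_def t4_def t3_def t2_def e_def)
  have t73: "t7 3 f = (if f = e then 1 else t 3 f)" if "f < bnd I" for f
  proof -
    have "t7 3 f = (if f = t5 14 0 then 1 else t5 3 f)" using that by (simp add: t7_def t6_def)
    then show ?thesis unfolding e14 by (simp add: t5_def t4_def t3_def t2_def t1_def)
  qed
  have t77: "t7 7 f = (if low I t then t 7 f else t 5 f)" if "f < bnd I" for f
  proof -
    have "low I t4 = low I t" by (rule low_cong) (simp_all add: t4_def t3_def t2_def t1_def)
    then have "t7 7 f = (if low I t then t4 7 f else t4 5 f)" using that by (simp add: t7_def t6_def t5_def)
    then show ?thesis by (simp add: t4_def t3_def t2_def t1_def)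
  qed
  have v3: "Cf t3 = Cf t" "Kf t3 = Kf t" "t3 5 = t 5" using view_cong[of t3 t] by (auto simp: t3_def t2_def t1_def)
  have t78: "t7 8 f \<noteq> 0 \<longleftrightarrow> f \<in> Al t \<and> f \<notin> P \<and> {Cf t (f div n), Cf t (f mod n)} = {x, y}" if f: "f < bnd I" for f
  proof -
    have "t7 8 f = of_bool (alv I t3 f \<and> t3 5 f = 0 \<and> ends I t3 f x y)" using f x12 y13 by (simp add: t7_def t6_def t5_def t4_def)
    moreover have "f \<in> P \<longleftrightarrow> t 5 f \<noteq> 0" using Pset f by blast
    ultimately show ?thesis using Al_E[of t] endsI[of f t3 x y] unfolding v3 alvI by (auto simp only: of_bool_eq_0_iff)
  qed
  let ?s = "floop I t7"
  have F7: "Ff t7 = Ff t" using t7s by (auto simp: Ff_def fun_eq_iff)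
  have lab7: "\<forall>q<bnd I. t7 2 q < bnd I" using InvD(3)[OF V] t7s by simp
  have DE: "Al t - P \<subseteq> E" using Al_E by blast
  have Q7: "\<And>f. f < bnd I \<Longrightarrow> t7 8 f \<noteq> 0 \<Longrightarrow> f \<in> Al t - P" using t78 by blast
  note fl = floop_spec[where s=t7 and D="Al t - P", OF lab7 Q7 DE]
  have sC: "Cf ?s v = (if Cf t v = y then x else Cf t v)" for v
    using fl(1)[of 0] t70[of v] xn bndI by (auto simp: Cf_def)
  have sK: "Kf ?s = Kf t" using fl(1)[of 1] t7s by (auto simp: Kf_def fun_eq_iff)
  have sT: "Tf ?s = insert e (Tf t)" using fl(1)[of 3] t73 E_lt[OF eE(1)] N_bnd by (auto simp: Tf_def)
  have s7: "?s 7 = t7 7" using fl(1)[of 7] by simp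
  have sH: "Hs ?s" unfolding Hs_def s7
  proof (cases "low I t")
    case True
    then obtain f where "f < bnd I" "t 7 f \<noteq> 0" by (auto simp: low_def)
    then show "\<exists>e<bnd I. t7 7 e \<noteq> 0" using t77 True by auto
  next
    case False
    then show "\<exists>e<bnd I. t7 7 e \<noteq> 0" using t77[OF e(1)] e by (auto simp: mid_def)
  qed
  have sW: "wsum 7 I ?s = (if Hs t \<and> wsum 7 I t \<le> wsum 5 I t then wsum 7 I t else wsum 5 I t)"
  proof -
    have "low I t \<longleftrightarrow> Hs t \<and> wsum 7 I t \<le> wsum 5 I t" by (simp add: low_def Hs_def)
    moreover have "wsum 7 I ?s = (if low I t then wsum 7 I t else wsum 5 I t)" unfolding wsum_def s7 using t77 by simp
    ultimately show ?thesis by simp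
  qed
  \<comment> \<open>Exactly the edges between \<open>x\<close> and \<open>y\<close> cease to be
    alive: those of the walk as \<open>P\<close>, the others through their flags.\<close>
  have Al': "alive (Cf ?s) (Kf t) = (Al t - P) - {f. f < bnd I \<and> t7 8 f \<noteq> 0}"
  proof (intro set_eqI iffI)
    fix f assume f: "f \<in> alive (Cf ?s) (Kf t)"
    then have "f \<in> Al t" and nl: "{Cf t (f div n), Cf t (f mod n)} \<noteq> {x, y}" by (auto simp: alive_def sC doubleton_eq_iff split: if_splits)
    then show "f \<in> (Al t - P) - {f. f < bnd I \<and> t7 8 f \<noteq> 0}" using lab t78 by blast
  next
    fix f assume f: "f \<in> (Al t - P) - {f. f < bnd I \<and> t7 8 f \<noteq> 0}"
    then have fb: "f < bnd I" using Al_E E_bnd by blast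
    then have "{Cf t (f div n), Cf t (f mod n)} \<noteq> {x, y}" using f t78[OF fb] by auto
    then show "f \<in> alive (Cf ?s) (Kf t)" using f by (auto simp: alive_def sC doubleton_eq_iff)
  qed
  have "INV (Cf ?s) (Kf t) (Ff ?s) (insert e (Tf t)) True (wsum 7 I ?s)"
  proof (rule merge_step[OF InvD(1)[OF V] T P_def j B kB h x_def y_def sC sW])
    fix TH Rem assume "core (Cf ?s) (Al t - P) (Ff t) TH Rem"
    then show "core (Cf ?s) (alive (Cf ?s) (Kf t)) (Ff ?s) TH Rem" unfolding Al' using fl(3) F7 by simp
  qed
  then have "Inv ?s" unfolding Inv_def sK sT using fl(2) sH by simp
  moreover have Cy: "Cf t y = y" "Cf t x = x" "Kf t y = 0" "Kf t x = 0"
  proof -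
    have "Kf t (e div n) = 0" "Kf t (e mod n) = 0" using eE(2) by (auto simp: alive_def)
    then show "Cf t y = y" "Cf t x = x" "Kf t y = 0" "Kf t x = 0" using L E_ends[OF eE(1)] by (auto simp: x_def y_def labels_ok_def)
  qed
  then have "LB (Cf ?s) (Kf ?s) = LB (Cf t) (Kf t) - {y}"
    unfolding sK LB_def using xy by (auto simp: sC split: if_splits)
  moreover have "y \<in> LB (Cf t) (Kf t)" using Cy xn by (simp add: LB_def)
  ultimately show ?thesis unfolding dm using card_Diff1_less[OF finite_LB] by simp
qed

lemma round_ok:
  assumes V: "Inv s"
  shows "Inv (round I s)" "2 * g < card (LB (Cf s) (Kf s)) \<Longrightarrow> card (LB (Cf (round I s)) (Kf (round I s))) < card (LB (Cf s) (Kf s))"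
    "\<not> 2 * g < card (LB (Cf s) (Kf s)) \<Longrightarrow> round I s = s"
proof -
  have gd: "fst I 2 + fst I 2 < nlab I s \<longleftrightarrow> 2 * g < card (LB (Cf s) (Kf s))" by (auto simp: nlabI)
  show no: "round I s = s" if "\<not> 2 * g < card (LB (Cf s) (Kf s))" using that gd by (simp add: round_def)
  have yes: "Inv (round I s) \<and> card (LB (Cf (round I s)) (Kf (round I s))) < card (LB (Cf s) (Kf s))" if big: "2 * g < card (LB (Cf s) (Kf s))"
  proof -
    define t where "t = best I s"
    have rd: "round I s = round1 I t" using big gd by (simp add: round_def t_def)
    note bs = best_spec[of s, folded t_def]
    have tj: "t j = s j" if "j \<notin> {4, 5, 6, 9, 10}" for j using bs that unfolding bestI_def by blast
    have v: "Cf t = Cf s" "Kf t = Kf s" "Ff t = Ff s" using view_cong[of t s] tj by auto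
    have Vt: "Inv t" using V Inv_cong[of t s] tj by simp
    have B0: "0 \<le> wsum 5 I t" unfolding wsum_def
    proof (rule sum_nonneg)
      fix e assume "e \<in> {..<bnd I}"
      have "(\<forall>e<bnd I. t 5 e = 0) \<or> (\<exists>ss. thread N (Ff s) (Al s) ss \<and> REP t 5 ss)" using bs unfolding bestI_def by blast
      then show "0 \<le> (if t 5 e \<noteq> 0 then wt I e else 0)"
      proof
        assume "\<forall>e<bnd I. t 5 e = 0"
        then show ?thesis using \<open>e \<in> {..<bnd I}\<close> by simp
      next
        assume "\<exists>ss. thread N (Ff s) (Al s) ss \<and> REP t 5 ss"
        then obtain ss where ss: "thread N (Ff s) (Al s) ss" "REP t 5 ss" by blast
        show ?thesis
        proof (cases "t 5 e = 0")
          case False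
          then have "e \<in> ed N ` set ss" using ss(2) \<open>e \<in> {..<bnd I}\<close> by (simp add: REP_def)
          then have "e \<in> E" using ss(1) Al_E[of s] unfolding thread_def by blast
          then show ?thesis using w0.w_nonneg by simp
        qed simp
      qed
    qed
    show ?thesis
    proof (cases "\<exists>x<bnd I. \<exists>r<bnd I. mk I t x r")
      case True
      then show ?thesis using domark_ok[OF Vt True B0] unfolding rd round1_def by (simp add: v)
    next
      case nm: False
      have thr: "sum (wt I) c \<le> 2 * wsum 5 I t" if "c \<in> Al t // trel N (Ff t) (Al t)" for c
        using best_threads[of c s] that unfolding v t_def[symmetric] by blast
      \<comment> \<open>If \<open>low\<close> holds, an earlier merging walk of weight at least
        \<open>kap\<close> is no heavier than this one. Otherwise \<open>heavy_or_mark\<close>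
        applies, since no pair can be marked.\<close>
      have kB: "kap \<le> wsum 5 I t"
      proof (cases "low I t")
        case True
        then have "Hs t" "wsum 7 I t \<le> wsum 5 I t" by (auto simp: low_def Hs_def)
        moreover have "split_ok (Cf t) (Hs t) (wsum 7 I t)" using InvD(1)[OF Vt] by (simp add: INV_def)
        ultimately show ?thesis by (auto simp: split_ok_def)
      next
        case nl: False
        show ?thesis
        proof (rule heavy_or_mark[OF InvD(1)[OF Vt] _ B0 thr LrS_def])
          show "2 * g < card (LB (Cf t) (Kf t))" using big v by simp
          fix x r assume x: "x < n" "Cf t x = x" "Kf t x = 0" and nb: "card {y. \<exists>e\<in>Al t. {Cf t (e div n), Cf t (e mod n)} = {x, y}} \<le> 12"
            and u: "sum (wt I) (w0.lcut (Cf t) (Al t) {x}) \<le> 24 * wsum 5 I t" and r: "r \<in> A"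
            and l: "48 * wsum 5 I t \<le> sum (wt I) (LrS t x r)" and mx: "\<forall>r'\<in>A. sum (wt I) (LrS t x r') \<le> sum (wt I) (LrS t x r)"
          \<comment> \<open>The program compares all indices below \<open>bnd I\<close>; an index
            that is no apex has an empty group.\<close>
          have "lw I t x r' \<le> lw I t x r" for r'
          proof (cases "r' \<in> A")
            case False
            have "LrS t x r' = {}"
            proof (rule ccontr)
              assume "LrS t x r' \<noteq> {}"
              then obtain f w where "f \<in> E" "w \<in> {f div n, f mod n}" "Kf t w = Suc r'" by (auto simp: LrS_def)
              then have "\<exists>r\<in>A. Suc r' = Suc r" using InvD(2)[OF Vt] E_ends[of f] unfolding labels_ok_def by (metis insertE nat.distinct(1) singletonD)
              then show False using False by auto
            qed
            moreover have "0 \<le> sum (wt I) (LrS t x r)" by (rule sum_w_nonneg) (auto simp: LrS_def)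
            ultimately show ?thesis unfolding lwI by simp
          qed (use mx lwI in auto)
          then have "mk I t x r" using x nb u l nl nbcI[OF Vt] uwI lwI by (auto simp: mk_def Cf_def Kf_def)
          moreover have "x < bnd I" "r < bnd I" using x r AV VG bndI by auto
          ultimately show False using nm by blast
        qed
      qed
      have "(\<forall>e<bnd I. t 5 e = 0) \<or> (\<exists>ss. thread N (Ff s) (Al s) ss \<and> REP t 5 ss)" using bs unfolding bestI_def by blast
      moreover have "\<not> (\<forall>e<bnd I. t 5 e = 0)" using kB kap_pos wsum_zero[of t 5] by (metis not_le)
      ultimately obtain ss where ss: "thread N (Ff t) (Al t) ss" "REP t 5 ss" unfolding v by blast
      have "round1 I t = domerge I t" unfolding round1_def by (rule if_not_P[OF nm])
      then show ?thesis using domerge_ok[OF Vt kB ss] unfolding rd by (simp add: v)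
    qed
  qed
  show "Inv (round I s)" using yes no V by (cases "2 * g < card (LB (Cf s) (Kf s))") auto
  show "card (LB (Cf (round I s)) (Kf (round I s))) < card (LB (Cf s) (Kf s))" if "2 * g < card (LB (Cf s) (Kf s))" using yes that by blast
qed

text \<open>Every effective round removes one unmarked cluster, and there are at most
  \<open>n\<close> of them, fewer than the number of rounds.\<close>

lemma rounds_ok:
  assumes V: "Inv s"
  shows "Inv ((round I ^^ bnd I) s)" "card (LB (Cf ((round I ^^ bnd I) s)) (Kf ((round I ^^ bnd I) s))) \<le> 2 * g"
proof -
  let ?S = "\<lambda>i. (round I ^^ i) s" and ?l = "\<lambda>s. card (LB (Cf s) (Kf s))"
  have "?l s \<le> card {..<n}" by (rule card_mono) (auto simp: LB_def)
  then have l0: "?l s \<le> n" by simp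
  have *: "Inv (?S i) \<and> (?l (?S i) \<le> 2 * g \<or> ?l (?S i) + i \<le> n)" for i
  proof (induction i)
    case 0
    then show ?case using V l0 by simp
  next
    case (Suc i)
    then have Vi: "Inv (?S i)" by blast
    show ?case
    proof (cases "2 * g < ?l (?S i)")
      case True
      then show ?thesis using round_ok(1)[OF Vi] round_ok(2)[OF Vi True] Suc by auto
    next
      case False
      then show ?thesis using round_ok(3)[OF Vi False] Vi by simp
    qed
  qed
  from *[of "bnd I"] show "Inv (?S (bnd I))" "?l (?S (bnd I)) \<le> 2 * g" using bndI by auto
qed
end

subsection \<open>Initialisation and output\<close>

context prob
begin

sublocale m: rmap n E "wt I" H rot twi F for F
proof
  show "finite_simple_graph H" using fsG by (auto simp: finite_simple_graph_def delete_vertices_def)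
  show "vertices H \<subseteq> {..<n}" using VG by (auto simp: delete_vertices_def)
  show "rotation_system H rot" using emb by (simp add: embedding_on_def)
qed

lemma edgesH: "{u, v} \<in> edges H \<longleftrightarrow> {u, v} \<in> edges G \<and> u \<notin> A \<and> v \<notin> A" by (auto simp: delete_vertices_def)

lemma sideI: assumes "{u, v} \<in> edges H" shows "sAI I v u = m.sA v u" "sBI I v u = m.sB v u" "rotI I v u = rot v u"
proof -
  have uv: "u < n" "v < n" using m.edge_props[OF assms] by auto
  then have dm: "(u * n + v) div n = u" "(u * n + v) mod n = v" "(v * n + u) div n = v" "(v * n + u) mod n = u" by auto
  have eid: "eidI I u v = m.eid u v" using uv by (simp add: eidI_def m.eid_def rowm_lt)
  have tw: "twI I u v \<longleftrightarrow> twi {u, v}" unfolding twI_def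
    using rdI(3)[OF index_less[OF uv]] assms uv by (simp add: dm rowm_lt)
  show "sAI I v u = m.sA v u" "sBI I v u = m.sB v u" by (simp_all add: sAI_def sBI_def m.sA_def m.sB_def eid tw)
  show "rotI I v u = rot v u" unfolding rotI_def
    using rdI(2)[OF index_less[OF uv(2,1)]] assms uv by (simp add: dm rowm_lt insert_commute)
qed

lemma side_lt: assumes "u \<in> neighbours H v" shows "m.sA v u < bnd I" "m.sB v u < bnd I"
  using m.eid_EH(2)[OF assms] N_bnd by (auto simp: m.sA_def m.sB_def)

definition s0 :: arrays where
  "s0 = czero I (upd 2 (\<lambda>I a s. s) I (upd 1 (\<lambda>I a v. if inA I v then v + 1 else 0) I (upd 0 (\<lambda>I a v. v) I (\<lambda>_ _. 0))))"

definition isH :: "nat \<Rightarrow> bool" where "isH i \<longleftrightarrow> i < N \<and> {i div n, i mod n} \<in> edges H"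
definition lA :: "nat \<Rightarrow> nat" where "lA i = m.sA (i mod n) (i div n)"
definition lB :: "nat \<Rightarrow> nat" where "lB i = m.sB (i mod n) (rot (i mod n) (i div n))"

lemma isH_props: assumes "isH i"
  shows "i div n \<in> neighbours H (i mod n)" "rot (i mod n) (i div n) \<in> neighbours H (i mod n)" "lA i < bnd I" "lB i < bnd I"
    "(lA i, lB i) \<in> m.links"
proof -
  show 1: "i div n \<in> neighbours H (i mod n)" using assms by (simp add: isH_def neighbours_def insert_commute)
  show 2: "rot (i mod n) (i div n) \<in> neighbours H (i mod n)" by (rule m.inv_rot(4)[OF 1])
  show "lA i < bnd I" "lB i < bnd I" unfolding lA_def lB_def using side_lt 1 2 by auto
  show "(lA i, lB i) \<in> m.links" unfolding lA_def lB_def m.links_def using 1 by blast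
qed

abbreviation "LS i \<equiv> (linit I ^^ i) s0"

lemma LS_other: "j \<noteq> 2 \<Longrightarrow> j \<noteq> 10 \<Longrightarrow> LS i j = s0 j"
  by (induction i) (auto simp: linit_def cinc_def)
lemma LS_counter: "LS i 10 0 = i"
  by (induction i) (auto simp: s0_def czero_def linit_def cinc_def)

lemma LS_step: assumes t: "t < bnd I"
  shows "LS (Suc i) 2 t = (if isH i \<and> LS i 2 t = LS i 2 (lB i) then LS i 2 (lA i) else LS i 2 t)"
proof -
  have c: "i < nsq I \<and> adjG I (eu I i) (ev I i) \<and> \<not> inA I (eu I i) \<and> \<not> inA I (ev I i) \<longleftrightarrow> isH i"
    by (cases "i < N") (simp_all add: isH_def euI adjI inAI edgesH)
  have s: "LS (Suc i) 2 t = (if isH i then (if LS i 2 t = LS i 2 (sBI I (ev I i) (rotI I (ev I i) (eu I i)))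
       then LS i 2 (sAI I (ev I i) (eu I i)) else LS i 2 t) else LS i 2 t)"
  proof -
    define q where "q = LS i"
    have q10: "q 10 0 = i" and S: "LS (Suc i) = linit I q" by (simp_all add: q_def LS_counter)
    show ?thesis unfolding S q_def[symmetric] linit_def q10 c using t by (simp add: cinc_def q10)
  qed
  show ?thesis
  proof (cases "isH i")
    case True
    then have e: "{i div n, i mod n} \<in> edges H" "i < N" by (auto simp: isH_def)
    have r: "{rot (i mod n) (i div n), i mod n} \<in> edges H" using isH_props(2)[OF True] by (simp add: neighbours_def insert_commute)
    show ?thesis unfolding s using True e sideI[OF e(1)] sideI(2)[OF r] by (simp add: euI lA_def lB_def)
  qed (use s in simp)
qed

text \<open>Completeness and soundness of the relabelling: the corners treated so far are
  identified, and equal labels always come from a chain of corners.\<close>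

lemma LS_inv: "i \<le> bnd I \<Longrightarrow> (\<forall>t<bnd I. LS i 2 t < bnd I) \<and> (\<forall>j<i. isH j \<longrightarrow> LS i 2 (lA j) = LS i 2 (lB j)) \<and>
   (\<forall>s<bnd I. \<forall>t<bnd I. LS i 2 s = LS i 2 t \<longrightarrow> (s, t) \<in> (m.links \<union> m.links\<inverse>)\<^sup>*)"
proof (induction i)
  case 0
  then show ?case by (simp add: s0_def czero_def)
next
  case (Suc i)
  let ?R = "(m.links \<union> m.links\<inverse>)\<^sup>*"
  let ?f = "LS i 2"
  have i1: "\<And>t. t < bnd I \<Longrightarrow> ?f t < bnd I" and i2: "\<And>j. j < i \<Longrightarrow> isH j \<Longrightarrow> ?f (lA j) = ?f (lB j)"
    and i3: "\<And>s t. s < bnd I \<Longrightarrow> t < bnd I \<Longrightarrow> ?f s = ?f t \<Longrightarrow> (s, t) \<in> ?R" using Suc by auto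
  have st: "LS (Suc i) 2 t = (if isH i \<and> ?f t = ?f (lB i) then ?f (lA i) else ?f t)" if "t < bnd I" for t by (rule LS_step[OF that])
  have 1: "LS (Suc i) 2 t < bnd I" if "t < bnd I" for t using st[OF that] i1 that isH_props(3)[of i] by auto
  have 2: "LS (Suc i) 2 (lA j) = LS (Suc i) 2 (lB j)" if "j < Suc i" "isH j" for j
    unfolding st[OF isH_props(3)[OF that(2)]] st[OF isH_props(4)[OF that(2)]] using i2[of j] that by (cases "j = i") auto
  have 3: "(s, t) \<in> ?R" if b: "s < bnd I" "t < bnd I" and eq: "LS (Suc i) 2 s = LS (Suc i) 2 t" for s t
  proof (cases "?f s = ?f t")
    case True
    then show ?thesis using i3 b by blast
  next
    case False
    then have h: "isH i" and d: "(?f s = ?f (lB i) \<and> ?f (lA i) = ?f t) \<or> (?f t = ?f (lB i) \<and> ?f s = ?f (lA i))"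
      using eq unfolding st[OF b(1)] st[OF b(2)] by (auto split: if_splits)
    have l: "(lA i, lB i) \<in> ?R" "(lB i, lA i) \<in> ?R" using isH_props(5)[OF h] by auto
    from d show ?thesis
    proof
      assume "?f s = ?f (lB i) \<and> ?f (lA i) = ?f t"
      then have "(s, lB i) \<in> ?R" "(lA i, t) \<in> ?R" using i3 b isH_props(3,4)[OF h] by auto
      then show ?thesis using l by (meson rtrancl_trans)
    next
      assume "?f t = ?f (lB i) \<and> ?f s = ?f (lA i)"
      then have "(s, lA i) \<in> ?R" "(lB i, t) \<in> ?R" using i3 b isH_props(3,4)[OF h] by auto
      then show ?thesis using l by (meson rtrancl_trans)
    qed
  qed
  show ?case using 1 2 3 by blast
qed

lemma init_ok: "Inv (init I (\<lambda>_ _. 0))"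
proof -
  define s where "s = init I (\<lambda>_ _. 0)"
  have sL: "s = LS (bnd I)" by (simp add: s_def init_def s0_def)
  have so: "s j = s0 j" if "j \<noteq> 2" "j \<noteq> 10" for j unfolding sL by (rule LS_other[OF that])
  have L: "\<And>t. t < bnd I \<Longrightarrow> s 2 t < bnd I" "\<And>j. j < bnd I \<Longrightarrow> isH j \<Longrightarrow> s 2 (lA j) = s 2 (lB j)"
    "\<And>q t. q < bnd I \<Longrightarrow> t < bnd I \<Longrightarrow> s 2 q = s 2 t \<Longrightarrow> (q, t) \<in> (m.links \<union> m.links\<inverse>)\<^sup>*"
    using LS_inv[OF order_refl] unfolding sL by auto
  have C: "Cf s = (\<lambda>v. v)" by (auto simp: Cf_def so s0_def czero_def bndI upd_def fun_eq_iff)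
  have AVn: "A \<subseteq> {..<n}" using AV VG by simp
  have K: "Kf s v = (if v \<in> A then Suc v else 0)" for v
    using AVn by (auto simp: Kf_def so s0_def czero_def bndI upd_def inAI)
  have T: "Tf s = {}" "\<not> Hs s" by (auto simp: Tf_def Hs_def so s0_def czero_def)
  have EHE: "m.EH \<subseteq> E"
  proof
    fix e assume e: "e \<in> m.EH"
    then show "e \<in> E" using m.EH_eid(6)[OF e] by (simp add: m.EH_def E_def edgesH)
  qed
  have al: "alive (\<lambda>v. v) (Kf s) = m.EH"
  proof (intro set_eqI iffI)
    fix e assume "e \<in> alive (\<lambda>v. v) (Kf s)"
    then have "e \<in> E" "e div n \<notin> A" "e mod n \<notin> A" by (auto simp: alive_def K split: if_splits)
    then show "e \<in> m.EH" by (simp add: m.EH_def E_def edgesH)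
  next
    fix e assume e: "e \<in> m.EH"
    then show "e \<in> alive (\<lambda>v. v) (Kf s)" using EHE by (auto simp: alive_def K m.EH_def edgesH)
  qed
  have link: "Ff s (m.sA v u) = Ff s (m.sB v (rot v u))" if u: "u \<in> neighbours H v" for u v
  proof -
    have uv: "u < n" "v < n" using m.nb_props[OF u] by auto
    have dm: "(u * n + v) div n = u" "(u * n + v) mod n = v" using uv by auto
    have h: "isH (u * n + v)" using u index_less[OF uv] unfolding isH_def dm by (simp add: neighbours_def insert_commute)
    have "u * n + v < bnd I" using index_less[OF uv] bndI by simp
    from L(2)[OF this h] show ?thesis using isH_props(3,4)[OF h] unfolding lA_def lB_def dm by (simp add: Ff_def)
  qed
  have cl: "(q, t) \<in> (m.links \<union> m.links\<inverse>)\<^sup>*" if "ed N q \<in> m.EH" "ed N t \<in> m.EH" "Ff s q = Ff s t" for q t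
  proof -
    have "q < bnd I" "t < bnd I" using side_bnd[of q s] side_bnd[of t s] that al C by auto
    then show ?thesis using L(3)[of q t] that(3) by (simp add: Ff_def)
  qed
  note ic = m.initial_core[of "Ff s", OF link EHE cl emb]
  have co: "core (\<lambda>v. v) m.EH (Ff s) {} {}" unfolding core_def
  proof (intro conjI allI)
    fix U
    have o: "oc N (Ff s) (w0.cutE U \<inter> m.EH) = {}" by (rule ic(2))
    show "kap / 2 * (2 * real (card ({} \<inter> w0.cutE U)) + real (card (oc N (Ff s) (w0.cutE U \<inter> m.EH)))) \<le> 4 * sum (wt I) (w0.cutE U \<inter> {})"
      unfolding o by simp
  qed (use EHE in \<open>simp_all only: ic(1)\<close>, simp_all)
  \<comment> \<open>Initially the marked vertices are the apices themselves, each attached to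
    itself, so no set separates any of them.\<close>
  have op: "opp (Kf s) U = {}" for U by (auto simp: opp_def K)
  have "mark_ok (\<lambda>v. v) (Kf s) {}" unfolding mark_ok_def
  proof (intro conjI allI)
    fix U
    have "0 \<le> sum (wt I) (w0.cutE U \<inter> Emm (Kf s))" by (rule sum_w_nonneg) (auto simp: w0.cutE_def)
    then show "kap * real (card (bad (\<lambda>v. v) (Kf s) U)) + sum (wt I) (DS (Kf s) U) \<le> 25 * sum (wt I) (w0.cutE U \<inter> Emm (Kf s))"
      by (simp add: bad_def DS_def op)
    show "card ({} \<inter> w0.cutE U) + card (Qp (\<lambda>v. v) (Kf s) U) \<le> 13 * card (bad (\<lambda>v. v) (Kf s) U)"
      by (simp add: bad_def Qp_def op)
  qed simp
  moreover have "labels_ok (\<lambda>v. v) (Kf s)" by (auto simp: labels_ok_def K)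
  moreover have "tree_ok (\<lambda>v. v) (Kf s) {}" by (auto simp: tree_ok_def K)
  moreover have "split_ok (\<lambda>v. v) False (wsum 7 I s)" by (auto simp: split_ok_def)
  ultimately have "INV (\<lambda>v. v) (Kf s) (Ff s) {} False (wsum 7 I s)" unfolding INV_def al using co by blast
  then show ?thesis unfolding s_def[symmetric] Inv_def C T(1) using T(2) L(1) by simp
qed

lemma eset_cut: assumes "e \<in> E" "eset e = {x, y}" shows "e \<in> w0.cutE U \<longleftrightarrow> (x \<in> U) \<noteq> (y \<in> U)"
  using assms by (auto simp: w0.cutE_def eset_def doubleton_eq_iff)

lemma main_output:
  assumes g1: "1 \<le> g" and st: "\<forall>i<bnd I. fst st i = main I (\<lambda>_ _. 0) 3 i"
  shows "spanning_forest G (output_graph n st)" "thin G z (output_graph n st) (30000 * (real a * real g) / \<beta>)"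
    "card (components (output_graph n st)) \<le> a + 2 * g"
proof -
  define s where "s = main I (\<lambda>_ _. 0)"
  define T where "T = Tf s"
  let ?D = "output_graph n st"
  have V: "Inv s" "card (LB (Cf s) (Kf s)) \<le> 2 * g" unfolding s_def main_def using rounds_ok[OF init_ok] by auto
  have inv: "INV (Cf s) (Kf s) (Ff s) T (Hs s) (wsum 7 I s)" and L: "labels_ok (Cf s) (Kf s)" unfolding T_def using InvD[OF V(1)] by auto
  then have TO: "tree_ok (Cf s) (Kf s) T" by (simp add: INV_def)
  then have TE: "T \<subseteq> E" by (simp add: tree_ok_def)
  have ed: "edges ?D = eset ` T"
  proof (intro set_eqI iffI)
    fix x assume "x \<in> edges ?D"
    then obtain u v where x: "x = {u, v}" "u < v" "v < n" "fst st (u * n + v) = 1" by (auto simp: output_graph_def)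
    then have i: "u * n + v < N" by (intro index_less) auto
    then have "u * n + v < bnd I" using bndI by simp
    then have "u * n + v \<in> T" using st x i by (simp add: T_def Tf_def s_def)
    moreover have "eset (u * n + v) = x" using x by (simp add: eset_def)
    ultimately show "x \<in> eset ` T" by blast
  next
    fix x assume "x \<in> eset ` T"
    then obtain e where e: "e \<in> T" "x = eset e" by blast
    then have eE: "e \<in> E" using TE by blast
    have "s 3 e = 1" using e by (simp add: T_def Tf_def)
    then have "fst st (e div n * n + e mod n) = 1" using st E_bnd[OF eE] by (simp add: s_def)
    moreover have "e div n < e mod n" "e mod n < n" using eE E_ends[OF eE] by (auto simp: E_def)
    ultimately have "\<exists>u v. {e div n, e mod n} = {u, v} \<and> u < v \<and> v < n \<and> fst st (u * n + v) = 1" by blast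
    then show "x \<in> edges ?D" unfolding e(2) eset_def output_graph_def by simp
  qed
  have vt: "vertices ?D = {..<n}" by (simp add: output_graph_def)
  have eG: "eset ` T \<subseteq> edges G" using TE eset_bij by (auto simp: bij_betw_def)
  have sub: "subgraph ?D G" unfolding subgraph_def ed vt VG using eG fsG VG unfolding finite_simple_graph_def by blast
  have "\<not> is_cycle ?D xs" for xs
  proof
    assume cy: "is_cycle ?D xs"
    let ?l = "length xs"
    have l: "3 \<le> ?l" "distinct xs" using cy by (auto simp: is_cycle_def)
    have ce: "\<exists>e\<in>T. eset e = {xs ! i, xs ! ((i + 1) mod ?l)}" if "i < ?l" for i
    proof -
      have "{xs ! i, xs ! ((i + 1) mod ?l)} \<in> eset ` T" using cy that unfolding is_cycle_def ed by blast
      then show ?thesis by auto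
    qed
    have m1: "(0 + 1) mod ?l = 1" using l by simp
    obtain e where e: "e \<in> T" "eset e = {xs ! 0, xs ! 1}" using ce[of 0] l unfolding m1 by fastforce
    \<comment> \<open>A cycle would cross the fundamental cut of its first edge exactly once: as it
      has at least three distinct vertices, no later step uses that edge again.\<close>
    obtain U where U: "T \<inter> w0.cutE U = {e}" using TO e(1) unfolding tree_ok_def by blast
    have eU: "(xs ! 0 \<in> U) \<noteq> (xs ! 1 \<in> U)" using eset_cut[of e _ _ U] e U TE by blast
    have stp: "xs ! i \<in> U \<longleftrightarrow> xs ! ((i + 1) mod ?l) \<in> U" if i: "1 \<le> i" "i < ?l" for i
    proof -
      obtain f where f: "f \<in> T" "eset f = {xs ! i, xs ! ((i + 1) mod ?l)}" using ce i by blast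
      have b: "(i + 1) mod ?l < ?l" by (rule mod_less_divisor) (use i in linarith)
      have "f \<noteq> e"
      proof
        assume "f = e"
        then have "{xs ! i, xs ! ((i + 1) mod ?l)} = {xs ! 0, xs ! 1}" using e f by simp
        then have "xs ! i \<in> {xs ! 0, xs ! 1}" "xs ! 0 \<in> {xs ! i, xs ! ((i + 1) mod ?l)}" by auto
        moreover have "xs ! i \<noteq> xs ! 0" using nth_eq_iff_index_eq[OF l(2), of i 0] i by linarith
        ultimately have "xs ! i = xs ! 1" "xs ! ((i + 1) mod ?l) = xs ! 0" by auto
        then have "i = 1" "(i + 1) mod ?l = 0"
          using nth_eq_iff_index_eq[OF l(2), of i 1] nth_eq_iff_index_eq[OF l(2) b, of 0] i l(1) by linarith+
        then show False using l(1) by simp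
      qed
      then have "f \<notin> w0.cutE U" using U f(1) by blast
      then show ?thesis using eset_cut[of f _ _ U] f TE by blast
    qed
    have "1 \<le> i \<Longrightarrow> i < ?l \<Longrightarrow> xs ! i \<in> U \<longleftrightarrow> xs ! 1 \<in> U" for i
    proof (induction i)
      case (Suc i)
      show ?case
      proof (cases "i = 0")
        case False
        then show ?thesis using Suc stp[of i] by simp
      qed simp
    qed simp
    moreover have "?l - 1 + 1 = ?l" using l(1) by linarith
    then have "(?l - 1 + 1) mod ?l = 0" by simp
    moreover have "?l - 1 < ?l" "1 \<le> ?l - 1" using l(1) by linarith+
    ultimately have "xs ! 1 \<in> U \<longleftrightarrow> xs ! 0 \<in> U" using stp[of "?l - 1"] by metis
    then show False using eU by blast
  qed
  then show "spanning_forest G ?D" using sub vt VG by (simp add: spanning_forest_def)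
  show "thin G z ?D (30000 * (real a * real g) / \<beta>)" unfolding thin_def
  proof (intro allI impI)
    fix U
    have "edges ?D \<inter> cut G U \<subseteq> eset ` (T \<inter> w0.cutE U)"
    proof
      fix x assume x: "x \<in> edges ?D \<inter> cut G U"
      then obtain e where e: "e \<in> T" "x = eset e" unfolding ed by blast
      have "x \<in> eset ` w0.cutE U" using x cut_bij[of U] by (simp add: bij_betw_def)
      then obtain e' where e': "e' \<in> w0.cutE U" "x = eset e'" by blast
      have "e = e'" using eset_bij e e' TE by (auto simp: bij_betw_def inj_on_def w0.cutE_def)
      then show "x \<in> eset ` (T \<inter> w0.cutE U)" using e e' by blast
    qed
    then have "card (edges ?D \<inter> cut G U) \<le> card (eset ` (T \<inter> w0.cutE U))" by (intro card_mono) auto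
    also have "\<dots> \<le> card (T \<inter> w0.cutE U)" by (intro card_image_le) auto
    finally have "real (card (edges ?D \<inter> cut G U)) \<le> real (card (T \<inter> w0.cutE U))" by simp
    also have "\<dots> \<le> 30000 * real a / \<beta> * sum (wt I) (w0.cutE U)" by (rule INV_thin[OF inv])
    also have "\<dots> \<le> 30000 * (real a * real g) / \<beta> * sum (wt I) (w0.cutE U)"
    proof (rule mult_right_mono)
      have "real a * 1 \<le> real a * real g" using g1 by (intro mult_left_mono) auto
      then show "30000 * real a / \<beta> \<le> 30000 * (real a * real g) / \<beta>" using b0 by (intro divide_right_mono) auto
      show "0 \<le> sum (wt I) (w0.cutE U)" by (rule sum_w_nonneg) (auto simp: w0.cutE_def)
    qed
    finally show "real (card (edges ?D \<inter> cut G U)) \<le> 30000 * (real a * real g) / \<beta> * (\<Sum>e\<in>cut G U. z e)" unfolding cut_sum .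
  qed
  have ad: "{(x, y). {x, y} \<in> edges ?D} = tadj T" unfolding ed tadj_def eset_def by auto
  define R where "R = {(u, v). u \<in> {..<n} \<and> v \<in> {..<n} \<and> (u, v) \<in> (tadj T)\<^sup>*}"
  have comp: "components ?D = {..<n} // R" unfolding components_def vt ad R_def ..
  have conn: "(v, Cf s v) \<in> (tadj T)\<^sup>*" "\<And>r. Kf s v = Suc r \<Longrightarrow> (v, r) \<in> (tadj T)\<^sup>*" if "v < n" for v
    using TO that unfolding tree_ok_def by simp_all
  have "{..<n} // R \<subseteq> (\<lambda>x. R `` {x}) ` (A \<union> LB (Cf s) (Kf s))"
  proof
    fix c assume "c \<in> {..<n} // R"
    then obtain v where v: "v < n" "c = R `` {v}" by (auto simp: quotient_def)
    \<comment> \<open>The forest joins a marked vertex to its apex and an unmarked one to the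
      representative of its cluster.\<close>
    have "\<exists>x\<in>A \<union> LB (Cf s) (Kf s). x < n \<and> (v, x) \<in> (tadj T)\<^sup>*"
    proof (cases "Kf s v = 0")
      case True
      then have "Cf s v \<in> LB (Cf s) (Kf s)" using L v by (simp add: LB_def labels_ok_def)
      moreover have "Cf s v < n" using L v(1) by (simp add: labels_ok_def)
      ultimately show ?thesis using conn(1)[OF v(1)] by blast
    next
      case False
      then obtain r where r: "r \<in> A" "Kf s v = Suc r" using L v unfolding labels_ok_def by blast
      then have "(v, r) \<in> (tadj T)\<^sup>*" "r < n" using conn[OF v(1)] AV VG by auto
      then show ?thesis using r(1) by blast
    qed
    then obtain x where x: "x \<in> A \<union> LB (Cf s) (Kf s)" "x < n" "(v, x) \<in> (tadj T)\<^sup>*" by blast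
    have "(v, y) \<in> R \<longleftrightarrow> (x, y) \<in> R" for y
      unfolding R_def using x(2,3) v(1) tadj_sym[OF x(3)] rtrancl_trans[of v x _ y] rtrancl_trans[of x v _ y] by blast
    then have "R `` {v} = R `` {x}" by blast
    then show "c \<in> (\<lambda>x. R `` {x}) ` (A \<union> LB (Cf s) (Kf s))" using v x by blast
  qed
  then have "card ({..<n} // R) \<le> card ((\<lambda>x. R `` {x}) ` (A \<union> LB (Cf s) (Kf s)))" using finA finite_LB by (intro card_mono) auto
  also have "\<dots> \<le> card (A \<union> LB (Cf s) (Kf s))" using finA finite_LB by (intro card_image_le) auto
  also have "\<dots> \<le> card A + card (LB (Cf s) (Kf s))" by (rule card_Un_le)
  finally show "card (components ?D) \<le> a + 2 * g" unfolding comp using V(2) AV by simp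
qed
end

text \<open>\<open>implP_program\<close> provides program and polynomial before any input is chosen.
  The constant 30000 comes from \<open>INV_thin\<close> and generously covers
  \<open>a + 2 * g\<close> components.\<close>

theorem theorem8p13:
  shows "\<exists>(P :: com) (p :: nat poly) (C :: real). C > 0 \<and>
    (\<forall>(a :: nat) (g :: nat) (n :: nat) (G :: nat ugraph) (A :: nat set) (z :: nat set \<Rightarrow> real)
      (k :: orientability) (rot :: nat \<Rightarrow> nat \<Rightarrow> nat) (twisted :: nat set \<Rightarrow> bool) (\<beta> :: real).
      a \<ge> 1 \<and> g \<ge> 1 \<and>
      finite_simple_graph G \<and> vertices G = {..<n} \<and>
      A \<subseteq> vertices G \<and> card A = a \<and>
      graph_genus k (delete_vertices G A) = g \<and>
      embedding_on k g (delete_vertices G A) rot twisted \<and>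
      (\<forall>e\<in>edges G. z e \<ge> 0) \<and> \<beta> > 0 \<and> thick G z \<beta>
      \<longrightarrow>
      (\<exists>t s. exec P (input_state n G A k g rot twisted z) t s \<and> t \<le> poly p n \<and>
         spanning_forest G (output_graph n s) \<and>
         thin G z (output_graph n s) (C * (real a * real g) / \<beta>) \<and>
         real (card (components (output_graph n s))) \<le> C * (real a + real g)))"
proof -
  obtain P p where Pp: "\<forall>I. (\<forall>i\<ge>bnd I. fst I i = 0) \<longrightarrow>
      (\<exists>t s. exec P I t s \<and> t \<le> poly p (fst I 0) \<and> (\<forall>i<bnd I. fst s i = main I (\<lambda>_ _. 0) 3 i))"
    using implP_program[OF implP_main] by blast
  show ?thesis
  proof (rule exI[of _ P], rule exI[of _ p], rule exI[of _ 30000], intro conjI allI impI)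
    fix a g n :: nat and G :: "nat ugraph" and A :: "nat set" and z :: "nat set \<Rightarrow> real" and k rot twisted and \<beta> :: real
    assume h: "a \<ge> 1 \<and> g \<ge> 1 \<and> finite_simple_graph G \<and> vertices G = {..<n} \<and> A \<subseteq> vertices G \<and> card A = a \<and>
      graph_genus k (delete_vertices G A) = g \<and> embedding_on k g (delete_vertices G A) rot twisted \<and>
      (\<forall>e\<in>edges G. z e \<ge> 0) \<and> \<beta> > 0 \<and> thick G z \<beta>"
    interpret prob n a g G A z k rot twisted \<beta> by unfold_locales (use h in auto)
    obtain t s where ts: "exec P I t s" "t \<le> poly p n" "\<forall>i<bnd I. fst s i = main I (\<lambda>_ _. 0) 3 i"
      using Pp I_zero I_simps(1) by metis
    have g1: "1 \<le> g" using h by blast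
    note mo = main_output[OF g1 ts(3)]
    have "real (card (components (output_graph n s))) \<le> real (a + 2 * g)" using mo(3) of_nat_mono by blast
    also have "\<dots> \<le> 30000 * (real a + real g)" by simp
    finally show "\<exists>t s. exec P (input_state n G A k g rot twisted z) t s \<and> t \<le> poly p n \<and>
         spanning_forest G (output_graph n s) \<and> thin G z (output_graph n s) (30000 * (real a * real g) / \<beta>) \<and>
         real (card (components (output_graph n s))) \<le> 30000 * (real a + real g)"
      using ts(1,2) mo(1,2) unfolding I_def by blast
  qed simp
qed



end
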